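(* Let $k$ be an algebraically closed field of characteristic $0$ and let $H$ be a finite dimensional Hopf algebra over $k$ whose antipode $S$ satisfies $S^2=\mathrm{Id}$. Then the DG-category of mixed complexes in stable anti-Yetter--Drinfeld contramodules over $H$ and the DG-category of mixed anti-Yetter--Drinfeld contramodules over $H$ are DG-equivalent.
   Context: Sweedler notation: $\Delta(h)=h^1\otimes h^2$, and $h^1\otimes h^2\otimes h^3$ for the iterated coproduct. $\epsilon$ is the counit of $H$. An anti-Yetter--Drinfeld (aYD) contramodule over $H$ is a left $H$-module $M$ with a $k$-linear map $\alpha\colon \mathrm{Hom}_k(H,M)\to M$ such that: $\alpha(h\mapsto\epsilon(h)m)=m$ for $m\in M$; $\alpha\big(h\mapsto\alpha(l\mapsto F(h\otimes l))\big)=\alpha\big(h\mapsto F(h^1\otimes h^2)\big)$ for $F\in\mathrm{Hom}_k(H\otimes H,M)$; and $x\cdot\alpha(\varphi)=\alpha\big(h\mapsto x^2\varphi(S(x^3)\,h\,x^1)\big)$ for $x\in H$, $\varphi\in \mathrm{Hom}_k(H,M)$. Morphisms are $H$-linear maps commuting with $\alpha$. Equivalently, these are modules over the monad $\mathrm{Hom}_k(H,-)$ on left $H$-modules. Every aYD contramodule $M$ carries a natural endomorphism $\sigma$ given by $\sigma(m)=\alpha(h\mapsto h\cdot m)$. $M$ is called stable if $\sigma=\mathrm{Id}_M$. A mixed aYD contramodule is a triple $(M^\bullet,d,h)$ where $(M^\bullet,d)$ is a complex of aYD contramodules ($d$ of degree $+1$, $d^2=0$) and $h$ is a degree $-1$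 map of graded aYD contramodules with $h^2=0$ and $dh+hd=\sigma-1$. A mixed complex in stable aYD contramodules is a triple $(M^\bullet,d,h)$ where $(M^\bullet,d)$ is a complex of stable aYD contramodules and $h$ is a degree $-1$ map of graded aYD contramodules with $h^2=0$ and $dh+hd=0$. Both form DG-categories: $\mathrm{Hom}^n(M,N)$ consists of degree $n$ maps $f$ of graded aYD contramodules with $hf=(-1)^n fh$, with differential $f\mapsto df-(-1)^n fd$. These DG-categories are considered up to quasi-isomorphism: a morphism is a quasi-isomorphism if it induces an isomorphism on cohomology with respect to $d$, and one passes to the associated derived DG-category (e.g. the DG quotient by the objects acyclic with respect to $d$). DG-equivalent means that the resulting DG-categories are connected by a chain of quasi-equivalences over $k$. *)

theory Defs
  imports
    "HOL-Algebra.Algebra"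
    "HOL-Algebra.Algebraic_Closure_Type"
    "HOL-Library.Poly_Mapping"
begin

section \<open>Linear maps, quotients of free modules, tensor products\<close>

text \<open>The ground field is a type \<open>'k\<close>; \<open>ground\<close> is the same field as a HOL-Algebra ring.
  Spaces that vary (the graded pieces of a complex, Hom spaces, tensor products) are HOL-Algebra
  modules over it. The ring fields \<open>mult\<close> and \<open>one\<close> of a module record carry no meaning.\<close>

abbreviation ground :: "'k::field ring" where
  "ground \<equiv> ring_of_type_algebra"

definition linear_maps ::
    "('k::field, 'a, 'x) module_scheme \<Rightarrow> ('k, 'b, 'y) module_scheme \<Rightarrow> ('a \<Rightarrow> 'b) set" where
  "linear_maps A B = {f \<in> carrier A \<rightarrow> carrier B.
     (\<forall>x\<in>carrier A. \<forall>y\<in>carrier A. f (x \<oplus>\<^bsub>A\<^esub> y) = f x \<oplus>\<^bsub>B\<^esub> f y) \<and>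
     (\<forall>c. \<forall>x\<in>carrier A. f (c \<odot>\<^bsub>A\<^esub> x) = c \<odot>\<^bsub>B\<^esub> f x)}"

text \<open>The free vector space on \<open>'w\<close> is \<open>'w \<Rightarrow>\<^sub>0 'k\<close>; the basis vector of \<open>w\<close> is \<open>basis w\<close>.\<close>

definition basis :: "'w \<Rightarrow> ('w \<Rightarrow>\<^sub>0 'k::field)" where
  "basis w = Poly_Mapping.single w 1"

definition free_scale :: "'k::field \<Rightarrow> ('w \<Rightarrow>\<^sub>0 'k) \<Rightarrow> ('w \<Rightarrow>\<^sub>0 'k)" where
  "free_scale c = Poly_Mapping.map ((*) c)"

definition free_ext :: "('v \<Rightarrow> ('w \<Rightarrow>\<^sub>0 'k::field)) \<Rightarrow> ('v \<Rightarrow>\<^sub>0 'k) \<Rightarrow> ('w \<Rightarrow>\<^sub>0 'k)" where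
  "free_ext f p = (\<Sum>v\<in>Poly_Mapping.keys p. free_scale (Poly_Mapping.lookup p v) (f v))"

definition free_class :: "('w \<Rightarrow>\<^sub>0 'k::field) set \<Rightarrow> ('w \<Rightarrow>\<^sub>0 'k) \<Rightarrow> ('w \<Rightarrow>\<^sub>0 'k) set" where
  "free_class R p = {p + r |r. r \<in> Modules.module.span free_scale R}"

text \<open>The space with generators \<open>W\<close> and relations \<open>R\<close>; its elements are cosets of the span of \<open>R\<close>.\<close>

definition presented ::
    "'w set \<Rightarrow> ('w \<Rightarrow>\<^sub>0 'k::field) set \<Rightarrow> ('k, ('w \<Rightarrow>\<^sub>0 'k) set) module" where
  "presented W R = \<lparr>
     carrier = free_class R ` {p. Poly_Mapping.keys p \<subseteq> W},
     monoid.mult = (\<lambda>_ _. undefined), one = undefined,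
     ring.zero = free_class R 0,
     add = (\<lambda>P Q. {p + q |p q. p \<in> P \<and> q \<in> Q}),
     module.smult = (\<lambda>c P. \<Union>p\<in>P. free_class R (free_scale c p)) \<rparr>"

definition tensor_rels ::
    "('k::field, 'a, 'x) module_scheme \<Rightarrow> ('k, 'b, 'y) module_scheme \<Rightarrow> ('a \<times> 'b \<Rightarrow>\<^sub>0 'k) set" where
  "tensor_rels A B =
     {basis (x \<oplus>\<^bsub>A\<^esub> x', y) - basis (x, y) - basis (x', y) |x x' y.
        x \<in> carrier A \<and> x' \<in> carrier A \<and> y \<in> carrier B} \<union>
     {basis (x, y \<oplus>\<^bsub>B\<^esub> y') - basis (x, y) - basis (x, y') |x y y'.
        x \<in> carrier A \<and> y \<in> carrier B \<and> y' \<in> carrier B} \<union>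
     {basis (c \<odot>\<^bsub>A\<^esub> x, y) - free_scale c (basis (x, y)) |c x y. x \<in> carrier A \<and> y \<in> carrier B} \<union>
     {basis (x, c \<odot>\<^bsub>B\<^esub> y) - free_scale c (basis (x, y)) |c x y. x \<in> carrier A \<and> y \<in> carrier B}"

definition tensor ::
    "('k::field, 'a, 'x) module_scheme \<Rightarrow> ('k, 'b, 'y) module_scheme
      \<Rightarrow> ('k, ('a \<times> 'b \<Rightarrow>\<^sub>0 'k) set) module" where
  "tensor A B = presented (carrier A \<times> carrier B) (tensor_rels A B)"

definition tensor_elem ::
    "('k::field, 'a, 'x) module_scheme \<Rightarrow> ('k, 'b, 'y) module_scheme \<Rightarrow> 'a \<Rightarrow> 'b
      \<Rightarrow> ('a \<times> 'b \<Rightarrow>\<^sub>0 'k) set" where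
  "tensor_elem A B x y = free_class (tensor_rels A B) (basis (x, y))"

text \<open>The linear map on a tensor product induced by a bilinear map \<open>b\<close> into \<open>M\<close>. For bilinear \<open>b\<close> the
  value does not depend on the chosen representative.\<close>

definition tensor_lift ::
    "('k::field, 'm, 'x) module_scheme \<Rightarrow> ('a \<Rightarrow> 'b \<Rightarrow> 'm) \<Rightarrow> ('a \<times> 'b \<Rightarrow>\<^sub>0 'k) set \<Rightarrow> 'm" where
  "tensor_lift M b t = (let p = (SOME p. p \<in> t) in
     \<Oplus>\<^bsub>M\<^esub>w\<in>Poly_Mapping.keys p. Poly_Mapping.lookup p w \<odot>\<^bsub>M\<^esub> b (fst w) (snd w))"


section \<open>Hopf algebras\<close>

text \<open>The ring structure of the Hopf algebra is that of the type \<open>'h\<close>.\<close>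

record (overloaded) ('k, 'h) hopf =
  hscale :: "'k \<Rightarrow> 'h \<Rightarrow> 'h"
  comult :: "'h \<Rightarrow> ('h \<times> 'h \<Rightarrow>\<^sub>0 'k::zero) set"
  counit :: "'h \<Rightarrow> 'k"
  antipode :: "'h \<Rightarrow> 'h"

definition hmod :: "('k::field, 'h::ring_1) hopf \<Rightarrow> ('k, 'h) module" where
  "hmod H = \<lparr>carrier = UNIV, monoid.mult = (*), one = 1, ring.zero = 0, add = (+), module.smult = hscale H\<rparr>"

abbreviation HH :: "('k::field, 'h::ring_1) hopf \<Rightarrow> ('k, ('h \<times> 'h \<Rightarrow>\<^sub>0 'k) set) module" where
  "HH H \<equiv> tensor (hmod H) (hmod H)"

abbreviation HHH ::
    "('k::field, 'h::ring_1) hopf \<Rightarrow> ('k, ('h \<times> ('h \<times> 'h \<Rightarrow>\<^sub>0 'k) set \<Rightarrow>\<^sub>0 'k) set) module" where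
  "HHH H \<equiv> tensor (hmod H) (HH H)"

abbreviation htens2 :: "('k::field, 'h::ring_1) hopf \<Rightarrow> 'h \<Rightarrow> 'h \<Rightarrow> ('h \<times> 'h \<Rightarrow>\<^sub>0 'k) set" where
  "htens2 H x y \<equiv> tensor_elem (hmod H) (hmod H) x y"

abbreviation htens3 ::
    "('k::field, 'h::ring_1) hopf \<Rightarrow> 'h \<Rightarrow> 'h \<Rightarrow> 'h \<Rightarrow> ('h \<times> ('h \<times> 'h \<Rightarrow>\<^sub>0 'k) set \<Rightarrow>\<^sub>0 'k) set" where
  "htens3 H x y z \<equiv> tensor_elem (hmod H) (HH H) x (htens2 H y z)"

text \<open>Sweedler notation: \<open>sweedler2 H M b x\<close> is \<open>b(x\<^sup>1, x\<^sup>2)\<close> and \<open>sweedler3 H M b x\<close> is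
  \<open>b(x\<^sup>1, x\<^sup>2, x\<^sup>3)\<close>, for multilinear \<open>b\<close> with values in \<open>M\<close>.\<close>

definition sweedler2 ::
    "('k::field, 'h::ring_1) hopf \<Rightarrow> ('k, 'm, 'x) module_scheme \<Rightarrow> ('h \<Rightarrow> 'h \<Rightarrow> 'm) \<Rightarrow> 'h \<Rightarrow> 'm" where
  "sweedler2 H M b x = tensor_lift M b (comult H x)"

definition sweedler3 ::
    "('k::field, 'h::ring_1) hopf \<Rightarrow> ('k, 'm, 'x) module_scheme \<Rightarrow> ('h \<Rightarrow> 'h \<Rightarrow> 'h \<Rightarrow> 'm) \<Rightarrow> 'h \<Rightarrow> 'm"
  where
  "sweedler3 H M b x = sweedler2 H M (\<lambda>x1 y. sweedler2 H M (\<lambda>x2 x3. b x1 x2 x3) y) x"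

locale hopf_algebra = vector_space "hscale H" for H :: "('k::field, 'h::ring_1) hopf" +
  assumes scale_mult_left: "hscale H c x * y = hscale H c (x * y)"
    and scale_mult_right: "x * hscale H c y = hscale H c (x * y)"
    and comult_linear: "comult H \<in> linear_maps (hmod H) (HH H)"
    and coassoc:
      "sweedler2 H (HHH H) (\<lambda>a z. sweedler2 H (HHH H) (\<lambda>x y. htens3 H x y z) a) h =
       sweedler2 H (HHH H) (\<lambda>x a. sweedler2 H (HHH H) (\<lambda>y z. htens3 H x y z) a) h"
    and counit_add: "counit H (x + y) = counit H x + counit H y"
    and counit_scale: "counit H (hscale H c x) = c * counit H x"
    and counit_left: "sweedler2 H (hmod H) (\<lambda>x y. hscale H (counit H x) y) h = h"
    and counit_right: "sweedler2 H (hmod H) (\<lambda>x y. hscale H (counit H y) x) h = h"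
    and comult_one: "comult H 1 = htens2 H 1 1"
    and comult_mult: "comult H (x * y) =
      sweedler2 H (HH H) (\<lambda>x1 x2. sweedler2 H (HH H) (\<lambda>y1 y2. htens2 H (x1 * y1) (x2 * y2)) y) x"
    and counit_one: "counit H 1 = 1"
    and counit_mult: "counit H (x * y) = counit H x * counit H y"
    and antipode_linear: "antipode H \<in> linear_maps (hmod H) (hmod H)"
    and antipode_left:
      "sweedler2 H (hmod H) (\<lambda>x y. antipode H x * y) h = hscale H (counit H h) 1"
    and antipode_right:
      "sweedler2 H (hmod H) (\<lambda>x y. x * antipode H y) h = hscale H (counit H h) 1"

locale finite_dimensional_hopf_algebra = hopf_algebra +
  assumes finite_dimensional: "\<exists>B. finite_dimensional_vector_space (hscale H) B"


section \<open>Anti-Yetter-Drinfeld contramodules\<close>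

text \<open>\<open>contra\<close> is only meaningful on \<open>Hom\<^sub>k(H,M)\<close>, i.e. on \<open>linear_maps (hmod H) M\<close>.\<close>

record ('k, 'h, 'm) contramodule = "('k, 'm) module" +
  act :: "'h \<Rightarrow> 'm \<Rightarrow> 'm"
  contra :: "('h \<Rightarrow> 'm) \<Rightarrow> 'm"

locale left_hmodule = M?: Module.module ground M
  for H :: "('k::field, 'h::ring_1) hopf" and M :: "('k, 'h, 'm) contramodule" (structure) +
  assumes act_linear: "act M x \<in> linear_maps M M"
    and act_add: "m \<in> carrier M \<Longrightarrow> act M (x + y) m = act M x m \<oplus> act M y m"
    and act_scale: "m \<in> carrier M \<Longrightarrow> act M (hscale H c x) m = c \<odot> act M x m"
    and act_one: "m \<in> carrier M \<Longrightarrow> act M 1 m = m"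
    and act_mult: "m \<in> carrier M \<Longrightarrow> act M (x * y) m = act M x (act M y m)"

locale aYD_contramodule = left_hmodule +
  assumes contra_closed: "\<phi> \<in> linear_maps (hmod H) M \<Longrightarrow> contra M \<phi> \<in> carrier M"
    and contra_add: "\<phi> \<in> linear_maps (hmod H) M \<Longrightarrow> \<psi> \<in> linear_maps (hmod H) M \<Longrightarrow>
      contra M (\<lambda>h. \<phi> h \<oplus> \<psi> h) = contra M \<phi> \<oplus> contra M \<psi>"
    and contra_smult: "\<phi> \<in> linear_maps (hmod H) M \<Longrightarrow>
      contra M (\<lambda>h. c \<odot> \<phi> h) = c \<odot> contra M \<phi>"
    and contra_counit: "m \<in> carrier M \<Longrightarrow> contra M (\<lambda>h. counit H h \<odot> m) = m"
    and contra_assoc: "F \<in> linear_maps (HH H) M \<Longrightarrow>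
      contra M (\<lambda>h. contra M (\<lambda>l. F (htens2 H h l))) = contra M (\<lambda>h. F (comult H h))"
    and aYD: "\<phi> \<in> linear_maps (hmod H) M \<Longrightarrow>
      act M x (contra M \<phi>) =
        contra M (\<lambda>h. sweedler3 H M (\<lambda>x1 x2 x3. act M x2 (\<phi> (antipode H x3 * h * x1))) x)"

definition sigma :: "('k, 'h, 'm) contramodule \<Rightarrow> 'm \<Rightarrow> 'm" where
  "sigma M m = contra M (\<lambda>h. act M h m)"

definition stable :: "('k, 'h, 'm) contramodule \<Rightarrow> bool" where
  "stable M \<longleftrightarrow> (\<forall>m\<in>carrier M. sigma M m = m)"

definition aYD_hom ::
    "('k::field, 'h::ring_1) hopf \<Rightarrow> ('k, 'h, 'm) contramodule \<Rightarrow> ('k, 'h, 'n) contramodule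
      \<Rightarrow> ('m \<Rightarrow> 'n) set" where
  "aYD_hom H M N = {f \<in> linear_maps M N.
     (\<forall>x. \<forall>m\<in>carrier M. f (act M x m) = act N x (f m)) \<and>
     (\<forall>\<phi>\<in>linear_maps (hmod H) M. f (contra M \<phi>) = contra N (\<lambda>h. f (\<phi> h)))}"


section \<open>Complexes and cohomology\<close>

definition cocycles :: "(int \<Rightarrow> ('k, 'm, 'x) module_scheme) \<Rightarrow> (int \<Rightarrow> 'm \<Rightarrow> 'm) \<Rightarrow> int \<Rightarrow> 'm set" where
  "cocycles C d n = {z \<in> carrier (C n). d n z = \<zero>\<^bsub>C (n + 1)\<^esub>}"

definition coboundaries ::
    "(int \<Rightarrow> ('k, 'm, 'x) module_scheme) \<Rightarrow> (int \<Rightarrow> 'm \<Rightarrow> 'm) \<Rightarrow> int \<Rightarrow> 'm set" where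
  "coboundaries C d n = d (n - 1) ` carrier (C (n - 1))"

definition cohomology ::
    "(int \<Rightarrow> ('k, 'm) module) \<Rightarrow> (int \<Rightarrow> 'm \<Rightarrow> 'm) \<Rightarrow> int \<Rightarrow> 'm set monoid" where
  "cohomology C d n =
     \<lparr>carrier = cocycles C d n, monoid.mult = add (C n), one = ring.zero (C n)\<rparr> Mod coboundaries C d n"

definition cohomology_map ::
    "(int \<Rightarrow> ('k, 'n) module) \<Rightarrow> (int \<Rightarrow> 'n \<Rightarrow> 'n) \<Rightarrow> (int \<Rightarrow> 'm \<Rightarrow> 'n) \<Rightarrow> int \<Rightarrow> 'm set \<Rightarrow> 'n set" where
  "cohomology_map D e f n c = (\<Union>z\<in>c. coboundaries D e n +>\<^bsub>D n\<^esub> f n z)"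

definition quasi_iso ::
    "(int \<Rightarrow> ('k, 'm) module) \<Rightarrow> (int \<Rightarrow> 'm \<Rightarrow> 'm) \<Rightarrow>
     (int \<Rightarrow> ('k, 'n) module) \<Rightarrow> (int \<Rightarrow> 'n \<Rightarrow> 'n) \<Rightarrow> (int \<Rightarrow> 'm \<Rightarrow> 'n) \<Rightarrow> bool" where
  "quasi_iso C d D e f \<longleftrightarrow>
     (\<forall>n. cohomology_map D e f n \<in> iso (cohomology C d n) (cohomology D e n))"


section \<open>DG-categories\<close>

text \<open>\<open>Comp C P Q R p q g f\<close> is \<open>g \<circ> f\<close> for \<open>g\<close> of degree \<open>p\<close> from \<open>Q\<close> to \<open>R\<close> and \<open>f\<close> of degree
  \<open>q\<close> from \<open>P\<close> to \<open>Q\<close>.\<close>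

record ('o, 'm, 'k) dgcat =
  Ob :: "'o set"
  Hom :: "'o \<Rightarrow> 'o \<Rightarrow> int \<Rightarrow> ('k, 'm) module"
  Comp :: "'o \<Rightarrow> 'o \<Rightarrow> 'o \<Rightarrow> int \<Rightarrow> int \<Rightarrow> 'm \<Rightarrow> 'm \<Rightarrow> 'm"
  Ident :: "'o \<Rightarrow> 'm"
  Diff :: "'o \<Rightarrow> 'o \<Rightarrow> int \<Rightarrow> 'm \<Rightarrow> 'm"

locale dg_category =
  fixes C :: "('o, 'm, 'k::field) dgcat"
  assumes Hom_module: "P \<in> Ob C \<Longrightarrow> Q \<in> Ob C \<Longrightarrow> Module.module ground (Hom C P Q n)"
    and Diff_linear: "P \<in> Ob C \<Longrightarrow> Q \<in> Ob C \<Longrightarrow>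
      Diff C P Q n \<in> linear_maps (Hom C P Q n) (Hom C P Q (n + 1))"
    and Diff_Diff: "P \<in> Ob C \<Longrightarrow> Q \<in> Ob C \<Longrightarrow> f \<in> carrier (Hom C P Q n) \<Longrightarrow>
      Diff C P Q (n + 1) (Diff C P Q n f) = \<zero>\<^bsub>Hom C P Q (n + 2)\<^esub>"
    and Comp_linear_left: "P \<in> Ob C \<Longrightarrow> Q \<in> Ob C \<Longrightarrow> R \<in> Ob C \<Longrightarrow> f \<in> carrier (Hom C P Q q) \<Longrightarrow>
      (\<lambda>g. Comp C P Q R p q g f) \<in> linear_maps (Hom C Q R p) (Hom C P R (p + q))"
    and Comp_linear_right: "P \<in> Ob C \<Longrightarrow> Q \<in> Ob C \<Longrightarrow> R \<in> Ob C \<Longrightarrow> g \<in> carrier (Hom C Q R p) \<Longrightarrow>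
      Comp C P Q R p q g \<in> linear_maps (Hom C P Q q) (Hom C P R (p + q))"
    and Comp_assoc: "W \<in> Ob C \<Longrightarrow> P \<in> Ob C \<Longrightarrow> Q \<in> Ob C \<Longrightarrow> R \<in> Ob C \<Longrightarrow>
      h \<in> carrier (Hom C Q R p) \<Longrightarrow> g \<in> carrier (Hom C P Q q) \<Longrightarrow> f \<in> carrier (Hom C W P r) \<Longrightarrow>
      Comp C W P R (p + q) r (Comp C P Q R p q h g) f =
      Comp C W Q R p (q + r) h (Comp C W P Q q r g f)"
    and Ident_closed: "P \<in> Ob C \<Longrightarrow> Ident C P \<in> carrier (Hom C P P 0)"
    and Ident_left: "P \<in> Ob C \<Longrightarrow> Q \<in> Ob C \<Longrightarrow> f \<in> carrier (Hom C P Q n) \<Longrightarrow>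
      Comp C P Q Q 0 n (Ident C Q) f = f"
    and Ident_right: "P \<in> Ob C \<Longrightarrow> Q \<in> Ob C \<Longrightarrow> f \<in> carrier (Hom C P Q n) \<Longrightarrow>
      Comp C P P Q n 0 f (Ident C P) = f"
    and Leibniz: "P \<in> Ob C \<Longrightarrow> Q \<in> Ob C \<Longrightarrow> R \<in> Ob C \<Longrightarrow>
      g \<in> carrier (Hom C Q R p) \<Longrightarrow> f \<in> carrier (Hom C P Q q) \<Longrightarrow>
      Diff C P R (p + q) (Comp C P Q R p q g f) =
        Comp C P Q R (p + 1) q (Diff C Q R p g) f \<oplus>\<^bsub>Hom C P R (p + q + 1)\<^esub>
        ((-1) powi p) \<odot>\<^bsub>Hom C P R (p + q + 1)\<^esub> Comp C P Q R p (q + 1) g (Diff C P Q q f)"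

locale dg_functor = source: dg_category C + target: dg_category D
  for C :: "('o, 'm, 'k::field) dgcat" and D :: "('p, 'n, 'k) dgcat"
    and FO :: "'o \<Rightarrow> 'p" and FM :: "'o \<Rightarrow> 'o \<Rightarrow> int \<Rightarrow> 'm \<Rightarrow> 'n" +
  assumes F_Ob: "P \<in> Ob C \<Longrightarrow> FO P \<in> Ob D"
    and F_linear: "P \<in> Ob C \<Longrightarrow> Q \<in> Ob C \<Longrightarrow>
      FM P Q n \<in> linear_maps (Hom C P Q n) (Hom D (FO P) (FO Q) n)"
    and F_Ident: "P \<in> Ob C \<Longrightarrow> FM P P 0 (Ident C P) = Ident D (FO P)"
    and F_Comp: "P \<in> Ob C \<Longrightarrow> Q \<in> Ob C \<Longrightarrow> R \<in> Ob C \<Longrightarrow>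
      g \<in> carrier (Hom C Q R p) \<Longrightarrow> f \<in> carrier (Hom C P Q q) \<Longrightarrow>
      FM P R (p + q) (Comp C P Q R p q g f) =
      Comp D (FO P) (FO Q) (FO R) p q (FM Q R p g) (FM P Q q f)"
    and F_Diff: "P \<in> Ob C \<Longrightarrow> Q \<in> Ob C \<Longrightarrow> f \<in> carrier (Hom C P Q n) \<Longrightarrow>
      FM P Q (n + 1) (Diff C P Q n f) = Diff D (FO P) (FO Q) n (FM P Q n f)"

text \<open>Isomorphism of two objects in the homotopy category \<open>H\<^sup>0(C)\<close>.\<close>

definition H0_isomorphic :: "('o, 'm, 'k::field) dgcat \<Rightarrow> 'o \<Rightarrow> 'o \<Rightarrow> bool" where
  "H0_isomorphic C P Q \<longleftrightarrow>
     (\<exists>f \<in> cocycles (Hom C P Q) (Diff C P Q) 0. \<exists>g \<in> cocycles (Hom C Q P) (Diff C Q P) 0.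
        Comp C P Q P 0 0 g f \<ominus>\<^bsub>Hom C P P 0\<^esub> Ident C P \<in> coboundaries (Hom C P P) (Diff C P P) 0 \<and>
        Comp C Q P Q 0 0 f g \<ominus>\<^bsub>Hom C Q Q 0\<^esub> Ident C Q \<in> coboundaries (Hom C Q Q) (Diff C Q Q) 0)"

locale quasi_equivalence = dg_functor +
  assumes quasi_fully_faithful: "P \<in> Ob C \<Longrightarrow> Q \<in> Ob C \<Longrightarrow>
      quasi_iso (Hom C P Q) (Diff C P Q) (Hom D (FO P) (FO Q)) (Diff D (FO P) (FO Q)) (FM P Q)"
    and H0_essentially_surjective: "R \<in> Ob D \<Longrightarrow> \<exists>P\<in>Ob C. H0_isomorphic D (FO P) R"

text \<open>Connected by a finite zig-zag of quasi-equivalences. Since HOL cannot quantify over types, the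
  intermediate DG-categories have the same object and morphism types as the two ends.\<close>

definition dg_equivalent :: "('o, 'm, 'k::field) dgcat \<Rightarrow> ('o, 'm, 'k) dgcat \<Rightarrow> bool" where
  "dg_equivalent = equivclp (\<lambda>C D. \<exists>FO FM. quasi_equivalence C D FO FM)"


section \<open>The Drinfeld DG quotient\<close>

text \<open>The DG quotient of \<open>C\<close> by the full subcategory on the objects \<open>B\<close> is obtained by freely
  adjoining, for each \<open>U \<in> B\<close>, a morphism \<open>\<epsilon>\<^sub>U : U \<rightarrow> U\<close> of degree \<open>-1\<close> with \<open>d \<epsilon>\<^sub>U = 1\<^sub>U\<close>. A morphism
  \<open>P \<rightarrow> Q\<close> is a linear combination of formal composites
  \<open>f\<^sub>n \<epsilon> f\<^sub>n\<^sub>-\<^sub>1 \<epsilon> \<dots> \<epsilon> f\<^sub>0\<close> (tensors, hence multilinear in the \<open>f\<^sub>i\<close>) through objects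
  \<open>U\<^sub>1, \<dots>, U\<^sub>n \<in> B\<close>. Such a composite is encoded as the list
  \<open>[(f\<^sub>0, |f\<^sub>0|, U\<^sub>1), (f\<^sub>1, |f\<^sub>1|, U\<^sub>2), \<dots>, (f\<^sub>n, |f\<^sub>n|, Q)]\<close>, i.e. in the order of application.\<close>

type_synonym ('o, 'm) word = "('m \<times> int \<times> 'o) list"

definition word_degree :: "('o, 'm) word \<Rightarrow> int" where
  "word_degree w = (\<Sum>(f, p, V)\<leftarrow>w. p) - (int (length w) - 1)"

fun is_word :: "('o, 'm, 'k) dgcat \<Rightarrow> 'o set \<Rightarrow> 'o \<Rightarrow> 'o \<Rightarrow> ('o, 'm) word \<Rightarrow> bool" where
  "is_word C B P Q [] = False"
| "is_word C B P Q [(f, p, V)] = (V = Q \<and> f \<in> carrier (Hom C P V p))"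
| "is_word C B P Q ((f, p, V) # x # w) =
     (V \<in> B \<and> f \<in> carrier (Hom C P V p) \<and> is_word C B V Q (x # w))"

definition words :: "('o, 'm, 'k) dgcat \<Rightarrow> 'o set \<Rightarrow> 'o \<Rightarrow> 'o \<Rightarrow> int \<Rightarrow> ('o, 'm) word set" where
  "words C B P Q n = {w. is_word C B P Q w \<and> word_degree w = n}"

text \<open>The object at which the path \<open>v\<close>, starting at \<open>P\<close>, ends.\<close>

definition endpoint :: "'o \<Rightarrow> ('o, 'm) word \<Rightarrow> 'o" where
  "endpoint P v = (if v = [] then P else snd (snd (last v)))"

definition word_rels ::
    "('o, 'm, 'k::field) dgcat \<Rightarrow> 'o set \<Rightarrow> 'o \<Rightarrow> 'o \<Rightarrow> int \<Rightarrow> (('o, 'm) word \<Rightarrow>\<^sub>0 'k) set" where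
  "word_rels C B P Q n =
     {basis (v @ (f \<oplus>\<^bsub>Hom C (endpoint P v) V p\<^esub> g, p, V) # w)
        - basis (v @ (f, p, V) # w) - basis (v @ (g, p, V) # w) |v f g p V w.
        v @ (f, p, V) # w \<in> words C B P Q n \<and> v @ (g, p, V) # w \<in> words C B P Q n} \<union>
     {basis (v @ (c \<odot>\<^bsub>Hom C (endpoint P v) V p\<^esub> f, p, V) # w)
        - free_scale c (basis (v @ (f, p, V) # w)) |v c f p V w.
        v @ (f, p, V) # w \<in> words C B P Q n}"

text \<open>The Leibniz rule for \<open>w' \<epsilon> f\<close>:
  \<open>d(w' \<epsilon> f) = d(w') \<epsilon> f + (-1)\<^bsup>|w'|\<^esup> w' f + (-1)\<^bsup>|w'|-1\<^esup> w' \<epsilon> d(f)\<close>.\<close>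

fun word_diff ::
    "('o, 'm, 'k::field) dgcat \<Rightarrow> 'o \<Rightarrow> ('o, 'm) word \<Rightarrow> (('o, 'm) word \<Rightarrow>\<^sub>0 'k)" where
  "word_diff C P [] = 0"
| "word_diff C P [(f, p, V)] = basis [(Diff C P V p f, p + 1, V)]"
| "word_diff C P ((f, p, V) # (g, q, W) # w) =
     (let r = word_degree ((g, q, W) # w) in
      free_ext (\<lambda>u. basis ((f, p, V) # u)) (word_diff C V ((g, q, W) # w))
      + free_scale ((-1) powi r) (basis ((Comp C P V W q p g f, q + p, W) # w))
      + free_scale ((-1) powi (r - 1)) (basis ((Diff C P V p f, p + 1, V) # (g, q, W) # w)))"

text \<open>\<open>word_comp C P w v\<close> is the composite \<open>w \<circ> v\<close>, where \<open>v\<close> starts at \<open>P\<close>.\<close>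

fun word_comp ::
    "('o, 'm, 'k) dgcat \<Rightarrow> 'o \<Rightarrow> ('o, 'm) word \<Rightarrow> ('o, 'm) word \<Rightarrow> ('o, 'm) word" where
  "word_comp C P ((g, q, W) # w) [(f, p, V)] = (Comp C P V W q p g f, q + p, W) # w"
| "word_comp C P w ((f, p, V) # x # v) = (f, p, V) # word_comp C V w (x # v)"
| "word_comp C P w v = []"

definition dg_quotient ::
    "('o, 'm, 'k::field) dgcat \<Rightarrow> 'o set \<Rightarrow> ('o, (('o, 'm) word \<Rightarrow>\<^sub>0 'k) set, 'k) dgcat" where
  "dg_quotient C B = \<lparr>
     Ob = Ob C,
     Hom = (\<lambda>P Q n. presented (words C B P Q n) (word_rels C B P Q n)),
     Comp = (\<lambda>P Q R p q G F. \<Union>g\<in>G. \<Union>f\<in>F. free_class (word_rels C B P R (p + q))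
        (free_ext (\<lambda>w. free_ext (\<lambda>v. basis (word_comp C P w v)) f) g)),
     Ident = (\<lambda>P. free_class (word_rels C B P P 0) (basis [(Ident C P, 0, P)])),
     Diff = (\<lambda>P Q n F. \<Union>f\<in>F. free_class (word_rels C B P Q (n + 1))
        (free_ext (word_diff C P) f)) \<rparr>"


section \<open>Mixed anti-Yetter-Drinfeld contramodules\<close>

record ('k, 'h, 'm) mixed =
  piece :: "int \<Rightarrow> ('k, 'h, 'm) contramodule"
  dmap :: "int \<Rightarrow> 'm \<Rightarrow> 'm"
  hmap :: "int \<Rightarrow> 'm \<Rightarrow> 'm"

locale mixed_base =
  fixes H :: "('k::field, 'h::ring_1) hopf" and P :: "('k, 'h, 'm) mixed"
  assumes piece_aYD: "aYD_contramodule H (piece P n)"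
    and d_hom: "dmap P n \<in> aYD_hom H (piece P n) (piece P (n + 1))"
    and h_hom: "hmap P n \<in> aYD_hom H (piece P n) (piece P (n - 1))"
    and d_d: "m \<in> carrier (piece P n) \<Longrightarrow> dmap P (n + 1) (dmap P n m) = \<zero>\<^bsub>piece P (n + 2)\<^esub>"
    and h_h: "m \<in> carrier (piece P n) \<Longrightarrow> hmap P (n - 1) (hmap P n m) = \<zero>\<^bsub>piece P (n - 2)\<^esub>"

locale mixed_aYD_contramodule = mixed_base +
  assumes dh_hd: "m \<in> carrier (piece P n) \<Longrightarrow>
    dmap P (n - 1) (hmap P n m) \<oplus>\<^bsub>piece P n\<^esub> hmap P (n + 1) (dmap P n m) =
    sigma (piece P n) m \<ominus>\<^bsub>piece P n\<^esub> m"

locale mixed_complex_stable_aYD = mixed_base +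
  assumes stable: "stable (piece P n)"
    and dh_hd: "m \<in> carrier (piece P n) \<Longrightarrow>
    dmap P (n - 1) (hmap P n m) \<oplus>\<^bsub>piece P n\<^esub> hmap P (n + 1) (dmap P n m) = \<zero>\<^bsub>piece P n\<^esub>"

definition acyclic_mixed :: "('k, 'h, 'm) mixed \<Rightarrow> bool" where
  "acyclic_mixed P \<longleftrightarrow> (\<forall>n. cocycles (piece P) (dmap P) n = coboundaries (piece P) (dmap P) n)"

text \<open>Degree \<open>n\<close> maps are extensional on each graded piece, so that equal maps are equal functions.\<close>

definition mixed_hom ::
    "('k::field, 'h::ring_1) hopf \<Rightarrow> ('k, 'h, 'm) mixed \<Rightarrow> ('k, 'h, 'm) mixed \<Rightarrow> int
      \<Rightarrow> ('k, int \<Rightarrow> 'm \<Rightarrow> 'm) module" where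
  "mixed_hom H P Q n = \<lparr>
     carrier = {f. (\<forall>i. f i \<in> aYD_hom H (piece P i) (piece Q (i + n)) \<inter> extensional (carrier (piece P i))) \<and>
       (\<forall>i. \<forall>m\<in>carrier (piece P i).
          hmap Q (i + n) (f i m) = ((-1) powi n) \<odot>\<^bsub>piece Q (i + n - 1)\<^esub> f (i - 1) (hmap P i m))},
     monoid.mult = (\<lambda>_ _. undefined), one = undefined,
     ring.zero = (\<lambda>i. \<lambda>m\<in>carrier (piece P i). \<zero>\<^bsub>piece Q (i + n)\<^esub>),
     add = (\<lambda>f g i. \<lambda>m\<in>carrier (piece P i). f i m \<oplus>\<^bsub>piece Q (i + n)\<^esub> g i m),
     module.smult = (\<lambda>c f i. \<lambda>m\<in>carrier (piece P i). c \<odot>\<^bsub>piece Q (i + n)\<^esub> f i m) \<rparr>"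

definition mixed_dgcat ::
    "('k::field, 'h::ring_1) hopf \<Rightarrow> ('k, 'h, 'm) mixed set
      \<Rightarrow> (('k, 'h, 'm) mixed, int \<Rightarrow> 'm \<Rightarrow> 'm, 'k) dgcat" where
  "mixed_dgcat H A = \<lparr>
     Ob = A,
     Hom = mixed_hom H,
     Comp = (\<lambda>P Q R p q g f i. \<lambda>m\<in>carrier (piece P i). g (i + q) (f i m)),
     Ident = (\<lambda>P i. \<lambda>m\<in>carrier (piece P i). m),
     Diff = (\<lambda>P Q n f i. \<lambda>m\<in>carrier (piece P i).
        dmap Q (i + n) (f i m)
        \<ominus>\<^bsub>piece Q (i + n + 1)\<^esub> ((-1) powi n) \<odot>\<^bsub>piece Q (i + n + 1)\<^esub> f (i + 1) (dmap P i m)) \<rparr>"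

text \<open>The contramodules have underlying sets in the type \<open>'m\<close>, which serves as a universe.\<close>

definition mixed_aYD_dgcat ::
    "('k::field, 'h::ring_1) hopf \<Rightarrow> (('k, 'h, 'm) mixed, int \<Rightarrow> 'm \<Rightarrow> 'm, 'k) dgcat" where
  "mixed_aYD_dgcat H = mixed_dgcat H {P. mixed_aYD_contramodule H P}"

definition mixed_stable_aYD_dgcat ::
    "('k::field, 'h::ring_1) hopf \<Rightarrow> (('k, 'h, 'm) mixed, int \<Rightarrow> 'm \<Rightarrow> 'm, 'k) dgcat" where
  "mixed_stable_aYD_dgcat H = mixed_dgcat H {P. mixed_complex_stable_aYD H P}"

definition derived ::
    "(('k, 'h, 'm) mixed, 'f, 'k::field) dgcat
      \<Rightarrow> (('k, 'h, 'm) mixed, ((('k, 'h, 'm) mixed, 'f) word \<Rightarrow>\<^sub>0 'k) set, 'k) dgcat" where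
  "derived C = dg_quotient C {P \<in> Ob C. acyclic_mixed P}"

end

(*
The antipode being involutive and k of characteristic 0, the trace of left multiplication is an
integral on H whose value at 1 is dim H, which is invertible, and there is a dual integral in H.
Averaging with these two integrals turns linear maps between aYD contramodules into morphisms, so
the natural endomorphism sigma - 1 has a quasi-inverse commuting with it. Hence every M splits
naturally as the stable part, the kernel of sigma - 1, plus a complement on which sigma - 1 is
invertible. For a mixed aYD contramodule d and h respect the splitting: the first summand is a
mixed complex of stable contramodules, and the second one is acyclic, since sigma - 1 = dh + hd is
invertible there. So the inclusion of the full subcategory of stable objects has a retraction whose
complement is acyclic, and the Drinfeld quotient of the large category deforms onto that of the
subcategory; the homotopy uses the contractions epsilon adjoined at acyclic objects.
*)

theory Submission
  imports Defs
begin

section \<open>Free and presented vector spaces\<close>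

text \<open>On the DG side the inclusion \<open>i\<close> of the stable part is natural for
  morphisms, but not for the adjoined contractions: i_U eps' and eps_U i_U differ, where eps' is the
  contraction at \<open>e U\<close>. Their difference is the boundary of eps_U i_U eps', of degree
  -2; inserting this element at each contraction of a word, with signs, gives the homotopy
  \<open>S\<close>. Words count modulo multilinear relations, so identities are proved for formal
  combinations modulo the span of the relations, and every operator must preserve that span. On the
  Hopf side let z = sigma - 1. Linear algebra gives y0 with z y0 z = z. As z commutes with the
  action and with alpha, averaging y0 keeps this equation up to the factor (dim H)^2, which
  characteristic 0 makes invertible. The averaged y commutes with z because sigma commutes with
  every morphism, so 1 - z y projects onto the kernel of z. Contramodules live on carrier sets,
  bases and linear sections on types; hence the averaging takes place in a free space containing
  \<open>M\<close> as a direct summand, where the unit of H acts as the projection onto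
  \<open>M\<close>.\<close>

lemma ground_simps [simp]:
  "carrier (ground :: 'k::field ring) = UNIV"
  "x \<oplus>\<^bsub>ground\<^esub> y = (x + y :: 'k)"
  "x \<otimes>\<^bsub>ground\<^esub> y = (x * y :: 'k)"
  "\<one>\<^bsub>ground\<^esub> = (1 :: 'k)"
  "\<zero>\<^bsub>ground\<^esub> = (0 :: 'k)"
  by (simp_all add: ring_of_type_algebra_def)

lemma ground_cring: "cring (ground :: 'k::field ring)"
  by (rule cring_from_type_algebra)

abbreviation kmodule :: "('k::field, 'm, 'x) module_scheme \<Rightarrow> bool" where
  "kmodule M \<equiv> Module.module ground M"

text \<open>Taking \<open>(- 1) \<odot> x\<close> as the inverse of \<open>x\<close> reduces the
  existence of inverses to one equation, which suits the many modules built below from explicit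
  records.\<close>

lemma kmoduleI:
  fixes M :: "('k::field, 'm, 'x) module_scheme" (structure)
  assumes "\<And>x y. x \<in> carrier M \<Longrightarrow> y \<in> carrier M \<Longrightarrow> x \<oplus> y \<in> carrier M"
    and "\<zero> \<in> carrier M"
    and "\<And>x y z. x \<in> carrier M \<Longrightarrow> y \<in> carrier M \<Longrightarrow> z \<in> carrier M \<Longrightarrow> (x \<oplus> y) \<oplus> z = x \<oplus> (y \<oplus> z)"
    and "\<And>x y. x \<in> carrier M \<Longrightarrow> y \<in> carrier M \<Longrightarrow> x \<oplus> y = y \<oplus> x"
    and "\<And>x. x \<in> carrier M \<Longrightarrow> \<zero> \<oplus> x = x"
    and "\<And>c x. x \<in> carrier M \<Longrightarrow> c \<odot> x \<in> carrier M"
    and "\<And>a b x. x \<in> carrier M \<Longrightarrow> (a + b) \<odot> x = a \<odot> x \<oplus> b \<odot> x"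
    and "\<And>a x y. x \<in> carrier M \<Longrightarrow> y \<in> carrier M \<Longrightarrow> a \<odot> (x \<oplus> y) = a \<odot> x \<oplus> a \<odot> y"
    and "\<And>a b x. x \<in> carrier M \<Longrightarrow> (a * b) \<odot> x = a \<odot> (b \<odot> x)"
    and "\<And>x. x \<in> carrier M \<Longrightarrow> 1 \<odot> x = x"
    and "\<And>x. x \<in> carrier M \<Longrightarrow> (- 1) \<odot> x \<oplus> x = \<zero>"
  shows "kmodule M"
proof (rule moduleI)
  show "abelian_group M"
    by (rule abelian_groupI) (use assms in \<open>auto intro!: bexI[of _ "(-1) \<odot> _"]\<close>)
qed (use assms in \<open>auto intro: ground_cring\<close>)

lemma kmodule_uminus:
  fixes M :: "('k::field, 'm, 'x) module_scheme" (structure)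
  assumes "kmodule M" "x \<in> carrier M"
  shows "\<ominus> x = (- 1) \<odot> x"
proof -
  interpret Module.module ground M by fact
  have "(-1) \<odot> x \<oplus> x = (-1) \<odot> x \<oplus> 1 \<odot> x"
    using smult_one[OF assms(2)] by simp
  also have "\<dots> = (-1 + 1) \<odot> x"
    using smult_l_distr[of "-1" 1 x] assms by simp
  also have "\<dots> = \<zero>"
    using smult_l_null[OF assms(2)] by simp
  finally show ?thesis
    using assms by (metis M.minus_equality UNIV_I ground_simps(1) smult_closed)
qed

lemma lookup_free_scale [simp]: "Poly_Mapping.lookup (free_scale c p) w = c * Poly_Mapping.lookup p w"
  unfolding free_scale_def by transfer (simp add: when_def)

interpretation free: vector_space "free_scale :: 'k::field \<Rightarrow> ('w \<Rightarrow>\<^sub>0 'k) \<Rightarrow> ('w \<Rightarrow>\<^sub>0 'k)"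
  by standard (rule poly_mapping_eqI; simp add: lookup_add algebra_simps)+

abbreviation flinear :: "(('v \<Rightarrow>\<^sub>0 'k::field) \<Rightarrow> ('w \<Rightarrow>\<^sub>0 'k)) \<Rightarrow> bool" where
  "flinear \<equiv> Vector_Spaces.linear free_scale free_scale"

abbreviation fspan :: "('w \<Rightarrow>\<^sub>0 'k::field) set \<Rightarrow> ('w \<Rightarrow>\<^sub>0 'k) set" where
  "fspan \<equiv> free.span"

text \<open>The generators of a Hom space depend on its end points and its degree, so they form a
  set inside one fixed type of words; \<open>fsupp W\<close> holds the representatives of
  \<open>presented W R\<close>.\<close>

definition fsupp :: "'w set \<Rightarrow> ('w \<Rightarrow>\<^sub>0 'k::field) set" where
  "fsupp W = {p. Poly_Mapping.keys p \<subseteq> W}"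

lemma keys_free_scale: "Poly_Mapping.keys (free_scale c p) \<subseteq> Poly_Mapping.keys p"
  by (auto simp: in_keys_iff)

lemma keys_basis [simp]: "Poly_Mapping.keys (basis w :: 'w \<Rightarrow>\<^sub>0 'k::field) = {w}"
  by (simp add: basis_def)

lemma mem_fsupp: "p \<in> fsupp W \<longleftrightarrow> (\<forall>w. w \<notin> W \<longrightarrow> Poly_Mapping.lookup p w = 0)"
  by (auto simp: fsupp_def in_keys_iff)

lemma subspace_fsupp: "free.subspace (fsupp W)"
  by (simp add: free.subspace_def mem_fsupp lookup_add)

lemma fsupp_closed [intro, simp]:
  "0 \<in> fsupp W"
  "p \<in> fsupp W \<Longrightarrow> q \<in> fsupp W \<Longrightarrow> p + q \<in> fsupp W"
  "p \<in> fsupp W \<Longrightarrow> q \<in> fsupp W \<Longrightarrow> p - q \<in> fsupp W"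
  "p \<in> fsupp W \<Longrightarrow> - p \<in> fsupp W"
  "p \<in> fsupp W \<Longrightarrow> free_scale c p \<in> fsupp W"
  by (rule free.subspace_0[OF subspace_fsupp] free.subspace_add[OF subspace_fsupp]
    free.subspace_diff[OF subspace_fsupp] free.subspace_neg[OF subspace_fsupp]
    free.subspace_scale[OF subspace_fsupp]; assumption)+

lemma basis_fsupp [simp]: "basis w \<in> fsupp W \<longleftrightarrow> w \<in> W"
  by (simp add: fsupp_def)

lemma free_expand:
  fixes p :: "'w \<Rightarrow>\<^sub>0 'k::field"
  shows "p = (\<Sum>w\<in>Poly_Mapping.keys p. free_scale (Poly_Mapping.lookup p w) (basis w))"
proof (rule poly_mapping_eqI)
  fix v
  have "Poly_Mapping.lookup (\<Sum>w\<in>Poly_Mapping.keys p. free_scale (Poly_Mapping.lookup p w) (basis w)) v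
    = (\<Sum>w\<in>Poly_Mapping.keys p. if w = v then Poly_Mapping.lookup p w else 0)"
    unfolding lookup_sum by (intro sum.cong) (auto simp: basis_def lookup_single)
  also have "\<dots> = Poly_Mapping.lookup p v"
    by (simp add: in_keys_iff)
  finally show "Poly_Mapping.lookup p v = Poly_Mapping.lookup
      (\<Sum>w\<in>Poly_Mapping.keys p. free_scale (Poly_Mapping.lookup p w) (basis w)) v" by simp
qed

lemma fsupp_eq_span: "fsupp W = (fspan (basis ` W) :: ('w \<Rightarrow>\<^sub>0 'k::field) set)"
proof
  show "fspan (basis ` W) \<subseteq> (fsupp W :: ('w \<Rightarrow>\<^sub>0 'k) set)"
    by (rule free.span_minimal) (auto intro: subspace_fsupp)
  show "(fsupp W :: ('w \<Rightarrow>\<^sub>0 'k) set) \<subseteq> fspan (basis ` W)"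
  proof
    fix p :: "'w \<Rightarrow>\<^sub>0 'k" assume "p \<in> fsupp W"
    then show "p \<in> fspan (basis ` W)"
      unfolding fsupp_def
      by (subst free_expand, intro free.span_sum free.span_scale free.span_base) auto
  qed
qed

lemma free_ext_superset:
  assumes "finite A" "Poly_Mapping.keys p \<subseteq> A"
  shows "free_ext f p = (\<Sum>v\<in>A. free_scale (Poly_Mapping.lookup p v) (f v))"
  unfolding free_ext_def using assms
  by (intro sum.mono_neutral_left) (auto simp: in_keys_iff)

lemma linear_free_ext [simp]:
  fixes f :: "'v \<Rightarrow> ('w \<Rightarrow>\<^sub>0 'k::field)"
  shows "flinear (free_ext f)"
proof (unfold Vector_Spaces.linear_iff, intro conjI allI)
  fix p q :: "'v \<Rightarrow>\<^sub>0 'k" and c :: 'k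
  let ?A = "Poly_Mapping.keys p \<union> Poly_Mapping.keys q"
  show "free_ext f (p + q) = free_ext f p + free_ext f q"
    using free_ext_superset[of ?A "p + q" f] free_ext_superset[of ?A p f] free_ext_superset[of ?A q f]
      keys_add[of p q] by (simp add: lookup_add free.scale_left_distrib sum.distrib)
  show "free_ext f (free_scale c p) = free_scale c (free_ext f p)"
    using free_ext_superset[of "Poly_Mapping.keys p" "free_scale c p" f]
      free_ext_superset[of "Poly_Mapping.keys p" p f]
      keys_free_scale[of c p] by (simp add: free.scale_sum_right)
qed (rule free.vector_space_axioms)+

lemma free_ext_basis [simp]: "free_ext f (basis w) = f w"
  by (simp add: free_ext_def basis_def)

lemmas flinear_add = Vector_Spaces.linear.axioms(3)[THEN module_hom.add]
lemmas flinear_scale = Vector_Spaces.linear.axioms(3)[THEN module_hom.scale]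
lemmas flinear_diff = Vector_Spaces.linear.axioms(3)[THEN module_hom.diff]
lemmas flinear_neg = Vector_Spaces.linear.axioms(3)[THEN module_hom.neg]
lemmas flinear_zero = Vector_Spaces.linear.axioms(3)[THEN module_hom.zero]
lemmas flinear_sum = Vector_Spaces.linear.axioms(3)[THEN module_hom.sum]

lemma free_ext_simps [simp]:
  "free_ext f (p + q) = free_ext f p + free_ext f q"
  "free_ext f (p - q) = free_ext f p - free_ext f q"
  "free_ext f (- p) = - free_ext f p"
  "free_ext f (free_scale c p) = free_scale c (free_ext f p)"
  "free_ext f 0 = 0"
  by (simp_all add: flinear_add[OF linear_free_ext] flinear_diff[OF linear_free_ext]
      flinear_scale[OF linear_free_ext] flinear_neg[OF linear_free_ext] flinear_zero[OF linear_free_ext])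

lemma flinearI:
  assumes "\<And>p q. f (p + q) = f p + f q" "\<And>c p. f (free_scale c p) = free_scale c (f p)"
  shows "flinear f"
  using assms by (simp add: Vector_Spaces.linear_iff free.vector_space_axioms)

lemma fspan_mapsto:
  assumes "flinear f" "free.subspace N" "\<And>r. r \<in> R \<Longrightarrow> f r \<in> N" "p \<in> fspan R"
  shows "f p \<in> N"
  using assms(4)
proof (induction rule: free.span_induct)
  case base
  show ?case
    by (auto simp: free.subspace_def flinear_add[OF assms(1)] flinear_scale[OF assms(1)] flinear_zero[OF assms(1)]
      intro: free.subspace_0[OF assms(2)] free.subspace_add[OF assms(2)] free.subspace_scale[OF assms(2)])
next
  case (step x)
  then show ?case by (rule assms(3))
qed

lemma fsupp_mapsto:
  assumes "flinear f" "free.subspace N" "\<And>w. w \<in> W \<Longrightarrow> f (basis w) \<in> N" "p \<in> fsupp W"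
  shows "f p \<in> N"
  by (rule fspan_mapsto[OF assms(1,2) _ assms(4)[unfolded fsupp_eq_span]]) (use assms(3) in auto)

lemma free_ext_mapsto:
  assumes "free.subspace N" "\<And>w. w \<in> W \<Longrightarrow> f w \<in> N" "p \<in> fsupp W"
  shows "free_ext f p \<in> N"
  by (rule fsupp_mapsto[OF linear_free_ext assms(1) _ assms(3)]) (use assms(2) in auto)

lemma flinear_intros [intro]:
  "flinear f \<Longrightarrow> flinear g \<Longrightarrow> flinear (\<lambda>p. f p + g p)"
  "flinear f \<Longrightarrow> flinear g \<Longrightarrow> flinear (\<lambda>p. f p - g p)"
  "flinear f \<Longrightarrow> flinear (\<lambda>p. - f p)"
  "flinear f \<Longrightarrow> flinear (\<lambda>p. free_scale c (f p))"
  "flinear f \<Longrightarrow> flinear (\<lambda>p. free_ext h (f p))"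
  "flinear (\<lambda>p. p)"
  "flinear (\<lambda>p. 0)"
  by (auto intro!: flinearI simp: flinear_add flinear_scale free.scale_right_distrib
     free.scale_right_diff_distrib free.scale_left_commute)

lemma free_ext_free_ext: "free_ext f (free_ext g p) = free_ext (\<lambda>w. free_ext f (g w)) p"
  unfolding free_ext_def[of g] free_ext_def[of "\<lambda>w. free_ext f (g w)"]
  by (simp add: flinear_sum[OF linear_free_ext])

lemma free_ext_add: "free_ext (\<lambda>w. f w + g w) p = free_ext f p + free_ext g p"
  unfolding free_ext_def by (simp add: free.scale_right_distrib sum.distrib)

lemma free_ext_scale: "free_ext (\<lambda>w. free_scale c (f w)) p = free_scale c (free_ext f p)"
  unfolding free_ext_def by (simp add: free.scale_sum_right mult.commute)

lemma free_ext_diff: "free_ext (\<lambda>w. f w - g w) p = free_ext f p - free_ext g p"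
  unfolding free_ext_def by (simp add: free.scale_right_diff_distrib sum_subtractf)

lemma free_ext_swap:
  "free_ext (\<lambda>w. free_ext (\<lambda>v. h w v) f) g = free_ext (\<lambda>v. free_ext (\<lambda>w. h w v) g) f"
  unfolding free_ext_def free.scale_sum_right
  by (subst sum.swap) (simp add: mult.commute)

lemma mem_free_class: "q \<in> free_class R p \<longleftrightarrow> q - p \<in> fspan R"
  unfolding free_class_def by (auto simp: algebra_simps intro!: exI[of _ "q - p"])

lemma free_class_self [simp]: "p \<in> free_class R p"
  by (simp add: mem_free_class free.span_zero)

lemma free_class_eq_iff: "free_class R p = free_class R q \<longleftrightarrow> p - q \<in> fspan R"
proof
  assume "free_class R p = free_class R q"
  then show "p - q \<in> fspan R" using free_class_self[of p R] by (simp add: mem_free_class)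
next
  assume *: "p - q \<in> fspan R"
  have "x - p \<in> fspan R \<longleftrightarrow> x - q \<in> fspan R" for x
    using free.span_add[OF _ *, of "x - p"] free.span_diff[OF _ *, of "x - q"] by auto
  then show "free_class R p = free_class R q" by (auto simp: mem_free_class)
qed

lemma free_class_eqI: "q - p \<in> fspan R \<Longrightarrow> free_class R p = free_class R q"
  using free_class_eq_iff by blast

text \<open>The operations of the DG quotient are unions of classes over all representatives. When
  \<open>L\<close> carries relations into the span of relations, all classes in such a union
  coincide and any one representative computes it.\<close>

lemma UN_free_class:
  assumes "flinear L" "\<And>r. r \<in> R \<Longrightarrow> L r \<in> fspan R'"
  shows "(\<Union>q\<in>free_class R p. free_class R' (L q)) = free_class R' (L p)"
proof -
  have "free_class R' (L q) = free_class R' (L p)" if "q \<in> free_class R p" for q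
    unfolding free_class_eq_iff flinear_diff[OF assms(1), symmetric]
    by (rule fspan_mapsto[OF assms(1) free.subspace_span assms(2)])
      (use that in \<open>auto simp: mem_free_class\<close>)
  then show ?thesis using free_class_self[of p R] by blast
qed

lemma presented_simps [simp]:
  "carrier (presented W R) = free_class R ` fsupp W"
  "\<zero>\<^bsub>presented W R\<^esub> = free_class R 0"
  by (simp_all add: presented_def fsupp_def)

lemma presented_add [simp]:
  "free_class R p \<oplus>\<^bsub>presented W R\<^esub> free_class R q = free_class R (p + q)"
proof -
  have "{p' + q' |p' q'. p' \<in> free_class R p \<and> q' \<in> free_class R q} = free_class R (p + q)"
  proof safe
    fix p' q' assume "p' \<in> free_class R p" "q' \<in> free_class R q"
    then have "(p' - p) + (q' - q) \<in> fspan R" by (auto simp: mem_free_class intro: free.span_add)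
    then show "p' + q' \<in> free_class R (p + q)" by (simp add: mem_free_class algebra_simps)
  next
    fix x assume "x \<in> free_class R (p + q)"
    then have "x - q \<in> free_class R p" by (simp add: mem_free_class algebra_simps)
    then show "\<exists>p' q'. x = p' + q' \<and> p' \<in> free_class R p \<and> q' \<in> free_class R q"
      by (intro exI[of _ "x - q"] exI[of _ q]) auto
  qed
  then show ?thesis by (simp add: presented_def)
qed

lemma presented_smult [simp]:
  "c \<odot>\<^bsub>presented W R\<^esub> free_class R p = free_class R (free_scale c p)"
proof -
  have "(\<Union>q\<in>free_class R p. free_class R (free_scale c q)) = free_class R (free_scale c p)"
  proof (rule UN_free_class)
    show "flinear (free_scale c)"
      by (rule flinear_intros(4)) (rule flinear_intros(6))
  qed (intro free.span_scale free.span_base)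
  then show ?thesis by (simp add: presented_def)
qed

lemma kmodule_presented: "kmodule (presented W R)"
  by (rule kmoduleI) (auto simp: algebra_simps free.scale_left_distrib free.scale_right_distrib)

lemma presented_minus [simp]:
  assumes "p \<in> fsupp W" "q \<in> fsupp W"
  shows "free_class R p \<ominus>\<^bsub>presented W R\<^esub> free_class R q = free_class R (p - q)"
  using assms by (simp add: a_minus_def kmodule_uminus[OF kmodule_presented])

lemma fspan_subset_fsupp: "R \<subseteq> fsupp W \<Longrightarrow> fspan R \<subseteq> fsupp W"
  by (rule free.span_minimal[OF _ subspace_fsupp])

lemma free_class_subset_fsupp:
  assumes "R \<subseteq> fsupp W" "p \<in> fsupp W" "q \<in> free_class R p"
  shows "q \<in> fsupp W"
proof -
  have "q - p \<in> fsupp W"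
    using assms(3) fspan_subset_fsupp[OF assms(1)] by (auto simp: mem_free_class)
  then have "(q - p) + p \<in> fsupp W"
    using assms(2) by (rule fsupp_closed)
  then show ?thesis by simp
qed

section \<open>The DG quotient is a DG category\<close>

lemma linear_mapsD:
  assumes "f \<in> linear_maps A B"
  shows "x \<in> carrier A \<Longrightarrow> f x \<in> carrier B"
    and "x \<in> carrier A \<Longrightarrow> y \<in> carrier A \<Longrightarrow> f (x \<oplus>\<^bsub>A\<^esub> y) = f x \<oplus>\<^bsub>B\<^esub> f y"
    and "x \<in> carrier A \<Longrightarrow> f (c \<odot>\<^bsub>A\<^esub> x) = c \<odot>\<^bsub>B\<^esub> f x"
  using assms by (auto simp: linear_maps_def)

lemma linear_mapsI:
  assumes "\<And>x. x \<in> carrier A \<Longrightarrow> f x \<in> carrier B"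
    and "\<And>x y. x \<in> carrier A \<Longrightarrow> y \<in> carrier A \<Longrightarrow> f (x \<oplus>\<^bsub>A\<^esub> y) = f x \<oplus>\<^bsub>B\<^esub> f y"
    and "\<And>c x. x \<in> carrier A \<Longrightarrow> f (c \<odot>\<^bsub>A\<^esub> x) = c \<odot>\<^bsub>B\<^esub> f x"
  shows "f \<in> linear_maps A B"
  using assms by (auto simp: linear_maps_def)

text \<open>As (-1)^n is its own inverse, every sign becomes a product of powers with atomic
  exponents, in which squares cancel.\<close>

lemma sign_simps [simp]:
  "(-1 :: 'k::field) powi (m + n) = (-1) powi m * (-1) powi n"
  "(-1 :: 'k::field) powi (m - n) = (-1) powi m * (-1) powi n"
  "(-1 :: 'k::field) powi n * (-1) powi n = 1"
  "(-1 :: 'k::field) powi n * ((-1) powi n * c) = c"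
proof -
  show "(-1 :: 'k) powi (m + n) = (-1) powi m * (-1) powi n"
    by (simp add: power_int_add)
  have "(-1 :: 'k) powi (2 * n) = 1"
    by (simp add: power_int_mult)
  then show sq: "(-1 :: 'k) powi n * (-1) powi n = 1"
    by (simp add: power_int_add[symmetric])
  show "(-1 :: 'k) powi (m - n) = (-1) powi m * (-1) powi n"
    using sq by (simp add: power_int_diff divide_eq_eq mult.assoc)
  show "(-1 :: 'k) powi n * ((-1) powi n * c) = c"
    using sq by (simp add: mult.assoc[symmetric])
qed

text \<open>Modulo the span of these, the free space on the carrier of a module \<open>A\<close> is
  \<open>A\<close> again. The relations among words are these, placed at one letter with all other
  letters fixed; isolating the letter lets any linear map act on it.\<close>

definition lin_rels :: "('k::field, 'a, 'x) module_scheme \<Rightarrow> ('a \<Rightarrow>\<^sub>0 'k) set" where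
  "lin_rels A = {basis (x \<oplus>\<^bsub>A\<^esub> y) - basis x - basis y |x y. x \<in> carrier A \<and> y \<in> carrier A} \<union>
     {basis (c \<odot>\<^bsub>A\<^esub> x) - free_scale c (basis x) |c x. x \<in> carrier A}"

lemma lin_rels_map:
  assumes "\<phi> \<in> linear_maps A A'" "l \<in> lin_rels A"
  shows "free_ext (\<lambda>x. basis (\<phi> x)) l \<in> lin_rels A'"
  using assms(2) linear_mapsD[OF assms(1)] unfolding lin_rels_def
  by (auto 0 4 simp: linear_mapsD[OF assms(1)])

lemma lin_rels_supp:
  assumes "kmodule A" "l \<in> lin_rels A" shows "l \<in> fsupp (carrier A)"
proof -
  interpret Module.module ground A by fact
  show ?thesis using assms(2) unfolding lin_rels_def by auto
qed

section \<open>Words: degree, composability and first letters\<close>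

lemma word_degree_simps [simp]:
  "word_degree [(f, p, V)] = p"
  "u \<noteq> [] \<Longrightarrow> word_degree ((f, p, V) # u) = p + word_degree u - 1"
  by (simp_all add: word_degree_def)

lemma is_word_Cons [simp]:
  "u \<noteq> [] \<Longrightarrow> is_word C B P Q ((f, p, V) # u) \<longleftrightarrow> V \<in> B \<and> f \<in> carrier (Hom C P V p) \<and> is_word C B V Q u"
  by (cases u) auto

lemma words_Cons:
  "(f, p, V) # u \<in> words C B P Q n \<longleftrightarrow>
    (if u = [] then V = Q \<and> p = n \<and> f \<in> carrier (Hom C P V p)
     else V \<in> B \<and> f \<in> carrier (Hom C P V p) \<and> u \<in> words C B V Q (n + 1 - p))"
  by (auto simp: words_def)

lemma Nil_not_word [simp]: "[] \<notin> words C B P Q n"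
  by (simp add: words_def)

lemma wordsD: "w \<in> words C B P Q n \<Longrightarrow> w \<noteq> [] \<and> word_degree w = n"
  by (auto simp: words_def)

lemma words_single: "f \<in> carrier (Hom C P Q p) \<Longrightarrow> [(f, p, Q)] \<in> words C B P Q p"
  by (simp add: words_Cons)

lemma words_ConsI:
  "V \<in> B \<Longrightarrow> f \<in> carrier (Hom C P V p) \<Longrightarrow> u \<in> words C B V Q m \<Longrightarrow> n = p + m - 1 \<Longrightarrow>
    (f, p, V) # u \<in> words C B P Q n"
  by (auto simp: words_Cons)

text \<open>Words are listed in the order of application, so attaching a first letter
  \<open>f\<close> to a word u means the composite u eps f, with a contraction in between.\<close>

definition pre :: "('m \<times> int \<times> 'o) \<Rightarrow> (('o, 'm) word \<Rightarrow>\<^sub>0 'k::field) \<Rightarrow> (('o, 'm) word \<Rightarrow>\<^sub>0 'k)" where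
  "pre x = free_ext (\<lambda>u. basis (x # u))"

lemma pre_simps [simp]:
  "pre x (p + q) = pre x p + pre x q"
  "pre x (p - q) = pre x p - pre x q"
  "pre x (- p) = - pre x p"
  "pre x (free_scale c p) = free_scale c (pre x p)"
  "pre x 0 = 0"
  "pre x (basis w) = basis (x # w)"
  by (simp_all add: pre_def)

lemma flinear_pre: "flinear (pre x)" "flinear f \<Longrightarrow> flinear (\<lambda>p. pre x (f p))"
  by (auto intro!: flinearI simp: flinear_add flinear_scale)

lemma word_comp_Cons [simp]: "v \<noteq> [] \<Longrightarrow> word_comp C P w ((f, p, V) # v) = (f, p, V) # word_comp C V w v"
  by (cases v; cases "(C, P, w, (f, p, V) # v)" rule: word_comp.cases) auto

lemma word_comp_nonempty [simp]: "w \<noteq> [] \<Longrightarrow> v \<noteq> [] \<Longrightarrow> word_comp C P w v \<noteq> []"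
  by (induction C P w v rule: word_comp.induct) auto

text \<open>The middle term of the Leibniz rule, where the contraction between \<open>u\<close> and
  \<open>f\<close> has been removed, is the composite of \<open>u\<close> with the one-letter word
  \<open>f\<close>. Written so, the rule keeps \<open>u\<close> whole and extends linearly in
  \<open>u\<close>.\<close>

lemma word_diff_Cons:
  assumes "u \<noteq> []"
  shows "word_diff C P ((f, p, V) # u) =
     pre (f, p, V) (word_diff C V u)
     + free_scale ((-1) powi word_degree u) (basis (word_comp C P u [(f, p, V)]))
     - free_scale ((-1) powi word_degree u) (basis ((Diff C P V p f, p + 1, V) # u))"
proof -
  obtain g q W w where "u = (g, q, W) # w" using assms by (cases u) auto
  then show ?thesis by (simp add: pre_def Let_def del: word_degree_simps)
qed

locale dg_pair = dg_category C for C :: "('o, 'm, 'k::field) dgcat" +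
  fixes B :: "'o set"
  assumes B_sub: "B \<subseteq> Ob C"
begin

abbreviation "Wd P Q n \<equiv> words C B P Q n"
abbreviation N :: "'o \<Rightarrow> 'o \<Rightarrow> int \<Rightarrow> (('o, 'm) word \<Rightarrow>\<^sub>0 'k) set" where
  "N P Q n \<equiv> fspan (word_rels C B P Q n)"
abbreviation FW :: "'o \<Rightarrow> 'o \<Rightarrow> int \<Rightarrow> (('o, 'm) word \<Rightarrow>\<^sub>0 'k) set" where
  "FW P Q n \<equiv> fsupp (Wd P Q n)"
abbreviation "cls P Q n \<equiv> free_class (word_rels C B P Q n)"

definition D :: "'o \<Rightarrow> (('o, 'm) word \<Rightarrow>\<^sub>0 'k) \<Rightarrow> (('o, 'm) word \<Rightarrow>\<^sub>0 'k)" where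
  "D P = free_ext (word_diff C P)"

definition cmp :: "'o \<Rightarrow> (('o, 'm) word \<Rightarrow>\<^sub>0 'k) \<Rightarrow> (('o, 'm) word \<Rightarrow>\<^sub>0 'k) \<Rightarrow> (('o, 'm) word \<Rightarrow>\<^sub>0 'k)" where
  "cmp P g f = free_ext (\<lambda>w. free_ext (\<lambda>v. basis (word_comp C P w v)) f) g"

lemma D_simps [simp]:
  "D P (p + q) = D P p + D P q"
  "D P (p - q) = D P p - D P q"
  "D P (- p) = - D P p"
  "D P (free_scale c p) = free_scale c (D P p)"
  "D P 0 = 0"
  "D P (basis w) = word_diff C P w"
  by (simp_all add: D_def)

lemma cmp_simps [simp]:
  "cmp P (g + g') f = cmp P g f + cmp P g' f"
  "cmp P (g - g') f = cmp P g f - cmp P g' f"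
  "cmp P (- g) f = - cmp P g f"
  "cmp P (free_scale c g) f = free_scale c (cmp P g f)"
  "cmp P 0 f = 0"
  "cmp P g (f + f') = cmp P g f + cmp P g f'"
  "cmp P g (f - f') = cmp P g f - cmp P g f'"
  "cmp P g (- f) = - cmp P g f"
  "cmp P g (free_scale c f) = free_scale c (cmp P g f)"
  "cmp P g 0 = 0"
  "cmp P (basis w) (basis v) = basis (word_comp C P w v)"
proof -
  have neg: "cmp P g (f - f') = cmp P g f - cmp P g f'" for f f'
    by (simp add: cmp_def free_ext_diff)
  show "cmp P g (f - f') = cmp P g f - cmp P g f'" by (rule neg)
  show z: "cmp P g 0 = 0" using neg[of 0 0] by simp
  show "cmp P g (- f) = - cmp P g f" using neg[of 0 f] z by simp
qed (simp_all add: cmp_def free_ext_add free_ext_scale)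

lemma flinear_D: "flinear (D P)" "flinear f \<Longrightarrow> flinear (\<lambda>p. D P (f p))"
  by (auto intro!: flinearI simp: flinear_add flinear_scale)

lemma flinear_cmp:
  "flinear (cmp P g)" "flinear (\<lambda>g. cmp P g f)"
  "flinear F \<Longrightarrow> flinear (\<lambda>p. cmp P g (F p))" "flinear F \<Longrightarrow> flinear (\<lambda>p. cmp P (F p) f)"
  by (auto intro!: flinearI simp: flinear_add flinear_scale)

lemmas flin = flinear_cmp flinear_D flinear_pre flinear_intros

lemma flin_mod:
  assumes "flinear f" "flinear g" "\<And>w. w \<in> A \<Longrightarrow> f (basis w) - g (basis w) \<in> fspan R" "p \<in> fsupp A"
  shows "f p - g p \<in> fspan R"
  by (rule fsupp_mapsto[where f = "\<lambda>p. f p - g p"]) (use assms in \<open>auto intro: flin\<close>)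

lemma flin_eq:
  assumes "flinear f" "flinear g" "\<And>w. w \<in> A \<Longrightarrow> f (basis w) = g (basis w)" "p \<in> fsupp A"
  shows "f p = g p"
  using flin_mod[OF assms(1,2), of A "{}" p] assms(3,4) by simp

lemma word_induct [consumes 2, case_names single cons]:
  assumes "w \<in> Wd P Q n" "P \<in> Ob C"
    and "\<And>P f p. P \<in> Ob C \<Longrightarrow> f \<in> carrier (Hom C P Q p) \<Longrightarrow> \<Phi> P p [(f, p, Q)]"
    and "\<And>P f p V u m. P \<in> Ob C \<Longrightarrow> V \<in> B \<Longrightarrow> V \<in> Ob C \<Longrightarrow> f \<in> carrier (Hom C P V p) \<Longrightarrow>
      u \<in> Wd V Q m \<Longrightarrow> u \<noteq> [] \<Longrightarrow> word_degree u = m \<Longrightarrow> \<Phi> V m u \<Longrightarrow> \<Phi> P (p + m - 1) ((f, p, V) # u)"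
  shows "\<Phi> P n w"
  using assms(1,2)
proof (induction w arbitrary: P n)
  case (Cons x u)
  obtain f p V where x: "x = (f, p, V)" by (cases x)
  show ?case
  proof (cases "u = []")
    case True
    then show ?thesis using Cons.prems assms(3) by (auto simp: x words_Cons)
  next
    case False
    then have *: "V \<in> B" "f \<in> carrier (Hom C P V p)" "u \<in> Wd V Q (n + 1 - p)"
      using Cons.prems by (auto simp: x words_Cons)
    then have V: "V \<in> Ob C" using B_sub by blast
    then have "\<Phi> P (p + (n + 1 - p) - 1) ((f, p, V) # u)"
      using * False Cons.prems by (intro assms(4) Cons.IH) (auto dest: wordsD)
    then show ?thesis by (simp add: x)
  qed
qed simp

text \<open>\<open>word_rels\<close> marks the varied letter by splitting a word into prefix, letter
  and rest. Here the prefix grows one letter at a time through \<open>cons\<close>, so that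
  induction over a relation follows the recursion of \<open>word_diff\<close> and
  \<open>word_comp\<close>.\<close>

inductive wrel :: "'o \<Rightarrow> 'o \<Rightarrow> int \<Rightarrow> (('o, 'm) word \<Rightarrow>\<^sub>0 'k) \<Rightarrow> bool" for Q where
  single: "l \<in> lin_rels (Hom C P Q n) \<Longrightarrow> wrel Q P n (free_ext (\<lambda>f. basis [(f, n, Q)]) l)"
| head: "V \<in> B \<Longrightarrow> l \<in> lin_rels (Hom C P V p) \<Longrightarrow> u \<in> Wd V Q m \<Longrightarrow> n = p + m - 1 \<Longrightarrow>
    wrel Q P n (free_ext (\<lambda>f. basis ((f, p, V) # u)) l)"
| cons: "V \<in> B \<Longrightarrow> f \<in> carrier (Hom C P V p) \<Longrightarrow> wrel Q V m r \<Longrightarrow> n = p + m - 1 \<Longrightarrow>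
    wrel Q P n (pre (f, p, V) r)"

lemma word_rels_iff:
  assumes "P \<in> Ob C" "Q \<in> Ob C"
  shows "r \<in> word_rels C B P Q n \<longleftrightarrow> wrel Q P n r"
proof
  \<comment> \<open>Induction on the prefix \<open>v\<close>. For an empty prefix the varied letter
    comes first, and an empty or nonempty rest \<open>w\<close> selects \<open>single\<close> or
    \<open>head\<close>.\<close>
  have add: "wrel Q P n (basis (v @ (f \<oplus>\<^bsub>Hom C (endpoint P v) V p\<^esub> g, p, V) # w)
        - basis (v @ (f, p, V) # w) - basis (v @ (g, p, V) # w))"
    if "v @ (f, p, V) # w \<in> Wd P Q n" "v @ (g, p, V) # w \<in> Wd P Q n" for v f g p V w
    using that
  proof (induction v arbitrary: P n)
    case Nil
    let ?l = "basis (f \<oplus>\<^bsub>Hom C P V p\<^esub> g) - basis f - basis g :: 'm \<Rightarrow>\<^sub>0 'k"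
    have l: "?l \<in> lin_rels (Hom C P V p)"
      using Nil by (auto simp: lin_rels_def words_Cons split: if_splits)
    show ?case
    proof (cases "w = []")
      case True
      then show ?thesis using Nil wrel.single[of ?l P Q n] l by (auto simp: endpoint_def words_Cons)
    next
      case False
      then show ?thesis using Nil wrel.head[of V ?l P p w Q "n + 1 - p" n] l
        by (auto simp: endpoint_def words_Cons)
    qed
  next
    case (Cons x v)
    obtain h q U where x: "x = (h, q, U)" by (cases x)
    from Cons.prems have *: "U \<in> B" "h \<in> carrier (Hom C P U q)"
      "v @ (f, p, V) # w \<in> Wd U Q (n + 1 - q)" "v @ (g, p, V) # w \<in> Wd U Q (n + 1 - q)"
      by (auto simp: x words_Cons)
    have ep: "endpoint P ((h, q, U) # v) = endpoint U v" by (auto simp: endpoint_def)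
    show ?case using wrel.cons[OF *(1,2) Cons.IH[OF *(3,4)], of n] by (simp add: ep x)
  qed
  have smult: "wrel Q P n (basis (v @ (c \<odot>\<^bsub>Hom C (endpoint P v) V p\<^esub> f, p, V) # w)
        - free_scale c (basis (v @ (f, p, V) # w)))"
    if "v @ (f, p, V) # w \<in> Wd P Q n" for v c f p V w
    using that
  proof (induction v arbitrary: P n)
    case Nil
    let ?l = "basis (c \<odot>\<^bsub>Hom C P V p\<^esub> f) - free_scale c (basis f) :: 'm \<Rightarrow>\<^sub>0 'k"
    have l: "?l \<in> lin_rels (Hom C P V p)"
      using Nil by (auto simp: lin_rels_def words_Cons split: if_splits)
    show ?case
    proof (cases "w = []")
      case True
      then show ?thesis using Nil wrel.single[of ?l P Q n] l by (auto simp: endpoint_def words_Cons)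
    next
      case False
      then show ?thesis using Nil wrel.head[of V ?l P p w Q "n + 1 - p" n] l
        by (auto simp: endpoint_def words_Cons)
    qed
  next
    case (Cons x v)
    obtain h q U where x: "x = (h, q, U)" by (cases x)
    from Cons.prems have *: "U \<in> B" "h \<in> carrier (Hom C P U q)"
      "v @ (f, p, V) # w \<in> Wd U Q (n + 1 - q)"
      by (auto simp: x words_Cons)
    have ep: "endpoint P ((h, q, U) # v) = endpoint U v" by (auto simp: endpoint_def)
    show ?case using wrel.cons[OF *(1,2) Cons.IH[OF *(3)], of n] by (simp add: ep x)
  qed
  assume "r \<in> word_rels C B P Q n"
  then show "wrel Q P n r"
    unfolding word_rels_def by (auto intro: add smult)
next
  have gen: "free_ext (\<lambda>f. basis ((f, p, V) # u)) l \<in> word_rels C B P Q n"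
    if "l \<in> lin_rels (Hom C P V p)" "\<And>f. f \<in> carrier (Hom C P V p) \<Longrightarrow> (f, p, V) # u \<in> Wd P Q n"
    for l p V u n P
  proof -
    have a: "basis ((x \<oplus>\<^bsub>Hom C P V p\<^esub> y, p, V) # u)
        - basis ((x, p, V) # u) - basis ((y, p, V) # u) \<in> word_rels C B P Q n"
      if "x \<in> carrier (Hom C P V p)" "y \<in> carrier (Hom C P V p)" for x y
    proof -
      have "[] @ (x, p, V) # u \<in> Wd P Q n" "[] @ (y, p, V) # u \<in> Wd P Q n"
        using \<open>\<And>f. f \<in> carrier (Hom C P V p) \<Longrightarrow> (f, p, V) # u \<in> Wd P Q n\<close> that by auto
      then show ?thesis unfolding word_rels_def
        by - (rule UnI1, rule CollectI, rule exI[of _ "[]"], rule exI[of _ x], rule exI[of _ y],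
            rule exI[of _ p], rule exI[of _ V], rule exI[of _ u], simp add: endpoint_def)
    qed
    have b: "basis ((c \<odot>\<^bsub>Hom C P V p\<^esub> x, p, V) # u)
        - free_scale c (basis ((x, p, V) # u)) \<in> word_rels C B P Q n"
      if "x \<in> carrier (Hom C P V p)" for x c
    proof -
      have "[] @ (x, p, V) # u \<in> Wd P Q n"
        using \<open>\<And>f. f \<in> carrier (Hom C P V p) \<Longrightarrow> (f, p, V) # u \<in> Wd P Q n\<close> that by auto
      then show ?thesis unfolding word_rels_def
        by - (rule UnI2, rule CollectI, rule exI[of _ "[]"], rule exI[of _ c], rule exI[of _ x],
            rule exI[of _ p], rule exI[of _ V], rule exI[of _ u], simp add: endpoint_def)
    qed
    show ?thesis
      using \<open>l \<in> lin_rels (Hom C P V p)\<close> a b unfolding lin_rels_def by (auto simp: endpoint_def)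
  qed
  assume "wrel Q P n r"
  then show "r \<in> word_rels C B P Q n" using assms(1)
  proof (induction rule: wrel.induct)
    case (single l P n)
    then show ?case by (intro gen) (auto intro: words_single)
  next
    case (head V l P p u m n)
    then show ?case by (intro gen) (auto intro: words_ConsI)
  next
    case (cons V f P p m r n)
    have ep: "endpoint P ((f, p, V) # v) = endpoint V v" for v by (auto simp: endpoint_def)
    have word: "(f, p, V) # v \<in> Wd P Q n" if "v \<in> Wd V Q m" for v
      using that cons by (auto intro: words_ConsI)
    have "r \<in> word_rels C B V Q m" using cons B_sub by blast
    then consider (a) v g h q U w where
      "r = basis (v @ (g \<oplus>\<^bsub>Hom C (endpoint V v) U q\<^esub> h, q, U) # w)
        - basis (v @ (g, q, U) # w) - basis (v @ (h, q, U) # w)"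
      "v @ (g, q, U) # w \<in> Wd V Q m" "v @ (h, q, U) # w \<in> Wd V Q m"
    | (b) v c g q U w where
      "r = basis (v @ (c \<odot>\<^bsub>Hom C (endpoint V v) U q\<^esub> g, q, U) # w)
        - free_scale c (basis (v @ (g, q, U) # w))"
      "v @ (g, q, U) # w \<in> Wd V Q m"
      unfolding word_rels_def by blast
    then show ?case
    proof cases
      case a
      let ?v = "(f, p, V) # v"
      have "pre (f, p, V) r = basis (?v @ (g \<oplus>\<^bsub>Hom C (endpoint P ?v) U q\<^esub> h, q, U) # w)
        - basis (?v @ (g, q, U) # w) - basis (?v @ (h, q, U) # w)"
        unfolding a(1) ep by simp
      moreover have "?v @ (g, q, U) # w \<in> Wd P Q n" "?v @ (h, q, U) # w \<in> Wd P Q n"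
        using word a by auto
      ultimately show ?thesis unfolding word_rels_def by blast
    next
      case b
      let ?v = "(f, p, V) # v"
      have "pre (f, p, V) r = basis (?v @ (c \<odot>\<^bsub>Hom C (endpoint P ?v) U q\<^esub> g, q, U) # w)
        - free_scale c (basis (?v @ (g, q, U) # w))"
        unfolding b(1) ep by simp
      moreover have "?v @ (g, q, U) # w \<in> Wd P Q n"
        using word b by auto
      ultimately show ?thesis unfolding word_rels_def by blast
    qed
  qed
qed

lemma wrel_N: "P \<in> Ob C \<Longrightarrow> Q \<in> Ob C \<Longrightarrow> wrel Q P n r \<Longrightarrow> r \<in> N P Q n"
  using word_rels_iff by (blast intro: free.span_base)

lemma N_map:
  assumes "P \<in> Ob C" "Q \<in> Ob C" "flinear f" "\<And>r. wrel Q P n r \<Longrightarrow> f r \<in> fspan R" "p \<in> N P Q n"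
  shows "f p \<in> fspan R"
  by (rule fspan_mapsto[OF assms(3) free.subspace_span _ assms(5)]) (use assms word_rels_iff in blast)

lemma wrel_supp:
  assumes "wrel Q P n r" "P \<in> Ob C" "Q \<in> Ob C"
  shows "r \<in> FW P Q n"
  using assms(1,2)
proof (induction rule: wrel.induct)
  case (single l P n)
  then show ?case
    by (intro free_ext_mapsto[OF subspace_fsupp _ lin_rels_supp[OF Hom_module]])
      (use assms in \<open>auto intro: words_single\<close>)
next
  case (head V l P p u m n)
  then show ?case
    by (intro free_ext_mapsto[OF subspace_fsupp _ lin_rels_supp[OF Hom_module]])
      (use assms B_sub in \<open>auto intro: words_ConsI\<close>)
next
  case (cons V f P p m r n)
  then have "r \<in> FW V Q m" using B_sub by blast
  then show ?case unfolding pre_def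
    by (intro free_ext_mapsto[OF subspace_fsupp]) (use cons in \<open>auto intro: words_ConsI\<close>)
qed

lemma rels_supp: "P \<in> Ob C \<Longrightarrow> Q \<in> Ob C \<Longrightarrow> word_rels C B P Q n \<subseteq> FW P Q n"
  using wrel_supp word_rels_iff by blast

lemma pre_supp:
  assumes "V \<in> B" "f \<in> carrier (Hom C P V p)" "t \<in> FW V Q m" "n = p + m - 1"
  shows "pre (f, p, V) t \<in> FW P Q n"
  unfolding pre_def by (intro free_ext_mapsto[OF subspace_fsupp _ assms(3)])
    (use assms in \<open>auto simp: words_Cons\<close>)

lemma pre_N:
  assumes "P \<in> Ob C" "Q \<in> Ob C" "V \<in> B" "f \<in> carrier (Hom C P V p)" "t \<in> N V Q m" "n = p + m - 1"
  shows "pre (f, p, V) t \<in> N P Q n"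
proof (rule N_map[OF _ assms(2) flinear_pre(1) _ assms(5)])
  fix r assume "wrel Q V m r"
  then show "pre (f, p, V) r \<in> N P Q n" using assms by (intro wrel_N wrel.cons) auto
qed (use assms B_sub in auto)

text \<open>\<open>wrel.head\<close> continues the varied letter by a single word. Exchanging the
  two linear extensions reduces a combination \<open>t\<close> of words to that case.\<close>

lemma head_N:
  assumes "P \<in> Ob C" "Q \<in> Ob C" "V \<in> B" "l \<in> lin_rels (Hom C P V p)" "t \<in> FW V Q m" "n = p + m - 1"
  shows "free_ext (\<lambda>f. pre (f, p, V) t) l \<in> N P Q n"
  unfolding pre_def free_ext_swap[of _ t l]
  by (intro free_ext_mapsto[OF free.subspace_span _ assms(5)] wrel_N wrel.head[of V l P p _ Q m])
    (use assms in auto)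

text \<open>The operations on words alter a letter by a linear map \<phi>: composition with a fixed
  morphism, the differential, or the compression \<open>em\<close>. Such a map carries linearity
  relations to linearity relations, so the altered words satisfy them as well.\<close>

lemma letter_N:
  assumes "P \<in> Ob C" "Q \<in> Ob C" "l \<in> lin_rels A" "\<phi> \<in> linear_maps A (Hom C P V p)"
    and "if u = [] then V = Q \<and> n = p else V \<in> B \<and> u \<in> Wd V Q m \<and> n = p + m - 1"
  shows "free_ext (\<lambda>f. basis ((\<phi> f, p, V) # u)) l \<in> N P Q n"
proof -
  let ?l = "free_ext (\<lambda>x. basis (\<phi> x)) l"
  have l: "?l \<in> lin_rels (Hom C P V p)" by (rule lin_rels_map[OF assms(4,3)])
  have "free_ext (\<lambda>f. basis ((\<phi> f, p, V) # u)) l = free_ext (\<lambda>f. basis ((f, p, V) # u)) ?l"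
    by (simp add: free_ext_free_ext)
  also have "\<dots> \<in> N P Q n"
    by (rule wrel_N[OF assms(1,2)], cases "u = []")
      (use assms l in \<open>auto intro: wrel.single wrel.head split: if_splits\<close>)
  finally show ?thesis .
qed

text \<open>The relation for the scalar 0 and the zero morphism consists of the word itself, since 0
  times a word vanishes. This is how equations such as d d f = 0 in \<open>C\<close> reach words
  with further letters.\<close>

lemma letter_zero:
  assumes "P \<in> Ob C" "Q \<in> Ob C" "V \<in> Ob C"
    and "if u = [] then V = Q \<and> n = p else V \<in> B \<and> u \<in> Wd V Q m \<and> n = p + m - 1"
  shows "basis ((\<zero>\<^bsub>Hom C P V p\<^esub>, p, V) # u) \<in> N P Q n"
proof -
  interpret Module.module ground "Hom C P V p" by (rule Hom_module) fact+
  have "basis (0 \<odot>\<^bsub>Hom C P V p\<^esub> \<zero>\<^bsub>Hom C P V p\<^esub>) - free_scale 0 (basis \<zero>\<^bsub>Hom C P V p\<^esub>)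
    \<in> lin_rels (Hom C P V p)"
    unfolding lin_rels_def by blast
  from letter_N[OF assms(1,2) this _ assms(4), of "\<lambda>x. x"] show ?thesis
    by (simp add: linear_maps_def)
qed

section \<open>Composition and differential on combinations of words\<close>

lemma Comp_closed:
  assumes "P \<in> Ob C" "Q \<in> Ob C" "R \<in> Ob C" "g \<in> carrier (Hom C Q R p)" "f \<in> carrier (Hom C P Q q)"
  shows "Comp C P Q R p q g f \<in> carrier (Hom C P R (p + q))"
  using linear_mapsD(1)[OF Comp_linear_left[OF assms(1-3,5)] assms(4)] .

lemma Diff_closed:
  assumes "P \<in> Ob C" "Q \<in> Ob C" "f \<in> carrier (Hom C P Q n)"
  shows "Diff C P Q n f \<in> carrier (Hom C P Q (n + 1))"
  using linear_mapsD(1)[OF Diff_linear[OF assms(1,2)] assms(3)] .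

lemma word_comp_single_word:
  assumes "w \<in> Wd V R m" "f \<in> carrier (Hom C P V p)" "P \<in> Ob C" "V \<in> Ob C" "R \<in> Ob C"
  shows "word_comp C P w [(f, p, V)] \<in> Wd P R (m + p)"
  using assms(1,4,2)
proof (induction rule: word_induct)
  case (single V g q)
  then show ?case using assms by (auto intro!: words_single Comp_closed)
next
  case (cons V g q U u m)
  then show ?case using assms by (auto intro!: words_ConsI Comp_closed)
qed

lemma word_comp_word:
  assumes "v \<in> Wd P Q n" "w \<in> Wd Q R m" "P \<in> Ob C" "Q \<in> Ob C" "R \<in> Ob C"
  shows "word_comp C P w v \<in> Wd P R (m + n)"
  using assms(1,3)
proof (induction rule: word_induct)
  case (single P f p)
  then show ?case using assms by (auto intro: word_comp_single_word)
next
  case (cons P f p V u n)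
  then show ?case by (auto intro!: words_ConsI)
qed

lemma cmp_supp:
  assumes "P \<in> Ob C" "Q \<in> Ob C" "R \<in> Ob C" "g \<in> FW Q R m" "f \<in> FW P Q n"
  shows "cmp P g f \<in> FW P R (m + n)"
  unfolding cmp_def
  by (intro free_ext_mapsto[OF subspace_fsupp _ assms(4)] free_ext_mapsto[OF subspace_fsupp _ assms(5)])
    (use assms in \<open>auto intro: word_comp_word\<close>)

lemma word_diff_supp:
  assumes "w \<in> Wd P Q n" "P \<in> Ob C" "Q \<in> Ob C"
  shows "word_diff C P w \<in> FW P Q (n + 1)"
  using assms(1,2)
proof (induction rule: word_induct)
  case (single P f p)
  then show ?case using assms by (auto intro: words_single Diff_closed)
next
  case (cons P f p V u m)
  have "pre (f, p, V) (word_diff C V u) \<in> FW P Q (p + m - 1 + 1)"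
    using cons by (intro pre_supp) auto
  moreover have "word_comp C P u [(f, p, V)] \<in> Wd P Q (m + p)"
    using cons assms by (intro word_comp_single_word) auto
  moreover have "(Diff C P V p f, p + 1, V) # u \<in> Wd P Q (p + m)"
    using cons by (intro words_ConsI) (auto intro: Diff_closed)
  ultimately show ?case using cons
    by (auto simp: word_diff_Cons add.commute intro!: fsupp_closed)
qed

lemma D_supp: "P \<in> Ob C \<Longrightarrow> Q \<in> Ob C \<Longrightarrow> t \<in> FW P Q n \<Longrightarrow> D P t \<in> FW P Q (n + 1)"
  unfolding D_def by (rule free_ext_mapsto[OF subspace_fsupp word_diff_supp]) auto

text \<open>Composing on the left meets only the last letter of the right factor, so a first letter
  stays in place. The support condition excludes the empty word: prepending to it produces a last
  letter, and the identity fails.\<close>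

lemma cmp_pre_right:
  assumes "b \<in> FW V Q n"
  shows "cmp P a (pre (f, p, V) b) = pre (f, p, V) (cmp V a b)"
proof -
  have "cmp P (basis w) (pre (f, p, V) b) = pre (f, p, V) (cmp V (basis w) b)" for w
    by (rule flin_eq[OF _ _ _ assms, where f = "\<lambda>b. cmp P (basis w) (pre (f, p, V) b)"])
      (auto intro!: flin dest: wordsD)
  then show ?thesis
    by (intro flin_eq[where A = UNIV and p = a and f = "\<lambda>a. cmp P a (pre (f, p, V) b)"
          and g = "\<lambda>a. pre (f, p, V) (cmp V a b)"])
      (auto intro!: flin simp: fsupp_def)
qed

lemma cmp_pre_left:
  "cmp P (pre (g, q, W) a) (basis [(f, p, V)]) = pre (Comp C P V W q p g f, q + p, W) a"
  by (rule flin_eq[where A = UNIV and p = a and f = "\<lambda>a. cmp P (pre (g, q, W) a) (basis [(f, p, V)])"])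
    (auto intro!: flin simp: fsupp_def)

lemma D_pre:
  assumes "t \<in> FW V Q m"
  shows "D P (pre (f, p, V) t) = pre (f, p, V) (D V t)
    + free_scale ((-1) powi m) (cmp P t (basis [(f, p, V)]))
    - free_scale ((-1) powi m) (pre (Diff C P V p f, p + 1, V) t)"
  by (rule flin_eq[OF _ _ _ assms, where f = "\<lambda>t. D P (pre (f, p, V) t)"])
    (auto intro!: flin simp: word_diff_Cons dest: wordsD)

end

context dg_pair begin

lemma id_linear: "(\<lambda>x. x) \<in> linear_maps A A"
  by (auto intro: linear_mapsI)

lemma lin_rels_addI:
  "x \<in> carrier A \<Longrightarrow> y \<in> carrier A \<Longrightarrow> basis (x \<oplus>\<^bsub>A\<^esub> y) - basis x - basis y \<in> lin_rels A"
  unfolding lin_rels_def by blast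

lemma lin_rels_smultI: "x \<in> carrier A \<Longrightarrow> basis (c \<odot>\<^bsub>A\<^esub> x) - free_scale c (basis x) \<in> lin_rels A"
  unfolding lin_rels_def by blast

lemma Comp_closed_deg:
  assumes "P \<in> Ob C" "Q \<in> Ob C" "R \<in> Ob C" "g \<in> carrier (Hom C Q R p)" "f \<in> carrier (Hom C P Q q)"
    and "n = p + q"
  shows "Comp C P Q R p q g f \<in> carrier (Hom C P R n)"
  using Comp_closed[OF assms(1-5)] assms(6) by simp

section \<open>Relations are preserved by composition and differential\<close>

lemma D_free_ext: "D P (free_ext F l) = free_ext (\<lambda>x. D P (F x)) l"
  by (simp add: D_def free_ext_free_ext)

lemma cmp_free_ext_left: "cmp P (free_ext F l) b = free_ext (\<lambda>x. cmp P (F x) b) l"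
  by (simp add: cmp_def free_ext_free_ext)

lemma cmp_free_ext_right: "cmp P a (free_ext F l) = free_ext (\<lambda>x. cmp P a (F x)) l"
  by (simp add: cmp_def free_ext_free_ext) (rule free_ext_swap)

text \<open>Only the first letter of \<open>r\<close> changes, by composition with \<open>f\<close>,
  and this is linear in that letter.\<close>

lemma wrel_comp_letter:
  assumes "wrel R Q m r" "Q \<in> Ob C" "P \<in> Ob C" "R \<in> Ob C" "f \<in> carrier (Hom C P Q p)"
  shows "cmp P r (basis [(f, p, Q)]) \<in> N P R (m + p)"
  using assms(1,2,5)
proof (induction rule: wrel.induct)
  case (single l Q m)
  show ?case using single assms
    by (auto simp: cmp_free_ext_left intro!: letter_N[OF _ _ single(1) Comp_linear_left])
next
  case (head V l Q q u m n)
  have V: "V \<in> Ob C" using head B_sub by auto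
  have "u \<noteq> []" using head by auto
  then show ?case using head assms V
    by (auto simp: cmp_free_ext_left intro!: letter_N[OF _ _ head(2) Comp_linear_left, where m = m])
next
  case (cons V g Q q m r n)
  have V: "V \<in> Ob C" using cons B_sub by auto
  show ?case unfolding cmp_pre_left
    by (rule pre_N[where m = m]) (use cons assms V in \<open>auto intro: wrel_N Comp_closed\<close>)
qed

lemma wrel_comp_left:
  assumes "v \<in> Wd P Q n" "P \<in> Ob C" "Q \<in> Ob C" "R \<in> Ob C" "wrel R Q m r"
  shows "cmp P r (basis v) \<in> N P R (m + n)"
  using assms(1,2)
proof (induction rule: word_induct)
  case (single P f p)
  then show ?case using assms by (auto intro: wrel_comp_letter)
next
  case (cons P f p V u n)
  have "cmp P r (basis ((f, p, V) # u)) = pre (f, p, V) (cmp V r (basis u))"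
    using cmp_pre_right[of "basis u" V Q n P r f p] cons by simp
  also have "\<dots> \<in> N P R (m + (p + n - 1))"
    by (rule pre_N[where m = "m + n"]) (use cons assms in auto)
  finally show ?case .
qed

lemma cmp_N_left:
  assumes "P \<in> Ob C" "Q \<in> Ob C" "R \<in> Ob C" "r \<in> N Q R m" "b \<in> FW P Q n"
  shows "cmp P r b \<in> N P R (m + n)"
proof (rule fsupp_mapsto[OF flinear_cmp(1) free.subspace_span _ assms(5)])
  fix v assume v: "v \<in> Wd P Q n"
  show "cmp P r (basis v) \<in> N P R (m + n)"
    by (rule N_map[OF assms(2,3) flinear_cmp(2) wrel_comp_left assms(4)]) (use assms v in auto)
qed

text \<open>A varied letter that is the last one is merged with the first letter of
  \<open>w\<close>, linearly; one with letters after it is left untouched.\<close>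

lemma wrel_comp_right:
  assumes "wrel Q P n r" "P \<in> Ob C" "Q \<in> Ob C" "R \<in> Ob C" "w \<in> Wd Q R m"
  shows "cmp P (basis w) r \<in> N P R (m + n)"
  using assms(1,2)
proof (induction rule: wrel.induct)
  case (single l P n)
  obtain g q W w' where w: "w = (g, q, W) # w'" using assms(5) by (cases w) auto
  have W: "W \<in> Ob C" using assms B_sub by (auto simp: w words_Cons split: if_splits)
  have g: "g \<in> carrier (Hom C Q W q)" using assms by (auto simp: w words_Cons split: if_splits)
  show ?case unfolding cmp_free_ext_right
    using letter_N[OF _ _ single(1) Comp_linear_right[OF _ _ _ g], where Q = R and u = w' and n = "m + n" and m = "m + 1 - q"]
      assms single W
    by (auto simp: w words_Cons split: if_splits)
next
  case (head V l P p u n' n)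
  have "u \<noteq> []" using head by auto
  have V: "V \<in> Ob C" using head B_sub by auto
  have "word_comp C V w u \<in> Wd V R (m + n')" by (rule word_comp_word[where Q = Q]) (use head assms V in auto)
  then have "free_ext (\<lambda>f. basis ((f, p, V) # word_comp C V w u)) l \<in> N P R (m + n)"
    by (intro letter_N[OF _ _ head(2) id_linear, where m = "m + n'"]) (use head assms in auto)
  then show ?case using \<open>u \<noteq> []\<close> by (simp add: cmp_free_ext_right)
next
  case (cons V f P p n' r n)
  have V: "V \<in> Ob C" using cons B_sub by auto
  have "r \<in> FW V Q n'" using wrel_supp cons assms V by auto
  then have "cmp P (basis w) (pre (f, p, V) r) = pre (f, p, V) (cmp V (basis w) r)"
    by (rule cmp_pre_right)
  also have "\<dots> \<in> N P R (m + n)"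
    by (rule pre_N[where m = "m + n'"]) (use cons assms V in auto)
  finally show ?case .
qed

lemma cmp_N_right:
  assumes "P \<in> Ob C" "Q \<in> Ob C" "R \<in> Ob C" "a \<in> FW Q R m" "r \<in> N P Q n"
  shows "cmp P a r \<in> N P R (m + n)"
proof (rule fsupp_mapsto[OF flinear_cmp(2) free.subspace_span _ assms(4)])
  fix w assume w: "w \<in> Wd Q R m"
  show "cmp P (basis w) r \<in> N P R (m + n)"
    by (rule N_map[OF assms(1,2) flinear_cmp(1) wrel_comp_right assms(5)]) (use assms w in auto)
qed

text \<open>Each of the three Leibniz terms is linear in the varied letter. If that letter comes
  first, it stays in front of d(u), is merged into \<open>u\<close>, or is differentiated; behind a
  fixed letter \<open>f\<close>, the relation itself is differentiated, composed with
  \<open>f\<close>, or put behind d(f).\<close>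

lemma wrel_D:
  assumes "wrel Q P n r" "P \<in> Ob C" "Q \<in> Ob C"
  shows "D P r \<in> N P Q (n + 1)"
  using assms(1,2)
proof (induction rule: wrel.induct)
  case (single l P n)
  show ?case unfolding D_free_ext
    using letter_N[OF _ _ single(1) Diff_linear, where Q = Q and u = "[]" and n = "n + 1"] assms single by simp
next
  case (head V l P p u m n)
  have u: "u \<noteq> []" and deg: "word_degree u = m" using wordsD[OF head(3)] by auto
  have V: "V \<in> Ob C" using head B_sub by auto
  have 1: "free_ext (\<lambda>f. pre (f, p, V) (word_diff C V u)) l \<in> N P Q (n + 1)"
    by (rule head_N[where m = "m + 1"]) (use head assms V in \<open>auto intro: word_diff_supp\<close>)
  have 2: "free_ext (\<lambda>f. basis (word_comp C P u [(f, p, V)])) l \<in> N P Q (n + 1)"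
    using wrel_comp_right[OF wrel.single[OF head(2)], of Q u m] head assms V
    by (auto simp: cmp_free_ext_right algebra_simps)
  have 3: "free_ext (\<lambda>f. basis ((Diff C P V p f, p + 1, V) # u)) l \<in> N P Q (n + 1)"
    by (rule letter_N[OF _ _ head(2) Diff_linear, where m = m]) (use head assms V u in auto)
  have "D P (free_ext (\<lambda>f. basis ((f, p, V) # u)) l) =
      free_ext (\<lambda>f. pre (f, p, V) (word_diff C V u)) l
      + free_scale ((-1) powi m) (free_ext (\<lambda>f. basis (word_comp C P u [(f, p, V)])) l)
      - free_scale ((-1) powi m) (free_ext (\<lambda>f. basis ((Diff C P V p f, p + 1, V) # u)) l)"
    by (simp add: D_free_ext word_diff_Cons u deg free_ext_add free_ext_diff free_ext_scale)
  also have "\<dots> \<in> N P Q (n + 1)"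
    by (intro free.span_add free.span_diff free.span_scale 1 2 3)
  finally show ?case .
next
  case (cons V f P p m r n)
  have V: "V \<in> Ob C" using cons B_sub by auto
  have r: "r \<in> FW V Q m" using wrel_supp cons assms V by auto
  have 1: "pre (f, p, V) (D V r) \<in> N P Q (n + 1)"
    by (rule pre_N[where m = "m + 1"]) (use cons assms V in auto)
  have 2: "cmp P r (basis [(f, p, V)]) \<in> N P Q (n + 1)"
    using wrel_comp_letter[OF cons(3) V, of P f p] cons assms by (simp add: algebra_simps)
  have 3: "pre (Diff C P V p f, p + 1, V) r \<in> N P Q (n + 1)"
    by (rule pre_N[where m = m]) (use cons assms V in \<open>auto intro: Diff_closed wrel_N\<close>)
  show ?case unfolding D_pre[OF r]
    by (intro free.span_add free.span_diff free.span_scale 1 2 3)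
qed

text \<open>Letters other than the last ones of \<open>f\<close> and \<open>g\<close> are passed
  over unchanged. After two inductions both are single letters, and what remains is associativity in
  \<open>C\<close> of them with the first letter of \<open>h\<close>.\<close>

lemma word_comp_assoc:
  assumes "f \<in> Wd W P r" "g \<in> Wd P Q q" "h \<in> Wd Q R p"
    "W \<in> Ob C" "P \<in> Ob C" "Q \<in> Ob C" "R \<in> Ob C"
  shows "word_comp C W (word_comp C P h g) f = word_comp C W h (word_comp C W g f)"
  using assms(1,4)
proof (induction rule: word_induct)
  case (single W x a)
  note x = single
  have hne: "h \<noteq> []" using assms by auto
  obtain z c Z h' where h: "h = (z, c, Z) # h'" using hne by (cases h) auto
  have Z: "Z \<in> Ob C" "z \<in> carrier (Hom C Q Z c)"
    using assms B_sub by (auto simp: h words_Cons split: if_splits)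
  from assms(2,5) show ?case using x
  proof (induction rule: word_induct)
    case (single P y b)
    then show ?case using Z assms Comp_assoc[of W P Q Z z c y b x a]
      by (simp add: h add.assoc)
  next
    case (cons P y b V u m)
    then show ?case using hne by simp
  qed
next
  case (cons W x a V u m)
  moreover have "g \<noteq> []" using assms by auto
  ultimately show ?case by simp
qed

lemma cmp_assoc:
  assumes "W \<in> Ob C" "P \<in> Ob C" "Q \<in> Ob C" "R \<in> Ob C"
    and "h \<in> FW Q R p" "g \<in> FW P Q q" "f \<in> FW W P r"
  shows "cmp W (cmp P h g) f = cmp W h (cmp W g f)"
proof (rule flin_eq[OF _ _ _ assms(5), where f = "\<lambda>h. cmp W (cmp P h g) f"])
  fix w assume w: "w \<in> Wd Q R p"
  show "cmp W (cmp P (basis w) g) f = cmp W (basis w) (cmp W g f)"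
  proof (rule flin_eq[OF _ _ _ assms(6), where f = "\<lambda>g. cmp W (cmp P (basis w) g) f"])
    fix v assume v: "v \<in> Wd P Q q"
    show "cmp W (cmp P (basis w) (basis v)) f = cmp W (basis w) (cmp W (basis v) f)"
      by (rule flin_eq[OF _ _ _ assms(7), where f = "cmp W (cmp P (basis w) (basis v))"])
        (use w v assms in \<open>auto intro!: flin simp: word_comp_assoc\<close>)
  qed (auto intro!: flin)
qed (auto intro!: flin)

text \<open>This holds only modulo relations: where two letters merge, d(g f) is one letter, equal
  to a sum of two morphisms in \<open>C\<close>, while the other side is a sum of two words. Two
  linearity relations bridge the gap, one for the sum and one for the sign as a scalar.\<close>

lemma word_Leibniz:
  assumes "v \<in> Wd P Q n" "w \<in> Wd Q R m" "P \<in> Ob C" "Q \<in> Ob C" "R \<in> Ob C"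
  shows "word_diff C P (word_comp C P w v) - cmp P (word_diff C Q w) (basis v)
    - free_scale ((-1) powi m) (cmp P (basis w) (word_diff C P v)) \<in> N P R (m + n + 1)"
  using assms(1,3)
proof (induction rule: word_induct)
  case (single P f p)
  let ?x = "(f, p, Q)"
  from assms(2,4) single show ?case
  proof (induction rule: word_induct)
    case (single Q g q)
    let ?H = "Hom C P R (q + p + 1)"
    let ?a = "Comp C P Q R (q + 1) p (Diff C Q R q g) f"
    let ?b = "Comp C P Q R q (p + 1) g (Diff C P Q p f)"
    let ?B = "\<lambda>x. basis [(x, q + p + 1, R)] :: ('o, 'm) word \<Rightarrow>\<^sub>0 'k"
    interpret H: Module.module ground ?H using Hom_module single assms by auto
    have a: "?a \<in> carrier ?H" by (rule Comp_closed_deg) (use single assms Diff_closed in auto)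
    have b: "?b \<in> carrier ?H" by (rule Comp_closed_deg) (use single assms Diff_closed in auto)
    let ?s = "(-1 :: 'k) powi q"
    have L: "Diff C P R (q + p) (Comp C P Q R q p g f) = ?a \<oplus>\<^bsub>?H\<^esub> ?s \<odot>\<^bsub>?H\<^esub> ?b"
      by (rule Leibniz) (use single assms in auto)
    have "basis (?a \<oplus>\<^bsub>?H\<^esub> ?s \<odot>\<^bsub>?H\<^esub> ?b) - basis ?a - basis (?s \<odot>\<^bsub>?H\<^esub> ?b) \<in> lin_rels ?H"
      by (intro lin_rels_addI) (use a b in auto)
    from letter_N[OF _ _ this id_linear, where Q = R and u = "[]" and n = "q + p + 1"]
    have 1: "?B (?a \<oplus>\<^bsub>?H\<^esub> ?s \<odot>\<^bsub>?H\<^esub> ?b) - ?B ?a - ?B (?s \<odot>\<^bsub>?H\<^esub> ?b) \<in> N P R (q + p + 1)"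
      using single assms by simp
    have "basis (?s \<odot>\<^bsub>?H\<^esub> ?b) - free_scale ?s (basis ?b) \<in> lin_rels ?H"
      by (intro lin_rels_smultI b)
    from letter_N[OF _ _ this id_linear, where Q = R and u = "[]" and n = "q + p + 1"]
    have 2: "?B (?s \<odot>\<^bsub>?H\<^esub> ?b) - free_scale ?s (?B ?b) \<in> N P R (q + p + 1)"
      using single assms by simp
    show ?case using free.span_add[OF 1 2]
      by (simp add: L[unfolded add.commute[of q p]] algebra_simps)
  next
    case (cons Q g q W u m)
    let ?H = "Hom C P W (q + p + 1)"
    let ?a = "Comp C P Q W (q + 1) p (Diff C Q W q g) f"
    let ?b = "Comp C P Q W q (p + 1) g (Diff C P Q p f)"
    let ?B = "\<lambda>x. basis ((x, q + p + 1, W) # u) :: ('o, 'm) word \<Rightarrow>\<^sub>0 'k"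
    interpret H: Module.module ground ?H using Hom_module cons assms by auto
    have a: "?a \<in> carrier ?H" by (rule Comp_closed_deg) (use cons assms Diff_closed in auto)
    have b: "?b \<in> carrier ?H" by (rule Comp_closed_deg) (use cons assms Diff_closed in auto)
    let ?s = "(-1 :: 'k) powi q"
    let ?t = "(-1 :: 'k) powi m"
    have L: "Diff C P W (q + p) (Comp C P Q W q p g f) = ?a \<oplus>\<^bsub>?H\<^esub> ?s \<odot>\<^bsub>?H\<^esub> ?b"
      by (rule Leibniz) (use cons assms in auto)
    have "basis (?a \<oplus>\<^bsub>?H\<^esub> ?s \<odot>\<^bsub>?H\<^esub> ?b) - basis ?a - basis (?s \<odot>\<^bsub>?H\<^esub> ?b) \<in> lin_rels ?H"
      by (intro lin_rels_addI) (use a b in auto)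
    from letter_N[OF _ _ this id_linear, where Q = R and u = u and m = m and n = "q + m + p"]
    have 1: "?B (?a \<oplus>\<^bsub>?H\<^esub> ?s \<odot>\<^bsub>?H\<^esub> ?b) - ?B ?a - ?B (?s \<odot>\<^bsub>?H\<^esub> ?b) \<in> N P R (q + m + p)"
      using cons assms by simp
    have "basis (?s \<odot>\<^bsub>?H\<^esub> ?b) - free_scale ?s (basis ?b) \<in> lin_rels ?H"
      by (intro lin_rels_smultI b)
    from letter_N[OF _ _ this id_linear, where Q = R and u = u and m = m and n = "q + m + p"]
    have 2: "?B (?s \<odot>\<^bsub>?H\<^esub> ?b) - free_scale ?s (?B ?b) \<in> N P R (q + m + p)"
      using cons assms by simp
    \<comment> \<open>\<open>f\<close> can be merged with \<open>g\<close> before or after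
      \<open>g\<close> is merged into \<open>u\<close>; the two words agree, so these terms can be
      compared.\<close>
    have "word_comp C P (word_comp C Q u [(g, q, W)]) [(f, p, Q)]
        = word_comp C P u [(Comp C P Q W q p g f, q + p, W)]"
      using word_comp_assoc[of "[(f, p, Q)]" P Q p "[(g, q, W)]" W q u R m] cons assms
      by (simp add: words_single)
    then have "word_diff C P (word_comp C P ((g, q, W) # u) [(f, p, Q)])
        - cmp P (word_diff C Q ((g, q, W) # u)) (basis [(f, p, Q)])
        - free_scale ((-1) powi (q + m - 1)) (cmp P (basis ((g, q, W) # u)) (word_diff C P [(f, p, Q)]))
      = - free_scale ?t ((?B (?a \<oplus>\<^bsub>?H\<^esub> ?s \<odot>\<^bsub>?H\<^esub> ?b) - ?B ?a - ?B (?s \<odot>\<^bsub>?H\<^esub> ?b))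
         + (?B (?s \<odot>\<^bsub>?H\<^esub> ?b) - free_scale ?s (?B ?b)))"
      using cons by (simp add: word_diff_Cons cmp_pre_left L[unfolded add.commute[of q p]] algebra_simps
        free.scale_right_diff_distrib free.scale_right_distrib)
    also have "\<dots> \<in> N P R (q + m + p)"
      by (intro free.span_neg free.span_scale free.span_add 1 2)
    finally show ?case by (simp add: algebra_simps)
  qed
next
  case (cons P f p V u n)
  let ?x = "(f, p, V)"
  have w: "w \<noteq> []" "word_degree w = m" using wordsD[OF assms(2)] by auto
  have wu: "word_comp C V w u \<in> Wd V R (m + n)"
    by (rule word_comp_word[where Q = Q]) (use cons assms in auto)
  have asc: "word_comp C P (word_comp C V w u) [?x] = word_comp C P w (word_comp C P u [?x])"
    by (rule word_comp_assoc[where P = V and Q = Q and R = R]) (use cons assms in \<open>auto intro: words_single\<close>)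
  have cu: "cmp P a (pre ?x (basis u)) = pre ?x (cmp V a (basis u))" for a
    by (rule cmp_pre_right) (use cons in simp)
  have cd: "cmp P a (pre ?x (word_diff C V u)) = pre ?x (cmp V a (word_diff C V u))" for a
    by (rule cmp_pre_right, rule word_diff_supp[where Q = Q]) (use cons assms in auto)
  have "word_diff C P (word_comp C P w (?x # u)) - cmp P (word_diff C Q w) (basis (?x # u))
    - free_scale ((-1) powi m) (cmp P (basis w) (word_diff C P (?x # u)))
    = pre ?x (word_diff C V (word_comp C V w u) - cmp V (word_diff C Q w) (basis u)
    - free_scale ((-1) powi m) (cmp V (basis w) (word_diff C V u)))"
    using cons w cu[of "word_diff C Q w"] wordsD[OF wu]
    by (simp add: word_diff_Cons asc cd free.scale_right_diff_distrib free.scale_right_distrib algebra_simps)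
  also have "\<dots> \<in> N P R (m + (p + n - 1) + 1)"
    by (rule pre_N[where m = "m + n + 1"]) (use cons assms in auto)
  finally show ?case .
qed

lemma D_Leibniz:
  assumes "P \<in> Ob C" "Q \<in> Ob C" "R \<in> Ob C" "g \<in> FW Q R m" "f \<in> FW P Q n"
  shows "D P (cmp P g f) - cmp P (D Q g) f - free_scale ((-1) powi m) (cmp P g (D P f)) \<in> N P R (m + n + 1)"
proof (rule fsupp_mapsto[OF _ free.subspace_span _ assms(4),
      where f = "\<lambda>g. D P (cmp P g f) - cmp P (D Q g) f - free_scale ((-1) powi m) (cmp P g (D P f))"])
  fix w assume w: "w \<in> Wd Q R m"
  show "D P (cmp P (basis w) f) - cmp P (D Q (basis w)) f
    - free_scale ((-1) powi m) (cmp P (basis w) (D P f)) \<in> N P R (m + n + 1)"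
    by (rule fsupp_mapsto[OF _ free.subspace_span _ assms(5),
      where f = "\<lambda>f. D P (cmp P (basis w) f) - cmp P (D Q (basis w)) f
        - free_scale ((-1) powi m) (cmp P (basis w) (D P f))"])
      (use w assms in \<open>auto intro!: flin word_Leibniz\<close>)
qed (auto intro!: flin)

text \<open>Apply the Leibniz rule twice to u eps f. The cross terms are, up to sign, the Leibniz
  defect of the composite of \<open>u\<close> with \<open>f\<close>, which lies in the relations by
  \<open>word_Leibniz\<close>. What remains is d d of the tail \<open>u\<close> and d d of the
  letter \<open>f\<close>.\<close>

lemma word_DD:
  assumes "w \<in> Wd P Q n" "P \<in> Ob C" "Q \<in> Ob C"
  shows "D P (word_diff C P w) \<in> N P Q (n + 2)"
  using assms(1,2)
proof (induction rule: word_induct)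
  case (single P f p)
  then show ?case using letter_zero[of P Q Q "[]" "p + 2" "p + 2"] assms
    by (simp add: Diff_Diff add.commute[of p 2])
next
  case (cons P f p V u m)
  let ?x = "(f, p, V)" and ?dx = "(Diff C P V p f, p + 1, V)" and ?s = "(-1 :: 'k) powi m"
  have ds: "word_diff C V u \<in> FW V Q (m + 1)" by (rule word_diff_supp) (use cons assms in auto)
  have 1: "pre ?x (D V (word_diff C V u)) \<in> N P Q (p + m - 1 + 2)"
    by (rule pre_N[where m = "m + 2"]) (use cons assms in auto)
  have 2: "D P (basis (word_comp C P u [?x])) - cmp P (word_diff C V u) (basis [?x])
    - free_scale ?s (cmp P (basis u) (word_diff C P [?x])) \<in> N P Q (p + m - 1 + 2)"
    using word_Leibniz[of "[?x]" P V p u Q m] cons assms words_single[of f C P V p B]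
    by (simp add: algebra_simps)
  have 3: "basis ((Diff C P V (p + 1) (Diff C P V p f), p + 1 + 1, V) # u) \<in> N P Q (p + m - 1 + 2)"
    using letter_zero[of P Q V u "p + m - 1 + 2" "p + 2" m] cons assms
    by (simp add: Diff_Diff add.commute[of p 2])
  have "D P (word_diff C P (?x # u)) = pre ?x (D V (word_diff C V u))
    + free_scale ?s (D P (basis (word_comp C P u [?x])) - cmp P (word_diff C V u) (basis [?x])
    - free_scale ?s (cmp P (basis u) (word_diff C P [?x])))
    + basis ((Diff C P V (p + 1) (Diff C P V p f), p + 1 + 1, V) # u)"
    using cons by (simp add: word_diff_Cons D_pre[OF ds]
      free.scale_right_diff_distrib free.scale_right_distrib algebra_simps)
  also have "\<dots> \<in> N P Q (p + m - 1 + 2)"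
    by (intro free.span_add free.span_scale 1 2 3)
  finally show ?case .
qed

lemma D_D: "P \<in> Ob C \<Longrightarrow> Q \<in> Ob C \<Longrightarrow> f \<in> FW P Q n \<Longrightarrow> D P (D P f) \<in> N P Q (n + 2)"
  by (rule fsupp_mapsto[OF flinear_D(2)[OF flinear_D(1)] free.subspace_span]) (auto intro: word_DD)

lemma word_comp_ident_left:
  assumes "v \<in> Wd P Q n" "P \<in> Ob C" "Q \<in> Ob C"
  shows "word_comp C P [(Ident C Q, 0, Q)] v = v"
  using assms(1,2)
  by (induction rule: word_induct) (use assms in \<open>auto simp: Ident_left\<close>)

lemma word_comp_ident_right:
  assumes "w \<in> Wd P Q n" "P \<in> Ob C" "Q \<in> Ob C"
  shows "word_comp C P w [(Ident C P, 0, P)] = w"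
  using assms(1,2)
  by (induction rule: word_induct) (use assms in \<open>auto simp: Ident_right\<close>)

lemma cmp_ident:
  assumes "P \<in> Ob C" "Q \<in> Ob C" "f \<in> FW P Q n"
  shows "cmp P (basis [(Ident C Q, 0, Q)]) f = f" "cmp P f (basis [(Ident C P, 0, P)]) = f"
  by (rule flin_eq[OF _ _ _ assms(3), where f = "cmp P _"] flin_eq[OF _ _ _ assms(3), where f = "\<lambda>f. cmp P f _"];
      use assms in \<open>auto intro!: flin simp: word_comp_ident_left word_comp_ident_right\<close>)+

section \<open>The quotient category\<close>

abbreviation "Quo \<equiv> dg_quotient C B"

lemma quotient_simps [simp]:
  "Ob Quo = Ob C"
  "Hom Quo P Q n = presented (Wd P Q n) (word_rels C B P Q n)"
  "Ident Quo P = cls P P 0 (basis [(Ident C P, 0, P)])"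
  by (simp_all add: dg_quotient_def)

lemma quotient_Diff [simp]:
  assumes "P \<in> Ob C" "Q \<in> Ob C"
  shows "Diff Quo P Q n (cls P Q n f) = cls P Q (n + 1) (D P f)"
  unfolding dg_quotient_def D_def[symmetric] dgcat.simps
  by (rule UN_free_class[OF flinear_D(1)]) (use assms word_rels_iff wrel_D in blast)

lemma quotient_Comp [simp]:
  assumes "P \<in> Ob C" "Q \<in> Ob C" "R \<in> Ob C" "g \<in> FW Q R p" "f \<in> FW P Q q"
  shows "Comp Quo P Q R p q (cls Q R p g) (cls P Q q f) = cls P R (p + q) (cmp P g f)"
proof -
  have "(\<Union>f'\<in>cls P Q q f. cls P R (p + q) (cmp P g' f')) = cls P R (p + q) (cmp P g' f)"
    if "g' \<in> cls Q R p g" for g'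
  proof (rule UN_free_class[OF flinear_cmp(1)])
    have "g' \<in> FW Q R p"
      by (rule free_class_subset_fsupp[OF rels_supp[OF assms(2,3)] assms(4) that])
    then show "cmp P g' r \<in> N P R (p + q)" if "r \<in> word_rels C B P Q q" for r
      using cmp_N_right[OF assms(1-3)] free.span_base[OF that] by blast
  qed
  moreover have "(\<Union>g'\<in>cls Q R p g. cls P R (p + q) (cmp P g' f)) = cls P R (p + q) (cmp P g f)"
    by (rule UN_free_class[OF flinear_cmp(2)]) (rule cmp_N_left[OF assms(1-3) free.span_base assms(5)])
  ultimately show ?thesis
    unfolding dg_quotient_def cmp_def[symmetric] dgcat.simps by simp
qed

lemma cls_eqI: "f - g \<in> N P Q n \<Longrightarrow> cls P Q n f = cls P Q n g"
  by (simp add: free_class_eq_iff)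

lemma Ident_FW: "P \<in> Ob C \<Longrightarrow> basis [(Ident C P, 0, P)] \<in> FW P P 0"
  by (auto intro: words_single Ident_closed)

lemma dg_category_quotient: "dg_category Quo"
proof (rule dg_category.intro)
  fix P Q n assume "P \<in> Ob Quo" "Q \<in> Ob Quo"
  then have PQ: "P \<in> Ob C" "Q \<in> Ob C" by auto
  show "kmodule (Hom Quo P Q n)" by (simp add: kmodule_presented)
  show "Diff Quo P Q n \<in> linear_maps (Hom Quo P Q n) (Hom Quo P Q (n + 1))"
    by (rule linear_mapsI) (use PQ D_supp in auto)
  fix f assume "f \<in> carrier (Hom Quo P Q n)"
  then obtain f' where f: "f = cls P Q n f'" "f' \<in> FW P Q n" by auto
  show "Diff Quo P Q (n + 1) (Diff Quo P Q n f) = \<zero>\<^bsub>Hom Quo P Q (n + 2)\<^esub>"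
    using D_D[OF PQ f(2)] PQ cls_eqI[of "D P (D P f')" 0 P Q "n + 2"] by (simp add: f(1) add.assoc)
  show "Comp Quo P Q Q 0 n (Ident Quo Q) f = f" "Comp Quo P P Q n 0 f (Ident Quo P) = f"
    using PQ f quotient_Comp[of P Q Q _ 0 f' n] quotient_Comp[of P P Q f' n _ 0] Ident_FW
    by (simp_all add: cmp_ident)
next
  fix P Q R f g p q assume "P \<in> Ob Quo" "Q \<in> Ob Quo" "R \<in> Ob Quo"
  then have PQR: "P \<in> Ob C" "Q \<in> Ob C" "R \<in> Ob C" by auto
  show "(\<lambda>g. Comp Quo P Q R p q g f) \<in> linear_maps (Hom Quo Q R p) (Hom Quo P R (p + q))"
    if "f \<in> carrier (Hom Quo P Q q)"
    by (rule linear_mapsI) (use that PQR cmp_supp in auto)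
  show "Comp Quo P Q R p q g \<in> linear_maps (Hom Quo P Q q) (Hom Quo P R (p + q))"
    if "g \<in> carrier (Hom Quo Q R p)"
    by (rule linear_mapsI) (use that PQR cmp_supp in auto)
  assume "g \<in> carrier (Hom Quo Q R p)" "f \<in> carrier (Hom Quo P Q q)"
  then obtain g' f' where gf: "g = cls Q R p g'" "g' \<in> FW Q R p" "f = cls P Q q f'" "f' \<in> FW P Q q" by auto
  have "cls P R (p + q + 1) (D P (cmp P g' f'))
      = cls P R (p + q + 1) (cmp P (D Q g') f' + free_scale ((-1) powi p) (cmp P g' (D P f')))"
    by (rule cls_eqI) (use D_Leibniz[OF PQR gf(2,4)] in \<open>simp add: algebra_simps\<close>)
  moreover have c1: "Comp Quo P Q R (p + 1) q (cls Q R (p + 1) (D Q g')) (cls P Q q f')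
      = cls P R (p + q + 1) (cmp P (D Q g') f')"
    using quotient_Comp[OF PQR D_supp[OF PQR(2,3) gf(2)] gf(4)] by (simp add: ac_simps)
  moreover have c2: "Comp Quo P Q R p (q + 1) (cls Q R p g') (cls P Q (q + 1) (D P f'))
      = cls P R (p + q + 1) (cmp P g' (D P f'))"
    using quotient_Comp[OF PQR gf(2) D_supp[OF PQR(1,2) gf(4)]] by (simp add: ac_simps)
  ultimately show "Diff Quo P R (p + q) (Comp Quo P Q R p q g f) =
        Comp Quo P Q R (p + 1) q (Diff Quo Q R p g) f \<oplus>\<^bsub>Hom Quo P R (p + q + 1)\<^esub>
        ((-1) powi p) \<odot>\<^bsub>Hom Quo P R (p + q + 1)\<^esub> Comp Quo P Q R p (q + 1) g (Diff Quo P Q q f)"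
    by (simp add: gf(1,3) PQR quotient_Comp[OF PQR gf(2,4)] c1 c2)
next
  fix W P Q R h p g q f r assume "W \<in> Ob Quo" "P \<in> Ob Quo" "Q \<in> Ob Quo" "R \<in> Ob Quo"
  then have Obs: "W \<in> Ob C" "P \<in> Ob C" "Q \<in> Ob C" "R \<in> Ob C" by auto
  assume "h \<in> carrier (Hom Quo Q R p)" "g \<in> carrier (Hom Quo P Q q)" "f \<in> carrier (Hom Quo W P r)"
  then obtain h' g' f' where hgf: "h = cls Q R p h'" "g = cls P Q q g'" "f = cls W P r f'"
    "h' \<in> FW Q R p" "g' \<in> FW P Q q" "f' \<in> FW W P r" by auto
  show "Comp Quo W P R (p + q) r (Comp Quo P Q R p q h g) f =
      Comp Quo W Q R p (q + r) h (Comp Quo W P Q q r g f)"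
    using Obs hgf quotient_Comp[of W P R "cmp P h' g'" "p + q" f' r]
      quotient_Comp[of W Q R h' p "cmp W g' f'" "q + r"]
    by (simp add: cmp_supp cmp_assoc[OF Obs hgf(4-6)] add.assoc)
next
  fix P assume "P \<in> Ob Quo"
  then show "Ident Quo P \<in> carrier (Hom Quo P P 0)" using Ident_FW by auto
qed

end

section \<open>Deforming a DG quotient onto a full subcategory\<close>

lemma free_ext_zero [simp]: "free_ext (\<lambda>_. 0) p = 0"
  by (simp add: free_ext_def)

lemma kmodule_rules:
  assumes "kmodule M" "x \<in> carrier M"
  shows "1 \<odot>\<^bsub>M\<^esub> x = x"
    and "(a * b) \<odot>\<^bsub>M\<^esub> x = a \<odot>\<^bsub>M\<^esub> (b \<odot>\<^bsub>M\<^esub> x)"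
    and "(a + b) \<odot>\<^bsub>M\<^esub> x = a \<odot>\<^bsub>M\<^esub> x \<oplus>\<^bsub>M\<^esub> b \<odot>\<^bsub>M\<^esub> x"
    and "0 \<odot>\<^bsub>M\<^esub> x = \<zero>\<^bsub>M\<^esub>"
    and "a \<odot>\<^bsub>M\<^esub> \<zero>\<^bsub>M\<^esub> = \<zero>\<^bsub>M\<^esub>"
proof -
  interpret Module.module ground M by fact
  show "1 \<odot>\<^bsub>M\<^esub> x = x" "(a * b) \<odot>\<^bsub>M\<^esub> x = a \<odot>\<^bsub>M\<^esub> (b \<odot>\<^bsub>M\<^esub> x)"
    "(a + b) \<odot>\<^bsub>M\<^esub> x = a \<odot>\<^bsub>M\<^esub> x \<oplus>\<^bsub>M\<^esub> b \<odot>\<^bsub>M\<^esub> x"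
    "0 \<odot>\<^bsub>M\<^esub> x = \<zero>\<^bsub>M\<^esub>" "a \<odot>\<^bsub>M\<^esub> \<zero>\<^bsub>M\<^esub> = \<zero>\<^bsub>M\<^esub>"
    using smult_one[OF assms(2)] smult_assoc1[of a b x] smult_l_distr[of a b x] smult_l_null[OF assms(2)]
      smult_r_null[of a] assms(2) by simp_all
qed

lemma linear_maps_zero:
  assumes "kmodule A" "kmodule A'" "g \<in> linear_maps A A'"
  shows "g \<zero>\<^bsub>A\<^esub> = \<zero>\<^bsub>A'\<^esub>"
proof -
  interpret A: Module.module ground A by fact
  interpret A': Module.module ground A' by fact
  have "g (0 \<odot>\<^bsub>A\<^esub> \<zero>\<^bsub>A\<^esub>) = 0 \<odot>\<^bsub>A'\<^esub> g \<zero>\<^bsub>A\<^esub>"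
    by (rule linear_mapsD(3)[OF assms(3)]) simp
  then show ?thesis
    using A.smult_r_null[of 0] A'.smult_l_null[of "g \<zero>\<^bsub>A\<^esub>"] linear_mapsD(1)[OF assms(3), of "\<zero>\<^bsub>A\<^esub>"] by simp
qed

section \<open>Complexes and a criterion for quasi-isomorphisms\<close>

locale kcomplex =
  fixes A :: "int \<Rightarrow> ('k::field, 'm) module" and a :: "int \<Rightarrow> 'm \<Rightarrow> 'm"
  assumes A: "kmodule (A n)"
    and a: "a n \<in> linear_maps (A n) (A (n + 1))"
    and aa: "x \<in> carrier (A n) \<Longrightarrow> a (n + 1) (a n x) = \<zero>\<^bsub>A (n + 2)\<^esub>"
begin

lemma cocycles_subgroup: "subgroup (cocycles A a n) (add_monoid (A n))"
  and coboundaries_subgroup: "subgroup (coboundaries A a n) (add_monoid (A n))"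
  and coboundaries_subset: "coboundaries A a n \<subseteq> cocycles A a n"
proof -
  interpret A: Module.module ground "A n" by (rule A)
  interpret A': Module.module ground "A (n + 1)" by (rule A)
  interpret A'': Module.module ground "A (n - 1)" by (rule A)
  note l = linear_mapsD[OF a]
  note u = kmodule_uminus[OF A]
  have u': "inv\<^bsub>add_monoid (A n)\<^esub> x = (- 1) \<odot>\<^bsub>A n\<^esub> x" if "x \<in> carrier (A n)" for x
    using u[OF that] by (simp add: a_inv_def)
  show "subgroup (cocycles A a n) (add_monoid (A n))"
    by (rule A.add.subgroupI) (use linear_maps_zero[OF A A a] l in \<open>auto simp: cocycles_def u' u\<close>)
  show "subgroup (coboundaries A a n) (add_monoid (A n))"
  proof (rule A.add.subgroupI)
    have cl: "a (n - 1) x \<in> carrier (A n)" if "x \<in> carrier (A (n - 1))" for x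
      using l(1)[of x "n - 1"] that by simp
    then show "coboundaries A a n \<subseteq> carrier (A n)" by (auto simp: coboundaries_def)
    show "coboundaries A a n \<noteq> {}" using A''.M.zero_closed by (auto simp: coboundaries_def)
    fix x assume "x \<in> coboundaries A a n"
    then obtain x' where x: "x = a (n - 1) x'" "x' \<in> carrier (A (n - 1))"
      by (auto simp: coboundaries_def)
    have "(-1) \<odot>\<^bsub>A n\<^esub> x = a (n - 1) ((-1) \<odot>\<^bsub>A (n - 1)\<^esub> x')"
      using l(3)[of x' "n - 1" "-1"] x by simp
    then show "\<ominus>\<^bsub>A n\<^esub> x \<in> coboundaries A a n"
      using x cl by (auto simp: u coboundaries_def)
    fix y assume "y \<in> coboundaries A a n"
    then obtain y' where y: "y = a (n - 1) y'" "y' \<in> carrier (A (n - 1))"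
      by (auto simp: coboundaries_def)
    have "x \<oplus>\<^bsub>A n\<^esub> y = a (n - 1) (x' \<oplus>\<^bsub>A (n - 1)\<^esub> y')"
      using l(2)[of x' "n - 1" y'] x y by simp
    then show "x \<oplus>\<^bsub>A n\<^esub> y \<in> coboundaries A a n"
      using x y by (auto simp: coboundaries_def)
  qed
  show "coboundaries A a n \<subseteq> cocycles A a n"
    using l(1)[of _ "n - 1"] aa[of _ "n - 1"] by (auto simp: coboundaries_def cocycles_def add.commute)
qed

lemma coboundaries_normal:
  "coboundaries A a n \<lhd> \<lparr>carrier = cocycles A a n, monoid.mult = add (A n), one = ring.zero (A n)\<rparr>"
proof -
  interpret A: Module.module ground "A n" by (rule A)
  let ?Z = "\<lparr>carrier = cocycles A a n, monoid.mult = add (A n), one = ring.zero (A n)\<rparr>"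
  note Zc = subgroup.subset[OF cocycles_subgroup] subgroup.m_closed[OF cocycles_subgroup]
    subgroup.one_closed[OF cocycles_subgroup] subgroup.m_inv_closed[OF cocycles_subgroup]
  note Bc = subgroup.subset[OF coboundaries_subgroup] subgroup.m_closed[OF coboundaries_subgroup]
    subgroup.one_closed[OF coboundaries_subgroup] subgroup.m_inv_closed[OF coboundaries_subgroup]
  have sub: "x \<in> cocycles A a n \<Longrightarrow> x \<in> carrier (A n)" for x by (simp add: cocycles_def)
  interpret Z: comm_group ?Z
  proof (rule comm_groupI, simp_all)
    fix x assume x: "x \<in> cocycles A a n"
    then show "\<exists>y\<in>cocycles A a n. y \<oplus>\<^bsub>A n\<^esub> x = \<zero>\<^bsub>A n\<^esub>"
      using Zc(4)[OF x] by (intro bexI[of _ "\<ominus>\<^bsub>A n\<^esub> x"]) (auto simp: a_inv_def A.M.l_neg[unfolded a_inv_def] sub)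
  qed (use Zc in \<open>auto simp: sub A.M.a_assoc intro: A.M.a_comm\<close>)
  have inv: "inv\<^bsub>?Z\<^esub> x = inv\<^bsub>add_monoid (A n)\<^esub> x" if "x \<in> cocycles A a n" for x
    by (rule Z.inv_equality) (use that Zc(4)[OF that] in \<open>auto simp: sub A.M.l_neg[unfolded a_inv_def]\<close>)
  have ne: "coboundaries A a n \<noteq> {}" using Bc(3)[of n] by blast
  have "subgroup (coboundaries A a n) ?Z"
    by (rule Z.subgroupI)
      (use Bc ne coboundaries_subset inv in \<open>auto simp: subset_iff\<close>)
  then show ?thesis by (rule Z.subgroup_imp_normal)
qed

end

text \<open>The first isomorphism theorem for the homomorphism sending a cocycle of \<open>C\<close>
  to the class of its image: \<open>surj\<close> makes it onto the cohomology of \<open>D\<close>,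
  and \<open>inj\<close> identifies its kernel with the coboundaries of \<open>C\<close>. The
  induced map is then matched with \<open>cohomology_map\<close>, which is a union over a
  coset.\<close>

lemma quasi_isoI:
  fixes C :: "int \<Rightarrow> ('k::field, 'm) module" and D :: "int \<Rightarrow> ('k, 'n) module"
  assumes C: "kcomplex C d" and D: "kcomplex D e"
    and f: "\<And>n. f n \<in> linear_maps (C n) (D n)"
    and fd: "\<And>n x. x \<in> carrier (C n) \<Longrightarrow> f (n + 1) (d n x) = e n (f n x)"
    and inj: "\<And>n z. z \<in> cocycles C d n \<Longrightarrow> f n z \<in> coboundaries D e n \<Longrightarrow> z \<in> coboundaries C d n"
    and surj: "\<And>n z. z \<in> cocycles D e n \<Longrightarrow> \<exists>y\<in>cocycles C d n. z \<ominus>\<^bsub>D n\<^esub> f n y \<in> coboundaries D e n"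
  shows "quasi_iso C d D e f"
  unfolding quasi_iso_def
proof
  fix n
  let ?Z = "\<lambda>A a. \<lparr>carrier = cocycles A a n, monoid.mult = add (A n), one = ring.zero (A n)\<rparr>"
  interpret C: kcomplex C d by fact
  interpret D: kcomplex D e by fact
  let ?ZC = "?Z C d" and ?ZD = "?Z D e" and ?BC = "coboundaries C d n" and ?BD = "coboundaries D e n"
  interpret NC: normal ?BC ?ZC by (rule C.coboundaries_normal)
  interpret ND: normal ?BD ?ZD by (rule D.coboundaries_normal)
  interpret DM: Module.module ground "D n" by (rule D.A)
  let ?\<phi> = "\<lambda>z. ?BD #>\<^bsub>?ZD\<^esub> f n z"
  have fz: "f n \<in> hom ?ZC ?ZD"
    using linear_mapsD(1,2)[OF f] fd[symmetric] linear_maps_zero[OF C.A D.A f]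
    by (auto simp: hom_def cocycles_def)
  have \<phi>: "?\<phi> \<in> hom ?ZC (?ZD Mod ?BD)"
    using hom_compose[OF fz ND.r_coset_hom_Mod] by (simp add: comp_def)
  interpret \<phi>: group_hom ?ZC "?ZD Mod ?BD" ?\<phi>
    by (intro group_hom.intro group_hom_axioms.intro ND.factorgroup_is_group \<phi>) (rule NC.is_group)
  have coset: "?BD #>\<^bsub>?ZD\<^esub> z = ?BD +>\<^bsub>D n\<^esub> z" for z
    by (simp add: a_r_coset_def r_coset_def)
  have one: "?BD #>\<^bsub>?ZD\<^esub> z = ?BD \<longleftrightarrow> z \<in> ?BD" if "z \<in> cocycles D e n" for z
    using ND.subgroup_axioms ND.is_group that
    by (metis (no_types, lifting) ND.coset_join1 ND.coset_join2 ND.is_subgroup ND.subset partial_object.select_convs(1))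
  have fc: "f n z \<in> cocycles D e n" if "z \<in> cocycles C d n" for z
    using hom_in_carrier[OF fz] that by simp
  have ker: "kernel ?ZC (?ZD Mod ?BD) ?\<phi> = ?BC"
  proof -
    have "f n z \<in> ?BD" if z: "z \<in> ?BC" for z
    proof -
      obtain y where y: "z = d (n - 1) y" "y \<in> carrier (C (n - 1))"
        using z by (auto simp: coboundaries_def)
      then have "f n z = e (n - 1) (f (n - 1) y)" using fd[of y "n - 1"] by simp
      then show ?thesis using linear_mapsD(1)[OF f y(2)] by (auto simp: coboundaries_def)
    qed
    then have "z \<in> ?BC \<longleftrightarrow> z \<in> cocycles C d n \<and> ?\<phi> z = ?BD" for z
      using inj one[OF fc] C.coboundaries_subset by blast
    then show ?thesis
      by (auto simp: kernel_def FactGroup_def)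
  qed
  have onto: "?\<phi> ` carrier ?ZC = carrier (?ZD Mod ?BD)"
  proof
    show "?\<phi> ` carrier ?ZC \<subseteq> carrier (?ZD Mod ?BD)"
      using hom_in_carrier[OF \<phi>] by blast
    show "carrier (?ZD Mod ?BD) \<subseteq> ?\<phi> ` carrier ?ZC"
    proof
      fix Xc assume "Xc \<in> carrier (?ZD Mod ?BD)"
      then obtain z where z: "Xc = ?BD #>\<^bsub>?ZD\<^esub> z" "z \<in> cocycles D e n"
        by (auto simp: FactGroup_def RCOSETS_def)
      obtain y where y: "y \<in> cocycles C d n" "z \<ominus>\<^bsub>D n\<^esub> f n y \<in> ?BD" using surj z by blast
      have c: "z \<in> carrier (D n)" "f n y \<in> carrier (D n)" using z fc[OF y(1)] by (auto simp: cocycles_def)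
      have "z = (z \<ominus>\<^bsub>D n\<^esub> f n y) \<oplus>\<^bsub>D n\<^esub> f n y"
        using c by (simp add: a_minus_def DM.M.a_assoc DM.M.l_neg)
      then have "z \<in> ?BD #>\<^bsub>?ZD\<^esub> f n y" using y(2) by (auto simp: r_coset_def)
      then have "?BD #>\<^bsub>?ZD\<^esub> f n y = ?BD #>\<^bsub>?ZD\<^esub> z"
        using ND.repr_independence[OF _ _ ND.is_subgroup, of z "f n y"] fc[OF y(1)] by simp
      then show "Xc \<in> ?\<phi> ` carrier ?ZC" using z y by auto
    qed
  qed
  have "(\<lambda>Xc. the_elem (?\<phi> ` Xc)) \<in> iso (?ZC Mod ?BC) (?ZD Mod ?BD)"
    using \<phi>.FactGroup_iso_set[OF onto] ker by simp
  \<comment> \<open>All elements of a coset have the same image, so the union in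
    \<open>cohomology_map\<close> runs over equal classes.\<close>
  moreover have "the_elem (?\<phi> ` Xc) = cohomology_map D e f n Xc" if Xc: "Xc \<in> carrier (?ZC Mod ?BC)" for Xc
  proof -
    obtain z where z: "Xc = ?BC #>\<^bsub>?ZC\<^esub> z" "z \<in> carrier ?ZC"
      using Xc by (auto simp: FactGroup_def RCOSETS_def)
    have "?\<phi> x = ?\<phi> z" if x: "x \<in> Xc" for x
    proof -
      obtain b where b: "b \<in> ?BC" "x = b \<otimes>\<^bsub>?ZC\<^esub> z" using x z by (auto simp: r_coset_def)
      then have "b \<in> kernel ?ZC (?ZD Mod ?BD) ?\<phi>" unfolding ker by simp
      then have "b \<in> carrier ?ZC" "?\<phi> b = \<one>\<^bsub>?ZD Mod ?BD\<^esub>" by (simp_all add: kernel_def)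
      then show ?thesis using \<phi>.hom_mult[of b z] \<phi>.H.l_one[OF \<phi>.hom_closed[OF z(2)]] z(2) b(2) by simp
    qed
    moreover have "Xc \<noteq> {}" using NC.rcosets_non_empty Xc by (auto simp: FactGroup_def)
    ultimately have "?\<phi> ` Xc = {?\<phi> z}" by blast
    then show ?thesis unfolding cohomology_map_def coset[symmetric] by auto
  qed
  ultimately show "cohomology_map D e f n \<in> iso (cohomology C d n) (cohomology D e n)"
    unfolding cohomology_def
    by - (rule group.iso_eq[OF NC.factorgroup_is_group], assumption, rule sym)
qed

section \<open>Passing to a full subcategory\<close>

lemma words_Ob_update [simp]: "words (C\<lparr>Ob := Os\<rparr>) B P Q n = words C B P Q n"
proof -
  have "is_word (C\<lparr>Ob := Os\<rparr>) B P Q w = is_word C B P Q w" for w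
    by (induction C B P Q w rule: is_word.induct) simp_all
  then show ?thesis by (simp add: words_def)
qed

lemma word_rels_Ob_update [simp]: "word_rels (C\<lparr>Ob := Os\<rparr>) B P Q n = word_rels C B P Q n"
  by (simp add: word_rels_def)

lemma word_comp_Ob_update [simp]: "word_comp (C\<lparr>Ob := Os\<rparr>) P w v = word_comp C P w v"
  by (induction C P w v rule: word_comp.induct) simp_all

lemma word_diff_Ob_update [simp]: "word_diff (C\<lparr>Ob := Os\<rparr>) P w = word_diff C P w"
  by (induction C P w rule: word_diff.induct) (simp_all add: Let_def)

lemma word_diff_Ob_update' [simp]: "word_diff (C\<lparr>Ob := Os\<rparr>) P = word_diff C P"
  by (rule ext) simp

lemma words_mono: "B' \<subseteq> B \<Longrightarrow> words C B' P Q n \<subseteq> words C B P Q n"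
proof
  fix w assume "B' \<subseteq> B" "w \<in> words C B' P Q n"
  moreover have "is_word C B' P Q w \<Longrightarrow> B' \<subseteq> B \<Longrightarrow> is_word C B P Q w"
    by (induction C B' P Q w rule: is_word.induct) auto
  ultimately show "w \<in> words C B P Q n" by (simp add: words_def)
qed

lemma word_rels_mono: "B' \<subseteq> B \<Longrightarrow> word_rels C B' P Q n \<subseteq> word_rels C B P Q n"
  unfolding word_rels_def
  by (intro Un_mono Collect_mono impI; elim exE conjE; intro exI conjI;
    (assumption | erule words_mono[THEN subsetD]))

lemma dg_category_restrict:
  assumes "dg_category C" "Os \<subseteq> Ob C"
  shows "dg_category (C\<lparr>Ob := Os\<rparr>)"
proof -
  interpret dg_category C by fact
  show ?thesis
    by (rule dg_category.intro)
      (use assms(2) in \<open>auto intro: Hom_module Diff_linear Diff_Diff Comp_linear_left Comp_linear_right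
        Comp_assoc Ident_closed Ident_left Ident_right Leibniz\<close>)
qed

text \<open>\<open>e P\<close> is a direct summand of \<open>P\<close>, with closed inclusion
  \<open>i\<close> and closed projection \<open>r\<close>. \<open>i_natural\<close> says that a
  morphism maps the summand of \<open>P\<close> into that of \<open>Q\<close>.
  \<open>complement\<close> says that 1 - i r factors through an object of \<open>B\<close>, so
  \<open>P\<close> and \<open>e P\<close> become homotopy equivalent in the quotient. On
  \<open>O'\<close> the data are identities, not just isomorphisms, so that compression fixes the
  words of the subcategory.\<close>

locale retract = dg_pair +
  fixes O' :: "'a set" and e :: "'a \<Rightarrow> 'a" and i r :: "'a \<Rightarrow> 'b"
  assumes O'_sub: "O' \<subseteq> Ob C"
    and e_Ob: "P \<in> Ob C \<Longrightarrow> e P \<in> O'"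
    and e_B: "P \<in> B \<Longrightarrow> e P \<in> B"
    and e_O': "P \<in> O' \<Longrightarrow> e P = P"
    and i_O': "P \<in> O' \<Longrightarrow> i P = Ident C P"
    and r_O': "P \<in> O' \<Longrightarrow> r P = Ident C P"
    and i_closed: "P \<in> Ob C \<Longrightarrow> i P \<in> carrier (Hom C (e P) P 0)"
    and r_closed: "P \<in> Ob C \<Longrightarrow> r P \<in> carrier (Hom C P (e P) 0)"
    and Diff_i: "P \<in> Ob C \<Longrightarrow> Diff C (e P) P 0 (i P) = \<zero>\<^bsub>Hom C (e P) P 1\<^esub>"
    and Diff_r: "P \<in> Ob C \<Longrightarrow> Diff C P (e P) 0 (r P) = \<zero>\<^bsub>Hom C P (e P) 1\<^esub>"
    and retraction: "P \<in> Ob C \<Longrightarrow> Comp C (e P) P (e P) 0 0 (r P) (i P) = Ident C (e P)"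
    and i_natural: "P \<in> Ob C \<Longrightarrow> Q \<in> Ob C \<Longrightarrow> f \<in> carrier (Hom C P Q n) \<Longrightarrow>
      Comp C (e P) (e Q) Q 0 n (i Q) (Comp C (e P) Q (e Q) 0 n (r Q) (Comp C (e P) P Q n 0 f (i P)))
      = Comp C (e P) P Q n 0 f (i P)"
    and complement: "P \<in> Ob C \<Longrightarrow> \<exists>U\<in>B. \<exists>a\<in>carrier (Hom C P U 0). \<exists>b\<in>carrier (Hom C U P 0).
      Diff C P U 0 a = \<zero>\<^bsub>Hom C P U 1\<^esub> \<and> Diff C U P 0 b = \<zero>\<^bsub>Hom C U P 1\<^esub> \<and>
      Ident C P = Comp C P (e P) P 0 0 (i P) (r P) \<oplus>\<^bsub>Hom C P P 0\<^esub> Comp C P U P 0 0 b a"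
begin

lemma eC: "P \<in> Ob C \<Longrightarrow> e P \<in> Ob C"
  using e_Ob O'_sub by blast

definition em :: "'a \<Rightarrow> 'a \<Rightarrow> int \<Rightarrow> 'b \<Rightarrow> 'b" where
  "em P Q n f = Comp C (e P) Q (e Q) 0 n (r Q) (Comp C (e P) P Q n 0 f (i P))"

lemma em_linear:
  assumes "P \<in> Ob C" "Q \<in> Ob C"
  shows "em P Q n \<in> linear_maps (Hom C P Q n) (Hom C (e P) (e Q) n)"
proof -
  have 1: "(\<lambda>f. Comp C (e P) P Q n 0 f (i P)) \<in> linear_maps (Hom C P Q n) (Hom C (e P) Q n)"
    using Comp_linear_left[OF eC[OF assms(1)] assms i_closed[OF assms(1)], of n] by simp
  have 2: "Comp C (e P) Q (e Q) 0 n (r Q) \<in> linear_maps (Hom C (e P) Q n) (Hom C (e P) (e Q) n)"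
    using Comp_linear_right[OF eC[OF assms(1)] assms(2) eC[OF assms(2)] r_closed[OF assms(2)], of n] by simp
  show ?thesis unfolding em_def
    by (rule linear_mapsI) (simp_all add: linear_mapsD[OF 1] linear_mapsD[OF 2])
qed

lemma em_closed: "P \<in> Ob C \<Longrightarrow> Q \<in> Ob C \<Longrightarrow> f \<in> carrier (Hom C P Q n) \<Longrightarrow>
    em P Q n f \<in> carrier (Hom C (e P) (e Q) n)"
  by (rule linear_mapsD(1)[OF em_linear])

lemma i_em:
  "P \<in> Ob C \<Longrightarrow> Q \<in> Ob C \<Longrightarrow> f \<in> carrier (Hom C P Q n) \<Longrightarrow>
    Comp C (e P) (e Q) Q 0 n (i Q) (em P Q n f) = Comp C (e P) P Q n 0 f (i P)"
  unfolding em_def by (rule i_natural)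

lemma em_id:
  assumes "P \<in> O'" "Q \<in> O'" "f \<in> carrier (Hom C P Q n)"
  shows "em P Q n f = f"
proof -
  have "P \<in> Ob C" "Q \<in> Ob C" using assms O'_sub by auto
  then show ?thesis using assms Ident_left[of P Q f n] Ident_right[of P Q f n]
    by (simp add: em_def e_O' i_O' r_O')
qed

text \<open>(r g i)(r f i) = r g (i r f i) = r g f i, the last step being
  \<open>i_natural\<close>.\<close>

lemma em_Comp:
  assumes "P \<in> Ob C" "Q \<in> Ob C" "R \<in> Ob C" "g \<in> carrier (Hom C Q R p)" "f \<in> carrier (Hom C P Q q)"
  shows "em P R (p + q) (Comp C P Q R p q g f)
    = Comp C (e P) (e Q) (e R) p q (em Q R p g) (em P Q q f)"
proof -
  note eP = eC[OF assms(1)] and eQ = eC[OF assms(2)] and eR = eC[OF assms(3)]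
  note iP = i_closed[OF assms(1)] and iQ = i_closed[OF assms(2)] and rR = r_closed[OF assms(3)]
  note emf = em_closed[OF assms(1,2,5)]
  have gi: "Comp C (e Q) Q R p 0 g (i Q) \<in> carrier (Hom C (e Q) R p)"
    using Comp_closed[OF eQ assms(2,3,4) iQ] by simp
  have "Comp C (e P) (e Q) (e R) p q (em Q R p g) (em P Q q f)
      = Comp C (e P) R (e R) 0 (p + q) (r R) (Comp C (e P) (e Q) R p q (Comp C (e Q) Q R p 0 g (i Q)) (em P Q q f))"
    using Comp_assoc[OF eP eQ assms(3) eR rR gi emf] by (simp add: em_def)
  also have "Comp C (e P) (e Q) R p q (Comp C (e Q) Q R p 0 g (i Q)) (em P Q q f)
      = Comp C (e P) Q R p q g (Comp C (e P) P Q q 0 f (i P))"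
    using Comp_assoc[OF eP eQ assms(2,3,4) iQ emf] i_em[OF assms(1,2,5)] by simp
  also have "\<dots> = Comp C (e P) P R (p + q) 0 (Comp C P Q R p q g f) (i P)"
    using Comp_assoc[OF eP assms(1,2,3,4,5) iP] by simp
  finally show ?thesis by (simp add: em_def)
qed

lemma Comp_zero_left:
  assumes "P \<in> Ob C" "Q \<in> Ob C" "R \<in> Ob C" "f \<in> carrier (Hom C P Q q)"
  shows "Comp C P Q R p q \<zero>\<^bsub>Hom C Q R p\<^esub> f = \<zero>\<^bsub>Hom C P R (p + q)\<^esub>"
  using linear_maps_zero[OF Hom_module Hom_module Comp_linear_left] assms by blast

lemma Comp_zero_right:
  assumes "P \<in> Ob C" "Q \<in> Ob C" "R \<in> Ob C" "g \<in> carrier (Hom C Q R p)"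
  shows "Comp C P Q R p q g \<zero>\<^bsub>Hom C P Q q\<^esub> = \<zero>\<^bsub>Hom C P R (p + q)\<^esub>"
  using linear_maps_zero[OF Hom_module Hom_module Comp_linear_right] assms by blast

text \<open>As \<open>i\<close> and \<open>r\<close> are closed of degree 0, the Leibniz rule leaves
  only r d(f) i, without a sign.\<close>

lemma em_Diff:
  assumes "P \<in> Ob C" "Q \<in> Ob C" "f \<in> carrier (Hom C P Q n)"
  shows "em P Q (n + 1) (Diff C P Q n f) = Diff C (e P) (e Q) n (em P Q n f)"
proof -
  note eP = eC[OF assms(1)] and eQ = eC[OF assms(2)]
  note iP = i_closed[OF assms(1)] and rQ = r_closed[OF assms(2)]
  let ?fi = "Comp C (e P) P Q n 0 f (i P)"
  have fi: "?fi \<in> carrier (Hom C (e P) Q n)" using Comp_closed[OF eP assms iP] by simp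
  have dfi: "Comp C (e P) P Q (n + 1) 0 (Diff C P Q n f) (i P) \<in> carrier (Hom C (e P) Q (n + 1))"
    using Comp_closed[OF eP assms(1,2) Diff_closed[OF assms] iP] by simp
  interpret H: Module.module ground "Hom C (e P) Q (n + 1)" by (rule Hom_module) fact+
  interpret H': Module.module ground "Hom C (e P) (e Q) (n + 1)" by (rule Hom_module) fact+
  have 1: "Diff C (e P) Q n ?fi = Comp C (e P) P Q (n + 1) 0 (Diff C P Q n f) (i P)"
    using Leibniz[OF eP assms iP] Comp_zero_right[OF eP assms, of 1] dfi by (simp add: Diff_i[OF assms(1)])
  have c: "Comp C (e P) Q (e Q) 0 (n + 1) (r Q) (Diff C (e P) Q n ?fi) \<in> carrier (Hom C (e P) (e Q) (n + 1))"
    using Comp_closed[OF eP assms(2) eQ rQ Diff_closed[OF eP assms(2) fi]] by simp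
  have "Diff C (e P) (e Q) n (em P Q n f)
      = Comp C (e P) Q (e Q) 0 (n + 1) (r Q) (Diff C (e P) Q n ?fi)"
    using Leibniz[OF eP assms(2) eQ rQ fi] Comp_zero_left[OF eP assms(2) eQ fi, of 1] c
    by (simp add: em_def Diff_r[OF assms(2)] add.commute[of 1 n] kmodule_rules(1)[OF H'.module_axioms])
  then show ?thesis by (simp add: em_def 1)
qed

fun emap :: "'a \<Rightarrow> ('a, 'b) word \<Rightarrow> ('a, 'b) word" where
  "emap P [] = []"
| "emap P ((f, p, V) # w) = (em P V p f, p, e V) # emap V w"

text \<open>One summand for each contraction of the word: earlier letters are compressed by
  \<open>em\<close>, \<open>i V\<close> is inserted between a contraction at \<open>e V\<close> and
  one at \<open>V\<close>, and later letters stay. The sign comes from moving an operator of degree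
  -1 past the later part \<open>w\<close>. A single letter contains no contraction and gives
  0.\<close>

fun sw :: "'a \<Rightarrow> ('a, 'b) word \<Rightarrow> (('a, 'b) word \<Rightarrow>\<^sub>0 'c)" where
  "sw P [] = 0"
| "sw P ((f, p, V) # w) = (if w = [] then 0 else
     pre (em P V p f, p, e V) (sw V w)
     + free_scale ((-1) powi (word_degree w)) (basis ((em P V p f, p, e V) # (i V, 0, V) # w)))"

text \<open>\<open>S\<close> is the derivation with \<open>S f = 0\<close> and \<open>S \<epsilon>\<^sub>U = \<epsilon>\<^sub>U i\<^sub>U \<epsilon>\<^bsub>e U\<^esub>\<close>; it makes \<open>i\<close> natural up to homotopy
  with respect to the adjoined morphisms \<open>\<epsilon>\<^sub>U\<close>.\<close>

definition S :: "'a \<Rightarrow> (('a, 'b) word \<Rightarrow>\<^sub>0 'c) \<Rightarrow> (('a, 'b) word \<Rightarrow>\<^sub>0 'c)" where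
  "S P = free_ext (sw P)"

definition E :: "'a \<Rightarrow> (('a, 'b) word \<Rightarrow>\<^sub>0 'c) \<Rightarrow> (('a, 'b) word \<Rightarrow>\<^sub>0 'c)" where
  "E P = free_ext (\<lambda>w. basis (emap P w))"

lemma S_simps [simp]:
  "S P (p + q) = S P p + S P q" "S P (p - q) = S P p - S P q" "S P (- p) = - S P p"
  "S P (free_scale c p) = free_scale c (S P p)" "S P 0 = 0" "S P (basis w) = sw P w"
  by (simp_all add: S_def)

lemma E_simps [simp]:
  "E P (p + q) = E P p + E P q" "E P (p - q) = E P p - E P q" "E P (- p) = - E P p"
  "E P (free_scale c p) = free_scale c (E P p)" "E P 0 = 0" "E P (basis w) = basis (emap P w)"
  by (simp_all add: E_def)

lemma flinear_S: "flinear (S P)" "flinear f \<Longrightarrow> flinear (\<lambda>p. S P (f p))"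
  by (auto intro!: flinearI simp: flinear_add flinear_scale)

lemma flinear_E: "flinear (E P)" "flinear f \<Longrightarrow> flinear (\<lambda>p. E P (f p))"
  by (auto intro!: flinearI simp: flinear_add flinear_scale)

lemmas flinS = flinear_S flinear_E flin

lemma emap_nonempty [simp]: "emap P w = [] \<longleftrightarrow> w = []"
  by (cases "(P, w)" rule: emap.cases) auto

lemma word_degree_emap [simp]: "word_degree (emap P w) = word_degree w"
proof (induction w arbitrary: P)
  case (Cons x w)
  then show ?case by (cases x; cases "w = []") auto
qed simp

abbreviation "B' \<equiv> B \<inter> O'"
abbreviation "C' \<equiv> C\<lparr>Ob := O'\<rparr>"

lemma B'_B: "B' \<subseteq> B" by blast

text \<open>Since \<open>e\<close> maps \<open>B\<close> into \<open>B\<close> and all objects into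
  \<open>O'\<close>, the contractions of a compressed word sit at objects of the
  subcategory.\<close>

lemma emap_word:
  assumes "w \<in> Wd P Q n" "P \<in> Ob C" "Q \<in> Ob C"
  shows "emap P w \<in> words C B' (e P) (e Q) n"
  using assms(1,2)
proof (induction rule: word_induct)
  case (single P f p)
  then show ?case using assms by (auto intro: words_single em_closed)
next
  case (cons P f p V u m)
  then show ?case by (auto intro!: words_ConsI em_closed e_B e_Ob)
qed

lemma emap_word_comp:
  assumes "w \<in> Wd V Q m" "f \<in> carrier (Hom C P V p)" "P \<in> Ob C" "V \<in> Ob C" "Q \<in> Ob C"
  shows "emap P (word_comp C P w [(f, p, V)]) = word_comp C (e P) (emap V w) [(em P V p f, p, e V)]"
  using assms(1,4,2)
  by (induction rule: word_induct) (use assms in \<open>auto simp: em_Comp\<close>)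

lemma emap_word_diff:
  assumes "w \<in> Wd P Q n" "P \<in> Ob C" "Q \<in> Ob C"
  shows "word_diff C (e P) (emap P w) = E P (word_diff C P w)"
  using assms(1,2)
proof (induction rule: word_induct)
  case (single P f p)
  then show ?case using assms by (simp add: em_Diff)
next
  case (cons P f p V u m)
  have "E P (pre (f, p, V) t) = pre (em P V p f, p, e V) (E V t)" for t
    by (rule flin_eq[where A = UNIV and p = t and f = "\<lambda>t. E P (pre (f, p, V) t)"])
      (auto intro!: flinS simp: fsupp_def)
  moreover have "emap P (word_comp C P u [(f, p, V)]) = word_comp C (e P) (emap V u) [(em P V p f, p, e V)]"
    by (rule emap_word_comp[where Q = Q]) (use cons assms in auto)
  ultimately show ?case using cons assms by (simp add: word_diff_Cons em_Diff)
qed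

lemma D_E:
  assumes "P \<in> Ob C" "Q \<in> Ob C" "t \<in> FW P Q n"
  shows "D (e P) (E P t) = E P (D P t)"
  by (rule flin_eq[OF _ _ _ assms(3), where f = "\<lambda>t. D (e P) (E P t)"])
    (use assms in \<open>auto intro!: flinS simp: emap_word_diff\<close>)

text \<open>The equality is strict owing to the normalisation of \<open>e\<close>, \<open>i\<close>
  and \<open>r\<close> on \<open>O'\<close>. It makes \<open>E\<close> a left inverse of the
  inclusion of words, which yields injectivity on cohomology.\<close>

lemma E_id:
  assumes "P \<in> O'" "Q \<in> O'" "t \<in> fsupp (words C B' P Q n)"
  shows "E P t = t"
proof (rule flin_eq[OF _ _ _ assms(3)])
  have "is_word C B' P Q w \<Longrightarrow> P \<in> O' \<Longrightarrow> Q \<in> O' \<Longrightarrow> emap P w = w" for P w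
  proof (induction w arbitrary: P)
    case (Cons x u)
    obtain f p V where "x = (f, p, V)" by (cases x)
    then show ?case using Cons by (cases "u = []") (auto simp: em_id e_O')
  qed simp
  then show "E P (basis w) = basis w" if "w \<in> words C B' P Q n" for w
    using that assms by (simp add: words_def)
qed (auto intro: flinS)

lemma dg_pair_sub: "dg_pair C' B'"
  by (intro dg_pair.intro dg_pair_axioms.intro dg_category_restrict dg_category_axioms O'_sub) simp

sublocale sub: dg_pair C' B'
  by (rule dg_pair_sub)

lemma sub_D [simp]: "sub.D = D"
  by (simp add: fun_eq_iff sub.D_def D_def)

lemma sub_cmp [simp]: "sub.cmp = cmp"
  by (simp add: fun_eq_iff sub.cmp_def cmp_def)

lemma E_supp:
  assumes "P \<in> Ob C" "Q \<in> Ob C" "t \<in> FW P Q n"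
  shows "E P t \<in> fsupp (words C B' (e P) (e Q) n)"
  unfolding E_def by (rule free_ext_mapsto[OF subspace_fsupp _ assms(3)]) (simp add: emap_word assms)

lemma em_lin_rels:
  assumes "P \<in> Ob C" "V \<in> Ob C" "l \<in> lin_rels (Hom C P V p)"
  shows "free_ext (\<lambda>f. basis (em P V p f)) l \<in> lin_rels (Hom C (e P) (e V) p)"
  by (rule lin_rels_map[OF em_linear assms(3)]) fact+

lemma wrel_E:
  assumes "wrel Q P n t" "P \<in> Ob C" "Q \<in> Ob C"
  shows "E P t \<in> fspan (word_rels C B' (e P) (e Q) n)"
  using assms(1,2)
proof (induction rule: wrel.induct)
  case (single l P n)
  have "free_ext (\<lambda>f. basis [(em P Q n f, n, e Q)]) l \<in> sub.N (e P) (e Q) n"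
    by (rule sub.letter_N[OF _ _ single(1)]) (use em_linear e_Ob single assms in auto)
  then show ?case by (simp add: E_def free_ext_free_ext)
next
  case (head V l P p u m n)
  have V: "V \<in> Ob C" using head B_sub by auto
  have u: "u \<noteq> []" using head by auto
  have "free_ext (\<lambda>f. basis ((em P V p f, p, e V) # emap V u)) l \<in> sub.N (e P) (e Q) n"
    by (rule sub.letter_N[OF _ _ head(2), where m = m])
      (use em_linear e_Ob e_B head assms V u emap_word in auto)
  then show ?case by (simp add: E_def free_ext_free_ext)
next
  case (cons V f P p m t n)
  have V: "V \<in> Ob C" using cons B_sub by auto
  have "E P (pre (f, p, V) t) = pre (em P V p f, p, e V) (E V t)"
    by (rule flin_eq[where A = UNIV and p = t and f = "\<lambda>t. E P (pre (f, p, V) t)"])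
      (auto intro!: flinS simp: fsupp_def)
  also have "\<dots> \<in> sub.N (e P) (e Q) n"
    by (rule sub.pre_N[where m = m]) (use cons assms V e_Ob e_B em_closed in auto)
  finally show ?case by simp
qed

lemma E_N:
  assumes "P \<in> Ob C" "Q \<in> Ob C" "t \<in> N P Q n"
  shows "E P t \<in> fspan (word_rels C B' (e P) (e Q) n)"
  by (rule N_map[OF assms(1,2) flinear_E(1) wrel_E assms(3)]) (use assms in auto)

lemma sw_supp:
  assumes "w \<in> Wd P Q n" "P \<in> Ob C" "Q \<in> Ob C"
  shows "sw P w \<in> FW (e P) Q (n - 1)"
  using assms(1,2)
proof (induction rule: word_induct)
  case (cons P f p V u m)
  have "pre (em P V p f, p, e V) (sw V u) \<in> FW (e P) Q (p + m - 1 - 1)"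
    by (rule pre_supp[where m = "m - 1"]) (use cons em_closed e_B in auto)
  moreover have "(i V, 0, V) # u \<in> Wd (e V) Q (m - 1)"
    by (rule words_ConsI) (use cons i_closed in auto)
  then have "(em P V p f, p, e V) # (i V, 0, V) # u \<in> Wd (e P) Q (p + m - 1 - 1)"
    by (rule words_ConsI[where m = "m - 1", rotated 2]) (use cons em_closed e_B in auto)
  ultimately show ?case using cons by auto
qed simp

lemma S_pre:
  assumes "t \<in> FW V Q m"
  shows "S P (pre (f, p, V) t) = pre (em P V p f, p, e V) (S V t)
    + free_scale ((-1) powi m) (pre (em P V p f, p, e V) (pre (i V, 0, V) t))"
  by (rule flin_eq[OF _ _ _ assms, where f = "\<lambda>t. S P (pre (f, p, V) t)"])
    (auto intro!: flinS dest!: wordsD)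

lemma wrel_S:
  assumes "wrel Q P n t" "P \<in> Ob C" "Q \<in> Ob C"
  shows "S P t \<in> N (e P) Q (n - 1)"
  using assms(1,2)
proof (induction rule: wrel.induct)
  case (single l P n)
  show ?case by (simp add: S_def free_ext_free_ext free.span_zero)
next
  case (head V l P p u m n)
  have V: "V \<in> Ob C" using head B_sub by auto
  have u: "u \<noteq> []" using head by auto
  let ?l = "free_ext (\<lambda>f. basis (em P V p f)) l"
  have l: "?l \<in> lin_rels (Hom C (e P) (e V) p)" by (rule em_lin_rels) (use head V in auto)
  have "free_ext (\<lambda>f. pre (f, p, e V) (sw V u)) ?l \<in> N (e P) Q (n - 1)"
    by (rule head_N[where m = "m - 1"]) (use head V l assms eC e_B sw_supp in auto)
  then have 1: "free_ext (\<lambda>f. pre (em P V p f, p, e V) (sw V u)) l \<in> N (e P) Q (n - 1)"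
    by (simp add: free_ext_free_ext)
  have "(i V, 0, V) # u \<in> Wd (e V) Q (m - 1)"
    by (rule words_ConsI) (use head V i_closed in auto)
  then have 2: "free_ext (\<lambda>f. basis ((em P V p f, p, e V) # (i V, 0, V) # u)) l \<in> N (e P) Q (n - 1)"
    by (intro letter_N[OF _ _ head(2) em_linear, where m = "m - 1"]) (use head V assms eC e_B in auto)
  show ?case using u free.span_add[OF 1 free.span_scale[OF 2]]
    by (simp add: S_def free_ext_free_ext free_ext_add free_ext_scale)
next
  case (cons V f P p m t n)
  have V: "V \<in> Ob C" using cons B_sub by auto
  have t: "t \<in> FW V Q m" using wrel_supp cons assms V by auto
  have 1: "pre (em P V p f, p, e V) (S V t) \<in> N (e P) Q (n - 1)"
    by (rule pre_N[where m = "m - 1"]) (use cons V assms eC e_B em_closed in auto)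
  have i: "pre (i V, 0, V) t \<in> N (e V) Q (m - 1)"
    by (rule pre_N[where m = m]) (use cons V assms eC i_closed wrel_N in auto)
  have 2: "pre (em P V p f, p, e V) (pre (i V, 0, V) t) \<in> N (e P) Q (n - 1)"
    by (rule pre_N[where m = "m - 1"]) (use i cons V assms eC e_B em_closed in auto)
  show ?case unfolding S_pre[OF t] by (intro free.span_add free.span_scale 1 2)
qed

lemma S_N: "P \<in> Ob C \<Longrightarrow> Q \<in> Ob C \<Longrightarrow> t \<in> N P Q n \<Longrightarrow> S P t \<in> N (e P) Q (n - 1)"
  by (rule N_map[OF _ _ flinear_S(1) wrel_S])

lemma S_supp: "P \<in> Ob C \<Longrightarrow> Q \<in> Ob C \<Longrightarrow> t \<in> FW P Q n \<Longrightarrow> S P t \<in> FW (e P) Q (n - 1)"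
  unfolding S_def by (rule free_ext_mapsto[OF subspace_fsupp sw_supp]) auto

lemma sw_word_comp:
  assumes "w \<in> Wd V Q m" "f \<in> carrier (Hom C P V p)" "P \<in> Ob C" "V \<in> Ob C" "Q \<in> Ob C"
  shows "sw P (word_comp C P w [(f, p, V)]) = cmp (e P) (sw V w) (basis [(em P V p f, p, e V)])"
  using assms(1,4,2)
  by (induction rule: word_induct) (use assms in \<open>auto simp: em_Comp cmp_pre_left\<close>)

text \<open>On letters the claim is \<open>i_natural\<close>; on a contraction it is d(eps i eps') =
  i eps' - eps i. In the induction, the word u i_V produced at the first contraction is the one that
  the claim for \<open>u\<close> requires, the product i_V em(f) becomes f i_P, and the other terms
  cancel in pairs.\<close>

lemma word_homotopy:
  assumes "w \<in> Wd P Q n" "P \<in> Ob C" "Q \<in> Ob C"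
  shows "D (e P) (sw P w) + S P (word_diff C P w)
    - (basis (word_comp C (e P) [(i Q, 0, Q)] (emap P w)) - basis (word_comp C (e P) w [(i P, 0, P)]))
    \<in> N (e P) Q n"
  using assms(1,2)
proof (induction rule: word_induct)
  case (single P f p)
  then show ?case using assms by (simp add: i_em free.span_zero)
next
  case (cons P f p V u m)
  let ?x = "(f, p, V)" and ?y = "(em P V p f, p, e V)" and ?i = "(i V, 0, V)"
  let ?dy = "(Diff C (e P) (e V) p (em P V p f), p + 1, e V)"
  let ?s = "(-1 :: 'c) powi m"
  have u: "u \<noteq> []" "word_degree u = m" using cons by auto
  have su: "sw V u \<in> FW (e V) Q (m - 1)" by (rule sw_supp) (use cons assms in auto)
  have du: "word_diff C V u \<in> FW V Q (m + 1)" by (rule word_diff_supp) (use cons assms in auto)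
  have iu: "?i # u \<in> Wd (e V) Q (m - 1)"
    by (rule words_ConsI) (use cons i_closed in auto)
  have iu': "basis (?i # u) \<in> FW (e V) Q (m - 1)" using iu by simp
  \<comment> \<open>d(i_V) = 0 enters as a word with a zero letter, which vanishes only modulo
    relations.\<close>
  have z: "basis ((\<zero>\<^bsub>Hom C (e V) V 1\<^esub>, 1, V) # u) \<in> N (e V) Q m"
    by (rule letter_zero[where m = m]) (use u cons assms eC in auto)
  have 1: "pre ?y (basis ((\<zero>\<^bsub>Hom C (e V) V 1\<^esub>, 1, V) # u)) \<in> N (e P) Q (p + m - 1)"
    by (rule pre_N[where m = m]) (use z cons assms eC em_closed e_B in auto)
  have 2: "pre ?y (D (e V) (sw V u) + S V (word_diff C V u)
    - (basis (word_comp C (e V) [(i Q, 0, Q)] (emap V u)) - basis (word_comp C (e V) u [?i])))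
    \<in> N (e P) Q (p + m - 1)"
    by (rule pre_N[where m = m]) (use cons assms eC em_closed e_B in auto)
  have swc: "sw P (word_comp C P u [?x]) = cmp (e P) (sw V u) (basis [?y])"
    by (rule sw_word_comp[where Q = Q]) (use cons assms in auto)
  have id: "Diff C (e V) V 0 (i V) = \<zero>\<^bsub>Hom C (e V) V 1\<^esub>" by (rule Diff_i) fact
  have dem: "em P V (p + 1) (Diff C P V p f) = Diff C (e P) (e V) p (em P V p f)"
    by (rule em_Diff) (use cons in auto)
  have iem: "Comp C (e P) (e V) V 0 p (i V) (em P V p f) = Comp C (e P) P V p 0 f (i P)"
    by (rule i_em) (use cons in auto)
  have iu_deg: "word_degree (?i # u) = m - 1" using u by simp
  have "D (e P) (sw P (?x # u)) = D (e P) (pre ?y (sw V u)) + free_scale ?s (D (e P) (pre ?y (basis (?i # u))))"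
    using u by simp
  also have "\<dots> = pre ?y (D (e V) (sw V u)) - free_scale ?s (cmp (e P) (sw V u) (basis [?y]))
       + free_scale ?s (pre ?dy (sw V u))
       + free_scale ?s (pre ?y (pre ?i (word_diff C V u)))
       + pre ?y (basis (word_comp C (e V) u [?i]))
       - pre ?y (basis ((\<zero>\<^bsub>Hom C (e V) V 1\<^esub>, 1, V) # u))
       - basis ((Comp C (e P) P V p 0 f (i P), p, V) # u)
       + basis (?dy # ?i # u)"
    unfolding D_pre[OF su] D_pre[OF iu'] using u
    by (simp add: word_diff_Cons id iem free.scale_right_distrib free.scale_right_diff_distrib algebra_simps)
  finally have DS: "D (e P) (sw P (?x # u)) = \<dots>" .
  have SD: "S P (word_diff C P (?x # u)) = pre ?y (S V (word_diff C V u))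
       - free_scale ?s (pre ?y (pre ?i (word_diff C V u)))
       + free_scale ?s (cmp (e P) (sw V u) (basis [?y]))
       - free_scale ?s (pre ?dy (sw V u)) - basis (?dy # ?i # u)"
    using u by (simp add: word_diff_Cons S_pre[OF du] swc dem[unfolded add.commute[of p 1]]
      free.scale_right_distrib free.scale_right_diff_distrib algebra_simps)
  have "D (e P) (sw P (?x # u)) + S P (word_diff C P (?x # u))
    - (basis (word_comp C (e P) [(i Q, 0, Q)] (emap P (?x # u))) - basis (word_comp C (e P) (?x # u) [(i P, 0, P)]))
    = pre ?y (D (e V) (sw V u) + S V (word_diff C V u)
    - (basis (word_comp C (e V) [(i Q, 0, Q)] (emap V u)) - basis (word_comp C (e V) u [?i])))
    - pre ?y (basis ((\<zero>\<^bsub>Hom C (e V) V 1\<^esub>, 1, V) # u))"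
    unfolding DS SD using u by (simp add: algebra_simps)
  also have "\<dots> \<in> N (e P) Q (p + m - 1)"
    by (intro free.span_diff 1 2)
  finally show ?case .
qed

lemma homotopy:
  assumes "P \<in> O'" "Q \<in> O'" "t \<in> FW P Q n"
  shows "D P (S P t) + S P (D P t) - (E P t - t) \<in> N P Q n"
proof (rule fsupp_mapsto[OF _ free.subspace_span _ assms(3),
      where f = "\<lambda>t. D P (S P t) + S P (D P t) - (E P t - t)"])
  fix w assume w: "w \<in> Wd P Q n"
  have Ob: "P \<in> Ob C" "Q \<in> Ob C" using assms O'_sub by auto
  have "emap P w \<in> Wd P Q n"
    using subsetD[OF words_mono[OF B'_B] emap_word[OF w Ob]] assms by (simp add: e_O')
  then show "D P (S P (basis w)) + S P (D P (basis w)) - (E P (basis w) - basis w) \<in> N P Q n"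
    using word_homotopy[OF w Ob] w Ob assms
    by (simp add: e_O' i_O' word_comp_ident_left word_comp_ident_right)
qed (auto intro!: flinS)

section \<open>Comparison of the two quotients\<close>

definition FM :: "'a \<Rightarrow> 'a \<Rightarrow> int \<Rightarrow> (('a, 'b) word \<Rightarrow>\<^sub>0 'c) set \<Rightarrow> (('a, 'b) word \<Rightarrow>\<^sub>0 'c) set" where
  "FM P Q n F = (\<Union>f\<in>F. cls P Q n f)"

text \<open>A class modulo the relations of the subcategory lies in one class modulo the larger set
  of relations, and the union over its elements is that class.\<close>

lemma FM_cls [simp]: "FM P Q n (free_class (word_rels C B' P Q n) f) = cls P Q n f"
  unfolding FM_def
  by (rule UN_free_class[OF flinear_intros(6)], rule free.span_base, erule subsetD[OF word_rels_mono[OF B'_B]])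

lemma sub_supp: "t \<in> fsupp (words C B' P Q n) \<Longrightarrow> t \<in> FW P Q n"
  using words_mono[OF B'_B, of C P Q n] by (auto simp: fsupp_def)

lemma dg_functor_FM: "dg_functor (dg_quotient C' B') Quo (\<lambda>P. P) FM"
proof (intro dg_functor.intro dg_functor_axioms.intro)
  show "dg_category (dg_quotient C' B')" by (rule sub.dg_category_quotient)
  show "dg_category Quo" by (rule dg_category_quotient)
next
  fix P assume "P \<in> Ob (dg_quotient C' B')"
  then show "P \<in> Ob Quo" using O'_sub by auto
  show "FM P P 0 (Ident (dg_quotient C' B') P) = Ident Quo P" by simp
next
  fix P Q n assume "P \<in> Ob (dg_quotient C' B')" "Q \<in> Ob (dg_quotient C' B')"
  then have O: "P \<in> O'" "Q \<in> O'" "P \<in> Ob C" "Q \<in> Ob C" using O'_sub by auto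
  show "FM P Q n \<in> linear_maps (Hom (dg_quotient C' B') P Q n) (Hom Quo P Q n)"
    by (rule linear_mapsI) (auto simp: sub_supp)
  fix f assume "f \<in> carrier (Hom (dg_quotient C' B') P Q n)"
  then show "FM P Q (n + 1) (Diff (dg_quotient C' B') P Q n f) = Diff Quo P Q n (FM P Q n f)"
    using O sub.quotient_Diff[of P Q n] by auto
next
  fix P Q R g f p q
  assume *: "P \<in> Ob (dg_quotient C' B')" "Q \<in> Ob (dg_quotient C' B')" "R \<in> Ob (dg_quotient C' B')"
    "g \<in> carrier (Hom (dg_quotient C' B') Q R p)" "f \<in> carrier (Hom (dg_quotient C' B') P Q q)"
  then have O: "P \<in> O'" "Q \<in> O'" "R \<in> O'" "P \<in> Ob C" "Q \<in> Ob C" "R \<in> Ob C" using O'_sub by auto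
  obtain g' f' where gf: "g = free_class (word_rels C B' Q R p) g'" "g' \<in> fsupp (words C B' Q R p)"
    "f = free_class (word_rels C B' P Q q) f'" "f' \<in> fsupp (words C B' P Q q)"
    using * by auto
  show "FM P R (p + q) (Comp (dg_quotient C' B') P Q R p q g f) = Comp Quo P Q R p q (FM Q R p g) (FM P Q q f)"
    using sub.quotient_Comp[of P Q R g' p f' q] gf O by (simp add: sub_supp)
qed

lemma coboundary_clsI:
  assumes "P \<in> Ob C" "Q \<in> Ob C" "q \<in> FW P Q (n - 1)" "z - D P q \<in> N P Q n"
  shows "cls P Q n z \<in> coboundaries (Hom Quo P Q) (Diff Quo P Q) n"
proof -
  have "cls P Q n z = Diff Quo P Q (n - 1) (cls P Q (n - 1) q)"
    using quotient_Diff[OF assms(1,2), of "n - 1" q] assms(4) by (simp add: free_class_eq_iff)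
  then show ?thesis unfolding coboundaries_def using assms(3) by simp
qed

lemma kcomplex_Hom: "dg_category A \<Longrightarrow> P \<in> Ob A \<Longrightarrow> Q \<in> Ob A \<Longrightarrow> kcomplex (Hom A P Q) (Diff A P Q)"
  by (intro kcomplex.intro dg_category.Hom_module dg_category.Diff_linear dg_category.Diff_Diff)

text \<open>\<open>E\<close> turns a primitive found in the large quotient into one in the small
  quotient without changing the given cocycle; this gives injectivity. For surjectivity, the
  homotopy \<open>S\<close> makes a cocycle cohomologous to its image under \<open>E\<close>, which
  comes from the small quotient.\<close>

lemma quasi_fully_faithful_FM:
  assumes O: "P \<in> O'" "Q \<in> O'"
  shows "quasi_iso (Hom (dg_quotient C' B') P Q) (Diff (dg_quotient C' B') P Q)
    (Hom Quo P Q) (Diff Quo P Q) (FM P Q)"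
proof (rule quasi_isoI)
  have Ob: "P \<in> Ob C" "Q \<in> Ob C" using O O'_sub by auto
  have eO: "e P = P" "e Q = Q" using O by (auto simp: e_O')
  let ?cls' = "\<lambda>n. free_class (word_rels C B' P Q n)"
  let ?N' = "\<lambda>n. fspan (word_rels C B' P Q n)"
  show "kcomplex (Hom (dg_quotient C' B') P Q) (Diff (dg_quotient C' B') P Q)"
    by (rule kcomplex_Hom[OF sub.dg_category_quotient]) (use O in auto)
  show "kcomplex (Hom Quo P Q) (Diff Quo P Q)"
    by (rule kcomplex_Hom[OF dg_category_quotient]) (use Ob in auto)
  interpret F: dg_functor "dg_quotient C' B'" Quo "\<lambda>P. P" FM by (rule dg_functor_FM)
  show "FM P Q n \<in> linear_maps (Hom (dg_quotient C' B') P Q n) (Hom Quo P Q n)" for n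
    by (rule F.F_linear) (use O in auto)
  show "FM P Q (n + 1) (Diff (dg_quotient C' B') P Q n x) = Diff Quo P Q n (FM P Q n x)"
    if "x \<in> carrier (Hom (dg_quotient C' B') P Q n)" for n x
    by (rule F.F_Diff) (use O that in auto)
  have dq': "Diff (dg_quotient C' B') P Q n (?cls' n z) = ?cls' (n + 1) (D P z)" for n z
    using sub.quotient_Diff[of P Q n z] O by simp
  show "z \<in> coboundaries (Hom (dg_quotient C' B') P Q) (Diff (dg_quotient C' B') P Q) n"
    if z: "z \<in> cocycles (Hom (dg_quotient C' B') P Q) (Diff (dg_quotient C' B') P Q) n"
      and Fz: "FM P Q n z \<in> coboundaries (Hom Quo P Q) (Diff Quo P Q) n" for n z
  proof -
    obtain z' where z': "z = ?cls' n z'" "z' \<in> fsupp (words C B' P Q n)"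
      using z by (auto simp: cocycles_def)
    obtain q where q: "cls P Q n z' = cls P Q n (D P q)" "q \<in> FW P Q (n - 1)"
      using Fz Ob by (auto simp: coboundaries_def z')
    then have "E P (z' - D P q) \<in> ?N' n"
      using E_N[OF Ob, of "z' - D P q" n] by (simp add: free_class_eq_iff eO)
    then have "z' - D P (E P q) \<in> ?N' n"
      using E_id[OF O z'(2)] D_E[OF Ob q(2)] by (simp add: eO)
    then have "z = Diff (dg_quotient C' B') P Q (n - 1) (?cls' (n - 1) (E P q))"
      using dq'[of "n - 1"] by (simp add: z' free_class_eq_iff)
    moreover have "E P q \<in> fsupp (words C B' P Q (n - 1))"
      using E_supp[OF Ob q(2)] by (simp add: eO)
    ultimately show ?thesis by (auto simp: coboundaries_def)
  qed
  show "\<exists>y\<in>cocycles (Hom (dg_quotient C' B') P Q) (Diff (dg_quotient C' B') P Q) n.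
      z \<ominus>\<^bsub>Hom Quo P Q n\<^esub> FM P Q n y \<in> coboundaries (Hom Quo P Q) (Diff Quo P Q) n"
    if z: "z \<in> cocycles (Hom Quo P Q) (Diff Quo P Q) n" for n z
  proof -
    obtain z' where z': "z = cls P Q n z'" "z' \<in> FW P Q n"
      using z by (auto simp: cocycles_def)
    then have Dz: "D P z' \<in> N P Q (n + 1)"
      using z Ob by (simp add: cocycles_def free_class_eq_iff)
    have Ez: "E P z' \<in> fsupp (words C B' P Q n)"
      using E_supp[OF Ob z'(2)] by (simp add: eO)
    have "D P (E P z') \<in> ?N' (n + 1)"
      using D_E[OF Ob z'(2)] E_N[OF Ob Dz] by (simp add: eO)
    then have y: "?cls' n (E P z') \<in> cocycles (Hom (dg_quotient C' B') P Q) (Diff (dg_quotient C' B') P Q) n"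
      using Ez dq' by (auto simp: cocycles_def intro!: imageI free_class_eq_iff[THEN iffD2])
    have "S P (D P z') \<in> N P Q n" using S_N[OF Ob Dz] by (simp add: eO)
    from free.span_diff[OF homotopy[OF O z'(2)] this]
    have "(z' - E P z') - D P (- S P z') \<in> N P Q n"
      by (simp add: algebra_simps)
    moreover have "- S P z' \<in> FW P Q (n - 1)"
      using S_supp[OF Ob z'(2)] by (auto simp: eO)
    ultimately have "cls P Q n (z' - E P z') \<in> coboundaries (Hom Quo P Q) (Diff Quo P Q) n"
      by (intro coboundary_clsI[OF Ob])
    then show ?thesis using y z' Ez by (intro bexI[OF _ y]) (simp add: sub_supp)
  qed
qed

text \<open>r i = 1 holds strictly. The other composite differs from 1 by b a, which factors through
  an object \<open>U\<close> with a contraction and is therefore the boundary of b eps_U a, the word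
  \<open>?w\<close>.\<close>

lemma H0_isomorphic_retract:
  assumes P: "P \<in> Ob C"
  shows "H0_isomorphic Quo (e P) P"
proof -
  note eP = eC[OF P]
  obtain U a b where U: "U \<in> B" and a: "a \<in> carrier (Hom C P U 0)" and b: "b \<in> carrier (Hom C U P 0)"
    and da: "Diff C P U 0 a = \<zero>\<^bsub>Hom C P U 1\<^esub>" and db: "Diff C U P 0 b = \<zero>\<^bsub>Hom C U P 1\<^esub>"
    and id: "Ident C P = Comp C P (e P) P 0 0 (i P) (r P) \<oplus>\<^bsub>Hom C P P 0\<^esub> Comp C P U P 0 0 b a"
    using complement[OF P] by blast
  have UC: "U \<in> Ob C" using U B_sub by auto
  let ?i = "basis [(i P, 0, P)] :: ('a, 'b) word \<Rightarrow>\<^sub>0 'c" and ?r = "basis [(r P, 0, e P)] :: ('a, 'b) word \<Rightarrow>\<^sub>0 'c"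
  let ?ba = "Comp C P U P 0 0 b a" and ?ir = "Comp C P (e P) P 0 0 (i P) (r P)"
  let ?w = "basis [(a, 0, U), (b, 0, P)] :: ('a, 'b) word \<Rightarrow>\<^sub>0 'c"
  have iF: "?i \<in> FW (e P) P 0" and rF: "?r \<in> FW P (e P) 0"
    using i_closed[OF P] r_closed[OF P] by (auto intro: words_single)
  have ba: "?ba \<in> carrier (Hom C P P 0)" and ir: "?ir \<in> carrier (Hom C P P 0)"
    using Comp_closed[OF P UC P b a] Comp_closed[OF P eP P i_closed[OF P] r_closed[OF P]] by simp_all
  have wF: "?w \<in> FW P P (- 1)"
    using U a b by (simp add: words_Cons)
  have zi: "basis [(\<zero>\<^bsub>Hom C (e P) P 1\<^esub>, 1, P)] \<in> N (e P) P 1"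
    by (rule letter_zero) (use P eP in auto)
  have zr: "basis [(\<zero>\<^bsub>Hom C P (e P) 1\<^esub>, 1, e P)] \<in> N P (e P) 1"
    by (rule letter_zero) (use P eP in auto)
  have zb: "basis [(\<zero>\<^bsub>Hom C U P 1\<^esub>, 1, P)] \<in> N U P 1"
    by (rule letter_zero) (use P UC in auto)
  have za: "basis [(\<zero>\<^bsub>Hom C P U 1\<^esub>, 1, U), (b, 0, P)] \<in> N P P 0"
    by (rule letter_zero[where m = 0]) (use P UC U b in \<open>auto intro: words_single\<close>)
  have zb': "pre (a, 0, U) (basis [(\<zero>\<^bsub>Hom C U P 1\<^esub>, 1, P)]) \<in> N P P 0"
    by (rule pre_N[where m = 1]) (use P UC U a zb in auto)
  have Dw: "D P ?w = basis [(?ba, 0, P)] + (pre (a, 0, U) (basis [(\<zero>\<^bsub>Hom C U P 1\<^esub>, 1, P)])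
      - basis [(\<zero>\<^bsub>Hom C P U 1\<^esub>, 1, U), (b, 0, P)])"
    by (simp add: word_diff_Cons da db)
  have "basis (?ir \<oplus>\<^bsub>Hom C P P 0\<^esub> ?ba) - basis ?ir - basis ?ba \<in> lin_rels (Hom C P P 0)"
    by (rule lin_rels_addI) fact+
  from letter_N[OF P P this id_linear, of "[]" 0]
  have sum: "basis [(Ident C P, 0, P)] - basis [(?ir, 0, P)] - basis [(?ba, 0, P)] \<in> N P P 0"
    by (simp add: id)
  have "(basis [(?ir, 0, P)] - basis [(Ident C P, 0, P)]) - D P (- ?w) =
      - (basis [(Ident C P, 0, P)] - basis [(?ir, 0, P)] - basis [(?ba, 0, P)])
      + (pre (a, 0, U) (basis [(\<zero>\<^bsub>Hom C U P 1\<^esub>, 1, P)])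
      - basis [(\<zero>\<^bsub>Hom C P U 1\<^esub>, 1, U), (b, 0, P)])"
    using Dw by (simp add: algebra_simps)
  also have "\<dots> \<in> N P P 0"
    by (intro free.span_add free.span_neg free.span_diff sum za zb')
  finally have "cls P P 0 (basis [(?ir, 0, P)] - basis [(Ident C P, 0, P)])
      \<in> coboundaries (Hom Quo P P) (Diff Quo P P) 0"
    by (intro coboundary_clsI[OF P P, of "- ?w"]) (use wF in auto)
  moreover have "cls (e P) (e P) 0 0 \<in> coboundaries (Hom Quo (e P) (e P)) (Diff Quo (e P) (e P)) 0"
    by (rule coboundary_clsI[OF eP eP, of 0]) (auto intro: free.span_zero)
  moreover have "cls (e P) P 0 ?i \<in> cocycles (Hom Quo (e P) P) (Diff Quo (e P) P) 0"
    using iF zi eP P by (auto simp: cocycles_def Diff_i intro!: imageI free_class_eq_iff[THEN iffD2])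
  moreover have "cls P (e P) 0 ?r \<in> cocycles (Hom Quo P (e P)) (Diff Quo P (e P)) 0"
    using rF zr eP P by (auto simp: cocycles_def Diff_r intro!: imageI free_class_eq_iff[THEN iffD2])
  moreover have "basis [(?ir, 0, P)] \<in> FW P P 0" using ir by (auto intro: words_single)
  ultimately show ?thesis
    unfolding H0_isomorphic_def
    using quotient_Comp[OF eP P eP rF iF] quotient_Comp[OF P eP P iF rF] Ident_FW[OF P] Ident_FW[OF eP] P
    by (intro bexI[of _ "cls (e P) P 0 ?i"] bexI[of _ "cls P (e P) 0 ?r"])
      (simp_all add: retraction)
qed

theorem quasi_equivalence_FM: "quasi_equivalence (dg_quotient C' B') Quo (\<lambda>P. P) FM"
proof (intro quasi_equivalence.intro quasi_equivalence_axioms.intro dg_functor_FM)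
  fix P Q assume "P \<in> Ob (dg_quotient C' B')" "Q \<in> Ob (dg_quotient C' B')"
  then show "quasi_iso (Hom (dg_quotient C' B') P Q) (Diff (dg_quotient C' B') P Q)
    (Hom Quo P Q) (Diff Quo P Q) (FM P Q)"
    by (intro quasi_fully_faithful_FM) auto
next
  fix R assume "R \<in> Ob Quo"
  then show "\<exists>P\<in>Ob (dg_quotient C' B'). H0_isomorphic Quo P R"
    using H0_isomorphic_retract[of R] e_Ob[of R] by auto
qed

end

section \<open>Sweedler calculus\<close>

definition vmod :: "('k::field \<Rightarrow> 'v::ab_group_add \<Rightarrow> 'v) \<Rightarrow> ('k, 'v) module" where
  "vmod s = \<lparr>carrier = UNIV, monoid.mult = (\<lambda>_ _. undefined), one = undefined, ring.zero = 0, add = (+), module.smult = s\<rparr>"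

lemma vmod_simps [simp]:
  "carrier (vmod s) = UNIV" "\<zero>\<^bsub>vmod s\<^esub> = 0" "x \<oplus>\<^bsub>vmod s\<^esub> y = x + y" "c \<odot>\<^bsub>vmod s\<^esub> x = s c x"
  by (simp_all add: vmod_def)

lemma hmod_simps [simp]:
  "carrier (hmod H) = UNIV" "\<zero>\<^bsub>hmod H\<^esub> = 0" "x \<oplus>\<^bsub>hmod H\<^esub> y = x + y" "c \<odot>\<^bsub>hmod H\<^esub> x = hscale H c x"
  by (simp_all add: hmod_def)

lemma kmodule_type:
  assumes "carrier M = UNIV" "\<And>x y. x \<oplus>\<^bsub>M\<^esub> y = x + y" "\<zero>\<^bsub>M\<^esub> = (0 :: 'v::ab_group_add)"
    "\<And>c x. c \<odot>\<^bsub>M\<^esub> x = s c x" "vector_space s"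
  shows "kmodule M"
proof -
  interpret vector_space s by fact
  show ?thesis by (rule kmoduleI) (simp_all add: assms(1-4) scale_right_distrib scale_left_distrib add_ac)
qed

lemma kmodule_vmod: "vector_space s \<Longrightarrow> kmodule (vmod s)"
  by (rule kmodule_type) simp_all

lemma finsum_type:
  assumes "carrier M = UNIV" "\<And>x y. x \<oplus>\<^bsub>M\<^esub> y = x + y" "\<zero>\<^bsub>M\<^esub> = (0 :: 'v::ab_group_add)" "finite I"
  shows "finsum M f I = sum f I"
proof -
  have "abelian_group M"
    by (rule abelian_groupI) (auto simp: assms add_ac intro!: exI[of _ "- _"])
  then interpret abelian_group M .
  show ?thesis using assms(4)
    by (induction I rule: finite_induct) (simp_all add: assms(1-3) finsum_insert)
qed

lemma finsum_linear:
  assumes "kmodule A" "kmodule A'" "L \<in> linear_maps A A'" "finite I" "f \<in> I \<rightarrow> carrier A"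
  shows "L (finsum A f I) = finsum A' (\<lambda>i. L (f i)) I"
proof -
  interpret A: Module.module ground A by fact
  interpret A': Module.module ground A' by fact
  show ?thesis using assms(4,5)
  proof (induction I rule: finite_induct)
    case empty
    then show ?case using linear_maps_zero[OF assms(1-3)] by simp
  next
    case (insert i I)
    then have "(\<lambda>i. L (f i)) \<in> I \<rightarrow> carrier A'" "L (f i) \<in> carrier A'" "f \<in> I \<rightarrow> carrier A" "f i \<in> carrier A"
      using linear_mapsD(1)[OF assms(3)] by auto
    then show ?case using insert
      by (simp add: A.M.finsum_insert A'.M.finsum_insert linear_mapsD(2)[OF assms(3)] A.M.finsum_closed)
  qed
qed

section \<open>Bilinear maps and tensor products\<close>

definition tensor_eval :: "('k::field \<Rightarrow> 'v::ab_group_add \<Rightarrow> 'v) \<Rightarrow> ('a \<Rightarrow> 'b \<Rightarrow> 'v) \<Rightarrow> ('a \<times> 'b \<Rightarrow>\<^sub>0 'k) \<Rightarrow> 'v" where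
  "tensor_eval s b p = (\<Sum>w\<in>Poly_Mapping.keys p. s (Poly_Mapping.lookup p w) (b (fst w) (snd w)))"

lemma linear_tensor_eval:
  fixes b :: "'a \<Rightarrow> 'b \<Rightarrow> 'v::ab_group_add" and s :: "'k::field \<Rightarrow> 'v \<Rightarrow> 'v"
  assumes "vector_space s"
  shows "Vector_Spaces.linear free_scale s (tensor_eval s b)"
proof -
  interpret vector_space s by fact
  have sup: "tensor_eval s b p = (\<Sum>w\<in>I. s (Poly_Mapping.lookup p w) (b (fst w) (snd w)))"
    if "finite I" "Poly_Mapping.keys p \<subseteq> I" for p I
    unfolding tensor_eval_def by (rule sum.mono_neutral_left) (use that in \<open>auto simp: in_keys_iff\<close>)
  show ?thesis
  proof (unfold Vector_Spaces.linear_iff, intro conjI allI)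
    fix p q :: "'a \<times> 'b \<Rightarrow>\<^sub>0 'k" and c :: 'k
    let ?I = "Poly_Mapping.keys p \<union> Poly_Mapping.keys q"
    show "tensor_eval s b (p + q) = tensor_eval s b p + tensor_eval s b q"
      using keys_add[of p q] sup[of ?I "p + q"] sup[of ?I p] sup[of ?I q]
      by (simp add: lookup_add scale_left_distrib sum.distrib)
    show "tensor_eval s b (free_scale c p) = s c (tensor_eval s b p)"
      using keys_free_scale[of c p] sup[of "Poly_Mapping.keys p" "free_scale c p"]
      by (simp add: tensor_eval_def scale_sum_right)
  qed (fact free.vector_space_axioms assms)+
qed

lemma tensor_eval_basis: "vector_space s \<Longrightarrow> tensor_eval s b (basis (x, y)) = b x y"
  by (simp add: tensor_eval_def basis_def vector_space.vector_space_assms(4))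

definition bilin :: "('k::field, 'a, 'x) module_scheme \<Rightarrow> ('k, 'b, 'y) module_scheme
    \<Rightarrow> ('k \<Rightarrow> 'v::ab_group_add \<Rightarrow> 'v) \<Rightarrow> ('a \<Rightarrow> 'b \<Rightarrow> 'v) \<Rightarrow> bool" where
  "bilin A B s b \<longleftrightarrow>
     (\<forall>x\<in>carrier A. \<forall>x'\<in>carrier A. \<forall>y\<in>carrier B. b (x \<oplus>\<^bsub>A\<^esub> x') y = b x y + b x' y) \<and>
     (\<forall>x\<in>carrier A. \<forall>y\<in>carrier B. \<forall>y'\<in>carrier B. b x (y \<oplus>\<^bsub>B\<^esub> y') = b x y + b x y') \<and>
     (\<forall>c. \<forall>x\<in>carrier A. \<forall>y\<in>carrier B. b (c \<odot>\<^bsub>A\<^esub> x) y = s c (b x y)) \<and>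
     (\<forall>c. \<forall>x\<in>carrier A. \<forall>y\<in>carrier B. b x (c \<odot>\<^bsub>B\<^esub> y) = s c (b x y))"

lemma bilinD:
  assumes "bilin A B s b" "x \<in> carrier A" "y \<in> carrier B"
  shows "x' \<in> carrier A \<Longrightarrow> b (x \<oplus>\<^bsub>A\<^esub> x') y = b x y + b x' y"
    and "y' \<in> carrier B \<Longrightarrow> b x (y \<oplus>\<^bsub>B\<^esub> y') = b x y + b x y'"
    and "b (c \<odot>\<^bsub>A\<^esub> x) y = s c (b x y)" and "b x (c \<odot>\<^bsub>B\<^esub> y) = s c (b x y)"
  using assms by (simp_all add: bilin_def)

lemma tensor_eval_cong_class:
  assumes "vector_space s" "bilin A B s b" "q - p \<in> fspan (tensor_rels A B)"
  shows "tensor_eval s b q = tensor_eval s b p"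
proof -
  interpret L: Vector_Spaces.linear free_scale s "tensor_eval s b" by (rule linear_tensor_eval) fact
  interpret vector_space s by fact
  note t = tensor_eval_basis[OF assms(1)] and bl = bilinD[OF assms(2)]
  have 1: "tensor_eval s b (basis (x \<oplus>\<^bsub>A\<^esub> x', y) - basis (x, y) - basis (x', y)) = 0"
    if "x \<in> carrier A" "x' \<in> carrier A" "y \<in> carrier B" for x x' y
    unfolding L.diff t bl(1)[OF that(1,3,2)] by simp
  have 2: "tensor_eval s b (basis (x, y \<oplus>\<^bsub>B\<^esub> y') - basis (x, y) - basis (x, y')) = 0"
    if "x \<in> carrier A" "y \<in> carrier B" "y' \<in> carrier B" for x y y'
    unfolding L.diff t bl(2)[OF that] by simp
  have 3: "tensor_eval s b (basis (c \<odot>\<^bsub>A\<^esub> x, y) - free_scale c (basis (x, y))) = 0"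
    if "x \<in> carrier A" "y \<in> carrier B" for c x y
    unfolding L.diff L.scale t bl(3)[OF that] by simp
  have 4: "tensor_eval s b (basis (x, c \<odot>\<^bsub>B\<^esub> y) - free_scale c (basis (x, y))) = 0"
    if "x \<in> carrier A" "y \<in> carrier B" for c x y
    unfolding L.diff L.scale t bl(4)[OF that] by simp
  have R: "tensor_eval s b r = 0" if "r \<in> tensor_rels A B" for r
    using that unfolding tensor_rels_def by (elim UnE CollectE exE conjE) (simp_all only: 1 2 3 4)
  have "tensor_eval s b (q - p) = 0"
    by (rule L.eq_0_on_span[OF R assms(3)])
  then show ?thesis by (simp add: L.diff)
qed

lemma tensor_lift_type:
  assumes "carrier M = UNIV" "\<And>x y. x \<oplus>\<^bsub>M\<^esub> y = x + y" "\<zero>\<^bsub>M\<^esub> = (0 :: 'v::ab_group_add)"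
    "\<And>c x. c \<odot>\<^bsub>M\<^esub> x = s c x"
  shows "tensor_lift M b t = tensor_eval s b (SOME p. p \<in> t)"
  by (simp add: tensor_lift_def Let_def finsum_type[OF assms(1-3)] assms(4) tensor_eval_def)

lemma tensor_lift_vmod: "tensor_lift (vmod s) b t = tensor_eval s b (SOME p. p \<in> t)"
  by (rule tensor_lift_type) simp_all

lemma tensor_lift_class:
  assumes "vector_space s" "bilin A B s b"
  shows "tensor_lift (vmod s) b (free_class (tensor_rels A B) p) = tensor_eval s b p"
proof -
  have "(SOME q. q \<in> free_class (tensor_rels A B) p) \<in> free_class (tensor_rels A B) p"
    by (rule someI[of _ p]) simp
  then show ?thesis unfolding tensor_lift_vmod
    by (intro tensor_eval_cong_class[OF assms]) (simp add: mem_free_class)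
qed

lemma tensor_lift_elem:
  "vector_space s \<Longrightarrow> bilin A B s b \<Longrightarrow> tensor_lift (vmod s) b (tensor_elem A B x y) = b x y"
  by (simp add: tensor_elem_def tensor_lift_class tensor_eval_basis)

lemma tensor_lift_linear:
  assumes "vector_space s" "bilin A B s b"
  shows "tensor_lift (vmod s) b \<in> linear_maps (tensor A B) (vmod s)"
proof -
  interpret L: Vector_Spaces.linear free_scale s "tensor_eval s b" by (rule linear_tensor_eval) fact
  show ?thesis unfolding tensor_def
    by (rule linear_mapsI) (auto simp: tensor_lift_class[OF assms] L.add L.scale)
qed

lemma kmodule_tensor: "kmodule (tensor A B)"
  unfolding tensor_def by (rule kmodule_presented)

lemma tensor_elem_closed: "x \<in> carrier A \<Longrightarrow> y \<in> carrier B \<Longrightarrow> tensor_elem A B x y \<in> carrier (tensor A B)"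
  by (simp add: tensor_elem_def tensor_def)

lemma sum_swap4:
  "(\<Sum>u\<in>I. \<Sum>v\<in>J. \<Sum>p\<in>K. \<Sum>q\<in>L. f u v p q) = (\<Sum>p\<in>K. \<Sum>q\<in>L. \<Sum>u\<in>I. \<Sum>v\<in>J. f u v p q)"
proof -
  have "(\<Sum>u\<in>I. \<Sum>v\<in>J. \<Sum>p\<in>K. \<Sum>q\<in>L. f u v p q) = (\<Sum>u\<in>I. \<Sum>p\<in>K. \<Sum>v\<in>J. \<Sum>q\<in>L. f u v p q)"
    by (intro sum.cong refl sum.swap)
  also have "\<dots> = (\<Sum>p\<in>K. \<Sum>u\<in>I. \<Sum>v\<in>J. \<Sum>q\<in>L. f u v p q)"
    by (rule sum.swap)
  also have "\<dots> = (\<Sum>p\<in>K. \<Sum>u\<in>I. \<Sum>q\<in>L. \<Sum>v\<in>J. f u v p q)"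
    by (intro sum.cong refl sum.swap)
  also have "\<dots> = (\<Sum>p\<in>K. \<Sum>q\<in>L. \<Sum>u\<in>I. \<Sum>v\<in>J. f u v p q)"
    by (intro sum.cong refl sum.swap)
  finally show ?thesis .
qed

lemma tensor_lift_closed:
  assumes "kmodule M" "\<And>x y. b x y \<in> carrier M"
  shows "tensor_lift M b t \<in> carrier M"
proof -
  interpret Module.module ground M by fact
  show ?thesis unfolding tensor_lift_def Let_def
    by (rule M.finsum_closed) (use assms in auto)
qed

lemma linear_tensor_lift:
  assumes "kmodule M" "kmodule M'" "L \<in> linear_maps M M'" "\<And>x y. b x y \<in> carrier M"
  shows "L (tensor_lift M b t) = tensor_lift M' (\<lambda>x y. L (b x y)) t"
proof -
  interpret Module.module ground M by fact
  show ?thesis unfolding tensor_lift_def Let_def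
    by (subst finsum_linear[OF assms(1-3)]) (use assms(4) linear_mapsD(3)[OF assms(3)] in auto)
qed

lemma linear_sweedler2:
  assumes "kmodule M" "kmodule M'" "L \<in> linear_maps M M'" "\<And>x y. b x y \<in> carrier M"
  shows "L (sweedler2 H M b x) = sweedler2 H M' (\<lambda>x y. L (b x y)) x"
  unfolding sweedler2_def by (rule linear_tensor_lift[OF assms])

lemma sweedler2_closed:
  "kmodule M \<Longrightarrow> (\<And>x y. b x y \<in> carrier M) \<Longrightarrow> sweedler2 H M b x \<in> carrier M"
  unfolding sweedler2_def by (rule tensor_lift_closed)

locale involutive_hopf = finite_dimensional_hopf_algebra H
  for H :: "('k::field_char_0, 'h::ring_1) hopf" +
  assumes S_S [simp]: "antipode H (antipode H x) = x"
begin

abbreviation hs (infixr \<open>*h\<close> 75) where "hs \<equiv> hscale H"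
abbreviation S where "S \<equiv> antipode H"
abbreviation eps where "eps \<equiv> counit H"

section \<open>Coordinates of the coproduct in a basis\<close>

definition Bs :: "'h set" where
  "Bs = (SOME B. finite_dimensional_vector_space hs B)"

lemma fd: "finite_dimensional_vector_space hs Bs"
  unfolding Bs_def using finite_dimensional by (rule someI_ex)

sublocale fdv: finite_dimensional_vector_space hs Bs
  by (rule fd)

definition co :: "'h \<Rightarrow> 'h \<Rightarrow> 'k" where
  "co a x = representation Bs x a"

lemma co_simps [simp]:
  "co a (x + y) = co a x + co a y" "co a (c *h x) = c * co a x" "co a (x - y) = co a x - co a y"
  "co a 0 = 0" "co a (- x) = - co a x" "co a (sum g I) = (\<Sum>i\<in>I. co a (g i))"
proof -
  interpret L: Vector_Spaces.linear hs "(*)" "co a"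
    unfolding co_def
    using linear_representation[OF fdv.independent_Basis fdv.span_Basis] .
  show "co a (x + y) = co a x + co a y" "co a (c *h x) = c * co a x" "co a (x - y) = co a x - co a y"
  "co a 0 = 0" "co a (- x) = - co a x" "co a (sum g I) = (\<Sum>i\<in>I. co a (g i))"
    by (simp_all add: L.add L.scale L.diff L.zero L.neg L.sum)
qed

lemma co_basis: "a \<in> Bs \<Longrightarrow> b \<in> Bs \<Longrightarrow> co a b = (if a = b then 1 else 0)"
  by (simp add: co_def representation_basis[OF fdv.independent_Basis])

lemma co_expand: "(\<Sum>a\<in>Bs. co a x *h a) = x"
  unfolding co_def
  using sum_representation_eq[OF fdv.independent_Basis _ fdv.finite_Basis order_refl, of x] fdv.span_Basis
  by simp

lemma eq_by_co: "(\<And>a. a \<in> Bs \<Longrightarrow> co a x = co a y) \<Longrightarrow> x = y"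
  by (metis (no_types, lifting) co_expand sum.cong)

definition hlin :: "('k \<Rightarrow> 'v::ab_group_add \<Rightarrow> 'v) \<Rightarrow> ('h \<Rightarrow> 'v) \<Rightarrow> bool" where
  "hlin s f \<longleftrightarrow> (\<forall>x y. f (x + y) = f x + f y) \<and> (\<forall>c x. f (c *h x) = s c (f x))"

lemma hlinI: "(\<And>x y. f (x + y) = f x + f y) \<Longrightarrow> (\<And>c x. f (c *h x) = s c (f x)) \<Longrightarrow> hlin s f"
  by (simp add: hlin_def)

lemma hlinD: assumes "hlin s f" shows "f (x + y) = f x + f y" "f (c *h x) = s c (f x)"
  using assms by (auto simp: hlin_def)

lemma hlin_sum:
  assumes "hlin s f"
  shows "f (sum g I) = (\<Sum>i\<in>I. f (g i))"
proof -
  have "f 0 = 0" using hlinD(1)[OF assms, of 0 0] by simp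
  then show ?thesis by (induction I rule: infinite_finite_induct) (simp_all add: hlinD(1)[OF assms])
qed

lemma hlin_expand: "hlin s f \<Longrightarrow> (\<Sum>a\<in>Bs. s (co a x) (f a)) = f x"
  using hlin_sum[of s f "\<lambda>a. co a x *h a" Bs] by (simp add: hlinD co_expand)

text \<open>This is the representative that \<open>tensor_lift\<close> itself picks, so a Sweedler
  sum unfolds to \<open>tensor_eval\<close> at \<open>rep x\<close> without a change of
  representative.\<close>

definition rep :: "'h \<Rightarrow> ('h \<times> 'h \<Rightarrow>\<^sub>0 'k)" where
  "rep x = (SOME p. p \<in> comult H x)"

lemma comult_rep: "comult H x = free_class (tensor_rels (hmod H) (hmod H)) (rep x)"
proof -
  have "comult H x \<in> carrier (HH H)" using linear_mapsD(1)[OF comult_linear, of x] by simp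
  then obtain p where p: "comult H x = free_class (tensor_rels (hmod H) (hmod H)) p"
    by (auto simp: tensor_def)
  then have "p \<in> comult H x" by simp
  then have "rep x \<in> comult H x" unfolding rep_def by (rule someI)
  then have "rep x - p \<in> fspan (tensor_rels (hmod H) (hmod H))" unfolding p mem_free_class .
  then show ?thesis unfolding p by (rule free_class_eqI)
qed

abbreviation blin :: "('k \<Rightarrow> 'v::ab_group_add \<Rightarrow> 'v) \<Rightarrow> ('h \<Rightarrow> 'h \<Rightarrow> 'v) \<Rightarrow> bool" where
  "blin \<equiv> bilin (hmod H) (hmod H)"

lemma blin_iff: "blin s b \<longleftrightarrow> (\<forall>x. hlin s (b x)) \<and> (\<forall>y. hlin s (\<lambda>x. b x y))"
  by (auto simp: bilin_def hlin_def)

text \<open>The structure constants of the coproduct: \<Delta>(x) is the sum of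
  \<open>cf a c x\<close> times a \<otimes> c over basis elements a and c.\<close>

definition cf :: "'h \<Rightarrow> 'h \<Rightarrow> 'h \<Rightarrow> 'k" where
  "cf a c x = tensor_eval (*) (\<lambda>u v. co a u * co c v) (rep x)"

lemma vs_k: "vector_space ((*) :: 'k \<Rightarrow> 'k \<Rightarrow> 'k)"
  by standard (simp_all add: algebra_simps)

lemma blin_co: "blin (*) (\<lambda>u v. co a u * co c v)"
  by (auto simp: blin_iff hlin_def algebra_simps)

lemma tensor_eval_rep_linear:
  assumes "vector_space s" "blin s b"
  shows "hlin s (\<lambda>x. tensor_eval s b (rep x))"
proof (rule hlinI)
  let ?R = "tensor_rels (hmod H) (hmod H)"
  interpret L: Vector_Spaces.linear free_scale s "tensor_eval s b" by (rule linear_tensor_eval) fact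
  fix x y c
  have "comult H (x + y) = free_class ?R (rep x + rep y)"
    using linear_mapsD(2)[OF comult_linear, of x y] by (simp add: comult_rep tensor_def)
  then have "rep (x + y) - (rep x + rep y) \<in> fspan ?R"
    by (simp add: comult_rep free_class_eq_iff)
  from tensor_eval_cong_class[OF assms this] show "tensor_eval s b (rep (x + y)) = tensor_eval s b (rep x) + tensor_eval s b (rep y)"
    by (simp add: L.add)
  have "comult H (c *h x) = free_class ?R (free_scale c (rep x))"
    using linear_mapsD(3)[OF comult_linear, of x c] by (simp add: comult_rep tensor_def)
  then have "rep (c *h x) - free_scale c (rep x) \<in> fspan ?R"
    by (simp add: comult_rep free_class_eq_iff)
  from tensor_eval_cong_class[OF assms this] show "tensor_eval s b (rep (c *h x)) = s c (tensor_eval s b (rep x))"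
    by (simp add: L.scale)
qed

lemma hlin_cf: "hlin (*) (cf a c)"
  using tensor_eval_rep_linear[OF vs_k blin_co[of a c]] by (simp add: cf_def[abs_def])

text \<open>This is b(x^1, x^2) in coordinates. Only the values of \<open>b\<close> at basis vectors
  enter, so exchange of sums and coassociativity become identities of finite sums, valid for
  arbitrary \<open>b\<close>; bilinearity is what links the sum to the tensor product.\<close>

definition sw :: "('k \<Rightarrow> 'v::ab_group_add \<Rightarrow> 'v) \<Rightarrow> ('h \<Rightarrow> 'h \<Rightarrow> 'v) \<Rightarrow> 'h \<Rightarrow> 'v" where
  "sw s b x = (\<Sum>a\<in>Bs. \<Sum>c\<in>Bs. s (cf a c x) (b a c))"

lemma tensor_eval_rep:
  assumes "vector_space s" "blin s b"
  shows "tensor_eval s b (rep x) = sw s b x"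
proof -
  interpret V: vector_space s by fact
  let ?K = "Poly_Mapping.keys (rep x)"
  let ?l = "Poly_Mapping.lookup (rep x)"
  have b: "b u v = (\<Sum>a\<in>Bs. \<Sum>c\<in>Bs. s (co a u * co c v) (b a c))" for u v
  proof -
    have "b u v = (\<Sum>a\<in>Bs. s (co a u) (b a v))"
      using assms(2) hlin_expand[of s "\<lambda>u. b u v" u] by (simp add: blin_iff)
    also have "\<dots> = (\<Sum>a\<in>Bs. s (co a u) (\<Sum>c\<in>Bs. s (co c v) (b a c)))"
      using assms(2) hlin_expand[of s "b _" v] by (simp add: blin_iff)
    finally show ?thesis by (simp add: V.scale_sum_right)
  qed
  have "tensor_eval s b (rep x) = (\<Sum>w\<in>?K. \<Sum>a\<in>Bs. \<Sum>c\<in>Bs. s (?l w * (co a (fst w) * co c (snd w))) (b a c))"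
    unfolding tensor_eval_def by (subst b) (simp add: V.scale_sum_right mult.assoc)
  also have "\<dots> = (\<Sum>a\<in>Bs. \<Sum>w\<in>?K. \<Sum>c\<in>Bs. s (?l w * (co a (fst w) * co c (snd w))) (b a c))"
    by (rule sum.swap)
  also have "\<dots> = (\<Sum>a\<in>Bs. \<Sum>c\<in>Bs. \<Sum>w\<in>?K. s (?l w * (co a (fst w) * co c (snd w))) (b a c))"
    by (intro sum.cong refl sum.swap)
  also have "\<dots> = sw s b x"
    unfolding sw_def cf_def tensor_eval_def by (simp add: V.scale_sum_left)
  finally show ?thesis .
qed

lemma sweedler2_vmod:
  assumes "vector_space s" "blin s b"
  shows "sweedler2 H (vmod s) b x = sw s b x"
  using tensor_eval_rep[OF assms] by (simp add: sweedler2_def tensor_lift_vmod rep_def)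

lemma sweedler2_hmod:
  assumes "blin hs b"
  shows "sweedler2 H (hmod H) b x = sw hs b x"
proof -
  have "tensor_lift (hmod H) b t = tensor_eval hs b (SOME p. p \<in> t)" for t
    by (rule tensor_lift_type) simp_all
  then show ?thesis
    using tensor_eval_rep[OF vector_space_axioms assms] by (simp add: sweedler2_def rep_def)
qed

lemma sw_cong: "(\<And>a c. a \<in> Bs \<Longrightarrow> c \<in> Bs \<Longrightarrow> b a c = b' a c) \<Longrightarrow> sw s b x = sw s b' x"
  by (simp add: sw_def)

lemma sw_linear_arg:
  assumes "vector_space s"
  shows "hlin s (sw s b)"
proof -
  interpret V: vector_space s by fact
  show ?thesis
    by (rule hlinI) (simp_all add: sw_def hlinD[OF hlin_cf] V.scale_left_distrib sum.distrib V.scale_sum_right)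
qed

lemma sw_push:
  assumes "\<And>x y. f (x + y) = f x + f y" "\<And>c x. f (s c x) = s' c (f x)"
  shows "f (sw s b x) = sw s' (\<lambda>u v. f (b u v)) x"
proof -
  have z: "f 0 = 0" using assms(1)[of 0 0] by simp
  have "f (sum g I) = (\<Sum>i\<in>I. f (g i))" for g :: "'h \<Rightarrow> _" and I
    by (induction I rule: infinite_finite_induct) (simp_all add: z assms(1))
  then show ?thesis by (simp add: sw_def assms(2))
qed

lemma sw_swap:
  assumes "vector_space s"
  shows "sw s (\<lambda>u v. sw s (\<lambda>p q. b u v p q) y) x = sw s (\<lambda>p q. sw s (\<lambda>u v. b u v p q) x) y"
proof -
  interpret V: vector_space s by fact
  show ?thesis
    unfolding sw_def V.scale_sum_right V.scale_scale
    by (subst sum_swap4) (simp add: mult.commute)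
qed

text \<open>Apply the functional \<open>co a\<close> \<otimes> \<open>co b\<close> \<otimes>
  \<open>co c\<close> to the coassociativity axiom in \<open>HHH H\<close>. It is the map
  \<open>L\<close>, built in two stages because the triple tensor product is nested.\<close>

lemma cf_coassoc:
  assumes "a \<in> Bs" "b \<in> Bs" "c \<in> Bs"
  shows "(\<Sum>p\<in>Bs. cf p c x * cf a b p) = (\<Sum>p\<in>Bs. cf a p x * cf b c p)"
proof -
  let ?k = "(*) :: 'k \<Rightarrow> 'k \<Rightarrow> 'k"
  define Lbc where "Lbc = tensor_lift (vmod ?k) (\<lambda>y z. co b y * co c z)"
  define L where "L = tensor_lift (vmod ?k) (\<lambda>x t. co a x * Lbc t)"
  have Lbc: "Lbc \<in> linear_maps (HH H) (vmod ?k)"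
    unfolding Lbc_def by (rule tensor_lift_linear[OF vs_k blin_co])
  have bl: "bilin (hmod H) (HH H) ?k (\<lambda>x t. co a x * Lbc t)"
    using linear_mapsD[OF Lbc] by (auto simp: bilin_def algebra_simps)
  have L: "L \<in> linear_maps (HHH H) (vmod ?k)"
    unfolding L_def by (rule tensor_lift_linear[OF vs_k bl])
  have cl2: "htens2 H y z \<in> carrier (HH H)" for y z by (rule tensor_elem_closed) simp_all
  have cl3: "htens3 H x y z \<in> carrier (HHH H)" for x y z by (rule tensor_elem_closed) (simp_all add: cl2)
  have L3: "L (htens3 H x y z) = co a x * (co b y * co c z)" for x y z
  proof -
    have "L (htens3 H x y z) = co a x * Lbc (htens2 H y z)"
      unfolding L_def by (rule tensor_lift_elem[OF vs_k bl])
    also have "Lbc (htens2 H y z) = co b y * co c z"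
      unfolding Lbc_def by (rule tensor_lift_elem[OF vs_k blin_co])
    finally show ?thesis .
  qed
  note km = kmodule_tensor kmodule_vmod[OF vs_k]
  have inner1: "L (sweedler2 H (HHH H) (\<lambda>x y. htens3 H x y z) p) = cf a b p * co c z" for z p
  proof -
    have "L (sweedler2 H (HHH H) (\<lambda>x y. htens3 H x y z) p)
        = sweedler2 H (vmod ?k) (\<lambda>x y. co a x * (co b y * co c z)) p"
      by (subst linear_sweedler2[OF km L]) (simp_all add: cl3 L3)
    also have "\<dots> = tensor_eval ?k (\<lambda>x y. co a x * (co b y * co c z)) (rep p)"
      by (simp add: sweedler2_def tensor_lift_vmod rep_def)
    also have "\<dots> = cf a b p * co c z"
      by (simp add: cf_def tensor_eval_def sum_distrib_right mult.assoc)
    finally show ?thesis .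
  qed
  have inner2: "L (sweedler2 H (HHH H) (\<lambda>y z. htens3 H x y z) p) = co a x * cf b c p" for x p
  proof -
    have "L (sweedler2 H (HHH H) (\<lambda>y z. htens3 H x y z) p)
        = sweedler2 H (vmod ?k) (\<lambda>y z. co a x * (co b y * co c z)) p"
      by (subst linear_sweedler2[OF km L]) (simp_all add: cl3 L3)
    also have "\<dots> = tensor_eval ?k (\<lambda>y z. co a x * (co b y * co c z)) (rep p)"
      by (simp add: sweedler2_def tensor_lift_vmod rep_def)
    also have "\<dots> = co a x * cf b c p"
      by (simp add: cf_def tensor_eval_def sum_distrib_left mult_ac)
    finally show ?thesis .
  qed
  have "L (sweedler2 H (HHH H) (\<lambda>p z. sweedler2 H (HHH H) (\<lambda>x y. htens3 H x y z) p) x)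
    = sweedler2 H (vmod ?k) (\<lambda>p z. cf a b p * co c z) x"
    by (subst linear_sweedler2[OF km L]) (auto intro!: sweedler2_closed kmodule_tensor cl3 simp: inner1)
  also have "\<dots> = sw ?k (\<lambda>p z. cf a b p * co c z) x"
    by (rule sweedler2_vmod[OF vs_k]) (auto simp: blin_iff hlin_def hlinD[OF hlin_cf] algebra_simps)
  also have "\<dots> = (\<Sum>p\<in>Bs. cf p c x * cf a b p)"
    using assms by (simp add: sw_def co_basis if_distrib[of "\<lambda>z. _ * z"] fdv.finite_Basis cong: if_cong)
  finally have 1: "L (sweedler2 H (HHH H) (\<lambda>p z. sweedler2 H (HHH H) (\<lambda>x y. htens3 H x y z) p) x)
    = (\<Sum>p\<in>Bs. cf p c x * cf a b p)" .
  have "L (sweedler2 H (HHH H) (\<lambda>x p. sweedler2 H (HHH H) (\<lambda>y z. htens3 H x y z) p) x)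
    = sweedler2 H (vmod ?k) (\<lambda>x p. co a x * cf b c p) x"
    by (subst linear_sweedler2[OF km L]) (auto intro!: sweedler2_closed kmodule_tensor cl3 simp: inner2)
  also have "\<dots> = sw ?k (\<lambda>x p. co a x * cf b c p) x"
    by (rule sweedler2_vmod[OF vs_k]) (auto simp: blin_iff hlin_def hlinD[OF hlin_cf] algebra_simps)
  also have "\<dots> = (\<Sum>p\<in>Bs. cf a p x * cf b c p)"
    unfolding sw_def by (subst sum.swap)
      (use assms in \<open>simp add: co_basis if_distrib[of "\<lambda>z. _ * z"] if_distrib[of "\<lambda>z. z * _"] fdv.finite_Basis cong: if_cong\<close>)
  finally have 2: "L (sweedler2 H (HHH H) (\<lambda>x p. sweedler2 H (HHH H) (\<lambda>y z. htens3 H x y z) p) x)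
    = (\<Sum>p\<in>Bs. cf a p x * cf b c p)" .
  show ?thesis using 1 2 coassoc[of x] by simp
qed

lemma sw_coassoc:
  assumes "vector_space s"
  shows "sw s (\<lambda>p q. sw s (\<lambda>r t. b r t q) p) x = sw s (\<lambda>r p. sw s (\<lambda>t q. b r t q) p) x"
proof -
  interpret V: vector_space s by fact
  have "sw s (\<lambda>p q. sw s (\<lambda>r t. b r t q) p) x
      = (\<Sum>p\<in>Bs. \<Sum>q\<in>Bs. \<Sum>r\<in>Bs. \<Sum>t\<in>Bs. s (cf p q x * cf r t p) (b r t q))"
    by (simp add: sw_def V.scale_sum_right)
  also have "\<dots> = (\<Sum>q\<in>Bs. \<Sum>p\<in>Bs. \<Sum>r\<in>Bs. \<Sum>t\<in>Bs. s (cf p q x * cf r t p) (b r t q))"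
    by (rule sum.swap)
  also have "\<dots> = (\<Sum>q\<in>Bs. \<Sum>r\<in>Bs. \<Sum>p\<in>Bs. \<Sum>t\<in>Bs. s (cf p q x * cf r t p) (b r t q))"
    by (intro sum.cong refl sum.swap)
  also have "\<dots> = (\<Sum>q\<in>Bs. \<Sum>r\<in>Bs. \<Sum>t\<in>Bs. \<Sum>p\<in>Bs. s (cf p q x * cf r t p) (b r t q))"
    by (intro sum.cong refl sum.swap)
  also have "\<dots> = (\<Sum>q\<in>Bs. \<Sum>r\<in>Bs. \<Sum>t\<in>Bs. \<Sum>p\<in>Bs. s (cf r p x * cf t q p) (b r t q))"
    by (rule sum.cong[OF refl], rule sum.cong[OF refl], rule sum.cong[OF refl])
      (simp only: V.scale_sum_left[symmetric] cf_coassoc)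
  also have "\<dots> = (\<Sum>r\<in>Bs. \<Sum>q\<in>Bs. \<Sum>t\<in>Bs. \<Sum>p\<in>Bs. s (cf r p x * cf t q p) (b r t q))"
    by (rule sum.swap)
  also have "\<dots> = (\<Sum>r\<in>Bs. \<Sum>q\<in>Bs. \<Sum>p\<in>Bs. \<Sum>t\<in>Bs. s (cf r p x * cf t q p) (b r t q))"
    by (intro sum.cong refl sum.swap)
  also have "\<dots> = (\<Sum>r\<in>Bs. \<Sum>p\<in>Bs. \<Sum>q\<in>Bs. \<Sum>t\<in>Bs. s (cf r p x * cf t q p) (b r t q))"
    by (intro sum.cong refl sum.swap)
  also have "\<dots> = (\<Sum>r\<in>Bs. \<Sum>p\<in>Bs. \<Sum>t\<in>Bs. \<Sum>q\<in>Bs. s (cf r p x * cf t q p) (b r t q))"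
    by (intro sum.cong refl sum.swap)
  also have "\<dots> = sw s (\<lambda>r p. sw s (\<lambda>t q. b r t q) p) x"
    by (simp add: sw_def V.scale_sum_right)
  finally show ?thesis .
qed

section \<open>Counit, antipode and product in Sweedler sums\<close>

lemma hlin_S: "S (x + y) = S x + S y" "S (c *h x) = c *h S x"
  using linear_mapsD(2,3)[OF antipode_linear, of x] by simp_all

lemma sw_counit_left:
  assumes "hlin s g"
  shows "sw s (\<lambda>u v. s (eps u) (g v)) x = g x"
proof -
  have "sw hs (\<lambda>u v. eps u *h v) x = x"
    using counit_left[of x] by (subst (asm) sweedler2_hmod)
      (auto simp: blin_iff hlin_def counit_add counit_scale algebra_simps scale_right_distrib scale_left_distrib)
  then have "g x = g (sw hs (\<lambda>u v. eps u *h v) x)" by simp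
  also have "\<dots> = sw s (\<lambda>u v. g (eps u *h v)) x" by (rule sw_push) (simp_all add: hlinD[OF assms])
  finally show ?thesis by (simp add: hlinD[OF assms])
qed

lemma sw_counit_right:
  assumes "hlin s g"
  shows "sw s (\<lambda>u v. s (eps v) (g u)) x = g x"
proof -
  have "sw hs (\<lambda>u v. eps v *h u) x = x"
    using counit_right[of x] by (subst (asm) sweedler2_hmod)
      (auto simp: blin_iff hlin_def counit_add counit_scale algebra_simps scale_right_distrib scale_left_distrib)
  then have "g x = g (sw hs (\<lambda>u v. eps v *h u) x)" by simp
  also have "\<dots> = sw s (\<lambda>u v. g (eps v *h u)) x" by (rule sw_push) (simp_all add: hlinD[OF assms])
  finally show ?thesis by (simp add: hlinD[OF assms])
qed

lemma sw_antipode_left: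
  assumes "hlin s g"
  shows "sw s (\<lambda>u v. g (S u * v)) x = s (eps x) (g 1)"
proof -
  have "sw hs (\<lambda>u v. S u * v) x = eps x *h 1"
    using antipode_left[of x] by (subst (asm) sweedler2_hmod)
      (auto simp: blin_iff hlin_def hlin_S algebra_simps scale_mult_left scale_mult_right)
  then have "s (eps x) (g 1) = g (sw hs (\<lambda>u v. S u * v) x)" by (simp add: hlinD[OF assms])
  also have "\<dots> = sw s (\<lambda>u v. g (S u * v)) x" by (rule sw_push) (simp_all add: hlinD[OF assms])
  finally show ?thesis by simp
qed

lemma sw_antipode_right:
  assumes "hlin s g"
  shows "sw s (\<lambda>u v. g (u * S v)) x = s (eps x) (g 1)"
proof -
  have "sw hs (\<lambda>u v. u * S v) x = eps x *h 1"
    using antipode_right[of x] by (subst (asm) sweedler2_hmod)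
      (auto simp: blin_iff hlin_def hlin_S algebra_simps scale_mult_left scale_mult_right)
  then have "s (eps x) (g 1) = g (sw hs (\<lambda>u v. u * S v) x)" by (simp add: hlinD[OF assms])
  also have "\<dots> = sw s (\<lambda>u v. g (u * S v)) x" by (rule sw_push) (simp_all add: hlinD[OF assms])
  finally show ?thesis by simp
qed

lemma sw_class:
  assumes "vector_space s" "blin s b"
  shows "tensor_lift (vmod s) b (comult H x) = sw s b x"
  by (simp add: comult_rep tensor_lift_class[OF assms] tensor_eval_rep[OF assms])

lemma sw_one:
  assumes "vector_space s" "blin s b"
  shows "sw s b 1 = b 1 1"
  using sw_class[OF assms, of 1] by (simp add: comult_one tensor_lift_elem[OF assms])

lemma sw_mult:
  assumes "vector_space s" "blin s b"
  shows "sw s b (x * y) = sw s (\<lambda>x1 x2. sw s (\<lambda>y1 y2. b (x1 * y1) (x2 * y2)) y) x"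
proof -
  let ?L = "tensor_lift (vmod s) b"
  have L: "?L \<in> linear_maps (HH H) (vmod s)" by (rule tensor_lift_linear[OF assms])
  note km = kmodule_tensor kmodule_vmod[OF assms(1)]
  have b: "hlin s (b u)" "hlin s (\<lambda>u. b u v)" for u v using assms(2) by (auto simp: blin_iff)
  have cl2: "htens2 H y z \<in> carrier (HH H)" for y z by (rule tensor_elem_closed) simp_all
  have bl: "blin s (\<lambda>y1 y2. b (x1 * y1) (x2 * y2))" for x1 x2
    by (auto simp: blin_iff hlin_def hlinD[OF b(1)] hlinD[OF b(2)] distrib_left scale_mult_right)
  have inner: "?L (sweedler2 H (HH H) (\<lambda>y1 y2. htens2 H (x1 * y1) (x2 * y2)) y)
      = sw s (\<lambda>y1 y2. b (x1 * y1) (x2 * y2)) y" for x1 x2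
    by (subst linear_sweedler2[OF km L]) (simp_all add: cl2 tensor_lift_elem[OF assms] sweedler2_vmod[OF assms(1) bl])
  interpret V: vector_space s by (rule assms(1))
  have "sw s b (x * y) = ?L (comult H (x * y))" by (simp add: sw_class[OF assms])
  also have "\<dots> = sweedler2 H (vmod s) (\<lambda>x1 x2. sw s (\<lambda>y1 y2. b (x1 * y1) (x2 * y2)) y) x"
    unfolding comult_mult
    by (subst linear_sweedler2[OF km L]) (auto intro!: sweedler2_closed kmodule_tensor cl2 simp: inner)
  also have "\<dots> = sw s (\<lambda>x1 x2. sw s (\<lambda>y1 y2. b (x1 * y1) (x2 * y2)) y) x"
    by (rule sweedler2_vmod[OF assms(1)])
      (auto simp: blin_iff hlin_def sw_def hlinD[OF b(1)] hlinD[OF b(2)] distrib_right scale_mult_left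
        V.scale_right_distrib sum.distrib V.scale_sum_right mult.commute)
  finally show ?thesis .
qed

end

section \<open>Integrals of an involutive Hopf algebra\<close>

context involutive_hopf begin

lemma sw_add: "vector_space s \<Longrightarrow> sw s (\<lambda>u v. b u v + b' u v) x = sw s b x + sw s b' x"
  by (simp add: sw_def vector_space.vector_space_assms(1) sum.distrib)

lemma sw_scale:
  assumes "vector_space s" shows "sw s (\<lambda>u v. s c (b u v)) x = s c (sw s b x)"
proof -
  interpret V: vector_space s by fact
  show ?thesis by (simp add: sw_def V.scale_sum_right mult.commute)
qed

lemma sw_sum:
  assumes "vector_space s" shows "sw s (\<lambda>u v. \<Sum>i\<in>I. b i u v) x = (\<Sum>i\<in>I. sw s (b i) x)"
proof -
  interpret V: vector_space s by fact
  have "(\<Sum>i\<in>I. sw s (b i) x) = (\<Sum>u\<in>Bs. \<Sum>i\<in>I. \<Sum>v\<in>Bs. s (cf u v x) (b i u v))"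
    unfolding sw_def by (rule sum.swap)
  also have "\<dots> = (\<Sum>u\<in>Bs. \<Sum>v\<in>Bs. \<Sum>i\<in>I. s (cf u v x) (b i u v))"
    by (intro sum.cong refl sum.swap)
  finally show ?thesis by (simp add: sw_def V.scale_sum_right)
qed

lemma eps_simps [simp]:
  "eps (x + y) = eps x + eps y" "eps (c *h x) = c * eps x" "eps (x * y) = eps x * eps y" "eps 1 = 1"
  by (simp_all add: counit_add counit_scale counit_mult counit_one)

lemmas hsimps = distrib_left distrib_right scale_mult_left scale_mult_right hlin_S scale_right_distrib

lemma hlin_id: "hlin hs (\<lambda>x. x)"
  by (simp add: hlin_def)

lemma S_one [simp]: "S 1 = 1"
proof -
  have "sw hs (\<lambda>u v. S u * v) 1 = S 1 * 1"
    by (rule sw_one[OF vector_space_axioms]) (simp add: blin_iff hlin_def hsimps)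
  then show ?thesis using sw_antipode_left[OF hlin_id, of 1] by simp
qed

text \<open>Both sides are convolution inverses of the multiplication. Concretely, \<open>Z\<close>
  is the sum S(x^1 y^1) x^2 y^2 S(y^3) S(x^3); collapsing its left part gives S(y) S(x), collapsing
  its right part gives S(x y).\<close>

lemma S_mult: "S (x * y) = S y * S x"
proof -
  note vs = vector_space_axioms
  define Z where "Z = sw hs (\<lambda>a x3. sw hs (\<lambda>x1 x2. sw hs (\<lambda>b y3. sw hs (\<lambda>y1 y2.
    S (x1 * y1) * (x2 * y2) * (S y3 * S x3)) b) y) a) x"
  have mult: "sw hs (\<lambda>x1 x2. sw hs (\<lambda>y1 y2. S (x1 * y1) * (x2 * y2) * (S y3 * S x3)) b) a
      = eps b *h (eps a *h (S y3 * S x3))" for a b x3 y3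
  proof -
    have "sw hs (\<lambda>x1 x2. sw hs (\<lambda>y1 y2. S (x1 * y1) * (x2 * y2) * (S y3 * S x3)) b) a
        = sw hs (\<lambda>u v. S u * v * (S y3 * S x3)) (a * b)"
      by (rule sw_mult[OF vs, symmetric]) (simp add: blin_iff hlin_def hsimps)
    also have "\<dots> = eps (a * b) *h (1 * (S y3 * S x3))"
      by (rule sw_antipode_left) (simp add: hlin_def hsimps)
    finally show ?thesis by (simp add: mult.commute)
  qed
  have "Z = sw hs (\<lambda>a x3. sw hs (\<lambda>b y3. sw hs (\<lambda>x1 x2. sw hs (\<lambda>y1 y2.
    S (x1 * y1) * (x2 * y2) * (S y3 * S x3)) b) a) y) x"
    unfolding Z_def by (subst sw_swap[OF vs]) simp
  also have "\<dots> = sw hs (\<lambda>a x3. sw hs (\<lambda>b y3. eps b *h (eps a *h (S y3 * S x3))) y) x"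
    by (simp add: mult)
  also have "\<dots> = sw hs (\<lambda>a x3. eps a *h (S y * S x3)) x"
    by (subst sw_counit_left) (simp_all add: hlin_def hsimps)
  also have "\<dots> = S y * S x"
    by (subst sw_counit_left) (simp_all add: hlin_def hsimps)
  finally have 1: "Z = S y * S x" .
  have in1: "sw hs (\<lambda>b y3. sw hs (\<lambda>y1 y2. S (x1 * y1) * (x2 * y2) * (S y3 * S x3)) b) y
      = S (x1 * y) * (x2 * S x3)" for x1 x2 x3
  proof -
    have "sw hs (\<lambda>y2 y3. S (x1 * y1) * (x2 * y2) * (S y3 * S x3)) = (\<lambda>t. eps t *h (S (x1 * y1) * (x2 * S x3)))" for y1
      using sw_antipode_right[of hs "\<lambda>z. S (x1 * y1) * (x2 * z) * S x3"]
      by (intro ext) (simp add: hlin_def hsimps mult.assoc)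
    then show ?thesis
      by (subst sw_coassoc[OF vs], simp) (subst sw_counit_right, simp_all add: hlin_def hsimps)
  qed
  have in2: "sw hs (\<lambda>x2 x3. S (x1 * y) * (x2 * S x3)) = (\<lambda>t. eps t *h S (x1 * y))" for x1
    using sw_antipode_right[of hs "\<lambda>z. S (x1 * y) * z"] by (intro ext) (simp add: hlin_def hsimps)
  have "Z = S (x * y)"
    unfolding Z_def in1
    by (subst sw_coassoc[OF vs], simp add: in2) (subst sw_counit_right, simp_all add: hlin_def hsimps)
  with 1 show ?thesis by simp
qed

text \<open>Since \<open>S\<close> is an involution, the antipode identities also hold with the factors exchanged.\<close>

lemma sw_antipode_right':
  assumes "hlin s g"
  shows "sw s (\<lambda>u v. g (v * S u)) x = s (eps x) (g 1)"
proof -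
  have "sw s (\<lambda>u v. g (S (u * S v))) x = s (eps x) (g (S 1))"
    by (rule sw_antipode_right[where g = "\<lambda>z. g (S z)"]) (simp add: hlin_def hsimps hlinD[OF assms])
  then show ?thesis by (simp add: S_mult)
qed

lemma sw_antipode_left':
  assumes "hlin s g"
  shows "sw s (\<lambda>u v. g (S v * u)) x = s (eps x) (g 1)"
proof -
  have "sw s (\<lambda>u v. g (S (S u * v))) x = s (eps x) (g (S 1))"
    by (rule sw_antipode_left[where g = "\<lambda>z. g (S z)"]) (simp add: hlin_def hsimps hlinD[OF assms])
  then show ?thesis by (simp add: S_mult)
qed

text \<open>S reverses the coproduct by the same uniqueness of inverses. \<open>G z w\<close> is
  \<open>b\<close> applied to \<Delta>(z) (S(w^2) \<otimes> S(w^1)), and \<open>Z\<close> is the sum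
  G(S(x^1) x^2, x^3). Either S(x^1) x^2 collapses, or \<Delta>(x^2) collapses against the factor
  made from x^3.\<close>

lemma sw_S:
  assumes vs: "vector_space s" and "blin s b"
  shows "sw s b (S x) = sw s (\<lambda>x1 x2. b (S x2) (S x1)) x"
proof -
  interpret V: vector_space s by fact
  have b: "hlin s (b u)" "hlin s (\<lambda>u. b u v)" for u v using assms(2) by (auto simp: blin_iff)
  note bs = hlinD[OF b(1)] hlinD[OF b(2)]
  define G where "G z w = sw s (\<lambda>z1 z2. sw s (\<lambda>c d. b (z1 * S d) (z2 * S c)) w) z" for z w
  have Glin: "hlin s (\<lambda>z. G z w)" for w
    unfolding G_def by (rule sw_linear_arg[OF vs])
  have Glin2: "hlin s (G z)" for z
  proof -
    have *: "hlin s (sw s (\<lambda>c d. b (z1 * S d) (z2 * S c)))" for z1 z2 by (rule sw_linear_arg[OF vs])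
    show ?thesis unfolding G_def
      by (rule hlinI) (simp_all add: hlinD[OF *] sw_add[OF vs] sw_scale[OF vs])
  qed
  have G1: "G 1 w = sw s (\<lambda>c d. b (S d) (S c)) w" for w
  proof -
    have "blin s (\<lambda>z1 z2. sw s (\<lambda>c d. b (z1 * S d) (z2 * S c)) w)"
      by (simp add: blin_iff hlin_def hsimps bs sw_add[OF vs] sw_scale[OF vs])
    then show ?thesis unfolding G_def by (subst sw_one[OF vs]) simp_all
  qed
  define Z where "Z = sw s (\<lambda>u w. sw s (\<lambda>x1 r. G (S x1 * r) w) u) x"
  have "Z = sw s (\<lambda>u w. s (eps u) (G 1 w)) x"
    unfolding Z_def using sw_antipode_left[OF Glin] by simp
  also have "\<dots> = G 1 x" by (rule sw_counit_left[OF Glin2])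
  finally have 1: "Z = sw s (\<lambda>c d. b (S d) (S c)) x" by (simp add: G1)
  have Gm: "G (a * r) w = sw s (\<lambda>p q. sw s (\<lambda>r1 r2. sw s (\<lambda>c d. b (p * r1 * S d) (q * r2 * S c)) w) r) a" for a r w
    unfolding G_def
    by (rule sw_mult[OF vs]) (simp add: blin_iff hlin_def hsimps bs sw_add[OF vs] sw_scale[OF vs])
  have col1: "sw s (\<lambda>r2 c. b (p * r1 * S d) (q * r2 * S c)) v = s (eps v) (b (p * r1 * S d) q)" for p q r1 d v
    using sw_antipode_right[of s "\<lambda>z. b (p * r1 * S d) (q * z)" v]
    by (simp add: hlin_def hsimps bs mult.assoc)
  have col2: "sw s (\<lambda>r1 d. b (p * r1 * S d) q) v = s (eps v) (b p q)" for p q v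
    using sw_antipode_right[of s "\<lambda>z. b (p * z) q" v]
    by (simp add: hlin_def hsimps bs mult.assoc)
  have inner: "sw s (\<lambda>r w. G (a * r) w) t = s (eps t) (sw s b a)" for a t
  proof -
    have "sw s (\<lambda>r w. G (a * r) w) t
        = sw s (\<lambda>p q. sw s (\<lambda>r w. sw s (\<lambda>r1 r2. sw s (\<lambda>c d. b (p * r1 * S d) (q * r2 * S c)) w) r) t) a"
      unfolding Gm by (rule sw_swap[OF vs])
    also have "\<dots> = sw s (\<lambda>p q. s (eps t) (b p q)) a"
    proof (rule arg_cong[where f = "\<lambda>b. sw s b a"], intro ext)
      fix p q
      have "sw s (\<lambda>r w. sw s (\<lambda>r1 r2. sw s (\<lambda>c d. b (p * r1 * S d) (q * r2 * S c)) w) r) t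
          = sw s (\<lambda>r1 t'. sw s (\<lambda>r2 w. sw s (\<lambda>c d. b (p * r1 * S d) (q * r2 * S c)) w) t') t"
        by (rule sw_coassoc[OF vs])
      also have "\<dots> = sw s (\<lambda>r1 t'. sw s (\<lambda>v d. sw s (\<lambda>r2 c. b (p * r1 * S d) (q * r2 * S c)) v) t') t"
        by (subst sw_coassoc[OF vs]) (rule refl)
      also have "\<dots> = sw s (\<lambda>r1 t'. sw s (\<lambda>v d. s (eps v) (b (p * r1 * S d) q)) t') t"
        by (simp only: col1)
      also have "\<dots> = sw s (\<lambda>r1 d. b (p * r1 * S d) q) t"
        by (subst sw_counit_left) (simp_all add: hlin_def hsimps bs)
      also have "\<dots> = s (eps t) (b p q)" by (rule col2)
      finally show "sw s (\<lambda>r w. sw s (\<lambda>r1 r2. sw s (\<lambda>c d. b (p * r1 * S d) (q * r2 * S c)) w) r) t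
        = s (eps t) (b p q)" .
    qed
    finally show ?thesis by (simp add: sw_scale[OF vs])
  qed
  then have inner': "sw s (\<lambda>r. G (a * r)) = (\<lambda>t. s (eps t) (sw s b a))" for a
    by (intro ext)
  have "Z = sw s (\<lambda>x1 t. s (eps t) (sw s b (S x1))) x"
    unfolding Z_def by (subst sw_coassoc[OF vs]) (simp only: inner')
  also have "\<dots> = sw s b (S x)"
    by (rule sw_counit_right[where g = "\<lambda>x. sw s b (S x)"])
      (simp add: hlin_def hlin_S hlinD[OF sw_linear_arg[OF vs]])
  finally show ?thesis using 1 by simp
qed

section \<open>Traces and the two integrals\<close>

definition tr :: "('h \<Rightarrow> 'h) \<Rightarrow> 'k" where
  "tr T = (\<Sum>b\<in>Bs. co b (T b))"

lemma tr_comm: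
  assumes "hlin hs T" "hlin hs T'"
  shows "tr (\<lambda>y. T (T' y)) = tr (\<lambda>y. T' (T y))"
proof -
  have e: "co b (T (T' b')) = (\<Sum>c\<in>Bs. co c (T' b') * co b (T c))"
    if "hlin hs T" for T T' and b b' :: 'h
    using hlin_expand[of "(*)" "\<lambda>y. co b (T y)" "T' b'"] hlinD[OF that] by (simp add: hlin_def)
  have "tr (\<lambda>y. T (T' y)) = (\<Sum>b\<in>Bs. \<Sum>c\<in>Bs. co c (T' b) * co b (T c))"
    by (simp add: tr_def e[OF assms(1)])
  also have "\<dots> = (\<Sum>c\<in>Bs. \<Sum>b\<in>Bs. co b (T c) * co c (T' b))"
    by (subst sum.swap) (simp add: mult.commute)
  also have "\<dots> = tr (\<lambda>y. T' (T y))"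
    by (simp add: tr_def e[OF assms(2)])
  finally show ?thesis .
qed

lemma tr_sw: "tr (\<lambda>y. sw hs (\<lambda>u v. T u v y) x) = sw (*) (\<lambda>u v. tr (T u v)) x"
proof -
  have "tr (\<lambda>y. sw hs (\<lambda>u v. T u v y) x) = (\<Sum>b\<in>Bs. \<Sum>u\<in>Bs. \<Sum>v\<in>Bs. cf u v x * co b (T u v b))"
    by (simp add: tr_def sw_def)
  also have "\<dots> = (\<Sum>u\<in>Bs. \<Sum>b\<in>Bs. \<Sum>v\<in>Bs. cf u v x * co b (T u v b))"
    by (rule sum.swap)
  also have "\<dots> = (\<Sum>u\<in>Bs. \<Sum>v\<in>Bs. \<Sum>b\<in>Bs. cf u v x * co b (T u v b))"
    by (intro sum.cong refl sum.swap)
  finally show ?thesis by (simp add: sw_def tr_def sum_distrib_left)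
qed

lemma tr_sum: "tr (\<lambda>y. \<Sum>i\<in>I. T i y) = (\<Sum>i\<in>I. tr (T i))"
  unfolding tr_def by (simp add: sum.swap[of _ I])

lemma tr_scale: "tr (\<lambda>y. c *h T y) = c * tr T"
  by (simp add: tr_def sum_distrib_left)

lemma tr_id: "tr (\<lambda>y. y) = of_nat (card Bs)"
  by (simp add: tr_def co_basis)

text \<open>The basis is nonempty because 0 and 1 differ in \<open>H\<close>, and in characteristic
  0 its cardinality is then nonzero.\<close>

lemma card_Bs: "(of_nat (card Bs) :: 'k) \<noteq> 0"
proof -
  have "Bs \<noteq> {}" using co_expand[of 1] by (metis sum.empty zero_neq_one)
  then show ?thesis by (simp add: fdv.finite_Basis)
qed

text \<open>The character of the left regular representation. Being a trace it is symmetric, which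
  later gives the equivariance of the average over \<open>al\<close>.\<close>

definition lam :: "'h \<Rightarrow> 'k" where
  "lam h = tr (\<lambda>y. h * y)"

lemma lam_linear: "lam (x + y) = lam x + lam y" "lam (c *h x) = c * lam x"
  by (simp_all add: lam_def tr_def hsimps sum.distrib sum_distrib_left)

lemma lam_commute: "lam (x * y) = lam (y * x)"
  using tr_comm[of "\<lambda>z. x * z" "\<lambda>z. y * z"] by (simp add: lam_def hlin_def hsimps mult.assoc)

lemma lam_one: "lam 1 = of_nat (card Bs)"
  by (simp add: lam_def tr_id)

text \<open>The functional \<open>lam\<close> is an integral: the operator with trace \<open>f(h\<^sup>1) lam(h\<^sup>2)\<close> is a sum of conjugates
  \<open>U\<^sub>c L\<^sub>h W\<^sub>c\<close> of the left multiplication \<open>L\<^sub>h\<close> with \<open>\<Sum> W\<^sub>c U\<^sub>c = f(1)\<close>.\<close>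

lemma lam_integral_functional:
  assumes f: "hlin (*) f"
  shows "sw (*) (\<lambda>h1 h2. f h1 * lam h2) h = f 1 * lam h"
proof -
  note vs = vector_space_axioms
  \<comment> \<open>Contracting the basis index uses that the sum over c of
    \<open>co c (S y1)\<close> f(x c) is f(x S(y^1)). So the families \<open>U c\<close> and
    \<open>W c\<close> encode b \<mapsto> f(b^1 _) b^2 and y \<mapsto> S(y^1) \<otimes> y^2, with
    the shared factor \<open>H\<close> split into coordinates.\<close>
  define U where "U c b = sw hs (\<lambda>b1 b2. f (b1 * c) *h b2) b" for c b
  define W where "W c y = sw hs (\<lambda>y1 y2. co c (S y1) *h y2) y" for c y
  have U: "hlin hs (U c)" and W: "hlin hs (W c)" for c
    unfolding U_def W_def by (rule sw_linear_arg[OF vs])+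
  note fs = hlinD[OF f]
  have fexp: "(\<Sum>c\<in>Bs. co c z * f (x * c)) = f (x * z)" for x z
    using hlin_expand[of "(*)" "\<lambda>c. f (x * c)" z] by (simp add: hlin_def hsimps fs)
  have UW: "(\<Sum>c\<in>Bs. U c (h * W c y)) = sw hs (\<lambda>h1 h2. f h1 *h (h2 * y)) h" for y
  proof -
    have U2: "U c (h * y2) = sw hs (\<lambda>h1 h2. sw hs (\<lambda>u1 u2. f (h1 * u1 * c) *h (h2 * u2)) y2) h" for c y2
      unfolding U_def by (rule sw_mult[OF vs]) (simp add: blin_iff hlin_def hsimps fs scale_left_distrib mult_ac)
    have "U c (h * W c y) = sw hs (\<lambda>y1 y2. co c (S y1) *h U c (h * y2)) y" for c
      unfolding W_def using sw_push[of "\<lambda>z. U c (h * z)" hs hs "\<lambda>y1 y2. co c (S y1) *h y2" y]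
      by (simp add: hlinD[OF U] hsimps)
    then have "(\<Sum>c\<in>Bs. U c (h * W c y))
      = (\<Sum>c\<in>Bs. sw hs (\<lambda>y1 y2. sw hs (\<lambda>h1 h2. sw hs (\<lambda>u1 u2. (co c (S y1) * f (h1 * u1 * c)) *h (h2 * u2)) y2) h) y)"
      by (simp add: U2 sw_scale[OF vs, symmetric])
    also have "\<dots> = sw hs (\<lambda>y1 y2. \<Sum>c\<in>Bs. sw hs (\<lambda>h1 h2. sw hs (\<lambda>u1 u2. (co c (S y1) * f (h1 * u1 * c)) *h (h2 * u2)) y2) h) y"
      by (rule sw_sum[symmetric, OF vs])
    also have "\<dots> = sw hs (\<lambda>y1 y2. sw hs (\<lambda>h1 h2. sw hs (\<lambda>u1 u2. f (h1 * u1 * S y1) *h (h2 * u2)) y2) h) y"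
      by (simp add: sw_sum[symmetric, OF vs] scale_sum_left[symmetric] fexp)
    also have "\<dots> = sw hs (\<lambda>h1 h2. sw hs (\<lambda>y1 y2. sw hs (\<lambda>u1 u2. f (h1 * u1 * S y1) *h (h2 * u2)) y2) y) h"
      by (rule sw_swap[OF vs])
    also have "\<dots> = sw hs (\<lambda>h1 h2. sw hs (\<lambda>p u2. sw hs (\<lambda>y1 u1. f (h1 * u1 * S y1) *h (h2 * u2)) p) y) h"
      by (simp add: sw_coassoc[OF vs, symmetric])
    also have "\<dots> = sw hs (\<lambda>h1 h2. sw hs (\<lambda>p u2. eps p *h (f h1 *h (h2 * u2))) y) h"
    proof -
      \<comment> \<open>The product is u1 S(y1), although y1 precedes u1 in the coproduct; this
        antipode identity with exchanged factors is where S^2 = Id enters.\<close>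
      have "sw hs (\<lambda>y1 u1. f (h1 * u1 * S y1) *h (h2 * u2)) p = eps p *h (f h1 *h (h2 * u2))" for h1 h2 u2 p
        using sw_antipode_right'[of hs "\<lambda>z. f (h1 * z) *h (h2 * u2)" p]
        by (simp add: hlin_def hsimps fs scale_left_distrib mult.assoc)
      then show ?thesis by simp
    qed
    also have "\<dots> = sw hs (\<lambda>h1 h2. f h1 *h (h2 * y)) h"
      by (subst sw_counit_left) (simp_all add: hlin_def hsimps mult_ac)
    finally show ?thesis .
  qed
  have WU: "(\<Sum>c\<in>Bs. W c (U c b)) = f 1 *h b" for b
  proof -
    have "W c (U c b) = sw hs (\<lambda>b1 b2. sw hs (\<lambda>y1 y2. (co c (S y1) * f (b1 * c)) *h y2) b2) b" for c
    proof -
      have "W c (U c b) = sw hs (\<lambda>b1 b2. f (b1 * c) *h W c b2) b"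
        unfolding U_def using sw_push[of "W c" hs hs "\<lambda>b1 b2. f (b1 * c) *h b2" b] by (simp add: hlinD[OF W])
      then show ?thesis unfolding W_def by (simp add: sw_scale[OF vs, symmetric] mult.commute)
    qed
    then have "(\<Sum>c\<in>Bs. W c (U c b)) = sw hs (\<lambda>b1 b2. sw hs (\<lambda>y1 y2. f (b1 * S y1) *h y2) b2) b"
      by (simp add: sw_sum[symmetric, OF vs] scale_sum_left[symmetric] fexp)
    also have "\<dots> = sw hs (\<lambda>p y2. sw hs (\<lambda>b1 y1. f (b1 * S y1) *h y2) p) b"
      by (rule sw_coassoc[OF vs, symmetric])
    also have "\<dots> = sw hs (\<lambda>p y2. eps p *h (f 1 *h y2)) b"
    proof -
      have "sw hs (\<lambda>b1 y1. f (b1 * S y1) *h y2) p = eps p *h (f 1 *h y2)" for p y2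
        using sw_antipode_right[of hs "\<lambda>z. f z *h y2" p] by (simp add: hlin_def fs scale_left_distrib)
      then show ?thesis by simp
    qed
    also have "\<dots> = f 1 *h b"
      by (subst sw_counit_left) (simp_all add: hlin_def hsimps mult_ac)
    finally show ?thesis .
  qed
  have "sw (*) (\<lambda>h1 h2. f h1 * lam h2) h = tr (\<lambda>y. sw hs (\<lambda>h1 h2. f h1 *h (h2 * y)) h)"
    by (simp add: tr_sw tr_scale lam_def)
  also have "\<dots> = (\<Sum>c\<in>Bs. tr (\<lambda>y. U c (h * W c y)))"
    by (simp add: UW[symmetric] tr_sum)
  also have "\<dots> = (\<Sum>c\<in>Bs. tr (\<lambda>y. h * W c (U c y)))"
    by (intro sum.cong refl tr_comm[OF U]) (simp add: hlin_def hsimps hlinD[OF W])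
  also have "\<dots> = tr (\<lambda>y. h * (f 1 *h y))"
    by (simp add: tr_sum[symmetric] sum_distrib_left[symmetric] WU)
  also have "\<dots> = f 1 * lam h"
    by (simp add: hsimps tr_scale lam_def)
  finally show ?thesis .
qed

text \<open>The functional version for every coordinate is an identity in \<open>H\<close>, to which
  an arbitrary linear \<open>g\<close> can be applied.\<close>

lemma lam_integral:
  assumes "hlin s g"
  shows "sw s (\<lambda>h1 h2. s (lam h2) (g h1)) h = s (lam h) (g 1)"
proof -
  have "sw hs (\<lambda>h1 h2. lam h2 *h h1) h = lam h *h 1"
  proof (rule eq_by_co)
    fix a
    have "co a (sw hs (\<lambda>h1 h2. lam h2 *h h1) h) = sw (*) (\<lambda>h1 h2. co a (lam h2 *h h1)) h"
      by (rule sw_push) simp_all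
    then show "co a (sw hs (\<lambda>h1 h2. lam h2 *h h1) h) = co a (lam h *h 1)"
      using lam_integral_functional[of "co a" h] by (simp add: hlin_def mult.commute)
  qed
  then have "s (lam h) (g 1) = g (sw hs (\<lambda>h1 h2. lam h2 *h h1) h)" by (simp add: hlinD[OF assms])
  also have "\<dots> = sw s (\<lambda>h1 h2. g (lam h2 *h h1)) h" by (rule sw_push) (simp_all add: hlinD[OF assms])
  finally show ?thesis by (simp add: hlinD[OF assms])
qed

text \<open>The form lam(h S(l)) lets a coproduct leg pass from h to l. It is the analogue, for the
  algebra dual to \<open>H\<close>, of the Casimir element of a separable algebra, and it makes the
  average \<open>avC\<close> commute with \<open>al\<close>. The proof expands lam(h y^2) by the
  integral property at the product h y^2 and cancels a leg of y^2 against S(y^1).\<close>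

lemma lam_casimir:
  assumes vs: "vector_space s" and \<phi>: "hlin s \<phi>"
  shows "sw s (\<lambda>h1 h2. s (lam (h2 * S l)) (\<phi> h1)) h = sw s (\<lambda>l1 l2. s (lam (h * S l1)) (\<phi> l2)) l"
proof -
  interpret V: vector_space s by fact
  note ps = hlinD[OF \<phi>] lam_linear V.scale_left_distrib V.scale_right_distrib mult_ac
  have main: "sw s (\<lambda>y1 y2. s (lam (h * y2)) (\<phi> (S y1))) y = sw s (\<lambda>h1 h2. s (lam (h2 * y)) (\<phi> h1)) h" for y
  proof -
    have "s (lam (h * y2)) (\<phi> (S y1)) = sw s (\<lambda>h1 h2. sw s (\<lambda>u1 u2. s (lam (h2 * u2)) (\<phi> (h1 * u1 * S y1))) y2) h" for y1 y2
    proof -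
      have "s (lam (h * y2)) (\<phi> (S y1)) = sw s (\<lambda>z1 z2. s (lam z2) (\<phi> (z1 * S y1))) (h * y2)"
        using lam_integral[of s "\<lambda>z. \<phi> (z * S y1)" "h * y2"] by (simp add: hlin_def distrib_right scale_mult_left hlinD[OF \<phi>])
      also have "\<dots> = sw s (\<lambda>h1 h2. sw s (\<lambda>u1 u2. s (lam (h2 * u2)) (\<phi> (h1 * u1 * S y1))) y2) h"
        by (rule sw_mult[OF vs])
          (simp add: blin_iff hlin_def hlinD[OF \<phi>] lam_linear distrib_right scale_mult_left
            V.scale_left_distrib V.scale_right_distrib mult.commute)
      finally show ?thesis .
    qed
    then have "sw s (\<lambda>y1 y2. s (lam (h * y2)) (\<phi> (S y1))) y
      = sw s (\<lambda>y1 y2. sw s (\<lambda>h1 h2. sw s (\<lambda>u1 u2. s (lam (h2 * u2)) (\<phi> (h1 * u1 * S y1))) y2) h) y"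
      by simp
    also have "\<dots> = sw s (\<lambda>h1 h2. sw s (\<lambda>y1 y2. sw s (\<lambda>u1 u2. s (lam (h2 * u2)) (\<phi> (h1 * u1 * S y1))) y2) y) h"
      by (rule sw_swap[OF vs])
    also have "\<dots> = sw s (\<lambda>h1 h2. sw s (\<lambda>r u2. sw s (\<lambda>y1 u1. s (lam (h2 * u2)) (\<phi> (h1 * u1 * S y1))) r) y) h"
      by (simp add: sw_coassoc[OF vs, symmetric])
    also have "\<dots> = sw s (\<lambda>h1 h2. sw s (\<lambda>r u2. s (eps r) (s (lam (h2 * u2)) (\<phi> h1))) y) h"
    proof -
      have "sw s (\<lambda>y1 u1. s (lam (h2 * u2)) (\<phi> (h1 * u1 * S y1))) r = s (eps r) (s (lam (h2 * u2)) (\<phi> h1))" for h1 h2 u2 r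
        using sw_antipode_right'[of s "\<lambda>z. s (lam (h2 * u2)) (\<phi> (h1 * z))" r]
        by (simp add: hlin_def distrib_left scale_mult_right hlinD[OF \<phi>] V.scale_right_distrib mult.assoc mult.commute)
      then show ?thesis by simp
    qed
    also have "\<dots> = sw s (\<lambda>h1 h2. s (lam (h2 * y)) (\<phi> h1)) h"
      by (subst sw_counit_left) (simp_all add: hlin_def distrib_left scale_mult_right lam_linear V.scale_left_distrib)
    finally show ?thesis .
  qed
  \<comment> \<open>At y = S(l) the coproduct is reversed by \<open>sw_S\<close>, and the second
    application of S is undone by S S = Id.\<close>
  have "sw s (\<lambda>y1 y2. s (lam (h * y2)) (\<phi> (S y1))) (S l) = sw s (\<lambda>l1 l2. s (lam (h * S l1)) (\<phi> (S (S l2)))) l"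
    by (rule sw_S[OF vs])
      (simp add: blin_iff hlin_def hlinD[OF \<phi>] hlin_S lam_linear distrib_left scale_mult_right
        V.scale_left_distrib V.scale_right_distrib mult.commute)
  then show ?thesis using main[of "S l"] by simp
qed

text \<open>The integral in \<open>H\<close>, obtained from \<open>lam\<close> by duality: \<open>f(Lam)\<close> is the trace of \<open>y \<mapsto> f(y\<^sup>1) y\<^sup>2\<close>.\<close>

definition Lam :: 'h where
  "Lam = (\<Sum>b\<in>Bs. sw hs (\<lambda>b1 b2. co b b2 *h b1) b)"

lemma Lam_functional:
  assumes f: "hlin (*) f"
  shows "f Lam = tr (\<lambda>y. sw hs (\<lambda>y1 y2. f y1 *h y2) y)"
proof -
  have "f Lam = (\<Sum>b\<in>Bs. sw (*) (\<lambda>b1 b2. f (co b b2 *h b1)) b)"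
    unfolding Lam_def hlin_sum[OF f]
    by (intro sum.cong refl sw_push) (simp_all add: hlinD[OF f])
  also have "\<dots> = (\<Sum>b\<in>Bs. co b (sw hs (\<lambda>y1 y2. f y1 *h y2) b))"
    by (intro sum.cong refl) (subst sw_push[where s' = "(*)"], simp_all add: hlinD[OF f] mult.commute)
  finally show ?thesis by (simp add: tr_def)
qed

lemma eps_Lam: "eps Lam = of_nat (card Bs)"
proof -
  have "eps Lam = tr (\<lambda>y. sw hs (\<lambda>y1 y2. eps y1 *h y2) y)"
    by (rule Lam_functional) (simp add: hlin_def)
  also have "\<dots> = tr (\<lambda>y. y)" using sw_counit_left[OF hlin_id] by simp
  finally show ?thesis by (simp add: tr_id)
qed

text \<open>For a coordinate f, the value f(Lam x) is the trace of y \<mapsto> f(y^1 x) y^2. This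
  map is the sum of y \<mapsto> R(y x^1) S(x^2); cyclicity of the trace moves S(x^2) inside, giving
  R(y S(x^2) x^1), and the antipode identity with exchanged factors leaves \<epsilon>(x).\<close>

lemma Lam_integral: "Lam * x = eps x *h Lam"
proof (rule eq_by_co)
  note vs = vector_space_axioms
  fix a
  let ?f = "co a"
  define R where "R y = sw hs (\<lambda>y1 y2. ?f y1 *h y2) y" for y
  have R: "hlin hs R" unfolding R_def by (rule sw_linear_arg[OF vs])
  have Rx: "sw hs (\<lambda>y1 y2. ?f (y1 * x) *h y2) y = sw hs (\<lambda>p q. R (y * p) * S q) x" for y
  proof -
    have "R (y * p) * S q = sw hs (\<lambda>y1 y2. sw hs (\<lambda>p1 p2. ?f (y1 * p1) *h (y2 * (p2 * S q))) p) y" for p q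
    proof -
      have "R (y * p) = sw hs (\<lambda>y1 y2. sw hs (\<lambda>p1 p2. ?f (y1 * p1) *h (y2 * p2)) p) y"
        unfolding R_def by (rule sw_mult[OF vs]) (simp add: blin_iff hlin_def hsimps scale_left_distrib mult_ac)
      then show ?thesis
        using sw_push[of "\<lambda>z. z * S q" hs hs] by (simp add: hsimps mult.assoc)
    qed
    then have "sw hs (\<lambda>p q. R (y * p) * S q) x
        = sw hs (\<lambda>p q. sw hs (\<lambda>y1 y2. sw hs (\<lambda>p1 p2. ?f (y1 * p1) *h (y2 * (p2 * S q))) p) y) x"
      by simp
    also have "\<dots> = sw hs (\<lambda>y1 y2. sw hs (\<lambda>p q. sw hs (\<lambda>p1 p2. ?f (y1 * p1) *h (y2 * (p2 * S q))) p) x) y"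
      by (rule sw_swap[OF vs])
    also have "\<dots> = sw hs (\<lambda>y1 y2. sw hs (\<lambda>p1 t. sw hs (\<lambda>p2 q. ?f (y1 * p1) *h (y2 * (p2 * S q))) t) x) y"
      by (simp add: sw_coassoc[OF vs])
    also have "\<dots> = sw hs (\<lambda>y1 y2. sw hs (\<lambda>p1 t. eps t *h (?f (y1 * p1) *h y2)) x) y"
    proof -
      have "sw hs (\<lambda>p2 q. ?f (y1 * p1) *h (y2 * (p2 * S q))) t = eps t *h (?f (y1 * p1) *h y2)" for y1 y2 p1 t
        using sw_antipode_right[of hs "\<lambda>z. ?f (y1 * p1) *h (y2 * z)" t] by (simp add: hlin_def hsimps mult_ac)
      then show ?thesis by simp
    qed
    also have "\<dots> = sw hs (\<lambda>y1 y2. ?f (y1 * x) *h y2) y"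
      by (subst sw_counit_right) (simp_all add: hlin_def hsimps scale_left_distrib)
    finally show ?thesis by simp
  qed
  have "?f (Lam * x) = tr (\<lambda>y. sw hs (\<lambda>y1 y2. ?f (y1 * x) *h y2) y)"
    by (rule Lam_functional[where f = "\<lambda>z. ?f (z * x)"]) (simp add: hlin_def hsimps)
  also have "\<dots> = sw (*) (\<lambda>p q. tr (\<lambda>y. R (y * p) * S q)) x"
    unfolding Rx by (rule tr_sw)
  also have "\<dots> = sw (*) (\<lambda>p q. tr (\<lambda>y. R (y * (S q * p)))) x"
  proof -
    have "tr (\<lambda>y. R (y * p) * S q) = tr (\<lambda>y. R (y * (S q * p)))" for p q
      using tr_comm[of "\<lambda>z. z * S q" "\<lambda>y. R (y * p)"] by (simp add: hlin_def hsimps hlinD[OF R] mult.assoc)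
    then show ?thesis by simp
  qed
  also have "\<dots> = eps x * tr (\<lambda>y. R (y * 1))"
    by (rule sw_antipode_left'[where g = "\<lambda>z. tr (\<lambda>y. R (y * z))"])
      (simp add: hlin_def hsimps hlinD[OF R] tr_def sum.distrib sum_distrib_left)
  also have "\<dots> = eps x * ?f Lam"
    using Lam_functional[of ?f] by (simp add: R_def hlin_def)
  finally show "?f (Lam * x) = ?f (eps x *h Lam)" by simp
qed

end

section \<open>Averaging over an involutive Hopf algebra\<close>

text \<open>A contramodule structure on a type \<open>'v\<close>. The unit of \<open>H\<close> acts by an idempotent, so that the structure of
  a contramodule on a subset can be transported along a linear section.\<close>

locale vcontra = involutive_hopf H + V: vector_space sV
  for H :: "('k::field_char_0, 'h::ring_1) hopf" and sV :: "'k \<Rightarrow> 'v::ab_group_add \<Rightarrow> 'v" (infixr \<open>*v\<close> 75) +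
  fixes A :: "'h \<Rightarrow> 'v \<Rightarrow> 'v" and al :: "('h \<Rightarrow> 'v) \<Rightarrow> 'v"
  assumes A_lin: "A (x + y) v = A x v + A y v" "A (c *h x) v = c *v A x v"
      "A x (v + w) = A x v + A x w" "A x (c *v v) = c *v A x v"
    and A_mult: "A (x * y) v = A x (A y v)"
    and al_add: "hlin sV \<phi> \<Longrightarrow> hlin sV \<psi> \<Longrightarrow> al (\<lambda>h. \<phi> h + \<psi> h) = al \<phi> + al \<psi>"
    and al_scale: "hlin sV \<phi> \<Longrightarrow> al (\<lambda>h. c *v \<phi> h) = c *v al \<phi>"
    and al_counit: "al (\<lambda>h. eps h *v v) = A 1 v"
    and al_assoc: "blin sV F \<Longrightarrow> al (\<lambda>h. al (F h)) = al (sw sV F)"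
    and A_al: "hlin sV \<phi> \<Longrightarrow> A x (al \<phi>)
      = al (\<lambda>h. sw sV (\<lambda>x1 t. sw sV (\<lambda>x2 x3. A x2 (\<phi> (S x3 * h * x1))) t) x)"
begin

lemma vs: "vector_space sV" by (rule V.vector_space_axioms)

section \<open>Natural endomorphisms\<close>

definition vlin :: "('v \<Rightarrow> 'v) \<Rightarrow> bool" where
  "vlin f \<longleftrightarrow> (\<forall>v w. f (v + w) = f v + f w) \<and> (\<forall>c v. f (c *v v) = c *v f v)"

lemma vlinD: assumes "vlin f" shows "f (v + w) = f v + f w" "f (c *v v) = c *v f v"
  using assms by (auto simp: vlin_def)

definition natural :: "('v \<Rightarrow> 'v) \<Rightarrow> bool" where
  "natural f \<longleftrightarrow> vlin f \<and> (\<forall>x v. f (A x v) = A x (f v)) \<and> (\<forall>\<phi>. hlin sV \<phi> \<longrightarrow> f (al \<phi>) = al (\<lambda>h. f (\<phi> h)))"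

lemma naturalD:
  assumes "natural f"
  shows "vlin f" "f (A x v) = A x (f v)" "hlin sV \<phi> \<Longrightarrow> f (al \<phi>) = al (\<lambda>h. f (\<phi> h))"
  using assms by (auto simp: natural_def)

lemma naturalI:
  assumes "vlin f" "\<And>x v. f (A x v) = A x (f v)" "\<And>\<phi>. hlin sV \<phi> \<Longrightarrow> f (al \<phi>) = al (\<lambda>h. f (\<phi> h))"
  shows "natural f"
  using assms by (auto simp: natural_def)

lemmas lins = A_lin V.scale_left_distrib V.scale_right_distrib lam_linear
  distrib_left distrib_right scale_mult_left scale_mult_right hlin_S

lemma hlin_vlin: "vlin f \<Longrightarrow> hlin sV \<phi> \<Longrightarrow> hlin sV (\<lambda>h. f (\<phi> h))"
  by (simp add: hlin_def vlin_def)

lemma hlin_zero: "hlin sV (\<lambda>_. 0)"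
  by (simp add: hlin_def)

lemma al_zero: "al (\<lambda>_. 0) = 0"
  using al_scale[OF hlin_zero, of 0] by simp

lemma hlin_sums: "(\<And>i. i \<in> I \<Longrightarrow> hlin sV (F i)) \<Longrightarrow> hlin sV (\<lambda>h. \<Sum>i\<in>I. F i h)"
  by (induction I rule: infinite_finite_induct) (auto simp: hlin_def V.scale_right_distrib algebra_simps)

lemma al_sum: "(\<And>i. hlin sV (F i)) \<Longrightarrow> al (\<lambda>h. \<Sum>i\<in>I. F i h) = (\<Sum>i\<in>I. al (F i))"
proof (induction I rule: infinite_finite_induct)
  case (insert i I)
  then show ?case using al_add[of "F i" "\<lambda>h. \<Sum>i\<in>I. F i h"] hlin_sums[of I F] by simp
qed (simp_all add: al_zero)

lemma hlin_scale: "hlin sV \<phi> \<Longrightarrow> hlin sV (\<lambda>h. c *v \<phi> h)"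
  by (simp add: hlin_def V.scale_right_distrib mult.commute)

lemma al_sw:
  assumes "\<And>u v. hlin sV (F u v)"
  shows "al (\<lambda>h. sw sV (\<lambda>u v. F u v h) x) = sw sV (\<lambda>u v. al (F u v)) x"
  unfolding sw_def
  by (subst al_sum, intro hlin_sums hlin_scale assms, subst al_sum, intro hlin_scale assms)
    (simp add: al_scale assms)

lemma hlin_al:
  assumes "\<And>h. hlin sV (F h)" "\<And>l. hlin sV (\<lambda>h. F h l)"
  shows "hlin sV (\<lambda>h. al (F h))"
proof (rule hlinI)
  fix x y c
  have "F (x + y) = (\<lambda>l. F x l + F y l)" "F (c *h x) = (\<lambda>l. c *v F x l)"
    using hlinD[OF assms(2)] by auto
  then show "al (F (x + y)) = al (F x) + al (F y)" "al (F (c *h x)) = c *v al (F x)"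
    by (simp_all add: al_add al_scale assms(1))
qed

lemma A_one_mult [simp]: "A 1 (A x v) = A x v" "A x (A 1 v) = A x v"
  by (simp_all add: A_mult[symmetric])

text \<open>The compatibility \<open>A_al\<close> at x = 1, where the iterated coproduct is 1
  \<otimes> 1 \<otimes> 1.\<close>

lemma natural_one: "natural (A 1)"
proof (rule naturalI)
  show "vlin (A 1)" by (simp add: vlin_def lins)
  fix \<phi> assume \<phi>: "hlin sV \<phi>"
  note p = hlinD[OF \<phi>]
  have 1: "sw sV (\<lambda>x2 x3. A x2 (\<phi> (S x3 * h * x1))) 1 = A 1 (\<phi> (h * x1))" for h x1
    by (subst sw_one[OF vs]) (simp_all add: blin_iff hlin_def lins p)
  have 2: "blin sV (\<lambda>x1. sw sV (\<lambda>x2 x3. A x2 (\<phi> (S x3 * h * x1))))" for h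
    by (simp add: blin_iff sw_linear_arg[OF vs]) (simp add: hlin_def lins p sw_add[OF vs] sw_scale[OF vs])
  show "A 1 (al \<phi>) = al (\<lambda>h. A 1 (\<phi> h))"
    by (simp only: A_al[OF \<phi>] sw_one[OF vs 2] mult_1_right 1[of _ 1, unfolded mult_1_right])
qed simp

definition sg :: "'v \<Rightarrow> 'v" where
  "sg v = al (\<lambda>h. A h v)"

lemma hlin_A: "hlin sV (\<lambda>h. A h v)"
  by (simp add: hlin_def lins)

text \<open>For the action, x^2 S(x^3) h x^1 collapses to h x. For \<open>al\<close>, the aYD
  compatibility gives two nested \<open>al\<close>; \<open>al_assoc\<close> merges their variables
  into one coproduct, in which S(h^3) h^4 collapses, and a second use of \<open>al_assoc\<close>
  separates the two remaining legs again.\<close>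

lemma natural_sg: "natural sg"
proof (rule naturalI)
  show "vlin sg" unfolding vlin_def sg_def by (simp add: lins al_add al_scale hlin_A)
next
  fix x v
  have "A x (sg v) = al (\<lambda>h. sw sV (\<lambda>x1 t. sw sV (\<lambda>x2 x3. A x2 (A (S x3 * h * x1) v)) t) x)"
    unfolding sg_def by (rule A_al[OF hlin_A])
  also have "\<dots> = al (\<lambda>h. sw sV (\<lambda>x1 t. eps t *v A (h * x1) v) x)"
  proof -
    have "sw sV (\<lambda>x2 x3. A x2 (A (S x3 * h * x1) v)) t = eps t *v A (h * x1) v" for h x1 t
      using sw_antipode_right[of sV "\<lambda>z. A (z * (h * x1)) v" t]
      by (simp add: hlin_def lins A_mult mult.assoc)
    then show ?thesis by simp
  qed
  also have "\<dots> = al (\<lambda>h. A (h * x) v)"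
    by (subst sw_counit_right) (simp_all add: hlin_def lins)
  finally show "sg (A x v) = A x (sg v)" by (simp add: sg_def A_mult)
next
  fix \<phi> assume \<phi>: "hlin sV \<phi>"
  note p = hlinD[OF \<phi>]
  define K where "K h1 h2 h3 w = A h2 (\<phi> (S h3 * w * h1))" for h1 h2 h3 w
  have K: "K (a + b) h2 h3 w = K a h2 h3 w + K b h2 h3 w" "K (c *h a) h2 h3 w = c *v K a h2 h3 w"
    "K h1 (a + b) h3 w = K h1 a h3 w + K h1 b h3 w" "K h1 (c *h a) h3 w = c *v K h1 a h3 w"
    "K h1 h2 (a + b) w = K h1 h2 a w + K h1 h2 b w" "K h1 h2 (c *h a) w = c *v K h1 h2 a w"
    "K h1 h2 h3 (a + b) = K h1 h2 h3 a + K h1 h2 h3 b" "K h1 h2 h3 (c *h a) = c *v K h1 h2 h3 a"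
    for a b c h1 h2 h3 w by (simp_all add: K_def lins p)
  define F where "F u w = sw sV (\<lambda>h1 t. sw sV (\<lambda>h2 h3. K h1 h2 h3 w) t) u" for u w
  have F: "blin sV F"
    by (simp add: blin_iff F_def sw_linear_arg[OF vs])
      (simp add: hlin_def F_def K sw_add[OF vs] sw_scale[OF vs])
  have col: "sw sV (\<lambda>h3 w. K h1 h2 h3 w) = (\<lambda>t. eps t *v A h2 (\<phi> h1))" for h1 h2
    using sw_antipode_left[of sV "\<lambda>z. A h2 (\<phi> (z * h1))"] by (intro ext) (simp add: K_def hlin_def lins p)
  have "sg (al \<phi>) = al (\<lambda>h. al (F h))"
    unfolding sg_def F_def K_def by (simp add: A_al[OF \<phi>])
  also have "\<dots> = al (sw sV F)" by (rule al_assoc[OF F])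
  also have "sw sV F = sw sV (\<lambda>h1 t. A t (\<phi> h1))"
  proof
    fix h
    have "sw sV F h = sw sV (\<lambda>u w. sw sV (\<lambda>h1 t. sw sV (\<lambda>h2 h3. K h1 h2 h3 w) t) u) h"
      by (rule sw_cong) (simp add: F_def)
    also have "\<dots> = sw sV (\<lambda>h1 t. sw sV (\<lambda>y w. sw sV (\<lambda>h2 h3. K h1 h2 h3 w) y) t) h"
      by (rule sw_coassoc[OF vs])
    also have "\<dots> = sw sV (\<lambda>h1 t. sw sV (\<lambda>h2 t'. sw sV (\<lambda>h3 w. K h1 h2 h3 w) t') t) h"
      by (subst sw_coassoc[OF vs]) (rule refl)
    also have "\<dots> = sw sV (\<lambda>h1 t. sw sV (\<lambda>h2 t'. eps t' *v A h2 (\<phi> h1)) t) h"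
      by (simp only: col)
    also have "\<dots> = sw sV (\<lambda>h1 t. A t (\<phi> h1)) h"
      by (subst sw_counit_right) (simp_all add: hlin_A)
    finally show "sw sV F h = sw sV (\<lambda>h1 t. A t (\<phi> h1)) h" .
  qed
  also have "al \<dots> = al (\<lambda>h. al (\<lambda>t. A t (\<phi> h)))"
    by (rule al_assoc[symmetric]) (simp add: blin_iff hlin_def lins p)
  finally show "sg (al \<phi>) = al (\<lambda>h. sg (\<phi> h))" by (simp add: sg_def)
qed

text \<open>Averaging over the action with the integral \<open>Lam\<close> makes a linear map equivariant, and averaging over \<open>al\<close>
  with the functional \<open>lam\<close> makes it commute with \<open>al\<close> while preserving equivariance.\<close>

definition avH :: "('v \<Rightarrow> 'v) \<Rightarrow> 'v \<Rightarrow> 'v" where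
  "avH y v = sw sV (\<lambda>a b. A (S a) (y (A b v))) Lam"

definition avC :: "('v \<Rightarrow> 'v) \<Rightarrow> 'v \<Rightarrow> 'v" where
  "avC y v = al (\<lambda>h. y (al (\<lambda>l. lam (h * S l) *v v)))"

lemma vlin_avH: "vlin y \<Longrightarrow> vlin (avH y)"
  unfolding vlin_def[of "avH y"] avH_def by (simp add: vlinD lins sw_add[OF vs] sw_scale[OF vs])

text \<open>Form the average with Lam x^2 in place of Lam, apply x^1, and compute the sum twice. The
  integral property gives x applied to the average; the coproduct of the product Lam x^2 gives a
  factor x^1 S(x^2) that collapses and leaves \<open>x\<close> inside \<open>y\<close>.\<close>

lemma avH_equivariant:
  assumes y: "vlin y"
  shows "avH y (A x v) = A x (avH y v)"
proof -
  note yl = vlinD[OF y]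
  define b0 where "b0 a b = A (S a) (y (A b v))" for a b
  have b0: "blin sV b0" by (simp add: blin_iff hlin_def b0_def lins yl)
  have A_push: "A p (sw sV f z) = sw sV (\<lambda>a b. A p (f a b)) z" for p f z
    by (rule sw_push) (simp_all add: lins)
  have "sw sV (\<lambda>p q. A p (sw sV b0 (Lam * q))) x = sw sV (\<lambda>p q. eps q *v A p (sw sV b0 Lam)) x"
    by (simp add: Lam_integral hlinD[OF sw_linear_arg[OF vs]] lins)
  also have "\<dots> = A x (sw sV b0 Lam)"
    by (rule sw_counit_right[OF hlin_A])
  also have "\<dots> = A x (avH y v)" by (simp add: avH_def b0_def[abs_def])
  finally have 1: "sw sV (\<lambda>p q. A p (sw sV b0 (Lam * q))) x = A x (avH y v)" .
  have "A p (sw sV b0 (Lam * q))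
      = sw sV (\<lambda>a b. sw sV (\<lambda>q1 q2. A (p * S q1) (A (S a) (y (A (b * q2) v)))) q) Lam" for p q
    unfolding sw_mult[OF vs b0] A_push b0_def by (simp add: S_mult A_mult)
  then have "sw sV (\<lambda>p q. A p (sw sV b0 (Lam * q))) x
      = sw sV (\<lambda>p q. sw sV (\<lambda>a b. sw sV (\<lambda>q1 q2. A (p * S q1) (A (S a) (y (A (b * q2) v)))) q) Lam) x"
    by simp
  also have "\<dots> = sw sV (\<lambda>a b. sw sV (\<lambda>p q. sw sV (\<lambda>q1 q2. A (p * S q1) (A (S a) (y (A (b * q2) v)))) q) x) Lam"
    by (rule sw_swap[OF vs])
  also have "\<dots> = sw sV (\<lambda>a b. sw sV (\<lambda>r q2. sw sV (\<lambda>p q1. A (p * S q1) (A (S a) (y (A (b * q2) v)))) r) x) Lam"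
    by (simp only: sw_coassoc[OF vs, symmetric])
  also have "\<dots> = sw sV (\<lambda>a b. sw sV (\<lambda>r q2. eps r *v A 1 (A (S a) (y (A (b * q2) v)))) x) Lam"
    using sw_antipode_right[OF hlin_A] by simp
  also have "\<dots> = sw sV (\<lambda>a b. A (S a) (y (A (b * x) v))) Lam"
    by (subst sw_counit_left) (simp_all add: hlin_def lins yl)
  also have "\<dots> = avH y (A x v)" by (simp add: avH_def A_mult)
  finally show ?thesis using 1 by simp
qed

lemma hlin_casimir: "hlin sV (\<lambda>l. lam (h * S l) *v v)" "hlin sV (\<lambda>h. lam (h * S l) *v v)"
  by (simp_all add: hlin_def lins)

lemma hlin_avC:
  assumes "vlin y" shows "hlin sV (\<lambda>h. y (al (\<lambda>l. lam (h * S l) *v v)))"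
  by (rule hlin_vlin[OF assms]) (rule hlin_al; rule hlin_casimir)

lemma al_casimir:
  "al (\<lambda>l. lam (h * S l) *v (v + w)) = al (\<lambda>l. lam (h * S l) *v v) + al (\<lambda>l. lam (h * S l) *v w)"
  "al (\<lambda>l. (lam (h * S l) * c) *v v) = c *v al (\<lambda>l. lam (h * S l) *v v)"
  using al_add[OF hlin_casimir(1) hlin_casimir(1), of h v h w] al_scale[OF hlin_casimir(1), of c h v]
  by (simp_all add: V.scale_right_distrib mult.commute)

lemma vlin_avC: assumes "vlin y" shows "vlin (avC y)"
  unfolding vlin_def avC_def
  using al_add[OF hlin_avC[OF assms] hlin_avC[OF assms]] al_scale[OF hlin_avC[OF assms]]
  by (simp add: al_casimir vlinD[OF assms])

text \<open>\<open>al_assoc\<close> turns the inner \<open>al\<close> over l and the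
  \<open>al\<close> of \<phi> into one over the coproduct of l; \<open>lam_casimir\<close> shifts
  that coproduct to the outer variable h; \<open>al_assoc\<close>, read backwards, splits h into two
  variables, one of which carries \<phi> outside the average.\<close>

lemma avC_al:
  assumes y: "vlin y" and \<phi>: "hlin sV \<phi>"
  shows "avC y (al \<phi>) = al (\<lambda>h. avC y (\<phi> h))"
proof -
  note yl = vlinD[OF y] and p = hlinD[OF \<phi>]
  define M where "M q h = y (al (\<lambda>l. lam (h * S l) *v \<phi> q))" for q h
  have M1: "hlin sV (M q)" for q unfolding M_def by (rule hlin_avC[OF y])
  have M: "blin sV M"
    by (simp add: blin_iff M1) (simp add: hlin_def M_def p al_casimir yl)
  have inner: "y (al (\<lambda>l. lam (h * S l) *v al \<phi>)) = sw sV M h" for h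
  proof -
    have "lam (h * S l) *v al \<phi> = al (\<lambda>q. lam (h * S l) *v \<phi> q)" for l
      by (rule al_scale[OF \<phi>, symmetric])
    then have "al (\<lambda>l. lam (h * S l) *v al \<phi>) = al (\<lambda>l. al (\<lambda>q. lam (h * S l) *v \<phi> q))"
      by simp
    also have "\<dots> = al (sw sV (\<lambda>l q. lam (h * S l) *v \<phi> q))"
      by (rule al_assoc) (simp add: blin_iff hlin_def lins p mult.commute)
    also have "\<dots> = al (\<lambda>l. sw sV (\<lambda>h1 h2. lam (h2 * S l) *v \<phi> h1) h)"
      by (rule arg_cong[where f = al], rule ext, rule lam_casimir[OF vs \<phi>, symmetric])
    also have "\<dots> = sw sV (\<lambda>h1 h2. al (\<lambda>l. lam (h2 * S l) *v \<phi> h1)) h"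
      by (rule al_sw[OF hlin_casimir(1)])
    finally have "y (al (\<lambda>l. lam (h * S l) *v al \<phi>)) = y \<dots>" by simp
    also have "\<dots> = sw sV M h"
      unfolding M_def by (rule sw_push) (simp_all add: yl)
    finally show ?thesis .
  qed
  have "avC y (al \<phi>) = al (sw sV M)" by (simp add: avC_def inner)
  also have "\<dots> = al (\<lambda>q. al (M q))" by (rule al_assoc[OF M, symmetric])
  finally show ?thesis by (simp add: avC_def M_def[abs_def])
qed

text \<open>In one fivefold coproduct the sum is G(x^1 S(x^2), x^4 S(x^5), x^3): both products
  consist of neighbouring legs and collapse, and the middle leg becomes x.\<close>

lemma sw_collapse5:
  assumes G: "\<And>a b c. hlin sV (\<lambda>a. G a b c)" "\<And>a b c. hlin sV (\<lambda>b. G a b c)" "\<And>a b c. hlin sV (\<lambda>c. G a b c)"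
  shows "sw sV (\<lambda>x1 t. sw sV (\<lambda>x2 x3. sw sV (\<lambda>u1 w. sw sV (\<lambda>u2 u3. G (x1 * S u1) (u3 * S x3) u2) w) x2) t) x
    = G 1 1 x"
proof -
  note g = hlinD[OF G(1)] hlinD[OF G(2)] hlinD[OF G(3)]
  have r: "sw sV (\<lambda>u3 x3. G a (u3 * S x3) u2) = (\<lambda>t. eps t *v G a 1 u2)" for a u2
    by (rule ext, rule sw_antipode_right[OF G(2)])
  have inner: "sw sV (\<lambda>x2 x3. sw sV (\<lambda>u1 w. sw sV (\<lambda>u2 u3. G (x1 * S u1) (u3 * S x3) u2) w) x2) t
      = sw sV (\<lambda>u1 t'. G (x1 * S u1) 1 t') t" for x1 t
  proof -
    have "sw sV (\<lambda>x2 x3. sw sV (\<lambda>u1 w. sw sV (\<lambda>u2 u3. G (x1 * S u1) (u3 * S x3) u2) w) x2) t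
        = sw sV (\<lambda>u1 t'. sw sV (\<lambda>w x3. sw sV (\<lambda>u2 u3. G (x1 * S u1) (u3 * S x3) u2) w) t') t"
      by (rule sw_coassoc[OF vs])
    also have "\<dots> = sw sV (\<lambda>u1 t'. sw sV (\<lambda>u2 t''. sw sV (\<lambda>u3 x3. G (x1 * S u1) (u3 * S x3) u2) t'') t') t"
      by (subst sw_coassoc[OF vs]) (rule refl)
    also have "\<dots> = sw sV (\<lambda>u1 t'. sw sV (\<lambda>u2 t''. eps t'' *v G (x1 * S u1) 1 u2) t') t"
      by (simp only: r)
    also have "\<dots> = sw sV (\<lambda>u1 t'. G (x1 * S u1) 1 t') t"
      by (subst sw_counit_right[OF G(3)]) (rule refl)
    finally show ?thesis .
  qed
  have "sw sV (\<lambda>x1 t. sw sV (\<lambda>u1 t'. G (x1 * S u1) 1 t') t) x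
      = sw sV (\<lambda>r t'. sw sV (\<lambda>x1 u1. G (x1 * S u1) 1 t') r) x"
    by (rule sw_coassoc[OF vs, symmetric])
  also have "\<dots> = sw sV (\<lambda>r t'. eps r *v G 1 1 t') x"
    by (simp add: sw_antipode_right[OF G(1)])
  also have "\<dots> = G 1 1 x" by (rule sw_counit_left[OF G(3)])
  finally show ?thesis by (simp only: inner)
qed

lemma avC_equivariant:
  assumes y: "vlin y" and yA: "\<And>x v. y (A x v) = A x (y v)"
  shows "avC y (A x v) = A x (avC y v)"
proof -
  note yl = vlinD[OF y]
  define G where "G h a b u = y (al (\<lambda>l. lam (h * a * S l * b) *v A u v))" for h a b u
  have hl: "hlin sV (\<lambda>l. lam (h * a * S l * b) *v A u v)" for h a b u
    by (simp add: hlin_def lins)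
  have G: "hlin sV (\<lambda>a. G h a b u)" "hlin sV (\<lambda>b. G h a b u)" "hlin sV (\<lambda>u. G h a b u)" for h a b u
    unfolding G_def
    by (rule hlin_vlin[OF y], rule hlin_al[OF hl], simp add: hlin_def lins mult.commute)+
  have inner: "A x2 (y (al (\<lambda>l. lam (S x3 * h * x1 * S l) *v v)))
      = sw sV (\<lambda>u1 w. sw sV (\<lambda>u2 u3. G h (x1 * S u1) (u3 * S x3) u2) w) x2" for x1 x2 x3 h
  proof -
    \<comment> \<open>S reverses S(u3) l u1 and is an involution; cyclicity of \<open>lam\<close>
      then carries S(x3) to the end, next to u3. This puts the legs in the order that
      \<open>sw_collapse5\<close> needs.\<close>
    have lamc: "lam (S x3 * h * x1 * S (S u3 * l * u1)) = lam (h * (x1 * S u1) * S l * (u3 * S x3))" for u1 u3 l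
      using lam_commute[of "S x3" "h * x1 * (S u1 * (S l * u3))"] by (simp add: S_mult mult.assoc)
    have "A x2 (y (al (\<lambda>l. lam (S x3 * h * x1 * S l) *v v)))
        = y (al (\<lambda>l. sw sV (\<lambda>u1 w. sw sV (\<lambda>u2 u3. A u2 (lam (S x3 * h * x1 * S (S u3 * l * u1)) *v v)) w) x2))"
      by (simp only: yA[symmetric] A_al[OF hlin_casimir(1)])
    also have "\<dots> = y (al (\<lambda>l. sw sV (\<lambda>u1 w. sw sV (\<lambda>u2 u3. lam (h * (x1 * S u1) * S l * (u3 * S x3)) *v A u2 v) w) x2))"
      by (simp only: lamc A_lin)
    also have "\<dots> = y (sw sV (\<lambda>u1 w. al (\<lambda>l. sw sV (\<lambda>u2 u3. lam (h * (x1 * S u1) * S l * (u3 * S x3)) *v A u2 v) w)) x2)"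
      by (subst al_sw) (simp_all add: hlin_def lins sw_add[OF vs] sw_scale[OF vs] V.scale_scale[symmetric] del: V.scale_scale)
    also have "\<dots> = y (sw sV (\<lambda>u1 w. sw sV (\<lambda>u2 u3. al (\<lambda>l. lam (h * (x1 * S u1) * S l * (u3 * S x3)) *v A u2 v)) w) x2)"
      by (simp only: al_sw[OF hl])
    also have "\<dots> = sw sV (\<lambda>u1 w. y (sw sV (\<lambda>u2 u3. al (\<lambda>l. lam (h * (x1 * S u1) * S l * (u3 * S x3)) *v A u2 v)) w)) x2"
      by (rule sw_push) (simp_all add: yl)
    also have "\<dots> = sw sV (\<lambda>u1 w. sw sV (\<lambda>u2 u3. G h (x1 * S u1) (u3 * S x3) u2) w) x2"
      unfolding G_def
      by (rule sw_cong, rule sw_push) (simp_all add: yl)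
    finally show ?thesis .
  qed
  have "A x (avC y v) = al (\<lambda>h. sw sV (\<lambda>x1 t. sw sV (\<lambda>x2 x3. A x2 (y (al (\<lambda>l. lam (S x3 * h * x1 * S l) *v v)))) t) x)"
    unfolding avC_def by (rule A_al[OF hlin_avC[OF y]])
  also have "\<dots> = al (\<lambda>h. G h 1 1 x)"
    by (simp only: inner sw_collapse5[OF G])
  also have "\<dots> = avC y (A x v)"
    by (simp add: G_def avC_def)
  finally show ?thesis by simp
qed

definition av :: "('v \<Rightarrow> 'v) \<Rightarrow> 'v \<Rightarrow> 'v" where
  "av y = avC (avH y)"

lemma natural_av: "vlin y \<Longrightarrow> natural (av y)"
  unfolding av_def
  by (intro naturalI vlin_avC vlin_avH avC_al avC_equivariant avH_equivariant[symmetric] avH_equivariant)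

lemma av_natural_left:
  assumes "vlin y" "natural g"
  shows "av (\<lambda>v. g (y v)) v = g (av y v)"
proof -
  note g = naturalD[OF assms(2)]
  have "avH (\<lambda>v. g (y v)) = (\<lambda>v. g (avH y v))"
  proof
    fix v
    have "g (avH y v) = sw sV (\<lambda>a b. g (A (S a) (y (A b v)))) Lam"
      unfolding avH_def by (rule sw_push) (simp_all add: vlinD[OF g(1)])
    then show "avH (\<lambda>v. g (y v)) v = g (avH y v)" by (simp add: avH_def g(2))
  qed
  moreover have "avC (\<lambda>v. g (y v)) v = g (avC y v)" if "vlin y" for y
    unfolding avC_def by (rule g(3)[OF hlin_avC[OF that], symmetric])
  ultimately show ?thesis using vlin_avH[OF assms(1)] by (simp add: av_def)
qed

lemma av_natural_right:
  assumes "vlin y" "natural g"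
  shows "av (\<lambda>v. y (g v)) v = av y (g v)"
proof -
  note g = naturalD[OF assms(2)]
  have "avH (\<lambda>v. y (g v)) = (\<lambda>v. avH y (g v))"
    by (rule ext) (simp add: avH_def g(2))
  moreover have "avC (\<lambda>v. y (g v)) v = avC y (g v)" if "vlin y" for y
    by (simp add: avC_def g(3)[OF hlin_casimir(1)] vlinD[OF g(1)])
  ultimately show ?thesis using vlin_avH[OF assms(1)] by (simp add: av_def)
qed

text \<open>S(a) b collapses in \<open>avH\<close> to \<epsilon>(Lam), and h S(l) collapses in
  \<open>avC\<close> to lam(1). Both numbers are dim H.\<close>

lemma av_one: "av (A 1) v = (of_nat (card Bs) * of_nat (card Bs)) *v A 1 v"
proof -
  let ?n = "of_nat (card Bs) :: 'k"
  have H: "avH (A 1) = (\<lambda>v. ?n *v A 1 v)"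
  proof
    fix v
    have "avH (A 1) v = sw sV (\<lambda>a b. A (S a * b) v) Lam"
      by (simp add: avH_def A_mult)
    also have "\<dots> = eps Lam *v A 1 v" by (rule sw_antipode_left[OF hlin_A])
    finally show "avH (A 1) v = ?n *v A 1 v" by (simp add: eps_Lam)
  qed
  have one: "A 1 (al \<phi>) = al (\<lambda>l. A 1 (\<phi> l))" if "hlin sV \<phi>" for \<phi>
    by (rule naturalD(3)[OF natural_one that])
  have "avC (\<lambda>v. ?n *v A 1 v) v = al (\<lambda>h. ?n *v al (\<lambda>l. lam (h * S l) *v A 1 v))"
    by (simp add: avC_def one[OF hlin_casimir(1)] lins)
  also have "\<dots> = ?n *v al (\<lambda>h. al (\<lambda>l. lam (h * S l) *v A 1 v))"
    by (rule al_scale) (rule hlin_al; rule hlin_casimir)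
  also have "al (\<lambda>h. al (\<lambda>l. lam (h * S l) *v A 1 v)) = al (sw sV (\<lambda>h l. lam (h * S l) *v A 1 v))"
    by (rule al_assoc) (simp add: blin_iff hlin_casimir)
  also have "sw sV (\<lambda>h l. lam (h * S l) *v A 1 v) = (\<lambda>h. eps h *v (lam 1 *v A 1 v))"
    by (rule ext, rule sw_antipode_right) (simp add: hlin_def lins)
  also have "al \<dots> = A 1 (lam 1 *v A 1 v)" by (rule al_counit)
  finally show ?thesis by (simp add: av_def H lins lam_one)
qed

lemma natural_comp: "natural f \<Longrightarrow> natural g \<Longrightarrow> natural (\<lambda>v. f (g v))"
  by (rule naturalI) (simp_all add: vlin_def naturalD vlinD[OF naturalD(1)] hlin_vlin)

lemma natural_scale: "natural f \<Longrightarrow> natural (\<lambda>v. c *v f v)"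
  by (rule naturalI) (simp_all add: vlin_def naturalD vlinD[OF naturalD(1)] hlin_vlin al_scale lins mult.commute)

lemma natural_add: "natural f \<Longrightarrow> natural g \<Longrightarrow> natural (\<lambda>v. f v + g v)"
  by (rule naturalI) (simp_all add: vlin_def naturalD vlinD[OF naturalD(1)] hlin_vlin al_add lins)

lemma natural_diff: "natural f \<Longrightarrow> natural g \<Longrightarrow> natural (\<lambda>v. f v - g v)"
  using natural_add[of f "\<lambda>v. (- 1) *v g v"] natural_scale[of g "- 1"] by simp

lemma vlin_diff: assumes "vlin f" shows "f (v - w) = f v - f w" "f 0 = 0"
  using vlinD(1)[OF assms, of "v - w" w] vlinD(1)[OF assms, of 0 0] by (auto simp: algebra_simps)

lemma sg_natural:
  assumes "natural f" shows "sg (f v) = f (sg v)"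
  using naturalD(3)[OF assms hlin_A] by (simp add: sg_def naturalD(2)[OF assms])

text \<open>Averaging a linear \<open>y\<^sub>0\<close> with \<open>z y\<^sub>0 z = z\<close>, where \<open>z = \<sigma> - 1\<close>, yields a natural \<open>y\<close> with \<open>z y z = z\<close>. As
  \<open>\<sigma>\<close> commutes with all natural maps, \<open>z y = y z\<close>, and \<open>1 - z y\<close> projects onto the kernel of \<open>z\<close>.\<close>

theorem sg_splitting:
  "\<exists>p. natural p \<and> (\<forall>v. A 1 (p v) = p v) \<and> (\<forall>v. sg (p v) = p v) \<and> (\<forall>v. A 1 v = v \<longrightarrow> sg v = v \<longrightarrow> p v = v) \<and>
    (\<forall>v. A 1 v = v \<longrightarrow> p v = 0 \<longrightarrow> (\<exists>w. A 1 w = w \<and> p w = 0 \<and> sg w - w = v))"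
proof -
  define z where "z v = sg v - A 1 v" for v
  have z: "natural z" unfolding z_def by (rule natural_diff[OF natural_sg natural_one])
  note zl = vlinD[OF naturalD(1)[OF z]]
  interpret VP: vector_space_pair sV sV by (rule vector_space_pair.intro; rule vs)
  have "Vector_Spaces.linear sV sV z"
    unfolding Vector_Spaces.linear_iff using zl vs by simp
  \<comment> \<open>A linear map that inverts \<open>z\<close> from the right on the range of
    \<open>z\<close> satisfies z y0 z = z.\<close>
  from VP.linear_exists_right_inverse_on[OF this V.subspace_UNIV]
  obtain y0 where y0: "Vector_Spaces.linear sV sV y0" "\<And>v. z (y0 (z v)) = z v" by auto
  have vy0: "vlin y0" using y0(1) unfolding Vector_Spaces.linear_iff vlin_def by simp
  let ?n = "of_nat (card Bs) :: 'k"
  define y where "y v = inverse (?n * ?n) *v av y0 v" for v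
  have y: "natural y" unfolding y_def by (rule natural_scale[OF natural_av[OF vy0]])
  note yl = vlinD[OF naturalD(1)[OF y]]
  note one = vlin_diff[OF naturalD(1)[OF natural_one]]
  have z1: "A 1 (z v) = z v" "z (A 1 v) = z v" for v
    using naturalD(3)[OF natural_one hlin_A, of v] by (simp_all add: z_def one sg_natural[OF natural_one] sg_def[symmetric])
  have vy0z: "vlin (\<lambda>v. y0 (z v))" using vy0 zl by (simp add: vlin_def)
  have zyz: "z (y (z v)) = z v" for v
  proof -
    have "z (av y0 (z v)) = av (\<lambda>v. z (y0 (z v))) v"
      using av_natural_left[OF vy0z z] av_natural_right[OF vy0 z] by simp
    also have "\<dots> = av (\<lambda>v. A 1 (z v)) v" by (simp add: y0(2) z1)
    also have "\<dots> = (?n * ?n) *v z v"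
      using av_natural_right[OF naturalD(1)[OF natural_one] z] by (simp add: av_one z1)
    finally have e: "z (av y0 (z v)) = (?n * ?n) *v z v" .
    have "inverse (?n * ?n) * (?n * ?n) = 1" using card_Bs by (intro left_inverse) simp
    then show ?thesis by (simp only: y_def zl(2) e V.scale_scale V.scale_one)
  qed
  have zy: "z (y v) = y (z v)" for v
    by (simp add: z_def sg_natural[OF y] naturalD(2)[OF y] vlin_diff[OF naturalD(1)[OF y]])
  note zd = vlin_diff[OF naturalD(1)[OF z]] and yd = vlin_diff[OF naturalD(1)[OF y]]
  define p where "p v = A 1 v - z (y v)" for v
  have "natural p" unfolding p_def by (intro natural_diff natural_one natural_comp[OF z y])
  moreover have p1: "A 1 (p v) = p v" for v by (simp add: p_def one z1)
  moreover have "sg (p v) = p v" for v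
  proof -
    have "z (p v) = 0" by (simp add: p_def zd z1 zy[of v] zyz)
    then show ?thesis using p1[of v] by (simp add: z_def)
  qed
  moreover have "p v = v" if "A 1 v = v" "sg v = v" for v
    using that zy[of v] by (simp add: p_def z_def[of v] yd)
  moreover have "\<exists>w. A 1 w = w \<and> p w = 0 \<and> sg w - w = v" if "A 1 v = v" "p v = 0" for v
  proof (intro exI conjI)
    \<comment> \<open>This is \<open>y v\<close>, since z y v = v and z commutes with y. Written as
      a value of z, it is visibly fixed by \<open>A 1\<close> and killed by
      \<open>p\<close>.\<close>
    let ?w = "z (y (y v))"
    have v: "z (y v) = v" using that by (simp add: p_def)
    show w: "A 1 ?w = ?w" by (rule z1)
    show "p ?w = 0" by (simp add: p_def z1 zyz)
    have "sg ?w - ?w = z ?w" using w by (simp add: z_def[of ?w])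
    also have "\<dots> = v" using v by (simp add: zy[of "y v"])
    finally show "sg ?w - ?w = v" .
  qed
  ultimately show ?thesis by blast
qed

end

section \<open>Splitting off the stable part of a contramodule\<close>

text \<open>\<open>M\<close> is a quotient of the free space on its elements, via \<open>ev\<close>.
  A projection \<open>q\<close> onto the kernel of \<open>ev\<close> gives the section m \<mapsto>
  basis m - q (basis m). It is additive because basis (x + y) - basis x - basis y lies in the kernel
  and so is fixed by \<open>q\<close>; scalars are treated alike.\<close>

lemma kmodule_embedding:
  fixes M :: "('k::field, 'm, 'x) module_scheme"
  assumes M: "kmodule M"
  obtains ev :: "('m \<Rightarrow>\<^sub>0 'k) \<Rightarrow> 'm" and j where "ev \<in> linear_maps (vmod free_scale) M"
    "j \<in> linear_maps M (vmod free_scale)" "\<And>m. m \<in> carrier M \<Longrightarrow> ev (j m) = m"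
proof -
  interpret Module.module ground M by (rule M)
  note [simp] = smult_closed[unfolded ground_simps, simplified]
  \<comment> \<open>Keys outside the carrier are discarded, so that \<open>ev\<close> is linear on
    the whole type.\<close>
  define ev where "ev p = (\<Oplus>\<^bsub>M\<^esub>w\<in>Poly_Mapping.keys p \<inter> carrier M. Poly_Mapping.lookup p w \<odot>\<^bsub>M\<^esub> w)" for p :: "'m \<Rightarrow>\<^sub>0 'k"
  have sup: "ev p = (\<Oplus>\<^bsub>M\<^esub>w\<in>I \<inter> carrier M. Poly_Mapping.lookup p w \<odot>\<^bsub>M\<^esub> w)"
    if "finite I" "Poly_Mapping.keys p \<subseteq> I" for I p
    unfolding ev_def
    by (rule M.add.finprod_mono_neutral_cong_left)
      (use that in \<open>auto simp: in_keys_iff kmodule_rules[OF M]\<close>)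
  have ev: "ev \<in> linear_maps (vmod free_scale) M"
  proof (rule linear_mapsI, simp_all)
    show cl: "ev p \<in> carrier M" for p unfolding ev_def by (rule M.finsum_closed) auto
    show "ev (p + q) = ev p \<oplus>\<^bsub>M\<^esub> ev q" for p q
    proof -
      let ?I = "Poly_Mapping.keys p \<union> Poly_Mapping.keys q"
      have "ev (p + q) = (\<Oplus>\<^bsub>M\<^esub>w\<in>?I \<inter> carrier M. Poly_Mapping.lookup p w \<odot>\<^bsub>M\<^esub> w \<oplus>\<^bsub>M\<^esub> Poly_Mapping.lookup q w \<odot>\<^bsub>M\<^esub> w)"
      proof -
        have "ev (p + q) = (\<Oplus>\<^bsub>M\<^esub>w\<in>?I \<inter> carrier M. Poly_Mapping.lookup (p + q) w \<odot>\<^bsub>M\<^esub> w)"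
          using keys_add[of p q] by (intro sup) auto
        also have "\<dots> = (\<Oplus>\<^bsub>M\<^esub>w\<in>?I \<inter> carrier M. Poly_Mapping.lookup p w \<odot>\<^bsub>M\<^esub> w \<oplus>\<^bsub>M\<^esub> Poly_Mapping.lookup q w \<odot>\<^bsub>M\<^esub> w)"
          by (rule M.finsum_cong') (auto simp: lookup_add kmodule_rules[OF M])
        finally show ?thesis .
      qed
      also have "\<dots> = ev p \<oplus>\<^bsub>M\<^esub> ev q"
        by (subst M.finsum_addf) (auto simp: sup[of ?I p] sup[of ?I q])
      finally show ?thesis .
    qed
    show "ev (free_scale c p) = c \<odot>\<^bsub>M\<^esub> ev p" for c p
    proof -
      have L: "(\<lambda>x. c \<odot>\<^bsub>M\<^esub> x) \<in> linear_maps M M"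
        by (rule linear_mapsI) (auto simp: smult_r_distr kmodule_rules(2)[OF M, symmetric] mult.commute)
      have "ev (free_scale c p) = (\<Oplus>\<^bsub>M\<^esub>w\<in>Poly_Mapping.keys p \<inter> carrier M. c \<odot>\<^bsub>M\<^esub> (Poly_Mapping.lookup p w \<odot>\<^bsub>M\<^esub> w))"
      proof -
        have "ev (free_scale c p) = (\<Oplus>\<^bsub>M\<^esub>w\<in>Poly_Mapping.keys p \<inter> carrier M. Poly_Mapping.lookup (free_scale c p) w \<odot>\<^bsub>M\<^esub> w)"
          using keys_free_scale[of c p] by (intro sup) auto
        also have "\<dots> = (\<Oplus>\<^bsub>M\<^esub>w\<in>Poly_Mapping.keys p \<inter> carrier M. c \<odot>\<^bsub>M\<^esub> (Poly_Mapping.lookup p w \<odot>\<^bsub>M\<^esub> w))"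
          by (rule M.finsum_cong') (auto simp: kmodule_rules[OF M])
        finally show ?thesis .
      qed
      also have "\<dots> = c \<odot>\<^bsub>M\<^esub> ev p"
        unfolding ev_def by (rule finsum_linear[OF M M L, symmetric]) auto
      finally show ?thesis .
    qed
  qed
  note evl = linear_mapsD[OF ev, simplified]
  have vs: "vector_space (free_scale :: 'k \<Rightarrow> ('m \<Rightarrow>\<^sub>0 'k) \<Rightarrow> _)" by (rule free.vector_space_axioms)
  have ev0: "ev 0 = \<zero>\<^bsub>M\<^esub>" using linear_maps_zero[OF kmodule_vmod[OF vs] M ev] by simp
  have evd: "ev (p - q) = ev p \<ominus>\<^bsub>M\<^esub> ev q" for p q
    using evl(2)[of p "- q"] evl(3)[of "-1" q] evl(1)[of q]
    by (simp add: a_minus_def kmodule_uminus[OF M])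
  have evb: "ev (basis m) = m" if "m \<in> carrier M" for m
    using that by (simp add: ev_def basis_def kmodule_rules[OF M] M.finsum_insert)
  let ?N = "{p. ev p = \<zero>\<^bsub>M\<^esub>}"
  have N: "free.subspace ?N"
    unfolding free.subspace_def using evl ev0 by (auto simp: kmodule_rules[OF M])
  interpret P: vector_space_pair "free_scale :: 'k \<Rightarrow> ('m \<Rightarrow>\<^sub>0 'k) \<Rightarrow> _" "free_scale :: 'k \<Rightarrow> ('m \<Rightarrow>\<^sub>0 'k) \<Rightarrow> _"
    by (rule vector_space_pair.intro; rule vs)
  obtain q where q: "\<And>p. ev (q p) = \<zero>\<^bsub>M\<^esub>" "flinear q" "\<And>p. ev p = \<zero>\<^bsub>M\<^esub> \<Longrightarrow> q p = p"
    using P.linear_exists_left_inverse_on[OF flinear_intros(6) N] by auto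
  note ql = flinear_add[OF q(2)] flinear_diff[OF q(2)] flinear_scale[OF q(2)]
  define j where "j m = basis m - q (basis m)" for m
  have "j \<in> linear_maps M (vmod free_scale)"
  proof (rule linear_mapsI, simp_all)
    fix x y c assume x: "x \<in> carrier M"
    show "j (c \<odot>\<^bsub>M\<^esub> x) = free_scale c (j x)"
      using q(3)[of "basis (c \<odot>\<^bsub>M\<^esub> x) - free_scale c (basis x)"] x
      by (simp add: evd evl(3) evb ql j_def M.r_neg a_minus_def free.scale_right_diff_distrib algebra_simps)
    assume y: "y \<in> carrier M"
    show "j (x \<oplus>\<^bsub>M\<^esub> y) = j x + j y"
      using q(3)[of "basis (x \<oplus>\<^bsub>M\<^esub> y) - (basis x + basis y)"] x y
      by (simp add: evd evl(2) evb ql j_def M.r_neg a_minus_def algebra_simps)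
  qed
  moreover have "ev (j m) = m" if "m \<in> carrier M" for m
    using that by (simp add: j_def evd evb q(1) a_minus_def)
  ultimately show thesis using that ev by blast
qed

text \<open>The free space carries the structure transported along \<open>j\<close> and
  \<open>ev\<close>. Its unit acts as \<open>j\<close> after \<open>ev\<close>, and the fixed
  vectors of this idempotent are a copy of \<open>M\<close>. The projection of
  \<open>sg_splitting\<close> is read back through the same pair of maps.\<close>

lemma (in involutive_hopf) aYD_splitting:
  fixes M :: "('k, 'h, 'm) contramodule"
  assumes aYD: "aYD_contramodule H M"
  obtains p where "p \<in> aYD_hom H M M" "\<And>m. m \<in> carrier M \<Longrightarrow> sigma M (p m) = p m"
    "\<And>m. m \<in> carrier M \<Longrightarrow> sigma M m = m \<Longrightarrow> p m = m"
    "\<And>m. m \<in> carrier M \<Longrightarrow> p m = \<zero>\<^bsub>M\<^esub> \<Longrightarrow> \<exists>w\<in>carrier M. p w = \<zero>\<^bsub>M\<^esub> \<and> sigma M w \<ominus>\<^bsub>M\<^esub> w = m"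
proof -
  interpret M: aYD_contramodule H M by (rule aYD)
  have km: "kmodule M" by (rule M.M.module_axioms)
  have vs: "vector_space (free_scale :: 'k \<Rightarrow> ('m \<Rightarrow>\<^sub>0 'k) \<Rightarrow> _)" by (rule free.vector_space_axioms)
  obtain ev :: "('m \<Rightarrow>\<^sub>0 'k) \<Rightarrow> 'm" and j where ev: "ev \<in> linear_maps (vmod free_scale) M"
    and j: "j \<in> linear_maps M (vmod free_scale)" and evj: "\<And>m. m \<in> carrier M \<Longrightarrow> ev (j m) = m"
    by (rule kmodule_embedding[OF km]) blast
  note evl = linear_mapsD[OF ev, simplified] and jl = linear_mapsD[OF j, simplified]
  note act = linear_mapsD[OF M.act_linear]
  define A where "A x v = j (act M x (ev v))" for x v
  define al where "al \<phi> = j (contra M (\<lambda>h. ev (\<phi> h)))" for \<phi>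
  have evA: "ev (A x v) = act M x (ev v)" for x v by (simp add: A_def evj act(1) evl(1))
  have ev\<phi>: "(\<lambda>h. ev (\<phi> h)) \<in> linear_maps (hmod H) M" if "hlin free_scale \<phi>" for \<phi>
    by (rule linear_mapsI) (simp_all add: evl hlinD[OF that])
  have eval: "ev (al \<phi>) = contra M (\<lambda>h. ev (\<phi> h))" if "hlin free_scale \<phi>" for \<phi>
    by (simp add: al_def evj M.contra_closed ev\<phi>[OF that])
  interpret W: vcontra H free_scale A al
  proof (intro vcontra.intro vcontra_axioms.intro)
    show "involutive_hopf H" ..
    show "vector_space (free_scale :: 'k \<Rightarrow> ('m \<Rightarrow>\<^sub>0 'k) \<Rightarrow> _)" by (rule vs)
    fix x y :: 'h and c :: 'k and v w :: "'m \<Rightarrow>\<^sub>0 'k"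
    show "A (x + y) v = A x v + A y v" "A (c *h x) v = free_scale c (A x v)"
      "A x (v + w) = A x v + A x w" "A x (free_scale c v) = free_scale c (A x v)"
      "A (x * y) v = A x (A y v)"
      by (simp_all add: A_def evl M.act_add M.act_scale M.act_mult act jl evj)
    show "al (\<lambda>h. free_scale (eps h) v) = A 1 v"
      by (simp add: al_def A_def evl M.contra_counit M.act_one)
  next
    fix \<phi> \<psi> :: "'h \<Rightarrow> 'm \<Rightarrow>\<^sub>0 'k" and c x assume \<phi>: "hlin free_scale \<phi>"
    show "al (\<lambda>h. free_scale c (\<phi> h)) = free_scale c (al \<phi>)"
      by (simp add: al_def evl M.contra_smult ev\<phi>[OF \<phi>] jl M.contra_closed)
    show "al (\<lambda>h. \<phi> h + \<psi> h) = al \<phi> + al \<psi>" if "hlin free_scale \<psi>"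
      by (simp add: al_def evl M.contra_add ev\<phi>[OF \<phi>] ev\<phi>[OF that] jl M.contra_closed)
    define K where "K h x1 x2 x3 = A x2 (\<phi> (S x3 * h * x1))" for h x1 x2 x3
    have Kl: "blin free_scale (K h x1)" for h x1
      by (simp add: K_def blin_iff hlin_def A_def evl M.act_add M.act_scale act jl hlinD[OF \<phi>] hsimps)
    have K1: "K h (a + b) x2 x3 = K h a x2 x3 + K h b x2 x3" "K h (c *h a) x2 x3 = free_scale c (K h a x2 x3)" for h a b c x2 x3
      by (simp_all add: K_def A_def evl act jl hlinD[OF \<phi>] hsimps)
    \<comment> \<open>The aYD axiom of \<open>M\<close> contains Sweedler sums formed in
      \<open>M\<close>. Being linear, \<open>ev\<close> commutes with such sums, so they match the
      coordinate sums of the free space.\<close>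
    have "ev (sw free_scale (\<lambda>x1 t. sw free_scale (\<lambda>x2 x3. K h x1 x2 x3) t) x)
      = sweedler3 H M (\<lambda>x1 x2 x3. act M x2 (ev (\<phi> (S x3 * h * x1)))) x" for h
    proof -
      have b: "blin free_scale (\<lambda>x1 t. sw free_scale (K h x1) t)"
        by (simp add: blin_iff sw_linear_arg[OF vs])
          (simp add: hlin_def K1 sw_add[OF vs] sw_scale[OF vs] K1[abs_def])
      have "ev (sw free_scale (\<lambda>x1 t. sw free_scale (K h x1) t) x)
        = sweedler2 H M (\<lambda>x1 t. ev (sw free_scale (K h x1) t)) x"
        unfolding sweedler2_vmod[OF vs b, symmetric]
        by (rule linear_sweedler2[OF kmodule_vmod[OF vs] km ev]) simp
      moreover have "ev (sw free_scale (K h x1) t) = sweedler2 H M (\<lambda>x2 x3. ev (K h x1 x2 x3)) t" for x1 t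
        unfolding sweedler2_vmod[OF vs Kl, symmetric]
        by (rule linear_sweedler2[OF kmodule_vmod[OF vs] km ev]) simp
      ultimately show ?thesis by (simp add: sweedler3_def K_def[abs_def] evA)
    qed
    then have "j (contra M (\<lambda>h. sweedler3 H M (\<lambda>x1 x2 x3. act M x2 (ev (\<phi> (S x3 * h * x1)))) x))
      = al (\<lambda>h. sw free_scale (\<lambda>x1 t. sw free_scale (\<lambda>x2 x3. A x2 (\<phi> (S x3 * h * x1))) t) x)"
      by (simp add: al_def K_def[abs_def])
    then show "A x (al \<phi>) = al (\<lambda>h. sw free_scale (\<lambda>x1 t. sw free_scale (\<lambda>x2 x3. A x2 (\<phi> (S x3 * h * x1))) t) x)"
      by (simp add: A_def[of x] eval[OF \<phi>] M.aYD[OF ev\<phi>[OF \<phi>]])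
  next
    fix F :: "'h \<Rightarrow> 'h \<Rightarrow> 'm \<Rightarrow>\<^sub>0 'k" assume F: "blin free_scale F"
    \<comment> \<open>\<open>contra_assoc\<close> speaks of linear maps on H \<otimes> H, so a
      bilinear \<open>F\<close> is first lifted to the tensor product and then evaluated in
      \<open>M\<close>.\<close>
    let ?F = "\<lambda>t. ev (tensor_lift (vmod free_scale) F t)"
    have L: "?F \<in> linear_maps (HH H) M"
      using linear_mapsD[OF tensor_lift_linear[OF vs F]] by (intro linear_mapsI) (simp_all add: evl)
    have Fh: "hlin free_scale (F h)" for h using F by (simp add: blin_iff)
    have "contra M (\<lambda>h. contra M (\<lambda>l. ev (F h l))) = contra M (\<lambda>h. ev (sw free_scale F h))"
      using M.contra_assoc[OF L] by (simp add: tensor_lift_elem[OF vs F] sw_class[OF vs F])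
    then show "al (\<lambda>h. al (F h)) = al (sw free_scale F)"
      by (simp add: al_def[of "\<lambda>h. al (F h)"] al_def[of "sw free_scale F"] eval[OF Fh])
  qed
  have jA: "j (act M x m) = A x (j m)" if "m \<in> carrier M" for x m using that by (simp add: A_def evj)
  have jal: "j (contra M \<phi>) = al (\<lambda>h. j (\<phi> h))" if "\<phi> \<in> linear_maps (hmod H) M" for \<phi>
    using linear_mapsD(1)[OF that] by (simp add: al_def evj)
  have sg: "W.sg v = j (sigma M (ev v))" for v
    by (simp add: W.sg_def al_def evA sigma_def)
  have scl: "sigma M m \<in> carrier M" if "m \<in> carrier M" for m
    unfolding sigma_def
    by (rule M.contra_closed, rule linear_mapsI) (use that in \<open>simp_all add: act M.act_add M.act_scale\<close>)
  have A1: "A 1 v = j (ev v)" for v by (simp add: A_def M.act_one evl)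
  obtain p where p: "W.natural p" and p1: "\<And>v. A 1 (p v) = p v" and p2: "\<And>v. W.sg (p v) = p v"
    and p3: "\<And>v. A 1 v = v \<Longrightarrow> W.sg v = v \<Longrightarrow> p v = v"
    and p4: "\<And>v. A 1 v = v \<Longrightarrow> p v = 0 \<Longrightarrow> \<exists>w. A 1 w = w \<and> p w = 0 \<and> W.sg w - w = v"
    using W.sg_splitting by blast
  note pl = W.vlinD[OF W.naturalD(1)[OF p]]
  have j0: "j \<zero>\<^bsub>M\<^esub> = 0" using linear_maps_zero[OF km kmodule_vmod[OF vs] j] by simp
  have ev0: "ev 0 = \<zero>\<^bsub>M\<^esub>" using linear_maps_zero[OF kmodule_vmod[OF vs] km ev] by simp
  define pM where "pM m = ev (p (j m))" for m
  show thesis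
  proof (rule that)
    have "pM (contra M \<phi>) = contra M (\<lambda>h. pM (\<phi> h))" if \<phi>: "\<phi> \<in> linear_maps (hmod H) M" for \<phi>
    proof -
      have jh: "hlin free_scale (\<lambda>h. j (\<phi> h))"
        using linear_mapsD[OF \<phi>] by (simp add: hlin_def jl)
      have "hlin free_scale (\<lambda>h. p (j (\<phi> h)))" by (rule W.hlin_vlin[OF W.naturalD(1)[OF p] jh])
      then show ?thesis
        by (simp add: pM_def jal[OF \<phi>] W.naturalD(3)[OF p jh] eval)
    qed
    then show "pM \<in> aYD_hom H M M"
      unfolding aYD_hom_def
      by (auto simp: pM_def jl pl evl jA W.naturalD(2)[OF p] evA intro!: linear_mapsI)
    fix m assume m: "m \<in> carrier M"
    have cl: "pM m \<in> carrier M" by (simp add: pM_def evl)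
    have "j (sigma M (pM m)) = p (j m)" using p2[of "j m"] by (simp add: sg pM_def)
    then have "ev (j (sigma M (pM m))) = pM m" by (simp add: pM_def)
    then show "sigma M (pM m) = pM m" using scl[OF cl] by (simp add: evj)
    show "pM m = m" if "sigma M m = m"
      using p3[of "j m"] that m by (simp add: pM_def A1 sg evj)
    assume z: "pM m = \<zero>\<^bsub>M\<^esub>"
    have "p (j m) = 0" using p1[of "j m"] z by (simp add: A1 pM_def j0)
    then obtain w where w: "A 1 w = w" "p w = 0" "W.sg w - w = j m"
      using p4[of "j m"] m by (auto simp: A1 evj)
    have jw: "j (ev w) = w" using w(1) by (simp add: A1)
    have "ev (W.sg w + free_scale (-1) w) = sigma M (ev w) \<ominus>\<^bsub>M\<^esub> ev w"
      using scl[of "ev w"] by (simp add: evl(2,3) sg evj evl(1) a_minus_def kmodule_uminus[OF km] del: free.scale_minus_left)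
    then have "sigma M (ev w) \<ominus>\<^bsub>M\<^esub> ev w = m"
      using w(3) m by (simp add: evj)
    moreover have "pM (ev w) = \<zero>\<^bsub>M\<^esub>" by (simp add: pM_def jw w(2) ev0)
    ultimately show "\<exists>w\<in>carrier M. pM w = \<zero>\<^bsub>M\<^esub> \<and> sigma M w \<ominus>\<^bsub>M\<^esub> w = m"
      using evl(1)[of w] by blast
  qed
qed

section \<open>The DG category of mixed contramodules\<close>

lemma linear_maps_minus:
  assumes "kmodule M" "kmodule N" "f \<in> linear_maps M N" "x \<in> carrier M" "y \<in> carrier M"
  shows "f (x \<ominus>\<^bsub>M\<^esub> y) = f x \<ominus>\<^bsub>N\<^esub> f y"
proof -
  interpret M: Module.module ground M by fact
  have "(- 1) \<odot>\<^bsub>M\<^esub> y \<in> carrier M" using M.smult_closed[of "-1" y] assms by simp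
  then show ?thesis
    using linear_mapsD[OF assms(3)] assms by (simp add: a_minus_def kmodule_uminus[OF assms(1)] kmodule_uminus[OF assms(2)])
qed

text \<open>An identity in a vector space on a carrier set can be checked after embedding it into a type.\<close>

lemma kmodule_eqI:
  fixes M :: "('k::field, 'm, 'x) module_scheme"
  assumes "kmodule M" "x \<in> carrier M" "y \<in> carrier M"
    and "\<And>j :: 'm \<Rightarrow> 'm \<Rightarrow>\<^sub>0 'k. (\<And>a b. a \<in> carrier M \<Longrightarrow> b \<in> carrier M \<Longrightarrow> j (a \<oplus>\<^bsub>M\<^esub> b) = j a + j b) \<Longrightarrow>
      (\<And>c a. a \<in> carrier M \<Longrightarrow> j (c \<odot>\<^bsub>M\<^esub> a) = free_scale c (j a)) \<Longrightarrow>
      (\<And>a b. a \<in> carrier M \<Longrightarrow> b \<in> carrier M \<Longrightarrow> j (a \<ominus>\<^bsub>M\<^esub> b) = j a - j b) \<Longrightarrow>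
      j \<zero>\<^bsub>M\<^esub> = 0 \<Longrightarrow> j x = j y"
  shows "x = y"
proof -
  obtain ev :: "('m \<Rightarrow>\<^sub>0 'k) \<Rightarrow> 'm" and j where j: "j \<in> linear_maps M (vmod free_scale)"
    and evj: "\<And>m. m \<in> carrier M \<Longrightarrow> ev (j m) = m"
    by (rule kmodule_embedding[OF assms(1)]) blast
  have V: "kmodule (vmod (free_scale :: 'k \<Rightarrow> ('m \<Rightarrow>\<^sub>0 'k) \<Rightarrow> _))"
    by (rule kmodule_vmod[OF free.vector_space_axioms])
  have "a \<ominus>\<^bsub>vmod free_scale\<^esub> b = a - b" for a b :: "'m \<Rightarrow>\<^sub>0 'k"
    by (simp add: a_minus_def kmodule_uminus[OF V])
  then have "j x = j y"
    using linear_mapsD[OF j] linear_maps_minus[OF assms(1) V j] linear_maps_zero[OF assms(1) V j]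
    by (intro assms(4)) simp_all
  then show ?thesis using evj assms(2,3) by metis
qed

lemma kmodule_closed:
  assumes "kmodule M"
  shows "x \<in> carrier M \<Longrightarrow> y \<in> carrier M \<Longrightarrow> x \<oplus>\<^bsub>M\<^esub> y \<in> carrier M"
    and "x \<in> carrier M \<Longrightarrow> y \<in> carrier M \<Longrightarrow> x \<ominus>\<^bsub>M\<^esub> y \<in> carrier M"
    and "x \<in> carrier M \<Longrightarrow> c \<odot>\<^bsub>M\<^esub> x \<in> carrier M" and "\<zero>\<^bsub>M\<^esub> \<in> carrier M"
proof -
  interpret Module.module ground M by fact
  show "x \<in> carrier M \<Longrightarrow> y \<in> carrier M \<Longrightarrow> x \<oplus>\<^bsub>M\<^esub> y \<in> carrier M"
    "x \<in> carrier M \<Longrightarrow> y \<in> carrier M \<Longrightarrow> x \<ominus>\<^bsub>M\<^esub> y \<in> carrier M"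
    "x \<in> carrier M \<Longrightarrow> c \<odot>\<^bsub>M\<^esub> x \<in> carrier M" "\<zero>\<^bsub>M\<^esub> \<in> carrier M"
    using smult_closed[of c x] by simp_all
qed

lemma kmodule_cancel:
  assumes "kmodule M" "x \<in> carrier M"
  shows "x \<ominus>\<^bsub>M\<^esub> x = \<zero>\<^bsub>M\<^esub>" "x \<oplus>\<^bsub>M\<^esub> \<zero>\<^bsub>M\<^esub> = x" "\<zero>\<^bsub>M\<^esub> \<oplus>\<^bsub>M\<^esub> x = x" "x \<ominus>\<^bsub>M\<^esub> \<zero>\<^bsub>M\<^esub> = x"
  by (rule kmodule_eqI[OF assms(1)]; simp add: assms kmodule_closed)+

lemma kmodule_minus_eq_zero:
  fixes M :: "('k::field, 'm, 'x) module_scheme"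
  assumes "kmodule M" "x \<in> carrier M" "y \<in> carrier M" "x \<ominus>\<^bsub>M\<^esub> y = \<zero>\<^bsub>M\<^esub>"
  shows "x = y"
proof (rule kmodule_eqI[OF assms(1-3)])
  fix j :: "'m \<Rightarrow> 'm \<Rightarrow>\<^sub>0 'k"
  assume "\<And>a b. a \<in> carrier M \<Longrightarrow> b \<in> carrier M \<Longrightarrow> j (a \<ominus>\<^bsub>M\<^esub> b) = j a - j b" "j \<zero>\<^bsub>M\<^esub> = 0"
  then have "j x - j y = 0" using assms by metis
  then show "j x = j y" by simp
qed

section \<open>Morphisms of contramodules\<close>

lemma aYD_kmodule: "aYD_contramodule H M \<Longrightarrow> kmodule M"
  by (simp add: aYD_contramodule_def left_hmodule_def)

lemma aYD_act_closed: "aYD_contramodule H M \<Longrightarrow> m \<in> carrier M \<Longrightarrow> act M x m \<in> carrier M"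
  by (rule linear_mapsD(1)[OF left_hmodule.act_linear[OF aYD_contramodule.axioms(1)]])

lemma aYD_homD:
  assumes "f \<in> aYD_hom H M N"
  shows "f \<in> linear_maps M N" and "m \<in> carrier M \<Longrightarrow> f (act M x m) = act N x (f m)"
    and "\<phi> \<in> linear_maps (hmod H) M \<Longrightarrow> f (contra M \<phi>) = contra N (\<lambda>h. f (\<phi> h))"
  using assms by (auto simp: aYD_hom_def)

lemma aYD_homI:
  assumes "f \<in> linear_maps M N" "\<And>x m. m \<in> carrier M \<Longrightarrow> f (act M x m) = act N x (f m)"
    "\<And>\<phi>. \<phi> \<in> linear_maps (hmod H) M \<Longrightarrow> f (contra M \<phi>) = contra N (\<lambda>h. f (\<phi> h))"
  shows "f \<in> aYD_hom H M N"
  using assms by (auto simp: aYD_hom_def)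

lemmas aYD_hom_linear = linear_mapsD[OF aYD_homD(1)]

lemma linear_maps_comp:
  "f \<in> linear_maps M N \<Longrightarrow> g \<in> linear_maps N P \<Longrightarrow> (\<lambda>m. g (f m)) \<in> linear_maps M P"
  by (rule linear_mapsI) (simp_all add: linear_mapsD)

lemma aYD_hom_comp:
  assumes "f \<in> aYD_hom H M N" "g \<in> aYD_hom H N P"
  shows "(\<lambda>m. g (f m)) \<in> aYD_hom H M P"
proof (rule aYD_homI)
  show "(\<lambda>m. g (f m)) \<in> linear_maps M P"
    by (rule linear_maps_comp[OF aYD_homD(1)[OF assms(1)] aYD_homD(1)[OF assms(2)]])
  show "g (f (act M x m)) = act P x (g (f m))" if "m \<in> carrier M" for x m
    using that by (simp add: aYD_homD[OF assms(1)] aYD_homD[OF assms(2)] aYD_hom_linear[OF assms(1)])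
  show "g (f (contra M \<phi>)) = contra P (\<lambda>h. g (f (\<phi> h)))" if \<phi>: "\<phi> \<in> linear_maps (hmod H) M" for \<phi>
    using linear_maps_comp[OF \<phi> aYD_homD(1)[OF assms(1)]]
    by (simp add: aYD_homD(3)[OF assms(1) \<phi>] aYD_homD(3)[OF assms(2)])
qed

text \<open>The conditions on a morphism involve only its values on the carrier; thus the
  extensional maps demanded by \<open>mixed_hom\<close> can replace the given ones.\<close>

lemma aYD_hom_cong:
  assumes "f \<in> aYD_hom H M N" "aYD_contramodule H M" "\<And>m. m \<in> carrier M \<Longrightarrow> g m = f m"
  shows "g \<in> aYD_hom H M N"
proof (rule aYD_homI)
  note cl = kmodule_closed[OF aYD_kmodule[OF assms(2)]] aYD_act_closed[OF assms(2)]
  show "g \<in> linear_maps M N"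
    by (rule linear_mapsI) (simp_all add: assms(3) cl aYD_hom_linear[OF assms(1)])
  show "g (act M x m) = act N x (g m)" if "m \<in> carrier M" for x m
    using that by (simp add: assms(3) cl aYD_homD[OF assms(1)])
  show "g (contra M \<phi>) = contra N (\<lambda>h. g (\<phi> h))" if \<phi>: "\<phi> \<in> linear_maps (hmod H) M" for \<phi>
    using linear_mapsD(1)[OF \<phi>] aYD_contramodule.contra_closed[OF assms(2) \<phi>]
    by (simp add: assms(3) aYD_homD(3)[OF assms(1) \<phi>])
qed

lemma aYD_hom_restrict:
  "f \<in> aYD_hom H M N \<Longrightarrow> aYD_contramodule H M \<Longrightarrow> restrict f (carrier M) \<in> aYD_hom H M N"
  by (rule aYD_hom_cong) auto

lemma aYD_hom_id: "(\<lambda>m. m) \<in> aYD_hom H M M"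
  by (rule aYD_homI) (auto intro: linear_mapsI)

lemma aYD_hom_smult:
  assumes "f \<in> aYD_hom H M N" "aYD_contramodule H N"
  shows "(\<lambda>m. c \<odot>\<^bsub>N\<^esub> f m) \<in> aYD_hom H M N"
proof (rule aYD_homI)
  interpret N: aYD_contramodule H N by fact
  note km = aYD_kmodule[OF assms(2)]
  note fl = aYD_hom_linear[OF assms(1)] and al = linear_mapsD[OF N.act_linear]
  show "(\<lambda>m. c \<odot>\<^bsub>N\<^esub> f m) \<in> linear_maps M N"
    by (rule linear_mapsI)
      (simp_all add: fl kmodule_closed[OF km] N.M.smult_r_distr kmodule_rules(2)[OF km, symmetric] mult.commute)
  show "c \<odot>\<^bsub>N\<^esub> f (act M x m) = act N x (c \<odot>\<^bsub>N\<^esub> f m)" if "m \<in> carrier M" for x m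
    using that by (simp add: aYD_homD[OF assms(1)] al fl)
  show "c \<odot>\<^bsub>N\<^esub> f (contra M \<phi>) = contra N (\<lambda>h. c \<odot>\<^bsub>N\<^esub> f (\<phi> h))" if \<phi>: "\<phi> \<in> linear_maps (hmod H) M" for \<phi>
    using linear_maps_comp[OF \<phi> aYD_homD(1)[OF assms(1)]] by (simp add: aYD_homD(3)[OF assms(1) \<phi>] N.contra_smult)
qed

lemma aYD_hom_add:
  assumes "f \<in> aYD_hom H M N" "g \<in> aYD_hom H M N" "aYD_contramodule H N"
  shows "(\<lambda>m. f m \<oplus>\<^bsub>N\<^esub> g m) \<in> aYD_hom H M N"
proof (rule aYD_homI)
  interpret N: aYD_contramodule H N by fact
  note km = aYD_kmodule[OF assms(3)]
  note fl = aYD_hom_linear[OF assms(1)] aYD_hom_linear[OF assms(2)] and al = linear_mapsD[OF N.act_linear]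
  show "(\<lambda>m. f m \<oplus>\<^bsub>N\<^esub> g m) \<in> linear_maps M N"
    by (rule linear_mapsI)
      (simp_all add: fl kmodule_closed[OF km] N.M.smult_r_distr N.M.M.a_ac)
  show "f (act M x m) \<oplus>\<^bsub>N\<^esub> g (act M x m) = act N x (f m \<oplus>\<^bsub>N\<^esub> g m)" if "m \<in> carrier M" for x m
    using that by (simp add: aYD_homD[OF assms(1)] aYD_homD[OF assms(2)] al fl)
  show "f (contra M \<phi>) \<oplus>\<^bsub>N\<^esub> g (contra M \<phi>) = contra N (\<lambda>h. f (\<phi> h) \<oplus>\<^bsub>N\<^esub> g (\<phi> h))"
    if \<phi>: "\<phi> \<in> linear_maps (hmod H) M" for \<phi>
    using linear_maps_comp[OF \<phi> aYD_homD(1)[OF assms(1)]] linear_maps_comp[OF \<phi> aYD_homD(1)[OF assms(2)]]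
    by (simp add: aYD_homD(3)[OF assms(1) \<phi>] aYD_homD(3)[OF assms(2) \<phi>] N.contra_add)
qed

lemma aYD_hom_diff:
  assumes "f \<in> aYD_hom H M N" "g \<in> aYD_hom H M N" "aYD_contramodule H M" "aYD_contramodule H N"
  shows "(\<lambda>m. f m \<ominus>\<^bsub>N\<^esub> g m) \<in> aYD_hom H M N"
  by (rule aYD_hom_cong[OF aYD_hom_add[OF assms(1) aYD_hom_smult[OF assms(2,4), of "-1"] assms(4)] assms(3)])
    (simp add: a_minus_def kmodule_uminus[OF aYD_kmodule[OF assms(4)]] aYD_hom_linear[OF assms(2)])

lemma act_linear_map: "aYD_contramodule H M \<Longrightarrow> m \<in> carrier M \<Longrightarrow> (\<lambda>h. act M h m) \<in> linear_maps (hmod H) M"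
  using left_hmodule.act_add[OF aYD_contramodule.axioms(1)] left_hmodule.act_scale[OF aYD_contramodule.axioms(1)]
  by (intro linear_mapsI) (auto intro: aYD_act_closed)

lemma sigma_closed: "aYD_contramodule H M \<Longrightarrow> m \<in> carrier M \<Longrightarrow> sigma M m \<in> carrier M"
  unfolding sigma_def by (rule aYD_contramodule.contra_closed[OF _ act_linear_map])

lemma sigma_natural:
  assumes "aYD_contramodule H M" "f \<in> aYD_hom H M N" "m \<in> carrier M"
  shows "f (sigma M m) = sigma N (f m)"
  using aYD_homD(3)[OF assms(2) act_linear_map[OF assms(1,3)]] aYD_homD(2)[OF assms(2,3)]
  by (simp add: sigma_def)

section \<open>Hom complexes of mixed contramodules\<close>

abbreviation cP :: "('k, 'h, 'm) mixed \<Rightarrow> int \<Rightarrow> 'm set" where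
  "cP P i \<equiv> carrier (piece P i)"

lemma mixed_homD:
  assumes "f \<in> carrier (mixed_hom H P Q n)"
  shows "f i \<in> aYD_hom H (piece P i) (piece Q (i + n))" "f i \<in> extensional (cP P i)"
    "m \<in> cP P i \<Longrightarrow> hmap Q (i + n) (f i m) = ((-1) powi n) \<odot>\<^bsub>piece Q (i + n - 1)\<^esub> f (i - 1) (hmap P i m)"
  using assms by (auto simp: mixed_hom_def)

lemma mixed_homI:
  assumes "\<And>i. f i \<in> aYD_hom H (piece P i) (piece Q (i + n))" "\<And>i. f i \<in> extensional (cP P i)"
    "\<And>i m. m \<in> cP P i \<Longrightarrow>
      hmap Q (i + n) (f i m) = ((-1) powi n) \<odot>\<^bsub>piece Q (i + n - 1)\<^esub> f (i - 1) (hmap P i m)"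
  shows "f \<in> carrier (mixed_hom H P Q n)"
  using assms by (auto simp: mixed_hom_def)

lemma mixed_hom_simps:
  "\<zero>\<^bsub>mixed_hom H P Q n\<^esub> = (\<lambda>i. \<lambda>m\<in>cP P i. \<zero>\<^bsub>piece Q (i + n)\<^esub>)"
  "f \<oplus>\<^bsub>mixed_hom H P Q n\<^esub> g = (\<lambda>i. \<lambda>m\<in>cP P i. f i m \<oplus>\<^bsub>piece Q (i + n)\<^esub> g i m)"
  "c \<odot>\<^bsub>mixed_hom H P Q n\<^esub> f = (\<lambda>i. \<lambda>m\<in>cP P i. c \<odot>\<^bsub>piece Q (i + n)\<^esub> f i m)"
  by (simp_all add: mixed_hom_def)

lemma mixed_hom_ext:
  assumes "\<And>i. f i \<in> extensional (cP P i)" "\<And>i. g i \<in> extensional (cP P i)"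
    "\<And>i m. m \<in> cP P i \<Longrightarrow> f i m = g i m"
  shows "f = g"
  using assms by (intro ext) (metis extensional_arb)

context
  fixes H :: "('k::field, 'h::ring_1) hopf"
begin

lemma mixedD:
  assumes "mixed_base H P"
  shows "aYD_contramodule H (piece P i)" "kmodule (piece P i)"
    "dmap P i \<in> aYD_hom H (piece P i) (piece P (i + 1))" "hmap P i \<in> aYD_hom H (piece P i) (piece P (i - 1))"
    "m \<in> cP P i \<Longrightarrow> dmap P i m \<in> cP P (i + 1)" "m \<in> cP P i \<Longrightarrow> hmap P i m \<in> cP P (i - 1)"
proof -
  interpret mixed_base H P by fact
  show "aYD_contramodule H (piece P i)" "kmodule (piece P i)"
    by (rule piece_aYD aYD_kmodule[OF piece_aYD])+
  show "dmap P i \<in> aYD_hom H (piece P i) (piece P (i + 1))" "hmap P i \<in> aYD_hom H (piece P i) (piece P (i - 1))"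
    "m \<in> cP P i \<Longrightarrow> dmap P i m \<in> cP P (i + 1)" "m \<in> cP P i \<Longrightarrow> hmap P i m \<in> cP P (i - 1)"
    using d_hom[of i] h_hom[of i] aYD_hom_linear(1)[OF d_hom] aYD_hom_linear(1)[OF h_hom] by auto
qed

lemma mixed_hom_cl: "f \<in> carrier (mixed_hom H P Q n) \<Longrightarrow> m \<in> cP P i \<Longrightarrow> f i m \<in> cP Q (i + n)"
  by (rule aYD_hom_linear(1)[OF mixed_homD(1)])

lemma kmodule_mixed_hom:
  assumes "mixed_base H P" "mixed_base H Q"
  shows "kmodule (mixed_hom H P Q n)"
proof -
  note mP = mixedD[OF assms(1)] and mQ = mixedD[OF assms(2)]
  note cl = kmodule_closed[OF mQ(2)]
  note hl = aYD_hom_linear[OF mQ(4)]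
  have ix: "i + n - 1 = i - 1 + n" for i :: int by simp
  have smult: "(\<lambda>i. \<lambda>m\<in>cP P i. c \<odot>\<^bsub>piece Q (i + n)\<^esub> f i m) \<in> carrier (mixed_hom H P Q n)"
    if f: "f \<in> carrier (mixed_hom H P Q n)" for c f
  proof (rule mixed_homI)
    fix i m
    show "(\<lambda>m\<in>cP P i. c \<odot>\<^bsub>piece Q (i + n)\<^esub> f i m) \<in> aYD_hom H (piece P i) (piece Q (i + n))"
      by (intro aYD_hom_restrict aYD_hom_smult mixed_homD(1)[OF f] mP mQ)
    show "(\<lambda>m\<in>cP P i. c \<odot>\<^bsub>piece Q (i + n)\<^esub> f i m) \<in> extensional (cP P i)" by simp
    assume m: "m \<in> cP P i"
    have "f (i - 1) (hmap P i m) \<in> cP Q (i - 1 + n)" using mixed_hom_cl[OF f] mP(6)[OF m] by blast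
    then show "hmap Q (i + n) ((\<lambda>m\<in>cP P i. c \<odot>\<^bsub>piece Q (i + n)\<^esub> f i m) m) = (- 1) powi n \<odot>\<^bsub>piece Q (i + n - 1)\<^esub>
       (\<lambda>m\<in>cP P (i - 1). c \<odot>\<^bsub>piece Q (i - 1 + n)\<^esub> f (i - 1) m) (hmap P i m)"
      using m mP(6)[OF m] mixed_hom_cl[OF f m]
      by (simp add: hl mixed_homD(3)[OF f m] ix kmodule_rules(2)[OF mQ(2), symmetric] mult.commute)
  qed
  have add: "(\<lambda>i. \<lambda>m\<in>cP P i. f i m \<oplus>\<^bsub>piece Q (i + n)\<^esub> g i m) \<in> carrier (mixed_hom H P Q n)"
    if f: "f \<in> carrier (mixed_hom H P Q n)" and g: "g \<in> carrier (mixed_hom H P Q n)" for f g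
  proof (rule mixed_homI)
    fix i m
    show "(\<lambda>m\<in>cP P i. f i m \<oplus>\<^bsub>piece Q (i + n)\<^esub> g i m) \<in> aYD_hom H (piece P i) (piece Q (i + n))"
      by (intro aYD_hom_restrict aYD_hom_add mixed_homD(1)[OF f] mixed_homD(1)[OF g] mP mQ)
    show "(\<lambda>m\<in>cP P i. f i m \<oplus>\<^bsub>piece Q (i + n)\<^esub> g i m) \<in> extensional (cP P i)" by simp
    assume m: "m \<in> cP P i"
    have "f (i - 1) (hmap P i m) \<in> cP Q (i - 1 + n)" "g (i - 1) (hmap P i m) \<in> cP Q (i - 1 + n)"
      using mixed_hom_cl[OF f] mixed_hom_cl[OF g] mP(6)[OF m] by blast+
    moreover have "(-1) powi n \<odot>\<^bsub>piece Q (i - 1 + n)\<^esub> (x \<oplus>\<^bsub>piece Q (i - 1 + n)\<^esub> y) =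
        (-1) powi n \<odot>\<^bsub>piece Q (i - 1 + n)\<^esub> x \<oplus>\<^bsub>piece Q (i - 1 + n)\<^esub> (-1) powi n \<odot>\<^bsub>piece Q (i - 1 + n)\<^esub> y"
      if "x \<in> cP Q (i - 1 + n)" "y \<in> cP Q (i - 1 + n)" for x y
      by (rule kmodule_eqI[OF mQ(2)[of "i - 1 + n"]]) (use that cl in \<open>simp_all add: free.scale_right_distrib\<close>)
    ultimately show "hmap Q (i + n) ((\<lambda>m\<in>cP P i. f i m \<oplus>\<^bsub>piece Q (i + n)\<^esub> g i m) m) = (- 1) powi n \<odot>\<^bsub>piece Q (i + n - 1)\<^esub>
       (\<lambda>m\<in>cP P (i - 1). f (i - 1) m \<oplus>\<^bsub>piece Q (i - 1 + n)\<^esub> g (i - 1) m) (hmap P i m)"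
      using m mP(6)[OF m] mixed_hom_cl[OF f m] mixed_hom_cl[OF g m]
      by (simp add: hl mixed_homD(3)[OF f m] mixed_homD(3)[OF g m] ix)
  qed
  have zero: "(\<lambda>i. \<lambda>m\<in>cP P i. \<zero>\<^bsub>piece Q (i + n)\<^esub>) \<in> carrier (mixed_hom H P Q n)"
  proof (rule mixed_homI)
    fix i m
    have "(\<lambda>m. \<zero>\<^bsub>piece Q (i + n)\<^esub>) \<in> aYD_hom H (piece P i) (piece Q (i + n))"
    proof (rule aYD_homI)
      interpret N: aYD_contramodule H "piece Q (i + n)" by (rule mQ)
      have z: "act (piece Q (i + n)) x \<zero>\<^bsub>piece Q (i + n)\<^esub> = \<zero>\<^bsub>piece Q (i + n)\<^esub>" for x
        by (rule linear_maps_zero[OF mQ(2) mQ(2) N.act_linear])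
      show "(\<lambda>m. \<zero>\<^bsub>piece Q (i + n)\<^esub>) \<in> linear_maps (piece P i) (piece Q (i + n))"
        by (rule linear_mapsI) (simp_all add: kmodule_cancel[OF mQ(2)] kmodule_rules[OF mQ(2)] cl)
      then show "\<zero>\<^bsub>piece Q (i + n)\<^esub> = act (piece Q (i + n)) x \<zero>\<^bsub>piece Q (i + n)\<^esub>" for x
        using z by simp
      have "(\<lambda>h. \<zero>\<^bsub>piece Q (i + n)\<^esub>) \<in> linear_maps (hmod H) (piece Q (i + n))"
        by (rule linear_mapsI) (simp_all add: kmodule_cancel[OF mQ(2)] kmodule_rules[OF mQ(2)] cl)
      \<comment> \<open>alpha sends the zero map to 0, by homogeneity with the scalar 0.\<close>
      from N.contra_smult[OF this, of 0] N.contra_closed[OF this]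
      show "\<zero>\<^bsub>piece Q (i + n)\<^esub> = contra (piece Q (i + n)) (\<lambda>h. \<zero>\<^bsub>piece Q (i + n)\<^esub>)"
        by (simp add: kmodule_rules[OF mQ(2)] cl)
    qed
    then show "(\<lambda>m\<in>cP P i. \<zero>\<^bsub>piece Q (i + n)\<^esub>) \<in> aYD_hom H (piece P i) (piece Q (i + n))"
      by (rule aYD_hom_restrict[OF _ mP(1)])
    show "(\<lambda>m\<in>cP P i. \<zero>\<^bsub>piece Q (i + n)\<^esub>) \<in> extensional (cP P i)" by simp
    assume m: "m \<in> cP P i"
    then show "hmap Q (i + n) ((\<lambda>m\<in>cP P i. \<zero>\<^bsub>piece Q (i + n)\<^esub>) m) = (- 1) powi n \<odot>\<^bsub>piece Q (i + n - 1)\<^esub>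
       (\<lambda>m\<in>cP P (i - 1). \<zero>\<^bsub>piece Q (i - 1 + n)\<^esub>) (hmap P i m)"
      using mP(6)[OF m] linear_maps_zero[OF mQ(2) mQ(2) aYD_homD(1)[OF mQ(4)], of "i + n"]
      by (simp add: ix kmodule_rules(5)[OF mQ(2) cl(4)])
  qed
  show ?thesis
  proof (rule kmoduleI; (unfold mixed_hom_simps)?)
    fix f assume f: "f \<in> carrier (mixed_hom H P Q n)"
    note fc = mixed_hom_cl[OF f] and fe = mixed_homD(2)[OF f]
    show "(\<lambda>i. \<lambda>m\<in>cP P i. (\<lambda>m\<in>cP P i. \<zero>\<^bsub>piece Q (i + n)\<^esub>) m \<oplus>\<^bsub>piece Q (i + n)\<^esub> f i m) = f"
      by (rule mixed_hom_ext) (use fe fc in \<open>auto simp: kmodule_cancel[OF mQ(2)]\<close>)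
    show "(\<lambda>i. \<lambda>m\<in>cP P i. 1 \<odot>\<^bsub>piece Q (i + n)\<^esub> f i m) = f"
      by (rule mixed_hom_ext) (use fe fc in \<open>auto simp: kmodule_rules[OF mQ(2)]\<close>)
    show "(\<lambda>i. \<lambda>m\<in>cP P i. (\<lambda>m\<in>cP P i. (- 1) \<odot>\<^bsub>piece Q (i + n)\<^esub> f i m) m \<oplus>\<^bsub>piece Q (i + n)\<^esub> f i m)
       = (\<lambda>i. \<lambda>m\<in>cP P i. \<zero>\<^bsub>piece Q (i + n)\<^esub>)"
    proof (rule mixed_hom_ext)
      fix i m assume m: "m \<in> cP P i"
      have "(- 1) \<odot>\<^bsub>piece Q (i + n)\<^esub> f i m \<oplus>\<^bsub>piece Q (i + n)\<^esub> f i m = \<zero>\<^bsub>piece Q (i + n)\<^esub>"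
        by (rule kmodule_eqI[OF mQ(2)[of "i + n"]]) (use fc[OF m] cl in simp_all)
      then show "(\<lambda>m\<in>cP P i. (\<lambda>m\<in>cP P i. (- 1) \<odot>\<^bsub>piece Q (i + n)\<^esub> f i m) m \<oplus>\<^bsub>piece Q (i + n)\<^esub> f i m) m
        = (\<lambda>m\<in>cP P i. \<zero>\<^bsub>piece Q (i + n)\<^esub>) m" using m by simp
    qed auto
    fix a b :: 'k
    show "(\<lambda>i. \<lambda>m\<in>cP P i. (a + b) \<odot>\<^bsub>piece Q (i + n)\<^esub> f i m) =
       (\<lambda>i. \<lambda>m\<in>cP P i. (\<lambda>m\<in>cP P i. a \<odot>\<^bsub>piece Q (i + n)\<^esub> f i m) m \<oplus>\<^bsub>piece Q (i + n)\<^esub> (\<lambda>m\<in>cP P i. b \<odot>\<^bsub>piece Q (i + n)\<^esub> f i m) m)"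
      by (rule mixed_hom_ext) (use fc in \<open>auto simp: kmodule_rules[OF mQ(2)]\<close>)
    show "(\<lambda>i. \<lambda>m\<in>cP P i. (a * b) \<odot>\<^bsub>piece Q (i + n)\<^esub> f i m) =
       (\<lambda>i. \<lambda>m\<in>cP P i. a \<odot>\<^bsub>piece Q (i + n)\<^esub> (\<lambda>m\<in>cP P i. b \<odot>\<^bsub>piece Q (i + n)\<^esub> f i m) m)"
      by (rule mixed_hom_ext) (use fc in \<open>auto simp: kmodule_rules[OF mQ(2)]\<close>)
    fix g assume g: "g \<in> carrier (mixed_hom H P Q n)"
    note gc = mixed_hom_cl[OF g]
    show "(\<lambda>i. \<lambda>m\<in>cP P i. f i m \<oplus>\<^bsub>piece Q (i + n)\<^esub> g i m) = (\<lambda>i. \<lambda>m\<in>cP P i. g i m \<oplus>\<^bsub>piece Q (i + n)\<^esub> f i m)"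
    proof (rule mixed_hom_ext)
      fix i m assume m: "m \<in> cP P i"
      have "f i m \<oplus>\<^bsub>piece Q (i + n)\<^esub> g i m = g i m \<oplus>\<^bsub>piece Q (i + n)\<^esub> f i m"
        by (rule kmodule_eqI[OF mQ(2)[of "i + n"]]) (use fc[OF m] gc[OF m] cl in \<open>simp_all add: add.commute\<close>)
      then show "(\<lambda>m\<in>cP P i. f i m \<oplus>\<^bsub>piece Q (i + n)\<^esub> g i m) m = (\<lambda>m\<in>cP P i. g i m \<oplus>\<^bsub>piece Q (i + n)\<^esub> f i m) m"
        using m by simp
    qed auto
    show "(\<lambda>i. \<lambda>m\<in>cP P i. a \<odot>\<^bsub>piece Q (i + n)\<^esub> (\<lambda>m\<in>cP P i. f i m \<oplus>\<^bsub>piece Q (i + n)\<^esub> g i m) m) =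
       (\<lambda>i. \<lambda>m\<in>cP P i. (\<lambda>m\<in>cP P i. a \<odot>\<^bsub>piece Q (i + n)\<^esub> f i m) m \<oplus>\<^bsub>piece Q (i + n)\<^esub> (\<lambda>m\<in>cP P i. a \<odot>\<^bsub>piece Q (i + n)\<^esub> g i m) m)"
    proof (rule mixed_hom_ext)
      fix i m assume m: "m \<in> cP P i"
      have "a \<odot>\<^bsub>piece Q (i + n)\<^esub> (f i m \<oplus>\<^bsub>piece Q (i + n)\<^esub> g i m) = a \<odot>\<^bsub>piece Q (i + n)\<^esub> f i m \<oplus>\<^bsub>piece Q (i + n)\<^esub> a \<odot>\<^bsub>piece Q (i + n)\<^esub> g i m"
        by (rule kmodule_eqI[OF mQ(2)[of "i + n"]]) (use fc[OF m] gc[OF m] cl in \<open>simp_all add: free.scale_right_distrib\<close>)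
      then show "(\<lambda>m\<in>cP P i. a \<odot>\<^bsub>piece Q (i + n)\<^esub> (\<lambda>m\<in>cP P i. f i m \<oplus>\<^bsub>piece Q (i + n)\<^esub> g i m) m) m =
       (\<lambda>m\<in>cP P i. (\<lambda>m\<in>cP P i. a \<odot>\<^bsub>piece Q (i + n)\<^esub> f i m) m \<oplus>\<^bsub>piece Q (i + n)\<^esub> (\<lambda>m\<in>cP P i. a \<odot>\<^bsub>piece Q (i + n)\<^esub> g i m) m) m"
        using m by simp
    qed auto
    fix h assume h: "h \<in> carrier (mixed_hom H P Q n)"
    note hc = mixed_hom_cl[OF h]
    show "(\<lambda>i. \<lambda>m\<in>cP P i. (\<lambda>m\<in>cP P i. f i m \<oplus>\<^bsub>piece Q (i + n)\<^esub> g i m) m \<oplus>\<^bsub>piece Q (i + n)\<^esub> h i m) =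
       (\<lambda>i. \<lambda>m\<in>cP P i. f i m \<oplus>\<^bsub>piece Q (i + n)\<^esub> (\<lambda>m\<in>cP P i. g i m \<oplus>\<^bsub>piece Q (i + n)\<^esub> h i m) m)"
    proof (rule mixed_hom_ext)
      fix i m assume m: "m \<in> cP P i"
      have "f i m \<oplus>\<^bsub>piece Q (i + n)\<^esub> g i m \<oplus>\<^bsub>piece Q (i + n)\<^esub> h i m = f i m \<oplus>\<^bsub>piece Q (i + n)\<^esub> (g i m \<oplus>\<^bsub>piece Q (i + n)\<^esub> h i m)"
        by (rule kmodule_eqI[OF mQ(2)[of "i + n"]]) (use fc[OF m] gc[OF m] hc[OF m] cl in \<open>simp_all add: add.assoc\<close>)
      then show "(\<lambda>m\<in>cP P i. (\<lambda>m\<in>cP P i. f i m \<oplus>\<^bsub>piece Q (i + n)\<^esub> g i m) m \<oplus>\<^bsub>piece Q (i + n)\<^esub> h i m) m =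
       (\<lambda>m\<in>cP P i. f i m \<oplus>\<^bsub>piece Q (i + n)\<^esub> (\<lambda>m\<in>cP P i. g i m \<oplus>\<^bsub>piece Q (i + n)\<^esub> h i m) m) m"
        using m by simp
    qed auto
  qed (auto intro: add smult zero)
qed

lemma mixed_dgcat_simps [simp]:
  "Ob (mixed_dgcat H A) = A" "Hom (mixed_dgcat H A) = mixed_hom H"
  "Ident (mixed_dgcat H A) P = (\<lambda>i. \<lambda>m\<in>cP P i. m)"
  "Comp (mixed_dgcat H A) P Q R p q g f = (\<lambda>i. \<lambda>m\<in>cP P i. g (i + q) (f i m))"
  "Diff (mixed_dgcat H A) P Q n f = (\<lambda>i. \<lambda>m\<in>cP P i. dmap Q (i + n) (f i m)
        \<ominus>\<^bsub>piece Q (i + n + 1)\<^esub> ((-1) powi n) \<odot>\<^bsub>piece Q (i + n + 1)\<^esub> f (i + 1) (dmap P i m))"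
  by (simp_all add: mixed_dgcat_def)

abbreviation "mixedC \<equiv> mixed_dgcat H {P. mixed_aYD_contramodule H P}"

lemma mixed_aYD_base: "mixed_aYD_contramodule H P \<Longrightarrow> mixed_base H P"
  by (simp add: mixed_aYD_contramodule_def)

text \<open>On source and target dh + hd = sigma - 1, and \<open>f\<close> commutes with sigma, so
  (dh + hd) f = f (dh + hd). Together with the sign rule between h and \<open>f\<close>, this is the
  sign rule between h and the differential of \<open>f\<close>.\<close>

lemma mixed_Diff_closed:
  fixes P Q :: "('k, 'h, 'm) mixed"
  assumes P: "mixed_aYD_contramodule H P" and Q: "mixed_aYD_contramodule H Q"
    and f: "f \<in> carrier (mixed_hom H P Q n)"
  shows "Diff mixedC P Q n f \<in> carrier (mixed_hom H P Q (n + 1))"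
proof (rule mixed_homI)
  fix i m
  note mP = mixedD[OF mixed_aYD_base[OF P]] and mQ = mixedD[OF mixed_aYD_base[OF Q]]
  note fc = mixed_hom_cl[OF f]
  let ?s = "(-1 :: 'k) powi n"
  have ix: "i + (n + 1) = i + n + 1" "i + n + 1 - 1 = i + n" "i - 1 + n = i + n - 1" "i + n - 1 + 1 = i + n"
    "i + 1 + n = i + n + 1" by simp_all
  have f1: "f (i + 1) \<in> aYD_hom H (piece P (i + 1)) (piece Q (i + n + 1))"
    using mixed_homD(1)[OF f, of "i + 1"] by (simp add: add_ac)
  have "(\<lambda>m\<in>cP P i. dmap Q (i + n) (f i m)
        \<ominus>\<^bsub>piece Q (i + n + 1)\<^esub> ?s \<odot>\<^bsub>piece Q (i + n + 1)\<^esub> f (i + 1) (dmap P i m))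
     \<in> aYD_hom H (piece P i) (piece Q (i + n + 1))"
    by (intro aYD_hom_restrict aYD_hom_diff aYD_hom_smult aYD_hom_comp[OF mixed_homD(1)[OF f] mQ(3)]
      aYD_hom_comp[OF mP(3) f1] mP mQ)
  then show "Diff mixedC P Q n f i \<in> aYD_hom H (piece P i) (piece Q (i + (n + 1)))" by (simp add: ix(1))
  show "Diff mixedC P Q n f i \<in> extensional (cP P i)" by simp
  assume m: "m \<in> cP P i"
  let ?K = "piece Q (i + n)"
  have cl: "hmap Q (i + n + 1) (dmap Q (i + n) (f i m)) \<in> carrier ?K"
    "dmap Q (i + n - 1) (f (i - 1) (hmap P i m)) \<in> carrier ?K"
    "f i (hmap P (i + 1) (dmap P i m)) \<in> carrier ?K" "f i (dmap P (i - 1) (hmap P i m)) \<in> carrier ?K"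
    "f i m \<in> carrier ?K" "f (i - 1) (hmap P i m) \<in> cP Q (i + n - 1)"
    "dmap Q (i + n) (f i m) \<in> cP Q (i + n + 1)" "f (i + 1) (dmap P i m) \<in> cP Q (i + n + 1)"
    "hmap P (i + 1) (dmap P i m) \<in> cP P i" "dmap P (i - 1) (hmap P i m) \<in> cP P i"
    using mQ(6)[OF mQ(5)[OF fc[OF m]]] mQ(5)[OF fc[OF mP(6)[OF m]]] fc[OF mP(6)[OF m]]
      mP(6)[OF mP(5)[OF m]] mP(5)[OF mP(6)[OF m]] fc[of _ i] fc[OF m] mQ(5)[OF fc[OF m]] fc[OF mP(5)[OF m]]
    by (simp_all add: ix)
  note kc = kmodule_closed[OF mQ(2)]
  have e1: "hmap Q (i + n) (f i m) = ?s \<odot>\<^bsub>piece Q (i + n - 1)\<^esub> f (i - 1) (hmap P i m)"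
    by (rule mixed_homD(3)[OF f m])
  have e2: "hmap Q (i + n + 1) (f (i + 1) (dmap P i m)) = ?s \<odot>\<^bsub>?K\<^esub> f i (hmap P (i + 1) (dmap P i m))"
    using mixed_homD(3)[OF f mP(5)[OF m]] by (simp add: add_ac diff_add_eq)
  have e3: "dmap Q (i + n - 1) (hmap Q (i + n) (f i m)) = ?s \<odot>\<^bsub>?K\<^esub> dmap Q (i + n - 1) (f (i - 1) (hmap P i m))"
    using aYD_hom_linear(3)[OF mQ(3)[of "i + n - 1"] cl(6)] by (simp add: e1)
  have dQ: "dmap Q (i + n - 1) (hmap Q (i + n) (f i m)) \<oplus>\<^bsub>?K\<^esub> hmap Q (i + n + 1) (dmap Q (i + n) (f i m))
      = sigma ?K (f i m) \<ominus>\<^bsub>?K\<^esub> f i m"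
    by (rule mixed_aYD_contramodule.dh_hd[OF Q cl(5)])
  have "f i (dmap P (i - 1) (hmap P i m) \<oplus>\<^bsub>piece P i\<^esub> hmap P (i + 1) (dmap P i m)) = f i (sigma (piece P i) m \<ominus>\<^bsub>piece P i\<^esub> m)"
    using mixed_aYD_contramodule.dh_hd[OF P m] by simp
  then have dP: "f i (dmap P (i - 1) (hmap P i m)) \<oplus>\<^bsub>?K\<^esub> f i (hmap P (i + 1) (dmap P i m))
      = sigma ?K (f i m) \<ominus>\<^bsub>?K\<^esub> f i m"
    using aYD_hom_linear(2)[OF mixed_homD(1)[OF f] cl(10,9)] sigma_natural[OF mP(1) mixed_homD(1)[OF f] m]
      linear_maps_minus[OF mP(2) mQ(2) aYD_homD(1)[OF mixed_homD(1)[OF f]] sigma_closed[OF mP(1) m] m] by simp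
  have hd: "hmap Q (i + n + 1) (dmap Q (i + n) (f i m)
        \<ominus>\<^bsub>piece Q (i + n + 1)\<^esub> ?s \<odot>\<^bsub>piece Q (i + n + 1)\<^esub> f (i + 1) (dmap P i m))
     = hmap Q (i + n + 1) (dmap Q (i + n) (f i m)) \<ominus>\<^bsub>?K\<^esub> ?s \<odot>\<^bsub>?K\<^esub> (?s \<odot>\<^bsub>?K\<^esub> f i (hmap P (i + 1) (dmap P i m)))"
    using linear_maps_minus[OF mQ(2) mQ(2) aYD_homD(1)[OF mQ(4)] cl(7) kc(3)[OF cl(8)], of ?s]
      aYD_hom_linear(3)[OF mQ(4) cl(8)]
    by (simp add: e2)
  have "hmap Q (i + n + 1) (dmap Q (i + n) (f i m)) \<ominus>\<^bsub>?K\<^esub> ?s \<odot>\<^bsub>?K\<^esub> (?s \<odot>\<^bsub>?K\<^esub> f i (hmap P (i + 1) (dmap P i m)))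
    = (- ?s) \<odot>\<^bsub>?K\<^esub> (dmap Q (i + n - 1) (f (i - 1) (hmap P i m)) \<ominus>\<^bsub>?K\<^esub> ?s \<odot>\<^bsub>?K\<^esub> f i (dmap P (i - 1) (hmap P i m)))"
  proof (rule kmodule_eqI[OF mQ(2)[of "i + n"]])
    fix j :: "'m \<Rightarrow> 'm \<Rightarrow>\<^sub>0 'k"
    assume j: "\<And>a b. a \<in> carrier ?K \<Longrightarrow> b \<in> carrier ?K \<Longrightarrow> j (a \<oplus>\<^bsub>?K\<^esub> b) = j a + j b"
      "\<And>c a. a \<in> carrier ?K \<Longrightarrow> j (c \<odot>\<^bsub>?K\<^esub> a) = free_scale c (j a)"
      "\<And>a b. a \<in> carrier ?K \<Longrightarrow> b \<in> carrier ?K \<Longrightarrow> j (a \<ominus>\<^bsub>?K\<^esub> b) = j a - j b"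
    have "j (?s \<odot>\<^bsub>?K\<^esub> dmap Q (i + n - 1) (f (i - 1) (hmap P i m)) \<oplus>\<^bsub>?K\<^esub> hmap Q (i + n + 1) (dmap Q (i + n) (f i m)))
      = j (f i (dmap P (i - 1) (hmap P i m)) \<oplus>\<^bsub>?K\<^esub> f i (hmap P (i + 1) (dmap P i m)))"
      using dQ dP e3 by simp
    then have "free_scale ?s (j (dmap Q (i + n - 1) (f (i - 1) (hmap P i m)))) + j (hmap Q (i + n + 1) (dmap Q (i + n) (f i m)))
      = j (f i (dmap P (i - 1) (hmap P i m))) + j (f i (hmap P (i + 1) (dmap P i m)))"
      using cl kc by (simp add: j)
    then show "j (hmap Q (i + n + 1) (dmap Q (i + n) (f i m)) \<ominus>\<^bsub>?K\<^esub> ?s \<odot>\<^bsub>?K\<^esub> (?s \<odot>\<^bsub>?K\<^esub> f i (hmap P (i + 1) (dmap P i m))))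
      = j ((- ?s) \<odot>\<^bsub>?K\<^esub> (dmap Q (i + n - 1) (f (i - 1) (hmap P i m)) \<ominus>\<^bsub>?K\<^esub> ?s \<odot>\<^bsub>?K\<^esub> f i (dmap P (i - 1) (hmap P i m))))"
      using cl kc by (simp add: j free.scale_right_diff_distrib algebra_simps)
  qed (use cl kc in simp_all)
  then show "hmap Q (i + (n + 1)) (Diff mixedC P Q n f i m) = (- 1) powi (n + 1) \<odot>\<^bsub>piece Q (i + (n + 1) - 1)\<^esub>
       Diff mixedC P Q n f (i - 1) (hmap P i m)"
    using m mP(6)[OF m] by (simp add: ix hd)
qed

lemma mixed_Diff_Diff:
  assumes P: "mixed_aYD_contramodule H P" and Q: "mixed_aYD_contramodule H Q"
    and f: "f \<in> carrier (mixed_hom H P Q n)"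
  shows "Diff mixedC P Q (n + 1) (Diff mixedC P Q n f) = \<zero>\<^bsub>mixed_hom H P Q (n + 2)\<^esub>"
  unfolding mixed_hom_simps
proof (rule mixed_hom_ext)
  fix i m assume m: "m \<in> cP P i"
  note mP = mixedD[OF mixed_aYD_base[OF P]] and mQ = mixedD[OF mixed_aYD_base[OF Q]]
  note fc = mixed_hom_cl[OF f] and kc = kmodule_closed[OF mQ(2)]
  let ?s = "(-1 :: 'k) powi n" and ?K1 = "piece Q (i + n + 1)" and ?K2 = "piece Q (i + n + 2)"
  have ix: "i + (n + 1) = i + n + 1" "i + (n + 2) = i + n + 2" "i + n + 1 + 1 = i + n + 2" "i + 1 + n = i + n + 1" by simp_all
  have c: "dmap Q (i + n) (f i m) \<in> carrier ?K1" "f (i + 1) (dmap P i m) \<in> carrier ?K1"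
    using mQ(5)[OF fc[OF m]] fc[OF mP(5)[OF m]] by (simp_all add: ix)
  have cd: "dmap Q (i + n + 1) x \<in> carrier ?K2" if "x \<in> carrier ?K1" for x
    using mQ(5)[OF that] by (simp add: ix)
  have ddP: "dmap P (i + 1) (dmap P i m) = \<zero>\<^bsub>piece P (i + 2)\<^esub>"
    by (rule mixed_base.d_d[OF mixed_aYD_base[OF P] m])
  have ddQ: "dmap Q (i + n + 1) (dmap Q (i + n) (f i m)) = \<zero>\<^bsub>?K2\<^esub>"
    by (rule mixed_base.d_d[OF mixed_aYD_base[OF Q] fc[OF m]])
  have f0: "f (i + 2) \<zero>\<^bsub>piece P (i + 2)\<^esub> = \<zero>\<^bsub>?K2\<^esub>"
    using linear_maps_zero[OF mP(2) mQ(2) aYD_homD(1)[OF mixed_homD(1)[OF f, of "i + 2"]]] by (simp add: add_ac)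
  have dl: "dmap Q (i + n + 1) \<in> linear_maps ?K1 ?K2"
    using aYD_homD(1)[OF mQ(3)[of "i + n + 1"]] by (simp add: ix)
  have d1: "dmap Q (i + n + 1) (dmap Q (i + n) (f i m) \<ominus>\<^bsub>?K1\<^esub> ?s \<odot>\<^bsub>?K1\<^esub> f (i + 1) (dmap P i m))
     = \<zero>\<^bsub>?K2\<^esub> \<ominus>\<^bsub>?K2\<^esub> ?s \<odot>\<^bsub>?K2\<^esub> dmap Q (i + n + 1) (f (i + 1) (dmap P i m))"
    by (simp add: linear_maps_minus[OF mQ(2) mQ(2) dl] linear_mapsD(3)[OF dl] c kc ddQ)
  have "(\<zero>\<^bsub>?K2\<^esub> \<ominus>\<^bsub>?K2\<^esub> ?s \<odot>\<^bsub>?K2\<^esub> dmap Q (i + n + 1) (f (i + 1) (dmap P i m)))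
     \<ominus>\<^bsub>?K2\<^esub> (- ?s) \<odot>\<^bsub>?K2\<^esub> (dmap Q (i + n + 1) (f (i + 1) (dmap P i m)) \<ominus>\<^bsub>?K2\<^esub> ?s \<odot>\<^bsub>?K2\<^esub> \<zero>\<^bsub>?K2\<^esub>) = \<zero>\<^bsub>?K2\<^esub>"
    by (rule kmodule_eqI[OF mQ(2)[of "i + n + 2"]]) (use c cd kc in \<open>simp_all add: free.scale_right_diff_distrib\<close>)
  then show "Diff mixedC P Q (n + 1) (Diff mixedC P Q n f) i m = (\<lambda>m\<in>cP P i. \<zero>\<^bsub>piece Q (i + (n + 2))\<^esub>) m"
    using m mP(5)[OF m] by (simp add: ix d1 ddP f0 add.commute[of 2])
qed auto

lemma mixed_Diff_linear:
  assumes P: "mixed_aYD_contramodule H P" and Q: "mixed_aYD_contramodule H Q"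
  shows "Diff mixedC P Q n \<in> linear_maps (mixed_hom H P Q n) (mixed_hom H P Q (n + 1))"
proof (rule linear_mapsI)
  note mP = mixedD[OF mixed_aYD_base[OF P]] and mQ = mixedD[OF mixed_aYD_base[OF Q]]
  note kc = kmodule_closed[OF mQ(2)]
  let ?s = "(-1 :: 'k) powi n"
  show "Diff mixedC P Q n f \<in> carrier (mixed_hom H P Q (n + 1))" if "f \<in> carrier (mixed_hom H P Q n)" for f
    by (rule mixed_Diff_closed[OF P Q that])
  have ix: "i + (n + 1) = i + n + 1" "i + 1 + n = i + n + 1" for i by simp_all
  have c: "dmap Q (i + n) (f i m) \<in> cP Q (i + n + 1)" "f (i + 1) (dmap P i m) \<in> cP Q (i + n + 1)" "f i m \<in> cP Q (i + n)"
    if "f \<in> carrier (mixed_hom H P Q n)" "m \<in> cP P i" for f i m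
    using mQ(5)[OF mixed_hom_cl[OF that]] mixed_hom_cl[OF that(1) mP(5)[OF that(2)]] mixed_hom_cl[OF that]
    by (simp_all add: ix)
  note dl = aYD_hom_linear[OF mQ(3)]
  fix f assume f: "f \<in> carrier (mixed_hom H P Q n)"
  show "Diff mixedC P Q n (a \<odot>\<^bsub>mixed_hom H P Q n\<^esub> f) = a \<odot>\<^bsub>mixed_hom H P Q (n + 1)\<^esub> Diff mixedC P Q n f" for a
    unfolding mixed_hom_simps
  proof (rule mixed_hom_ext)
    fix i m assume m: "m \<in> cP P i"
    let ?K = "piece Q (i + n + 1)"
    have "(a \<odot>\<^bsub>?K\<^esub> dmap Q (i + n) (f i m)) \<ominus>\<^bsub>?K\<^esub> ?s \<odot>\<^bsub>?K\<^esub> (a \<odot>\<^bsub>?K\<^esub> f (i + 1) (dmap P i m))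
      = a \<odot>\<^bsub>?K\<^esub> (dmap Q (i + n) (f i m) \<ominus>\<^bsub>?K\<^esub> ?s \<odot>\<^bsub>?K\<^esub> f (i + 1) (dmap P i m))"
      by (rule kmodule_eqI[OF mQ(2)[of "i + n + 1"]])
        (use c[OF f m] kc in \<open>simp_all add: free.scale_right_diff_distrib mult.commute\<close>)
    then show "Diff mixedC P Q n (\<lambda>i. \<lambda>m\<in>cP P i. a \<odot>\<^bsub>piece Q (i + n)\<^esub> f i m) i m
       = (\<lambda>m\<in>cP P i. a \<odot>\<^bsub>piece Q (i + (n + 1))\<^esub> Diff mixedC P Q n f i m) m"
      using m mP(5)[OF m] c[OF f m] by (simp add: ix dl)
  qed auto
  fix g assume g: "g \<in> carrier (mixed_hom H P Q n)"
  show "Diff mixedC P Q n (f \<oplus>\<^bsub>mixed_hom H P Q n\<^esub> g) = Diff mixedC P Q n f \<oplus>\<^bsub>mixed_hom H P Q (n + 1)\<^esub> Diff mixedC P Q n g"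
    unfolding mixed_hom_simps
  proof (rule mixed_hom_ext)
    fix i m assume m: "m \<in> cP P i"
    let ?K = "piece Q (i + n + 1)"
    have "(dmap Q (i + n) (f i m) \<oplus>\<^bsub>?K\<^esub> dmap Q (i + n) (g i m)) \<ominus>\<^bsub>?K\<^esub> ?s \<odot>\<^bsub>?K\<^esub> (f (i + 1) (dmap P i m) \<oplus>\<^bsub>?K\<^esub> g (i + 1) (dmap P i m))
      = (dmap Q (i + n) (f i m) \<ominus>\<^bsub>?K\<^esub> ?s \<odot>\<^bsub>?K\<^esub> f (i + 1) (dmap P i m)) \<oplus>\<^bsub>?K\<^esub> (dmap Q (i + n) (g i m) \<ominus>\<^bsub>?K\<^esub> ?s \<odot>\<^bsub>?K\<^esub> g (i + 1) (dmap P i m))"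
      by (rule kmodule_eqI[OF mQ(2)[of "i + n + 1"]])
        (use c[OF f m] c[OF g m] kc in \<open>simp_all add: free.scale_right_distrib\<close>)
    then show "Diff mixedC P Q n (\<lambda>i. \<lambda>m\<in>cP P i. f i m \<oplus>\<^bsub>piece Q (i + n)\<^esub> g i m) i m
       = (\<lambda>m\<in>cP P i. Diff mixedC P Q n f i m \<oplus>\<^bsub>piece Q (i + (n + 1))\<^esub> Diff mixedC P Q n g i m) m"
      using m mP(5)[OF m] c[OF f m] c[OF g m] by (simp add: ix dl)
  qed auto
qed

lemma mixed_Comp_closed:
  assumes P: "mixed_base H P" and Q: "mixed_base H Q" and R: "mixed_base H R"
    and g: "g \<in> carrier (mixed_hom H Q R p)" and f: "f \<in> carrier (mixed_hom H P Q q)"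
  shows "(\<lambda>i. \<lambda>m\<in>cP P i. g (i + q) (f i m)) \<in> carrier (mixed_hom H P R (p + q))"
proof (rule mixed_homI)
  note mP = mixedD[OF P] and mQ = mixedD[OF Q] and mR = mixedD[OF R]
  fix i m
  have ix: "i + (p + q) = i + q + p" by simp
  show "(\<lambda>m\<in>cP P i. g (i + q) (f i m)) \<in> aYD_hom H (piece P i) (piece R (i + (p + q)))"
    unfolding ix by (intro aYD_hom_restrict aYD_hom_comp[OF mixed_homD(1)[OF f] mixed_homD(1)[OF g]] mP)
  show "(\<lambda>m\<in>cP P i. g (i + q) (f i m)) \<in> extensional (cP P i)" by simp
  assume m: "m \<in> cP P i"
  have c: "f (i - 1) (hmap P i m) \<in> cP Q (i + q - 1)"
    using mixed_hom_cl[OF f mP(6)[OF m]] by (simp add: diff_add_eq)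
  have gc: "g (i + q - 1) (f (i - 1) (hmap P i m)) \<in> cP R (i + q + p - 1)"
    using mixed_hom_cl[OF g c] by (simp add: diff_add_eq)
  have gl: "g (i + q - 1) (a \<odot>\<^bsub>piece Q (i + q - 1)\<^esub> x) = a \<odot>\<^bsub>piece R (i + q + p - 1)\<^esub> g (i + q - 1) x"
    if "x \<in> cP Q (i + q - 1)" for a x
    using aYD_hom_linear(3)[OF mixed_homD(1)[OF g] that] by (simp add: diff_add_eq)
  have "hmap R (i + q + p) (g (i + q) (f i m)) = ((-1) powi p) \<odot>\<^bsub>piece R (i + q + p - 1)\<^esub> g (i + q - 1) (hmap Q (i + q) (f i m))"
    by (rule mixed_homD(3)[OF g mixed_hom_cl[OF f m]])
  also have "\<dots> = ((-1) powi (p + q)) \<odot>\<^bsub>piece R (i + q + p - 1)\<^esub> g (i + q - 1) (f (i - 1) (hmap P i m))"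
    by (simp add: mixed_homD(3)[OF f m] gl[OF c] kmodule_rules(2)[OF mR(2) gc])
  finally show "hmap R (i + (p + q)) ((\<lambda>m\<in>cP P i. g (i + q) (f i m)) m) = (-1) powi (p + q) \<odot>\<^bsub>piece R (i + (p + q) - 1)\<^esub>
      (\<lambda>m\<in>cP P (i - 1). g (i - 1 + q) (f (i - 1) m)) (hmap P i m)"
    unfolding ix using m mP(6)[OF m] by (simp add: diff_add_eq)
qed

lemma dg_category_mixed: "dg_category (mixedC :: (('k, 'h, 'm) mixed, int \<Rightarrow> 'm \<Rightarrow> 'm, 'k) dgcat)"
proof (rule dg_category.intro)
  fix P Q :: "('k, 'h, 'm) mixed" and n assume "P \<in> Ob mixedC" "Q \<in> Ob mixedC"
  then have P: "mixed_aYD_contramodule H P" and Q: "mixed_aYD_contramodule H Q" by auto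
  note bP = mixed_aYD_base[OF P] and bQ = mixed_aYD_base[OF Q]
  show "kmodule (Hom mixedC P Q n)" using kmodule_mixed_hom[OF bP bQ] by simp
  show "Diff mixedC P Q n \<in> linear_maps (Hom mixedC P Q n) (Hom mixedC P Q (n + 1))"
    using mixed_Diff_linear[OF P Q] by (simp del: mixed_dgcat_simps(5))
  fix f assume "f \<in> carrier (Hom mixedC P Q n)"
  then have f: "f \<in> carrier (mixed_hom H P Q n)" by simp
  show "Diff mixedC P Q (n + 1) (Diff mixedC P Q n f) = \<zero>\<^bsub>Hom mixedC P Q (n + 2)\<^esub>"
    using mixed_Diff_Diff[OF P Q f] by (simp del: mixed_dgcat_simps(5))
  show "Comp mixedC P Q Q 0 n (Ident mixedC Q) f = f" "Comp mixedC P P Q n 0 f (Ident mixedC P) = f"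
    using mixed_hom_cl[OF f] mixed_homD(2)[OF f]
    by (auto intro!: mixed_hom_ext)
next
  fix P Q R :: "('k, 'h, 'm) mixed" and f g and p q :: int assume "P \<in> Ob mixedC" "Q \<in> Ob mixedC" "R \<in> Ob mixedC"
  then have P: "mixed_aYD_contramodule H P" and Q: "mixed_aYD_contramodule H Q" and R: "mixed_aYD_contramodule H R" by auto
  note mP = mixedD[OF mixed_aYD_base[OF P]] and mQ = mixedD[OF mixed_aYD_base[OF Q]] and mR = mixedD[OF mixed_aYD_base[OF R]]
  note cc = mixed_Comp_closed[OF mixed_aYD_base[OF P] mixed_aYD_base[OF Q] mixed_aYD_base[OF R]]
  note kc = kmodule_closed[OF mR(2)]
  have ix: "i + (p + q) = i + q + p" for i by simp
  show "(\<lambda>g. Comp mixedC P Q R p q g f) \<in> linear_maps (Hom mixedC Q R p) (Hom mixedC P R (p + q))"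
    if "f \<in> carrier (Hom mixedC P Q q)"
  proof -
    have f: "f \<in> carrier (mixed_hom H P Q q)" using that by simp
    show ?thesis
      by (rule linear_mapsI)
        (use f cc[OF _ f] mixed_hom_cl[OF f] in \<open>auto simp: mixed_hom_simps ix intro!: mixed_hom_ext\<close>)
  qed
  show "Comp mixedC P Q R p q g \<in> linear_maps (Hom mixedC P Q q) (Hom mixedC P R (p + q))"
    if "g \<in> carrier (Hom mixedC Q R p)"
  proof -
    have g: "g \<in> carrier (mixed_hom H Q R p)" using that by simp
    have fc: "x i m \<in> cP Q (i + q)" if "x \<in> carrier (mixed_hom H P Q q)" "m \<in> cP P i" for x i m
      using mixed_hom_cl[OF that] .
    show ?thesis
      by (rule linear_mapsI)
        (auto simp: mixed_hom_simps ix fc cc[OF g, simplified] aYD_hom_linear[OF mixed_homD(1)[OF g]] intro!: mixed_hom_ext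
          cc[OF g])
  qed
  assume "g \<in> carrier (Hom mixedC Q R p)" "f \<in> carrier (Hom mixedC P Q q)"
  then have g: "g \<in> carrier (mixed_hom H Q R p)" and f: "f \<in> carrier (mixed_hom H P Q q)" by auto
  show "Diff mixedC P R (p + q) (Comp mixedC P Q R p q g f) =
        Comp mixedC P Q R (p + 1) q (Diff mixedC Q R p g) f \<oplus>\<^bsub>Hom mixedC P R (p + q + 1)\<^esub>
        ((-1) powi p) \<odot>\<^bsub>Hom mixedC P R (p + q + 1)\<^esub> Comp mixedC P Q R p (q + 1) g (Diff mixedC P Q q f)"
    unfolding mixed_dgcat_simps(2) mixed_hom_simps
  proof (rule mixed_hom_ext)
    fix i m assume m: "m \<in> cP P i"
    let ?K = "piece R (i + q + p + 1)" and ?s = "(-1 :: 'k) powi p" and ?t = "(-1 :: 'k) powi q"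
    have ix2: "i + (p + q) + 1 = i + q + p + 1" "i + (p + q + 1) = i + q + p + 1" "i + (q + 1) = i + q + 1"
      "i + 1 + q = i + q + 1" "i + q + 1 + p = i + q + p + 1" "i + (p + q) = i + q + p" by simp_all
    have fm: "f i m \<in> cP Q (i + q)" by (rule mixed_hom_cl[OF f m])
    have fd: "f (i + 1) (dmap P i m) \<in> cP Q (i + q + 1)"
      using mixed_hom_cl[OF f mP(5)[OF m]] by (simp add: ix2)
    have df: "dmap Q (i + q) (f i m) \<in> cP Q (i + q + 1)" by (rule mQ(5)[OF fm])
    have gK: "g (i + q + 1) x \<in> carrier ?K" if "x \<in> cP Q (i + q + 1)" for x
      using mixed_hom_cl[OF g that] by (simp add: ix2)
    have gl: "g (i + q + 1) \<in> linear_maps (piece Q (i + q + 1)) ?K"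
      using aYD_homD(1)[OF mixed_homD(1)[OF g, of "i + q + 1"]] by (simp add: ix2)
    have dg: "dmap R (i + q + p) (g (i + q) (f i m)) \<in> carrier ?K"
      by (rule mR(5)[OF mixed_hom_cl[OF g fm]])
    have 1: "g (i + q + 1) (dmap Q (i + q) (f i m) \<ominus>\<^bsub>piece Q (i + q + 1)\<^esub> ?t \<odot>\<^bsub>piece Q (i + q + 1)\<^esub> f (i + 1) (dmap P i m))
      = g (i + q + 1) (dmap Q (i + q) (f i m)) \<ominus>\<^bsub>?K\<^esub> ?t \<odot>\<^bsub>?K\<^esub> g (i + q + 1) (f (i + 1) (dmap P i m))"
      by (simp add: linear_maps_minus[OF mQ(2) mR(2) gl] linear_mapsD(3)[OF gl] df fd kmodule_closed[OF mQ(2)])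
    have "dmap R (i + q + p) (g (i + q) (f i m)) \<ominus>\<^bsub>?K\<^esub> (?s * ?t) \<odot>\<^bsub>?K\<^esub> g (i + q + 1) (f (i + 1) (dmap P i m))
      = (dmap R (i + q + p) (g (i + q) (f i m)) \<ominus>\<^bsub>?K\<^esub> ?s \<odot>\<^bsub>?K\<^esub> g (i + q + 1) (dmap Q (i + q) (f i m)))
        \<oplus>\<^bsub>?K\<^esub> ?s \<odot>\<^bsub>?K\<^esub> (g (i + q + 1) (dmap Q (i + q) (f i m)) \<ominus>\<^bsub>?K\<^esub> ?t \<odot>\<^bsub>?K\<^esub> g (i + q + 1) (f (i + 1) (dmap P i m)))"
      by (rule kmodule_eqI[OF mR(2)[of "i + q + p + 1"]])
        (use dg gK[OF df] gK[OF fd] kc in \<open>simp_all add: free.scale_right_diff_distrib\<close>)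
    then show "Diff mixedC P R (p + q) (Comp mixedC P Q R p q g f) i m = (\<lambda>m\<in>cP P i.
        (Comp mixedC P Q R (p + 1) q (Diff mixedC Q R p g) f) i m \<oplus>\<^bsub>piece R (i + (p + q + 1))\<^esub>
        (\<lambda>m\<in>cP P i. ((-1) powi p) \<odot>\<^bsub>piece R (i + (p + q + 1))\<^esub> (Comp mixedC P Q R p (q + 1) g (Diff mixedC P Q q f)) i m) m) m"
      using m mP(5)[OF m] fm by (simp add: ix2 1)
  qed auto
next
  fix W P Q R :: "('k, 'h, 'm) mixed" and h p g q f r assume "W \<in> Ob mixedC" "P \<in> Ob mixedC" "Q \<in> Ob mixedC" "R \<in> Ob mixedC"
    "h \<in> carrier (Hom mixedC Q R p)" "g \<in> carrier (Hom mixedC P Q q)" "f \<in> carrier (Hom mixedC W P r)"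
  then show "Comp mixedC W P R (p + q) r (Comp mixedC P Q R p q h g) f =
      Comp mixedC W Q R p (q + r) h (Comp mixedC W P Q q r g f)"
    using mixed_hom_cl[where f = f and P = W and Q = P and n = r] by (auto intro!: mixed_hom_ext simp: add_ac)
next
  fix P :: "('k, 'h, 'm) mixed" assume "P \<in> Ob mixedC"
  then have P: "mixed_aYD_contramodule H P" by simp
  note mP = mixedD[OF mixed_aYD_base[OF P]]
  have "(\<lambda>i. \<lambda>m\<in>cP P i. m) \<in> carrier (mixed_hom H P P 0)"
    by (rule mixed_homI)
      (use mP(6) in \<open>auto intro: aYD_hom_restrict aYD_hom_id mP(1) simp: kmodule_rules(1)[OF mP(2)]\<close>)
  then show "Ident mixedC P \<in> carrier (Hom mixedC P P 0)" by simp
qed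

end

section \<open>The stable part\<close>

lemma carrier_restrict_minus:
  assumes "kmodule M" "kmodule (M\<lparr>carrier := K\<rparr>)" "K \<subseteq> carrier M" "y \<in> K"
  shows "x \<ominus>\<^bsub>M\<lparr>carrier := K\<rparr>\<^esub> y = x \<ominus>\<^bsub>M\<^esub> y"
  using assms(3,4) kmodule_uminus[OF assms(1), of y] kmodule_uminus[OF assms(2), of y] by (auto simp: a_minus_def)

text \<open>The fixed points are the equaliser of \<open>f\<close> and the identity, so closure
  under each operation follows from \<open>f\<close> commuting with it.\<close>

lemma aYD_hom_fixed_closed:
  assumes M: "aYD_contramodule H M" and f: "f \<in> aYD_hom H M M"
  defines "K \<equiv> {m \<in> carrier M. f m = m}"
  shows "kmodule (M\<lparr>carrier := K\<rparr>)" and "m \<in> K \<Longrightarrow> act M x m \<in> K"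
    and "\<phi> \<in> linear_maps (hmod H) (M\<lparr>carrier := K\<rparr>) \<Longrightarrow> \<phi> \<in> linear_maps (hmod H) M \<and> contra M \<phi> \<in> K"
proof -
  note km = aYD_kmodule[OF M] and fl = aYD_hom_linear[OF f]
  interpret Module.module ground M by (rule km)
  have fz: "f \<zero>\<^bsub>M\<^esub> = \<zero>\<^bsub>M\<^esub>" by (rule linear_maps_zero[OF km km aYD_homD(1)[OF f]])
  show "kmodule (M\<lparr>carrier := K\<rparr>)"
  proof (rule kmoduleI)
    fix x assume "x \<in> carrier (M\<lparr>carrier := K\<rparr>)"
    then have x: "x \<in> carrier M" by (simp add: K_def)
    have "(- 1) \<odot>\<^bsub>M\<^esub> x \<oplus>\<^bsub>M\<^esub> x = \<zero>\<^bsub>M\<^esub>"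
      by (rule kmodule_eqI[OF km]) (use x kmodule_closed[OF km] in simp_all)
    then show "(- 1) \<odot>\<^bsub>M\<lparr>carrier := K\<rparr>\<^esub> x \<oplus>\<^bsub>M\<lparr>carrier := K\<rparr>\<^esub> x = \<zero>\<^bsub>M\<lparr>carrier := K\<rparr>\<^esub>" by simp
    fix a y assume "y \<in> carrier (M\<lparr>carrier := K\<rparr>)"
    then have y: "y \<in> carrier M" by (simp add: K_def)
    have "a \<odot>\<^bsub>M\<^esub> (x \<oplus>\<^bsub>M\<^esub> y) = a \<odot>\<^bsub>M\<^esub> x \<oplus>\<^bsub>M\<^esub> a \<odot>\<^bsub>M\<^esub> y"
      by (rule kmodule_eqI[OF km]) (use x y kmodule_closed[OF km] in \<open>simp_all add: free.scale_right_distrib\<close>)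
    then show "a \<odot>\<^bsub>M\<lparr>carrier := K\<rparr>\<^esub> (x \<oplus>\<^bsub>M\<lparr>carrier := K\<rparr>\<^esub> y) =
      a \<odot>\<^bsub>M\<lparr>carrier := K\<rparr>\<^esub> x \<oplus>\<^bsub>M\<lparr>carrier := K\<rparr>\<^esub> a \<odot>\<^bsub>M\<lparr>carrier := K\<rparr>\<^esub> y" by simp
  qed (simp_all add: K_def fz fl kmodule_closed[OF km] kmodule_rules[OF km] M.a_ac)
  show "m \<in> K \<Longrightarrow> act M x m \<in> K"
    using aYD_act_closed[OF M] by (simp add: K_def aYD_homD(2)[OF f])
  assume \<phi>: "\<phi> \<in> linear_maps (hmod H) (M\<lparr>carrier := K\<rparr>)"
  have \<phi>M: "\<phi> \<in> linear_maps (hmod H) M"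
    using linear_mapsD[OF \<phi>] by (intro linear_mapsI) (auto simp: K_def)
  moreover have "f (\<phi> h) = \<phi> h" for h
    using linear_mapsD(1)[OF \<phi>, of h] by (simp add: K_def hmod_def)
  ultimately show "\<phi> \<in> linear_maps (hmod H) M \<and> contra M \<phi> \<in> K"
    using aYD_contramodule.contra_closed[OF M] by (simp add: K_def aYD_homD(3)[OF f])
qed

lemma aYD_contramodule_fixed:
  assumes M: "aYD_contramodule H M" and f: "f \<in> aYD_hom H M M"
  shows "aYD_contramodule H (M\<lparr>carrier := {m \<in> carrier M. f m = m}\<rparr>)"
proof -
  define K where "K = {m \<in> carrier M. f m = m}"
  interpret M: aYD_contramodule H M by fact
  note c = aYD_hom_fixed_closed[OF M f, folded K_def]
  have KM: "K \<subseteq> carrier M" by (auto simp: K_def)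
  have incl: "(\<lambda>m. m) \<in> linear_maps (M\<lparr>carrier := K\<rparr>) M"
    by (rule linear_mapsI) (use KM in auto)
  \<comment> \<open>Addition and scalars are inherited, but a Sweedler sum is a
    \<open>finsum\<close>, which refers to the carrier; the linear inclusion identifies the two
    sums.\<close>
  have sw2: "sweedler2 H (M\<lparr>carrier := K\<rparr>) b = sweedler2 H M b" if "\<And>x y. b x y \<in> K" for b
    using linear_sweedler2[OF c(1) aYD_kmodule[OF M] incl, of b] that by (simp add: fun_eq_iff)
  have sw2c: "sweedler2 H (M\<lparr>carrier := K\<rparr>) b x \<in> K" if "\<And>x y. b x y \<in> K" for b x
    using sweedler2_closed[OF c(1), of b] that by simp
  have sw3: "sweedler3 H (M\<lparr>carrier := K\<rparr>) b x = sweedler3 H M b x" if "\<And>x y z. b x y z \<in> K" for b x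
    unfolding sweedler3_def using that sw2c by (simp add: sw2 fun_eq_iff)
  have "aYD_contramodule H (M\<lparr>carrier := K\<rparr>)"
  proof (intro aYD_contramodule.intro left_hmodule.intro left_hmodule_axioms.intro aYD_contramodule_axioms.intro)
    show "kmodule (M\<lparr>carrier := K\<rparr>)" by (rule c)
    show "act (M\<lparr>carrier := K\<rparr>) x \<in> linear_maps (M\<lparr>carrier := K\<rparr>) (M\<lparr>carrier := K\<rparr>)" for x
      by (rule linear_mapsI) (use c(2) KM linear_mapsD[OF M.act_linear] in \<open>auto simp: subset_iff\<close>)
    fix \<phi> x assume \<phi>: "\<phi> \<in> linear_maps (hmod H) (M\<lparr>carrier := K\<rparr>)"
    then have \<phi>K: "\<phi> h \<in> K" for h using linear_mapsD(1)[OF \<phi>, of h] by (simp add: hmod_def)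
    show "act (M\<lparr>carrier := K\<rparr>) x (contra (M\<lparr>carrier := K\<rparr>) \<phi>) = contra (M\<lparr>carrier := K\<rparr>) (\<lambda>h. sweedler3 H (M\<lparr>carrier := K\<rparr>)
        (\<lambda>x1 x2 x3. act (M\<lparr>carrier := K\<rparr>) x2 (\<phi> (antipode H x3 * h * x1))) x)"
      using c(3)[OF \<phi>] \<phi>K by (simp add: sw3 c(2) M.aYD)
  next
    fix F assume F: "F \<in> linear_maps (HH H) (M\<lparr>carrier := K\<rparr>)"
    have "F \<in> linear_maps (HH H) M"
      using linear_maps_comp[OF F incl] by simp
    then show "contra (M\<lparr>carrier := K\<rparr>) (\<lambda>h. contra (M\<lparr>carrier := K\<rparr>) (\<lambda>l. F (htens2 H h l))) =
        contra (M\<lparr>carrier := K\<rparr>) (\<lambda>h. F (comult H h))"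
      by (simp add: M.contra_assoc)
  qed (use KM c(3) in \<open>auto simp: M.act_add M.act_scale M.act_one M.act_mult M.contra_add M.contra_smult M.contra_counit subset_iff\<close>)
  then show ?thesis by (simp add: K_def)
qed

lemma aYD_hom_carriers:
  assumes f: "f \<in> aYD_hom H M N" and "K \<subseteq> carrier M" "f ` K \<subseteq> K'"
  shows "f \<in> aYD_hom H (M\<lparr>carrier := K\<rparr>) (N\<lparr>carrier := K'\<rparr>)"
proof (rule aYD_homI)
  show "f \<in> linear_maps (M\<lparr>carrier := K\<rparr>) (N\<lparr>carrier := K'\<rparr>)"
    by (rule linear_mapsI) (use aYD_hom_linear[OF f] assms in \<open>auto simp: subset_iff\<close>)
  show "f (act (M\<lparr>carrier := K\<rparr>) x m) = act (N\<lparr>carrier := K'\<rparr>) x (f m)" if "m \<in> carrier (M\<lparr>carrier := K\<rparr>)" for x m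
    using that assms(2) by (auto intro: aYD_homD(2)[OF f])
  show "f (contra (M\<lparr>carrier := K\<rparr>) \<phi>) = contra (N\<lparr>carrier := K'\<rparr>) (\<lambda>h. f (\<phi> h))"
    if "\<phi> \<in> linear_maps (hmod H) (M\<lparr>carrier := K\<rparr>)" for \<phi>
  proof -
    have "\<phi> \<in> linear_maps (hmod H) M"
      using linear_mapsD[OF that] assms(2) by (intro linear_mapsI) auto
    then show ?thesis using aYD_homD(3)[OF f] by simp
  qed
qed

text \<open>For an idempotent \<open>f\<close> this is its image, a direct summand. Keeping it as a
  subset of each piece leaves it in the universe \<open>'m\<close> of objects. It serves both for
  the stable part and for the complement.\<close>

definition fixed_part :: "('k, 'h, 'm) mixed \<Rightarrow> (int \<Rightarrow> 'm \<Rightarrow> 'm) \<Rightarrow> ('k, 'h, 'm) mixed" where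
  "fixed_part P f = P\<lparr>piece := \<lambda>i. (piece P i)\<lparr>carrier := {m \<in> cP P i. f i m = m}\<rparr>\<rparr>"

lemma fixed_part_simps [simp]:
  "piece (fixed_part P f) i = (piece P i)\<lparr>carrier := {m \<in> cP P i. f i m = m}\<rparr>"
  "dmap (fixed_part P f) = dmap P" "hmap (fixed_part P f) = hmap P"
  by (simp_all add: fixed_part_def)

lemma sigma_carrier [simp]: "sigma (M\<lparr>carrier := K\<rparr>) = sigma M"
  by (simp add: sigma_def fun_eq_iff)

definition mixed_endo :: "('k::field, 'h::ring_1) hopf \<Rightarrow> ('k, 'h, 'm) mixed \<Rightarrow> (int \<Rightarrow> 'm \<Rightarrow> 'm) \<Rightarrow> bool" where
  "mixed_endo H P f \<longleftrightarrow> (\<forall>i. f i \<in> aYD_hom H (piece P i) (piece P i)) \<and>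
     (\<forall>i. \<forall>m\<in>cP P i. dmap P i (f i m) = f (i + 1) (dmap P i m)) \<and>
     (\<forall>i. \<forall>m\<in>cP P i. hmap P i (f i m) = f (i - 1) (hmap P i m))"

lemma mixed_endoD:
  assumes "mixed_endo H P f"
  shows "f i \<in> aYD_hom H (piece P i) (piece P i)"
    and "m \<in> cP P i \<Longrightarrow> dmap P i (f i m) = f (i + 1) (dmap P i m)"
    and "m \<in> cP P i \<Longrightarrow> hmap P i (f i m) = f (i - 1) (hmap P i m)"
  using assms by (auto simp: mixed_endo_def)

lemma mixed_base_fixed:
  assumes P: "mixed_base H P" and f: "mixed_endo H P f"
  shows "mixed_base H (fixed_part P f)"
proof (rule mixed_base.intro)
  note mP = mixedD[OF P]
  note fD = mixed_endoD[OF f]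
  fix n
  show "aYD_contramodule H (piece (fixed_part P f) n)"
    by (simp add: aYD_contramodule_fixed[OF mP(1) fD(1)])
  show "dmap (fixed_part P f) n \<in> aYD_hom H (piece (fixed_part P f) n) (piece (fixed_part P f) (n + 1))"
    unfolding fixed_part_simps by (rule aYD_hom_carriers[OF mP(3)]) (use mP(5) fD(2) in force)+
  show "hmap (fixed_part P f) n \<in> aYD_hom H (piece (fixed_part P f) n) (piece (fixed_part P f) (n - 1))"
    unfolding fixed_part_simps by (rule aYD_hom_carriers[OF mP(4)]) (use mP(6) fD(3) in force)+
qed (use mixed_base.d_d[OF P] mixed_base.h_h[OF P] in auto)

lemma fixed_part_minus:
  assumes P: "mixed_base H P" and f: "mixed_endo H P f" and "y \<in> cP (fixed_part P f) i"
  shows "x \<ominus>\<^bsub>piece (fixed_part P f) i\<^esub> y = x \<ominus>\<^bsub>piece P i\<^esub> y"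
  unfolding fixed_part_simps
  by (rule carrier_restrict_minus[OF mixedD(2)[OF P] aYD_hom_fixed_closed(1)[OF mixedD(1)[OF P] mixed_endoD(1)[OF f]]])
    (use assms(3) in auto)

lemma mixed_aYD_fixed:
  assumes P: "mixed_aYD_contramodule H P" and f: "mixed_endo H P f"
  shows "mixed_aYD_contramodule H (fixed_part P f)"
proof (intro mixed_aYD_contramodule.intro mixed_aYD_contramodule_axioms.intro)
  note bP = mixed_aYD_base[OF P]
  show "mixed_base H (fixed_part P f)" by (rule mixed_base_fixed[OF bP f])
  fix m n assume m: "m \<in> carrier (piece (fixed_part P f) n)"
  then show "dmap (fixed_part P f) (n - 1) (hmap (fixed_part P f) n m) \<oplus>\<^bsub>piece (fixed_part P f) n\<^esub>
      hmap (fixed_part P f) (n + 1) (dmap (fixed_part P f) n m) =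
    sigma (piece (fixed_part P f) n) m \<ominus>\<^bsub>piece (fixed_part P f) n\<^esub> m"
    unfolding fixed_part_minus[OF bP f m] using mixed_aYD_contramodule.dh_hd[OF P] by simp
qed

text \<open>On stable pieces sigma - 1 is zero, so the two conditions on dh + hd agree. Thus the
  stable category is the full subcategory of the mixed one on these objects.\<close>

lemma stable_mixed_aYD:
  assumes "mixed_complex_stable_aYD H P"
  shows "mixed_aYD_contramodule H P"
proof (intro mixed_aYD_contramodule.intro mixed_aYD_contramodule_axioms.intro)
  interpret mixed_complex_stable_aYD H P by fact
  show b: "mixed_base H P" by (rule mixed_base_axioms)
  fix m n assume m: "m \<in> cP P n"
  then show "dmap P (n - 1) (hmap P n m) \<oplus>\<^bsub>piece P n\<^esub> hmap P (n + 1) (dmap P n m) =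
     sigma (piece P n) m \<ominus>\<^bsub>piece P n\<^esub> m"
    using stable[of n] by (simp add: dh_hd stable_def kmodule_cancel[OF mixedD(2)[OF b]])
qed

lemma acyclic_mixed_iff:
  assumes "mixed_base H P"
  shows "acyclic_mixed P \<longleftrightarrow>
    (\<forall>n. \<forall>z\<in>cP P n. dmap P n z = \<zero>\<^bsub>piece P (n + 1)\<^esub> \<longrightarrow> (\<exists>y\<in>cP P (n - 1). dmap P (n - 1) y = z))"
proof -
  have cl: "dmap P (n - 1) y \<in> cP P n" and dd: "dmap P n (dmap P (n - 1) y) = \<zero>\<^bsub>piece P (n + 1)\<^esub>"
    if "y \<in> cP P (n - 1)" for n y
  proof -
    have "n - 1 + 1 = n" "n - 1 + 2 = n + 1" by simp_all
    then show "dmap P (n - 1) y \<in> cP P n" "dmap P n (dmap P (n - 1) y) = \<zero>\<^bsub>piece P (n + 1)\<^esub>"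
      using mixedD(5)[OF assms that] mixed_base.d_d[OF assms that] by metis+
  qed
  have "coboundaries (piece P) (dmap P) n \<subseteq> cocycles (piece P) (dmap P) n" for n
    using cl dd by (auto simp: cocycles_def coboundaries_def)
  then have "acyclic_mixed P \<longleftrightarrow> (\<forall>n. cocycles (piece P) (dmap P) n \<subseteq> coboundaries (piece P) (dmap P) n)"
    unfolding acyclic_mixed_def by blast
  also have "\<dots> \<longleftrightarrow>
    (\<forall>n. \<forall>z\<in>cP P n. dmap P n z = \<zero>\<^bsub>piece P (n + 1)\<^esub> \<longrightarrow> (\<exists>y\<in>cP P (n - 1). dmap P (n - 1) y = z))"
    by (auto simp: cocycles_def coboundaries_def image_iff subset_iff)
  finally show ?thesis .
qed

text \<open>If d y = z and f z = z, then d (f y) = z, so a primitive can be chosen in the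
  summand.\<close>

lemma acyclic_fixed:
  assumes P: "mixed_base H P" and f: "mixed_endo H P f" and "acyclic_mixed P"
    and idem: "\<And>i m. m \<in> cP P i \<Longrightarrow> f i (f i m) = f i m"
  shows "acyclic_mixed (fixed_part P f)"
  unfolding acyclic_mixed_iff[OF mixed_base_fixed[OF P f]]
proof (intro allI ballI impI)
  fix n z assume z: "z \<in> cP (fixed_part P f) n" "dmap (fixed_part P f) n z = \<zero>\<^bsub>piece (fixed_part P f) (n + 1)\<^esub>"
  then obtain y where y: "y \<in> cP P (n - 1)" "dmap P (n - 1) y = z"
    using assms(3) unfolding acyclic_mixed_iff[OF P] by auto
  have "dmap P (n - 1) (f (n - 1) y) = z"
    using mixed_endoD(2)[OF f y(1)] y(2) z(1) by simp
  then show "\<exists>y\<in>cP (fixed_part P f) (n - 1). dmap (fixed_part P f) (n - 1) y = z"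
    using y(1) idem aYD_hom_linear(1)[OF mixed_endoD(1)[OF f] y(1)] by (intro bexI[of _ "f (n - 1) y"]) auto
qed

text \<open>In degree 0 all signs are trivial: commuting with \<open>hmap\<close> gives membership
  in the Hom complex, and commuting with \<open>dmap\<close> gives closedness.\<close>

lemma mixed_hom_familyI:
  assumes P: "mixed_base H P" and Q: "mixed_base H Q"
    and f: "\<And>i. f i \<in> aYD_hom H (piece P i) (piece Q i)"
    and d: "\<And>i m. m \<in> cP P i \<Longrightarrow> dmap Q i (f i m) = f (i + 1) (dmap P i m)"
    and h: "\<And>i m. m \<in> cP P i \<Longrightarrow> hmap Q i (f i m) = f (i - 1) (hmap P i m)"
  shows "(\<lambda>i. \<lambda>m\<in>cP P i. f i m) \<in> carrier (mixed_hom H P Q 0)"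
    and "Diff (mixed_dgcat H A) P Q 0 (\<lambda>i. \<lambda>m\<in>cP P i. f i m) = \<zero>\<^bsub>mixed_hom H P Q 1\<^esub>"
proof -
  note mP = mixedD[OF P] and mQ = mixedD[OF Q] and fc = aYD_hom_linear(1)[OF f]
  show "(\<lambda>i. \<lambda>m\<in>cP P i. f i m) \<in> carrier (mixed_hom H P Q 0)"
    by (rule mixed_homI)
      (use f mP fc in \<open>auto intro: aYD_hom_restrict simp: h kmodule_rules(1)[OF mQ(2)]\<close>)
  have fd: "f (i + 1) (dmap P i m) \<in> cP Q (i + 1)" if "m \<in> cP P i" for i m
    by (rule fc[OF mP(5)[OF that]])
  show "Diff (mixed_dgcat H A) P Q 0 (\<lambda>i. \<lambda>m\<in>cP P i. f i m) = \<zero>\<^bsub>mixed_hom H P Q 1\<^esub>"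
    unfolding mixed_hom_simps
    by (rule mixed_hom_ext)
      (use mP(5) fd in \<open>auto simp: d kmodule_rules(1)[OF mQ(2)] kmodule_cancel(1)[OF mQ(2)]\<close>)
qed

lemma mixed_hom_fixed:
  assumes P: "mixed_base H P" and f: "mixed_endo H P f"
  shows "(\<lambda>i. \<lambda>m\<in>cP (fixed_part P f) i. m) \<in> carrier (mixed_hom H (fixed_part P f) P 0)"
    and "Diff (mixed_dgcat H A) (fixed_part P f) P 0 (\<lambda>i. \<lambda>m\<in>cP (fixed_part P f) i. m) = \<zero>\<^bsub>mixed_hom H (fixed_part P f) P 1\<^esub>"
    and "(\<And>i m. m \<in> cP P i \<Longrightarrow> f i (f i m) = f i m) \<Longrightarrow>
      (\<lambda>i. \<lambda>m\<in>cP P i. f i m) \<in> carrier (mixed_hom H P (fixed_part P f) 0) \<and>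
      Diff (mixed_dgcat H A) P (fixed_part P f) 0 (\<lambda>i. \<lambda>m\<in>cP P i. f i m) = \<zero>\<^bsub>mixed_hom H P (fixed_part P f) 1\<^esub>"
proof -
  note bF = mixed_base_fixed[OF P f] and fD = mixed_endoD[OF f]
  have incl: "(\<lambda>m. m) \<in> aYD_hom H (piece (fixed_part P f) i) (piece P i)" for i
    using aYD_hom_carriers[OF aYD_hom_id[of H "piece P i"], of "cP (fixed_part P f) i" "cP P i"] by auto
  show "(\<lambda>i. \<lambda>m\<in>cP (fixed_part P f) i. m) \<in> carrier (mixed_hom H (fixed_part P f) P 0)"
    "Diff (mixed_dgcat H A) (fixed_part P f) P 0 (\<lambda>i. \<lambda>m\<in>cP (fixed_part P f) i. m) = \<zero>\<^bsub>mixed_hom H (fixed_part P f) P 1\<^esub>"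
    by (rule mixed_hom_familyI[OF bF P incl]; simp)+
  assume idem: "\<And>i m. m \<in> cP P i \<Longrightarrow> f i (f i m) = f i m"
  have proj: "f i \<in> aYD_hom H (piece P i) (piece (fixed_part P f) i)" for i
    using aYD_hom_carriers[OF fD(1)[of i], of "cP P i" "cP (fixed_part P f) i"] idem aYD_hom_linear(1)[OF fD(1)]
    by auto
  show "(\<lambda>i. \<lambda>m\<in>cP P i. f i m) \<in> carrier (mixed_hom H P (fixed_part P f) 0) \<and>
      Diff (mixed_dgcat H A) P (fixed_part P f) 0 (\<lambda>i. \<lambda>m\<in>cP P i. f i m) = \<zero>\<^bsub>mixed_hom H P (fixed_part P f) 1\<^esub>"
    by (intro conjI; rule mixed_hom_familyI[OF P bF proj]) (simp_all add: fD)
qed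

section \<open>Mixed contramodules retract onto stable ones\<close>

context involutive_hopf
begin

text \<open>A projection is chosen separately for each contramodule; its compatibility with
  morphisms is not part of the choice but follows from the stated properties in
  \<open>stable_proj_natural\<close>.\<close>

definition stable_proj :: "('k, 'h, 'm) contramodule \<Rightarrow> 'm \<Rightarrow> 'm" where
  "stable_proj M = (SOME p. p \<in> aYD_hom H M M \<and> (\<forall>m\<in>carrier M. sigma M (p m) = p m \<and>
     (sigma M m = m \<longrightarrow> p m = m) \<and>
     (p m = \<zero>\<^bsub>M\<^esub> \<longrightarrow> (\<exists>w\<in>carrier M. p w = \<zero>\<^bsub>M\<^esub> \<and> sigma M w \<ominus>\<^bsub>M\<^esub> w = m))))"

lemma stable_proj:
  assumes "aYD_contramodule H M"
  shows "stable_proj M \<in> aYD_hom H M M"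
    and "m \<in> carrier M \<Longrightarrow> sigma M (stable_proj M m) = stable_proj M m"
    and "m \<in> carrier M \<Longrightarrow> sigma M m = m \<Longrightarrow> stable_proj M m = m"
    and "m \<in> carrier M \<Longrightarrow> stable_proj M m = \<zero>\<^bsub>M\<^esub> \<Longrightarrow>
      \<exists>w\<in>carrier M. stable_proj M w = \<zero>\<^bsub>M\<^esub> \<and> sigma M w \<ominus>\<^bsub>M\<^esub> w = m"
    and "m \<in> carrier M \<Longrightarrow> stable_proj M m \<in> carrier M"
proof -
  obtain p where p: "p \<in> aYD_hom H M M \<and> (\<forall>m\<in>carrier M. sigma M (p m) = p m \<and>
     (sigma M m = m \<longrightarrow> p m = m) \<and>
     (p m = \<zero>\<^bsub>M\<^esub> \<longrightarrow> (\<exists>w\<in>carrier M. p w = \<zero>\<^bsub>M\<^esub> \<and> sigma M w \<ominus>\<^bsub>M\<^esub> w = m)))"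
    by (rule aYD_splitting[OF assms]) blast
  note * = someI[of "\<lambda>p. p \<in> aYD_hom H M M \<and> (\<forall>m\<in>carrier M. sigma M (p m) = p m \<and>
     (sigma M m = m \<longrightarrow> p m = m) \<and>
     (p m = \<zero>\<^bsub>M\<^esub> \<longrightarrow> (\<exists>w\<in>carrier M. p w = \<zero>\<^bsub>M\<^esub> \<and> sigma M w \<ominus>\<^bsub>M\<^esub> w = m)))", OF p, folded stable_proj_def]
  show 1: "stable_proj M \<in> aYD_hom H M M" using * by blast
  show "m \<in> carrier M \<Longrightarrow> sigma M (stable_proj M m) = stable_proj M m"
    "m \<in> carrier M \<Longrightarrow> sigma M m = m \<Longrightarrow> stable_proj M m = m"
    "m \<in> carrier M \<Longrightarrow> stable_proj M m = \<zero>\<^bsub>M\<^esub> \<Longrightarrow>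
      \<exists>w\<in>carrier M. stable_proj M w = \<zero>\<^bsub>M\<^esub> \<and> sigma M w \<ominus>\<^bsub>M\<^esub> w = m"
    using * by blast+
  show "m \<in> carrier M \<Longrightarrow> stable_proj M m \<in> carrier M"
    by (rule aYD_hom_linear(1)[OF 1])
qed

lemma stable_proj_idem:
  "aYD_contramodule H M \<Longrightarrow> m \<in> carrier M \<Longrightarrow> stable_proj M (stable_proj M m) = stable_proj M m"
  by (simp add: stable_proj)

lemma stable_proj_complement:
  assumes M: "aYD_contramodule H M" and m: "m \<in> carrier M"
  shows "stable_proj M (m \<ominus>\<^bsub>M\<^esub> stable_proj M m) = \<zero>\<^bsub>M\<^esub>"
  by (simp add: linear_maps_minus[OF aYD_kmodule[OF M] aYD_kmodule[OF M] aYD_homD(1)[OF stable_proj(1)[OF M]]] m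
      stable_proj_idem[OF M] stable_proj(5)[OF M] kmodule_cancel(1)[OF aYD_kmodule[OF M]])

text \<open>A morphism commutes with sigma. Hence it preserves sigma-fixed elements, and it maps the
  complement, which consists of values of sigma - 1, to values of sigma - 1, where the projection of
  \<open>N\<close> vanishes.\<close>

lemma stable_proj_natural:
  assumes M: "aYD_contramodule H M" and N: "aYD_contramodule H N" and f: "f \<in> aYD_hom H M N" and m: "m \<in> carrier M"
  shows "f (stable_proj M m) = stable_proj N (f m)"
proof -
  note kM = aYD_kmodule[OF M] and kN = aYD_kmodule[OF N]
  let ?p = "stable_proj M m"
  have pc: "?p \<in> carrier M" by (rule stable_proj(5)[OF M m])
  have fc: "f x \<in> carrier N" if "x \<in> carrier M" for x by (rule aYD_hom_linear(1)[OF f that])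
  note fm = linear_maps_minus[OF kM kN aYD_homD(1)[OF f]]
    and qm = linear_maps_minus[OF kN kN aYD_homD(1)[OF stable_proj(1)[OF N]]]
  have "sigma N (f ?p) = f ?p" using sigma_natural[OF M f pc] stable_proj(2)[OF M m] by simp
  then have 1: "stable_proj N (f ?p) = f ?p" by (rule stable_proj(3)[OF N fc[OF pc]])
  obtain w where w: "w \<in> carrier M" "sigma M w \<ominus>\<^bsub>M\<^esub> w = m \<ominus>\<^bsub>M\<^esub> ?p"
    using stable_proj(4)[OF M _ stable_proj_complement[OF M m]] kmodule_closed(2)[OF kM m pc] by blast
  have "stable_proj N (f m) \<ominus>\<^bsub>N\<^esub> f ?p = stable_proj N (f (m \<ominus>\<^bsub>M\<^esub> ?p))"
    by (simp add: fm m pc qm fc 1)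
  also have "\<dots> = stable_proj N (sigma N (f w)) \<ominus>\<^bsub>N\<^esub> stable_proj N (f w)"
    unfolding w(2)[symmetric]
    by (simp add: fm w(1) sigma_closed[OF M] sigma_natural[OF M f] qm fc sigma_closed[OF N])
  also have "\<dots> = \<zero>\<^bsub>N\<^esub>"
    using sigma_natural[OF N stable_proj(1)[OF N] fc[OF w(1)]] stable_proj(2)[OF N fc[OF w(1)]]
    by (simp add: kmodule_cancel(1)[OF kN] stable_proj(5)[OF N] fc[OF w(1)])
  finally show ?thesis
    using kmodule_minus_eq_zero[OF kN] stable_proj(5)[OF N fc[OF m]] fc[OF pc] by metis
qed

definition sp :: "('k, 'h, 'm) mixed \<Rightarrow> int \<Rightarrow> 'm \<Rightarrow> 'm" where
  "sp P i = stable_proj (piece P i)"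

definition cp :: "('k, 'h, 'm) mixed \<Rightarrow> int \<Rightarrow> 'm \<Rightarrow> 'm" where
  "cp P i m = m \<ominus>\<^bsub>piece P i\<^esub> sp P i m"

lemma sp_endo:
  assumes "mixed_base H P"
  shows "mixed_endo H P (sp P)"
  using stable_proj(1) stable_proj_natural mixedD[OF assms] unfolding mixed_endo_def sp_def by metis

lemma cp_endo:
  assumes P: "mixed_base H P"
  shows "mixed_endo H P (cp P)"
proof -
  note mP = mixedD[OF P] and sD = mixed_endoD[OF sp_endo[OF P]]
  have "cp P i \<in> aYD_hom H (piece P i) (piece P i)" for i
    using aYD_hom_diff[OF aYD_hom_id sD(1) mP(1) mP(1), of i] by (simp add: cp_def[abs_def])
  moreover have "dmap P i (cp P i m) = cp P (i + 1) (dmap P i m)" "hmap P i (cp P i m) = cp P (i - 1) (hmap P i m)"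
    if "m \<in> cP P i" for i m
    using that aYD_hom_linear(1)[OF sD(1)]
    by (simp_all add: cp_def sD linear_maps_minus[OF mP(2) mP(2) aYD_homD(1)[OF mP(3)]]
        linear_maps_minus[OF mP(2) mP(2) aYD_homD(1)[OF mP(4)]])
  ultimately show ?thesis unfolding mixed_endo_def by blast
qed

lemma sp_cl: "mixed_base H P \<Longrightarrow> m \<in> cP P i \<Longrightarrow> sp P i m \<in> cP P i"
  by (simp add: sp_def stable_proj(5)[OF mixedD(1)])

lemma sp_idem: "mixed_base H P \<Longrightarrow> m \<in> cP P i \<Longrightarrow> sp P i (sp P i m) = sp P i m"
  by (simp add: sp_def stable_proj_idem[OF mixedD(1)])

lemma sp_cp: "mixed_base H P \<Longrightarrow> m \<in> cP P i \<Longrightarrow> sp P i (cp P i m) = \<zero>\<^bsub>piece P i\<^esub>"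
  by (simp add: sp_def cp_def stable_proj_complement[OF mixedD(1)])

lemma cp_idem:
  assumes P: "mixed_base H P" and m: "m \<in> cP P i"
  shows "cp P i (cp P i m) = cp P i m"
proof -
  have "cp P i m \<in> cP P i" using m sp_cl[OF P m] by (simp add: cp_def kmodule_closed[OF mixedD(2)[OF P]])
  then show ?thesis
    unfolding cp_def[of P i "cp P i m"] by (simp add: sp_cp[OF P m] kmodule_cancel(4)[OF mixedD(2)[OF P]])
qed

lemma cp_fixed_iff:
  assumes P: "mixed_base H P" and m: "m \<in> cP P i"
  shows "cp P i m = m \<longleftrightarrow> sp P i m = \<zero>\<^bsub>piece P i\<^esub>"
  using sp_cp[OF P m] m by (auto simp: cp_def kmodule_cancel(4)[OF mixedD(2)[OF P]])

text \<open>On the complement of the stable part \<open>\<sigma> - 1 = dh + hd\<close> is invertible, so \<open>h\<close> contracts it.\<close>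

lemma acyclic_complement:
  assumes P: "mixed_aYD_contramodule H P"
  shows "acyclic_mixed (fixed_part P (cp P))"
proof -
  note bP = mixed_aYD_base[OF P]
  note mP = mixedD[OF bP] and sD = mixed_endoD[OF sp_endo[OF bP]]
  note kc = kmodule_closed[OF mP(2)]
  have z0: "f \<zero>\<^bsub>piece P i\<^esub> = \<zero>\<^bsub>piece P j\<^esub>" if "f \<in> aYD_hom H (piece P i) (piece P j)" for f i j
    by (rule linear_maps_zero[OF mP(2) mP(2) aYD_homD(1)[OF that]])
  show ?thesis unfolding acyclic_mixed_iff[OF mixed_base_fixed[OF bP cp_endo[OF bP]]]
  proof (intro allI ballI impI)
    fix n z assume z: "z \<in> cP (fixed_part P (cp P)) n"
      "dmap (fixed_part P (cp P)) n z = \<zero>\<^bsub>piece (fixed_part P (cp P)) (n + 1)\<^esub>"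
    then have zP: "z \<in> cP P n" and dz: "dmap P n z = \<zero>\<^bsub>piece P (n + 1)\<^esub>" and sz: "sp P n z = \<zero>\<^bsub>piece P n\<^esub>"
      using cp_fixed_iff[OF bP] by auto
    obtain w where w: "w \<in> cP P n" "sp P n w = \<zero>\<^bsub>piece P n\<^esub>" "sigma (piece P n) w \<ominus>\<^bsub>piece P n\<^esub> w = z"
      using stable_proj(4)[OF mP(1) zP] sz unfolding sp_def by blast
    have dw: "dmap P n w \<in> cP P (n + 1)" and hw: "hmap P n w \<in> cP P (n - 1)"
      using mP(5,6) w(1) by blast+
    \<comment> \<open>z = (sigma - 1) w and d z = 0 show that d w is stable. Since the projection
      commutes with d, d w also lies in the complement along with w. So d w = 0, and (dh + hd) w
      reduces to d h w.\<close>
    have "sigma (piece P (n + 1)) (dmap P n w) \<ominus>\<^bsub>piece P (n + 1)\<^esub> dmap P n w = \<zero>\<^bsub>piece P (n + 1)\<^esub>"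
      using dz unfolding w(3)[symmetric]
      by (simp add: linear_maps_minus[OF mP(2) mP(2) aYD_homD(1)[OF mP(3)]] w(1) sigma_closed[OF mP(1)]
          sigma_natural[OF mP(1) mP(3)])
    then have "sigma (piece P (n + 1)) (dmap P n w) = dmap P n w"
      by (rule kmodule_minus_eq_zero[OF mP(2) sigma_closed[OF mP(1) dw] dw])
    then have "dmap P n w = sp P (n + 1) (dmap P n w)"
      using stable_proj(3)[OF mP(1) dw] by (simp add: sp_def)
    also have "\<dots> = \<zero>\<^bsub>piece P (n + 1)\<^esub>"
      by (simp add: sD(2)[OF w(1), symmetric] w(2) z0[OF mP(3)])
    finally have "hmap P (n + 1) (dmap P n w) = \<zero>\<^bsub>piece P n\<^esub>"
      using z0[OF mP(4), of "n + 1"] by simp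
    moreover have "dmap P (n - 1) (hmap P n w) \<in> cP P n"
      using mP(5)[OF hw] by simp
    ultimately have "dmap P (n - 1) (hmap P n w) = z"
      using mixed_aYD_contramodule.dh_hd[OF P w(1)] w(3) by (simp add: kmodule_cancel(2)[OF mP(2)])
    \<comment> \<open>h commutes with the projections, so the primitive h w stays in the
      complement.\<close>
    moreover have "cp P (n - 1) (hmap P n w) = hmap P n w"
      using cp_fixed_iff[OF bP hw] sD(3)[OF w(1)] w(2) z0[OF mP(4)] by simp
    ultimately show "\<exists>y\<in>cP (fixed_part P (cp P)) (n - 1). dmap (fixed_part P (cp P)) (n - 1) y = z"
      using hw by auto
  qed
qed

text \<open>On the image of \<open>sp\<close>, sigma is the identity, so dh + hd = sigma - 1 becomes
  0.\<close>

lemma stable_fixed: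
  assumes P: "mixed_aYD_contramodule H P"
  shows "mixed_complex_stable_aYD H (fixed_part P (sp P))"
proof (intro mixed_complex_stable_aYD.intro mixed_complex_stable_aYD_axioms.intro)
  note bP = mixed_aYD_base[OF P]
  note fP = mixed_aYD_fixed[OF P sp_endo[OF bP]]
  note bF = mixed_aYD_base[OF fP]
  show "mixed_base H (fixed_part P (sp P))" by (rule bF)
  show st: "stable (piece (fixed_part P (sp P)) n)" for n
    unfolding stable_def
  proof
    fix m assume "m \<in> cP (fixed_part P (sp P)) n"
    then have m: "m \<in> cP P n" "stable_proj (piece P n) m = m" by (auto simp: sp_def)
    then show "sigma (piece (fixed_part P (sp P)) n) m = m"
      using stable_proj(2)[OF mixedD(1)[OF bP] m(1)] by simp
  qed
  fix m n assume m: "m \<in> carrier (piece (fixed_part P (sp P)) n)"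
  show "dmap (fixed_part P (sp P)) (n - 1) (hmap (fixed_part P (sp P)) n m) \<oplus>\<^bsub>piece (fixed_part P (sp P)) n\<^esub>
      hmap (fixed_part P (sp P)) (n + 1) (dmap (fixed_part P (sp P)) n m) = \<zero>\<^bsub>piece (fixed_part P (sp P)) n\<^esub>"
    using mixed_aYD_contramodule.dh_hd[OF fP m] st[of n] m kmodule_cancel(1)[OF mixedD(2)[OF bF] m]
    unfolding stable_def by metis
qed

lemma sp_stable:
  assumes "mixed_complex_stable_aYD H P" "m \<in> cP P i"
  shows "sp P i m = m"
  using mixed_complex_stable_aYD.stable[OF assms(1), of i] assms(2)
    stable_proj(3)[OF mixedD(1)[OF mixed_aYD_base[OF stable_mixed_aYD[OF assms(1)]]] assms(2)]
  by (simp add: stable_def sp_def)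

text \<open>An equality of records, as \<open>retract\<close> requires on \<open>O'\<close>, and not
  merely an isomorphism.\<close>

lemma fixed_part_stable:
  assumes "mixed_complex_stable_aYD H P"
  shows "fixed_part P (sp P) = P"
proof -
  have "{m \<in> cP P i. sp P i m = m} = cP P i" for i using sp_stable[OF assms] by auto
  then show ?thesis by (simp add: fixed_part_def)
qed

text \<open>The summand \<open>e P\<close> is the stable part, and the object through which 1 - i r
  factors is its acyclic complement. A morphism commutes with the stable projections, so it carries
  stable elements to stable elements, which is \<open>i_natural\<close>.\<close>

lemma retract_stable:
  "retract (mixed_dgcat H {P. mixed_aYD_contramodule H P} :: (('k, 'h, 'm) mixed, int \<Rightarrow> 'm \<Rightarrow> 'm, 'k) dgcat)
     {P. mixed_aYD_contramodule H P \<and> acyclic_mixed P} {P. mixed_complex_stable_aYD H P}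
     (\<lambda>P. fixed_part P (sp P)) (\<lambda>P i. \<lambda>m\<in>cP (fixed_part P (sp P)) i. m) (\<lambda>P i. \<lambda>m\<in>cP P i. sp P i m)"
  (is "retract ?C ?B ?O ?e ?i ?r")
proof (intro retract.intro dg_pair.intro dg_pair_axioms.intro retract_axioms.intro dg_category_mixed)
  show "?B \<subseteq> Ob ?C" "?O \<subseteq> Ob ?C" using stable_mixed_aYD by auto
  fix P :: "('k, 'h, 'm) mixed"
  show "?e P \<in> ?B" if "P \<in> ?B"
    using that by (auto intro: mixed_aYD_fixed acyclic_fixed sp_endo mixed_aYD_base sp_idem)
  { assume P: "P \<in> ?O"
    then show eP: "?e P = P" by (simp add: fixed_part_stable)
    show "?i P = Ident ?C P" unfolding eP by simp
    show "?r P = Ident ?C P" using P by (auto simp: fun_eq_iff restrict_def sp_stable) }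
next
  fix P :: "('k, 'h, 'm) mixed" assume "P \<in> Ob ?C"
  then have P: "mixed_aYD_contramodule H P" by simp
  note bP = mixed_aYD_base[OF P]
  note eP = sp_endo[OF bP] and eC = cp_endo[OF bP] and mP = mixedD[OF bP]
  note mi = mixed_hom_fixed(1,2)[OF bP eP] and mr = mixed_hom_fixed(3)[OF bP eP sp_idem[OF bP]]
  note bi = mixed_hom_fixed(1,2)[OF bP eC] and br = mixed_hom_fixed(3)[OF bP eC cp_idem[OF bP]]
  show "?e P \<in> ?O" using stable_fixed[OF P] by simp
  show "?i P \<in> carrier (Hom ?C (?e P) P 0)" "?r P \<in> carrier (Hom ?C P (?e P) 0)"
    using mi mr by simp_all
  show "Diff ?C (?e P) P 0 (?i P) = \<zero>\<^bsub>Hom ?C (?e P) P 1\<^esub>" "Diff ?C P (?e P) 0 (?r P) = \<zero>\<^bsub>Hom ?C P (?e P) 1\<^esub>"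
    using mi mr unfolding mixed_dgcat_simps(2) by blast+
  show "Comp ?C (?e P) P (?e P) 0 0 (?r P) (?i P) = Ident ?C (?e P)"
    by (rule mixed_hom_ext[where P = "?e P"]) auto
  show "\<exists>U\<in>?B. \<exists>a\<in>carrier (Hom ?C P U 0). \<exists>b\<in>carrier (Hom ?C U P 0).
      Diff ?C P U 0 a = \<zero>\<^bsub>Hom ?C P U 1\<^esub> \<and> Diff ?C U P 0 b = \<zero>\<^bsub>Hom ?C U P 1\<^esub> \<and>
      Ident ?C P = Comp ?C P (?e P) P 0 0 (?i P) (?r P) \<oplus>\<^bsub>Hom ?C P P 0\<^esub> Comp ?C P U P 0 0 b a"
  proof (intro bexI conjI)
    let ?U = "fixed_part P (cp P)"
    let ?a = "\<lambda>i. \<lambda>m\<in>cP P i. cp P i m" and ?b = "\<lambda>i. \<lambda>m\<in>cP ?U i. m"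
    show "Diff ?C P ?U 0 ?a = \<zero>\<^bsub>Hom ?C P ?U 1\<^esub>" "Diff ?C ?U P 0 ?b = \<zero>\<^bsub>Hom ?C ?U P 1\<^esub>"
      using bi br unfolding mixed_dgcat_simps(2) by blast+
    show "?a \<in> carrier (Hom ?C P ?U 0)" "?b \<in> carrier (Hom ?C ?U P 0)" using bi br by simp_all
    show "?U \<in> ?B" using mixed_aYD_fixed[OF P eC] acyclic_complement[OF P] by simp
    have sum: "m = sp P i m \<oplus>\<^bsub>piece P i\<^esub> cp P i m" if m: "m \<in> cP P i" for i m
      by (rule kmodule_eqI[OF mP(2)[of i] m])
        (use m sp_cl[OF bP m] kmodule_closed[OF mP(2)] in \<open>simp_all add: cp_def\<close>)
    have cc: "cp P i m \<in> cP P i" if "m \<in> cP P i" for i m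
      using that sp_cl[OF bP that] kmodule_closed[OF mP(2)] by (simp add: cp_def)
    show "Ident ?C P = Comp ?C P (?e P) P 0 0 (?i P) (?r P) \<oplus>\<^bsub>Hom ?C P P 0\<^esub> Comp ?C P ?U P 0 0 ?b ?a"
      unfolding mixed_dgcat_simps(2) mixed_hom_simps
      by (rule mixed_hom_ext[where P = P])
        (auto simp: sum[symmetric] sp_cl[OF bP] sp_idem[OF bP] cp_idem[OF bP] cc)
  qed
  fix Q :: "('k, 'h, 'm) mixed" and f and n :: int assume "Q \<in> Ob ?C" and f: "f \<in> carrier (Hom ?C P Q n)"
  then have Q: "mixed_aYD_contramodule H Q" by simp
  have f: "f \<in> carrier (mixed_hom H P Q n)" using f by simp
  have "sp Q (i + n) (f i m) = f i m" if "m \<in> cP P i" "sp P i m = m" for i m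
    using stable_proj_natural[OF mP(1) mixedD(1)[OF mixed_aYD_base[OF Q]] mixed_homD(1)[OF f] that(1)] that(2)
    by (simp add: sp_def)
  then show "Comp ?C (?e P) (?e Q) Q 0 n (?i Q) (Comp ?C (?e P) Q (?e Q) 0 n (?r Q) (Comp ?C (?e P) P Q n 0 f (?i P)))
      = Comp ?C (?e P) P Q n 0 f (?i P)"
    by (intro mixed_hom_ext[where P = "?e P"]) (auto simp: mixed_hom_cl[OF f])
qed

end

theorem mainTheorem1:
  fixes H :: "('k::{alg_closed_field, field_char_0}, 'h::ring_1) hopf"
  assumes "finite_dimensional_hopf_algebra H"
    and "antipode H \<circ> antipode H = id"
  shows "dg_equivalent
    (derived (mixed_stable_aYD_dgcat H
       :: (('k, 'h, 'm) mixed, int \<Rightarrow> 'm \<Rightarrow> 'm, 'k) dgcat))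
    (derived (mixed_aYD_dgcat H))"
proof -
  let ?C = "mixed_aYD_dgcat H :: (('k, 'h, 'm) mixed, int \<Rightarrow> 'm \<Rightarrow> 'm, 'k) dgcat"
  let ?D = "mixed_stable_aYD_dgcat H :: (('k, 'h, 'm) mixed, int \<Rightarrow> 'm \<Rightarrow> 'm, 'k) dgcat"
  let ?B = "{P :: ('k, 'h, 'm) mixed. mixed_aYD_contramodule H P \<and> acyclic_mixed P}"
  let ?O = "{P :: ('k, 'h, 'm) mixed. mixed_complex_stable_aYD H P}"
  interpret H: involutive_hopf H
    using assms by (intro involutive_hopf.intro involutive_hopf_axioms.intro) (auto simp: fun_eq_iff)
  \<comment> \<open>Restricting \<open>Ob\<close> of the mixed category yields the stable one as a
    record, and the acyclic stable objects are \<open>?B \<inter> ?O\<close>; so the abstract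
    comparison of quotients is literally one of the two derived categories.\<close>
  have 1: "?C\<lparr>Ob := ?O\<rparr> = ?D"
    by (simp add: mixed_aYD_dgcat_def mixed_stable_aYD_dgcat_def mixed_dgcat_def)
  have 2: "?B \<inter> ?O = {P \<in> Ob ?D. acyclic_mixed P}"
    using stable_mixed_aYD by (auto simp: mixed_stable_aYD_dgcat_def)
  have 3: "?B = {P \<in> Ob ?C. acyclic_mixed P}" by (simp add: mixed_aYD_dgcat_def)
  note qe = retract.quasi_equivalence_FM[OF H.retract_stable[where 'm = 'm, folded mixed_aYD_dgcat_def]]
  have "\<exists>FO FM. quasi_equivalence (derived ?D) (derived ?C) FO FM"
    using qe unfolding 1 2 derived_def 3[symmetric] by blast
  \<comment> \<open>A single quasi-equivalence is a zig-zag of length one.\<close>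
  then show ?thesis unfolding dg_equivalent_def by (rule r_into_equivclp)
qed

end
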